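(* Let $\sigma(\cdot)$ be a bounded continuous function on $\mathbb{R}$ with $\sigma(x)\ge\epsilon$ for all $x\in\mathbb{R}$, for some constant $\epsilon>0$, and let $\mu\in M(\mathbb{R})$. A probability measure $\mathbf{Q}_\mu$ on $C([0,\infty),M(\mathbb{R}))$ is a solution of the $(\mathcal{L},\mathcal{D}(\mathcal{L}))$-martingale problem with $\mathbf{Q}_\mu\{w_0=\mu\}=1$ if and only if for each $\phi\in C^2(\mathbb{R})$, $$M_t(\phi)=\langle\phi,w_t\rangle-\langle\phi,\mu\rangle-\frac12\rho(0)\int_0^t\langle\phi'',w_s\rangle ds,\quad t\ge0,$$ under $\mathbf{Q}_\mu$ is a continuous martingale with quadratic variation process $$\langle M(\phi)\rangle_t=\int_0^t\langle\sigma\phi^2,w_s\rangle ds+\int_0^tds\int_{\mathbb{R}}\langle h(z-\cdot)\phi',w_s\rangle^2dz.$$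
   Context: $M(\mathbb{R})$ is the space of finite Borel measures on $\mathbb{R}$ with the topology of weak convergence; $\langle f,\mu\rangle=\int f\,d\mu$. $C(\mathbb{R}^n)$ is the set of bounded continuous functions and $C^2(\mathbb{R}^n)$ the set of those with bounded continuous partial derivatives up to order 2. $\{w_t:t\ge0\}$ is the coordinate process of $C([0,\infty),M(\mathbb{R}))$. The function $h$ on $\mathbb{R}$ is continuously differentiable with $h$ and $h'$ square-integrable, and $\rho(x)=\int_{\mathbb{R}}h(y-x)h(y)\,dy$. The operator $\mathcal{L}$ is $$\mathcal{L}F(\nu)=\frac12\rho(0)\int_{\mathbb{R}}\frac{d^2}{dx^2}\frac{\delta F(\nu)}{\delta\nu(x)}\nu(dx)+\frac12\int_{\mathbb{R}^2}\rho(x-y)\frac{d^2}{dx\,dy}\frac{\delta^2F(\nu)}{\delta\nu(x)\delta\nu(y)}\nu(dx)\nu(dy)+\frac12\int_{\mathbb{R}}\sigma(x)\frac{\delta^2F(\nu)}{\delta\nu(x)^2}\nu(dx),$$ where $\frac{\delta F(\nu)}{\delta\nu(x)}=\lim_{r\to0^+}r^{-1}[F(\nu+r\delta_x)-F(\nu)]$ and second derivatives are defined by iterating. $\mathcal{D}(\mathcal{L})$ is the collection of all functions $F_{n,f}(\nu)=\int f\,d\nu^n$ with $n\ge1$, $f\in C^2(\mathbb{R}^n)$, and all functions $F_{f,\{\phi_i\}}(\nu)=f(\langle\phi_1,\nu\rangle,\dots,\langle\phi_n,\nu\rangle)$ with $f\in C^2(\mathbb{R}^n)$, $\phi_1,\dots,\phi_n\in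 C^2(\mathbb{R})$. $\mathbf{Q}_\mu$ solves the $(\mathcal{L},\mathcal{D}(\mathcal{L}))$-martingale problem if for every $F\in\mathcal{D}(\mathcal{L})$ the process $F(w_t)-F(w_0)-\int_0^t\mathcal{L}F(w_s)ds$, $t\ge0$, is a continuous martingale under $\mathbf{Q}_\mu$.
   Formalization: The right-hand side is read with the martingale null at zero, M_0(φ)=0 almost surely, part of some definitions of quadratic variation; without it, a solution started at a measure other than μ would satisfy the right-hand side, and w_0=μ would not follow. *)

theory Defs
  imports "HOL-Probability.Probability"
begin

section \<open>Finite Borel measures on the real line with the weak topology\<close>

typedef fmeasure = "{M :: real measure. sets M = sets borel \<and> finite_measure M}"
  morphisms meas_of Abs_fmeasure
proof
  show "null_measure borel \<in> {M :: real measure. sets M = sets borel \<and> finite_measure M}"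
    by (auto intro: finite_measureI)
qed

setup_lifting type_definition_fmeasure

definition pairing :: "(real \<Rightarrow> real) \<Rightarrow> fmeasure \<Rightarrow> real" where
  "pairing f \<nu> = (LINT x|meas_of \<nu>. f x)"

definition Cb :: "'a::topological_space set \<Rightarrow> ('a \<Rightarrow> real) set" where
  "Cb S = {f. continuous_on S f \<and> bounded (f ` S)}"

text \<open>The weak topology is the initial topology of the maps
  \<open>\<nu> \<mapsto> \<langle>f, \<nu>\<rangle>\<close> with \<open>f\<close> bounded and continuous.\<close>

instantiation fmeasure :: topological_space
begin

definition open_fmeasure :: "fmeasure set \<Rightarrow> bool" where
  "open_fmeasure = generate_topology {pairing f -` V | f V. f \<in> Cb UNIV \<and> open V}"

instance
proof
  show "open (UNIV :: fmeasure set)"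
    by (simp add: open_fmeasure_def generate_topology.UNIV)
  show "open (S \<inter> T)" if "open S" "open T" for S T :: "fmeasure set"
    using that by (simp add: open_fmeasure_def generate_topology.Int)
  show "open (\<Union>K)" if "\<forall>S\<in>K. open S" for K :: "fmeasure set set"
    using that unfolding open_fmeasure_def by (intro generate_topology.UN) blast
qed

end

lemma
  fixes M :: "real measure"
  assumes M: "sets M = sets borel"
  defines "N \<equiv> \<lambda>r x. measure_of UNIV (sets borel) (\<lambda>A. emeasure M A + ennreal r * indicator A x)"
  shows sets_plus_dirac: "sets (N r x) = sets borel"
    and emeasure_plus_dirac:
      "A \<in> sets borel \<Longrightarrow> emeasure (N r x) A = emeasure M A + ennreal r * indicator A x"
proof -
  let ?f = "\<lambda>A. emeasure M A + ennreal r * indicator A x"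
  have sa: "sigma_algebra UNIV (sets borel :: real set set)"
    using sets.sigma_algebra_axioms[of borel] by simp
  show "sets (N r x) = sets borel"
    unfolding N_def by (rule sigma_algebra.sets_measure_of_eq[OF sa])
  have "countably_additive (sets borel) ?f"
  proof (rule countably_additiveI)
    fix A :: "nat \<Rightarrow> real set"
    assume A: "range A \<subseteq> sets borel" "disjoint_family A" "(\<Union>i. A i) \<in> sets borel"
    have "(\<Sum>i. emeasure M (A i)) = emeasure M (\<Union>i. A i)"
      using A M by (intro suminf_emeasure) auto
    moreover have "(\<Sum>i. ennreal r * indicator (A i) x) = ennreal r * indicator (\<Union>i. A i) x"
      using A by (simp add: suminf_indicator)
    ultimately show "(\<Sum>i. ?f (A i)) = ?f (\<Union>i. A i)"
      by (simp add: suminf_add[symmetric])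
  qed
  then show "emeasure (N r x) A = ?f A" if "A \<in> sets borel"
    unfolding N_def using that sa
    by (intro emeasure_measure_of_sigma) (auto simp: positive_def)
qed

text \<open>\<open>add_dirac \<nu> r x\<close> is \<open>\<nu> + r \<delta>\<^sub>x\<close> for \<open>r \<ge> 0\<close>
  (a negative \<open>r\<close> is read as 0, because \<^const>\<open>ennreal\<close> truncates).\<close>

lift_definition add_dirac :: "fmeasure \<Rightarrow> real \<Rightarrow> real \<Rightarrow> fmeasure"
  is "\<lambda>M r x. measure_of UNIV (sets borel) (\<lambda>A. emeasure M A + ennreal r * indicator A x)"
proof -
  fix M :: "real measure" and r x :: real
  assume "sets M = sets borel \<and> finite_measure M"
  then have M: "sets M = sets borel" and fin: "finite_measure M" by auto
  interpret finite_measure M by fact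
  let ?N = "measure_of UNIV (sets borel) (\<lambda>A. emeasure M A + ennreal r * indicator A x)"
  have "emeasure ?N UNIV \<noteq> \<infinity>"
    using emeasure_plus_dirac[OF M, of UNIV r x] emeasure_finite[of UNIV]
    by (simp add: ennreal_add_eq_top)
  then show "sets ?N = sets borel \<and> finite_measure ?N"
    using sets_plus_dirac[OF M] by (intro conjI finite_measureI) (auto simp: space_measure_of_conv)
qed

lemma emeasure_add_dirac:
  assumes "A \<in> sets borel"
  shows "emeasure (meas_of (add_dirac \<nu> r x)) A = emeasure (meas_of \<nu>) A + ennreal r * indicator A x"
  using meas_of[of \<nu>] emeasure_plus_dirac[OF _ assms] by (simp add: add_dirac.rep_eq)

section \<open>Twice differentiable test functions\<close>

definition C2_real :: "(real \<Rightarrow> real) set" where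
  "C2_real = {\<phi>. \<phi> \<in> Cb UNIV \<and>
     (\<forall>x. \<phi> field_differentiable at x) \<and> deriv \<phi> \<in> Cb UNIV \<and>
     (\<forall>x. deriv \<phi> field_differentiable at x) \<and> deriv (deriv \<phi>) \<in> Cb UNIV}"

text \<open>Since \<open>n\<close> is quantified inside the statement, a point of \<open>\<real>\<^sup>n\<close> is represented by a
  function in \<^term>\<open>extensional {..<n} :: (nat \<Rightarrow> real) set\<close>, whose subspace topology in the product
  topology is that of \<open>\<real>\<^sup>n\<close>. This set is also the space of the \<open>n\<close>-fold product measure below.\<close>

abbreviation Rn :: "nat \<Rightarrow> (nat \<Rightarrow> real) set" where
  "Rn n \<equiv> extensional {..<n}"

definition pdifferentiable :: "nat \<Rightarrow> ((nat \<Rightarrow> real) \<Rightarrow> real) \<Rightarrow> (nat \<Rightarrow> real) \<Rightarrow> bool" where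
  "pdifferentiable i f x \<longleftrightarrow> (\<lambda>u. f (x(i := u))) field_differentiable at (x i)"

definition pderivative :: "nat \<Rightarrow> ((nat \<Rightarrow> real) \<Rightarrow> real) \<Rightarrow> (nat \<Rightarrow> real) \<Rightarrow> real" where
  "pderivative i f x = deriv (\<lambda>u. f (x(i := u))) (x i)"

definition C2_Rn :: "nat \<Rightarrow> ((nat \<Rightarrow> real) \<Rightarrow> real) set" where
  "C2_Rn n = {f. f \<in> Cb (Rn n) \<and>
     (\<forall>i<n. (\<forall>x\<in>Rn n. pdifferentiable i f x) \<and> pderivative i f \<in> Cb (Rn n) \<and>
       (\<forall>j<n. (\<forall>x\<in>Rn n. pdifferentiable j (pderivative i f) x) \<and>
         pderivative j (pderivative i f) \<in> Cb (Rn n)))}"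

section \<open>The generator and its domain\<close>

definition vderiv :: "(fmeasure \<Rightarrow> real) \<Rightarrow> real \<Rightarrow> fmeasure \<Rightarrow> real" where
  "vderiv F x \<nu> = Lim (at_right 0) (\<lambda>r. (F (add_dirac \<nu> r x) - F \<nu>) / r)"

definition vderiv2 :: "(fmeasure \<Rightarrow> real) \<Rightarrow> real \<Rightarrow> real \<Rightarrow> fmeasure \<Rightarrow> real" where
  "vderiv2 F x y = vderiv (vderiv F y) x"

definition rho :: "(real \<Rightarrow> real) \<Rightarrow> real \<Rightarrow> real" where
  "rho h x = (LBINT y. h (y - x) * h y)"

definition generator ::
  "(real \<Rightarrow> real) \<Rightarrow> (real \<Rightarrow> real) \<Rightarrow> (fmeasure \<Rightarrow> real) \<Rightarrow> fmeasure \<Rightarrow> real" where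
  "generator h \<sigma> F \<nu> =
     1 / 2 * rho h 0 * (LINT x|meas_of \<nu>. deriv (deriv (\<lambda>u. vderiv F u \<nu>)) x)
   + 1 / 2 * (LINT (x, y)|(meas_of \<nu> \<Otimes>\<^sub>M meas_of \<nu>).
       rho h (x - y) * deriv (\<lambda>u. deriv (\<lambda>v. vderiv2 F u v \<nu>) y) x)
   + 1 / 2 * (LINT x|meas_of \<nu>. \<sigma> x * vderiv2 F x x \<nu>)"

definition poly_functional :: "nat \<Rightarrow> ((nat \<Rightarrow> real) \<Rightarrow> real) \<Rightarrow> fmeasure \<Rightarrow> real" where
  "poly_functional n f \<nu> = (LINT x|(\<Pi>\<^sub>M i\<in>{..<n}. meas_of \<nu>). f x)"

definition cyl_functional ::
  "nat \<Rightarrow> ((nat \<Rightarrow> real) \<Rightarrow> real) \<Rightarrow> (nat \<Rightarrow> real \<Rightarrow> real) \<Rightarrow> fmeasure \<Rightarrow> real" where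
  "cyl_functional n f \<phi> \<nu> = f (\<lambda>i\<in>{..<n}. pairing (\<phi> i) \<nu>)"

definition gen_domain :: "(fmeasure \<Rightarrow> real) set" where
  "gen_domain =
     {poly_functional n f | n f. 1 \<le> n \<and> f \<in> C2_Rn n} \<union>
     {cyl_functional n f \<phi> | n f \<phi>. 1 \<le> n \<and> f \<in> C2_Rn n \<and> (\<forall>i<n. \<phi> i \<in> C2_real)}"

section \<open>Path space and the filtration of the coordinate process\<close>

text \<open>The space of \<^const>\<open>PiM\<close> consists of functions that are \<^const>\<open>undefined\<close> at negative times, so
  its elements are exactly the functions on \<open>[0, \<infinity>)\<close>.\<close>

definition path_space :: "(real \<Rightarrow> fmeasure) measure" where
  "path_space = restrict_space (\<Pi>\<^sub>M t\<in>{0..}. borel) {w. continuous_on {0..} w}"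

text \<open>For \<open>t < 0\<close> this is the trivial \<open>\<sigma>\<close>-algebra. The total index type is that of
  \<^const>\<open>stopping_time\<close> and \<^locale>\<open>filtration\<close>.\<close>

definition path_filtration :: "real \<Rightarrow> (real \<Rightarrow> fmeasure) measure" where
  "path_filtration t = sigma (space path_space)
     {{w \<in> space path_space. w s \<in> B} | s B. 0 \<le> s \<and> s \<le> t \<and> B \<in> sets borel}"

lemma space_path_space:
  "space path_space = {w \<in> extensional {0..}. continuous_on {0..} w}"
  by (auto simp: path_space_def space_restrict_space space_PiM PiE_def)

lemma subalgebra_path_filtration: "subalgebra path_space (path_filtration t)"
proof -
  have *: "(\<lambda>w. w s) \<in> path_space \<rightarrow>\<^sub>M borel" if "0 \<le> s" for s
    unfolding path_space_def using that
    by (intro measurable_restrict_space1 measurable_component_singleton) auto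
  have "{w \<in> space path_space. w s \<in> B} \<in> sets path_space" if "0 \<le> s" "B \<in> sets borel" for s B
    using measurable_sets[OF *[OF that(1)] that(2)] by (simp add: vimage_def Int_def conj_commute)
  then show ?thesis
    unfolding subalgebra_def path_filtration_def
    by (subst sigma_le_sets) (auto simp: space_measure_of_conv)
qed

lemma filtration_path_filtration: "filtration (space path_space) path_filtration"
proof
  show "space (path_filtration t) = space path_space" for t
    by (simp add: path_filtration_def space_measure_of_conv)
  show "sets (path_filtration s) \<le> sets (path_filtration t)" if "s \<le> t" for s t
  proof -
    have "{{w \<in> space path_space. w u \<in> B} | u B. 0 \<le> u \<and> u \<le> s \<and> B \<in> sets borel}
        \<subseteq> {{w \<in> space path_space. w u \<in> B} | u B. 0 \<le> u \<and> u \<le> t \<and> B \<in> sets borel}"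
      using that by fastforce
    then show ?thesis
      unfolding path_filtration_def by (subst (1 2) sets_measure_of) (blast, blast, rule sigma_sets_mono')
  qed
qed

section \<open>Martingales and quadratic variation\<close>

text \<open>All notions below are for real time, restricted to \<open>[0, \<infinity>)\<close>.\<close>

definition adapted :: "(real \<Rightarrow> 'a measure) \<Rightarrow> (real \<Rightarrow> 'a \<Rightarrow> real) \<Rightarrow> bool" where
  "adapted F X \<longleftrightarrow> (\<forall>t\<ge>0. X t \<in> borel_measurable (F t))"

definition continuous_paths :: "'a measure \<Rightarrow> (real \<Rightarrow> 'a \<Rightarrow> real) \<Rightarrow> bool" where
  "continuous_paths P X \<longleftrightarrow> (AE w in P. continuous_on {0..} (\<lambda>t. X t w))"

definition martingale ::
  "'a measure \<Rightarrow> (real \<Rightarrow> 'a measure) \<Rightarrow> (real \<Rightarrow> 'a \<Rightarrow> real) \<Rightarrow> bool" where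
  "martingale P F X \<longleftrightarrow>
     filtration (space P) F \<and> (\<forall>t. subalgebra P (F t)) \<and>
     adapted F X \<and> (\<forall>t\<ge>0. integrable P (X t)) \<and>
     (\<forall>s t. 0 \<le> s \<and> s \<le> t \<longrightarrow> (AE w in P. real_cond_exp P (F s) (X t) w = X s w))"

definition continuous_martingale ::
  "'a measure \<Rightarrow> (real \<Rightarrow> 'a measure) \<Rightarrow> (real \<Rightarrow> 'a \<Rightarrow> real) \<Rightarrow> bool" where
  "continuous_martingale P F X \<longleftrightarrow> martingale P F X \<and> continuous_paths P X"

text \<open>Real-valued localizing times are no restriction: extended ones \<open>\<tau>\<^sub>n\<close> may be replaced by
  \<open>min \<tau>\<^sub>n n\<close>.\<close>

definition continuous_local_martingale ::
  "'a measure \<Rightarrow> (real \<Rightarrow> 'a measure) \<Rightarrow> (real \<Rightarrow> 'a \<Rightarrow> real) \<Rightarrow> bool" where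
  "continuous_local_martingale P F X \<longleftrightarrow>
     adapted F X \<and> continuous_paths P X \<and>
     (\<exists>\<tau> :: nat \<Rightarrow> 'a \<Rightarrow> real.
        (\<forall>n. stopping_time F (\<tau> n) \<and> (\<forall>w\<in>space P. 0 \<le> \<tau> n w)) \<and>
        (AE w in P. incseq (\<lambda>n. \<tau> n w) \<and> filterlim (\<lambda>n. \<tau> n w) at_top sequentially) \<and>
        (\<forall>n. martingale P F (\<lambda>t w. X (min t (\<tau> n w)) w)))"

text \<open>The quadratic variation process is defined for continuous local martingales \<open>X\<close> null at 0; it
  is the (up to indistinguishability unique) continuous increasing adapted process \<open>A\<close> null at 0 for
  which \<open>X\<^sup>2 - A\<close> is a local martingale. The condition \<open>X\<^sub>0 = 0\<close> is part of the convention: adding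
  a constant to \<open>X\<close> would not be detected by \<open>A\<close>.\<close>

definition quadratic_variation ::
  "'a measure \<Rightarrow> (real \<Rightarrow> 'a measure) \<Rightarrow> (real \<Rightarrow> 'a \<Rightarrow> real) \<Rightarrow> (real \<Rightarrow> 'a \<Rightarrow> real) \<Rightarrow> bool" where
  "quadratic_variation P F X A \<longleftrightarrow>
     continuous_local_martingale P F X \<and> (AE w in P. X 0 w = 0) \<and>
     adapted F A \<and> continuous_paths P A \<and>
     (AE w in P. A 0 w = 0 \<and> mono_on {0..} (\<lambda>t. A t w)) \<and>
     continuous_local_martingale P F (\<lambda>t w. (X t w)\<^sup>2 - A t w)"

section \<open>The martingale problem\<close>

definition solves_martingale_problem ::
  "(real \<Rightarrow> real) \<Rightarrow> (real \<Rightarrow> real) \<Rightarrow> (real \<Rightarrow> fmeasure) measure \<Rightarrow> bool" where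
  "solves_martingale_problem h \<sigma> Q \<longleftrightarrow>
     (\<forall>F\<in>gen_domain. continuous_martingale Q path_filtration
        (\<lambda>t w. F (w t) - F (w 0) - (LBINT s:{0..t}. generator h \<sigma> F (w s))))"

definition M_process ::
  "(real \<Rightarrow> real) \<Rightarrow> fmeasure \<Rightarrow> (real \<Rightarrow> real) \<Rightarrow> real \<Rightarrow> (real \<Rightarrow> fmeasure) \<Rightarrow> real" where
  "M_process h \<mu> \<phi> t w =
     pairing \<phi> (w t) - pairing \<phi> \<mu>
     - 1 / 2 * rho h 0 * (LBINT s:{0..t}. pairing (deriv (deriv \<phi>)) (w s))"

definition M_bracket ::
  "(real \<Rightarrow> real) \<Rightarrow> (real \<Rightarrow> real) \<Rightarrow> (real \<Rightarrow> real) \<Rightarrow> real \<Rightarrow> (real \<Rightarrow> fmeasure) \<Rightarrow> real" where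
  "M_bracket h \<sigma> \<phi> t w =
     (LBINT s:{0..t}. pairing (\<lambda>x. \<sigma> x * (\<phi> x)\<^sup>2) (w s))
   + (LBINT s:{0..t}. (LBINT z. (pairing (\<lambda>x. h (z - x) * deriv \<phi> x) (w s))\<^sup>2))"

end

theory Submission
  imports Defs
begin

text \<open>For the direction from the brackets to \<open>\<L>\<close>, localisation and Fatou's lemma give moments
  of the total mass, first of order two and then, through Ito's formula for powers, of every order;
  Doob's inequality makes all local martingales true ones. Ito's formula, proved by
  Taylor expansion along equidistant partitions for the process stopped when the mass
  becomes large, yields the martingale problem for cylinder functions. Products of one-variable
  functions are cylinder functions of a polynomial. A general \<open>F\<^sub>n\<^sub>,\<^sub>f\<close> is reached one coordinate at a
  time: \<open>f(\<dots>, R sin(x\<^sub>i/R), \<dots>)\<close> tends to \<open>f\<close> with its derivatives as \<open>R \<rightarrow> \<infinity>\<close> and is a limit of Bernstein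
  polynomials in \<open>(1 + sin(x\<^sub>i/R))/2\<close>, which separate the variable \<open>x\<^sub>i\<close>. Conversely \<open>\<L>\<close> applied to
  \<open>\<langle>\<phi>,\<nu>\<rangle>\<close> and \<open>\<langle>\<phi>,\<nu>\<rangle>\<^sup>2\<close>, both of the form \<open>F\<^sub>n\<^sub>,\<^sub>f\<close>, gives drift and bracket.\<close>

text \<open>The test function 1 drives the integrability: its drift vanishes, so the mass is a
  nonnegative martingale, and the generator maps the p-th power of the mass to at most a constant
  times the (p-1)-st, so the moments close by induction. No stochastic integral occurs: every
  martingale statement is an identity of expectations against weights known at the earlier time, and
  Ito's formula needs such identities only for the coordinates and for their pairwise products,
  which polarisation supplies. The obstacle for F_{n,f} is that f need not vanish at infinity, so
  sums of products need not approximate f and its derivatives uniformly on the whole space. The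
  generator involves f and its second derivatives only under integrals, so bounded pointwise
  convergence is enough; Bernstein polynomials preserve the bounds of derivatives, and the sine
  confines their argument to a compact interval. For the converse the degrees 1 and 2 must be
  written as F_{n,f}: as cylinder functions they would require f(x) = x and f(x) = x^2, which are
  unbounded and hence not in C^2.\<close>

abbreviation (input) bmeas where "bmeas \<equiv> borel_measurable"
abbreviation (input) pfilt where "pfilt \<equiv> path_filtration"
abbreviation (input) pder where "pder \<equiv> pderivative"
abbreviation (input) meas2 where "meas2 \<nu> \<equiv> meas_of \<nu> \<Otimes>\<^sub>M meas_of \<nu>"
abbreviation (input) has_rd (infix "has'_rd" 50) where "(f has_rd D) F \<equiv> (f has_real_derivative D) F"
abbreviation (input) ind :: "'a set \<Rightarrow> 'a \<Rightarrow> real" where "ind \<equiv> indicator"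
abbreviation (input) seq_tendsto :: "(nat \<Rightarrow> 'a::topological_space) \<Rightarrow> 'a \<Rightarrow> bool" (infix "~~>" 60)
  where "X ~~> L \<equiv> X \<longlonglongrightarrow> L"

lemmas bi_add = Bochner_Integration.integral_add and bi_diff = Bochner_Integration.integral_diff
  and bi_sum = Bochner_Integration.integral_sum and bi_cong = Bochner_Integration.integral_cong
  and bi_nonneg = Bochner_Integration.integral_nonneg
  and bi_norm_bound_integral = Bochner_Integration.integral_norm_bound_integral
  and bib_add = Bochner_Integration.integrable_add and bib_diff = Bochner_Integration.integrable_diff
  and bib_sum = Bochner_Integration.integrable_sum and bib_bound = Bochner_Integration.integrable_bound
  and bib_cong = Bochner_Integration.integrable_cong

section \<open>Calculus on \<open>Rn n\<close>: the chain rule along lines and a second-order Taylor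
  estimate\<close>

lemma tendsto_funI:
 fixes g :: "'a => nat => real"
 assumes "!!i. ((%s. g s i) \<longlongrightarrow> l i) F"
 shows "(g \<longlongrightarrow> l) F"
proof -
 have "limitin (product_topology (%_. euclidean) UNIV) g l F"
  unfolding limitin_componentwise using assms by (auto simp: topspace_product_topology)
 then show ?thesis by (simp add: euclidean_product_topology)
qed

text \<open>Restricting to \<open>{..<n}\<close> keeps the line inside \<open>Rn n\<close>, the only
  place where f is assumed differentiable.\<close>

definition line :: "nat => (nat => real) => (nat => real) => real => nat => real" where
 "line n x d u = (\<lambda>i\<in>{..<n}. x i + u * d i)"

lemma line_Rn [simp]: "line n x d u : Rn n"
 by (simp add: line_def)

lemma fun_upd_Rn: "x : Rn n ==> i < n ==> x(i := u) : Rn n"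
 by (auto simp: extensional_def)

lemma pdifferentiable_has_derivative:
 assumes "!!x. x : Rn n ==> pdifferentiable i f x" "x : Rn n" "i < n"
 shows "((%u. f (x(i := u))) has_rd pder i f (x(i := v))) (at v)"
proof -
 have "x(i := v) : Rn n" using assms by (simp add: fun_upd_Rn)
 from assms(1)[OF this] show ?thesis
  unfolding pdifferentiable_def pderivative_def
  by (simp add: DERIV_deriv_iff_field_differentiable)
qed

text \<open>Only partial derivatives are given, and no total derivative is constructed. The
  increment along the line is telescoped into n moves of a single coordinate; each move is handled
  by the one-variable mean value theorem, and continuity of the partial derivatives carries the
  intermediate points to the base point.\<close>

lemma chain_rule_line:
 assumes pd: "!!i x. i < n ==> x : Rn n ==> pdifferentiable i f x"
  and pc: "!!i. i < n ==> continuous_on (Rn n) (pder i f)"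
 shows "((%s. f (line n x d s)) has_rd
  (SUM i<n. pder i f (line n x d u) * d i)) (at u)"
proof -
 \<comment> \<open>\<open>z k s\<close> has its first k coordinates at parameter s and the others
   still at u, so consecutive points differ in coordinate k only.\<close>
 define z where "z k s = (\<lambda>i\<in>{..<n}. if i < k then x i + s * d i else x i + u * d i)" for k s
 have zR: "z k s : Rn n" for k s by (simp add: z_def)
 have z0: "z 0 s = line n x d u" for s by (simp add: z_def line_def)
 have zn: "z n s = line n x d s" for s by (auto simp: z_def line_def)
 have tele: "f (line n x d s) = f (line n x d u) + (SUM k<n. f (z (Suc k) s) - f (z k s))" for s
  by (subst sum_lessThan_telescope) (simp add: z0 zn)
 have der: "((%s. f (z (Suc k) s) - f (z k s)) has_rd
  pder k f (line n x d u) * d k) (at u)" if k: "k < n" for k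
 proof -
  have zS: "z (Suc k) s = (z k s)(k := x k + s * d k)" for s
  using k by (auto simp: z_def fun_eq_iff)
  have zK: "z k s = (z k s)(k := x k + u * d k)" for s
  using k by (auto simp: z_def fun_eq_iff)
  \<comment> \<open>Three cases, because \<open>(s - u) * d k\<close> may vanish or have either
    sign; the bound on v is all that the limit needs.\<close>
  have "EX v. abs (v - (x k + u * d k)) <= abs (s - u) * abs (d k) &
  f (z (Suc k) s) - f (z k s) = (s - u) * d k * pder k f ((z k s)(k := v))" for s
  proof -
  define g where "g v = f ((z k s)(k := v))" for v
  have gd: "(g has_rd pder k f ((z k s)(k := v))) (at v)" for v
  unfolding g_def by (rule pdifferentiable_has_derivative[OF pd[OF k] zR k])
  let ?a = "x k + u * d k" and ?b = "x k + s * d k"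
  consider "?a = ?b" | "?a < ?b" | "?b < ?a" by linarith
  then have "EX v. abs (v - ?a) <= abs (?b - ?a) & g ?b - g ?a = (?b - ?a) * pder k f ((z k s)(k := v))"
  proof cases
  case 1 then show ?thesis by auto
  next
  case 2
  obtain v where "?a < v" "v < ?b" "g ?b - g ?a = (?b - ?a) * pder k f ((z k s)(k := v))"
  using MVT2[OF 2, of g "%v. pder k f ((z k s)(k := v))"] gd by auto
  then show ?thesis by (intro exI[of _ v]) auto
  next
  case 3
  obtain v where "?b < v" "v < ?a" "g ?a - g ?b = (?a - ?b) * pder k f ((z k s)(k := v))"
  using MVT2[OF 3, of g "%v. pder k f ((z k s)(k := v))"] gd by auto
  then show ?thesis by (intro exI[of _ v]) (auto simp: algebra_simps)
  qed
  moreover have "?b - ?a = (s - u) * d k" by (simp add: algebra_simps)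
  moreover have "g ?a = f (z k s)" unfolding g_def by (subst zK[of s, symmetric]) (rule refl)
  moreover have "g ?b = f (z (Suc k) s)" by (simp add: g_def zS)
  ultimately show ?thesis by (simp add: abs_mult)
  qed
  then obtain v where v: "!!s. abs (v s - (x k + u * d k)) <= abs (s - u) * abs (d k)"
  "!!s. f (z (Suc k) s) - f (z k s) = (s - u) * d k * pder k f ((z k s)(k := v s))"
  by metis
  have vlim: "(v \<longlongrightarrow> x k + u * d k) (at u)"
  proof (rule Lim_null_comparison[THEN LIM_zero_cancel])
  show "\<forall>\<^sub>F s in at u. norm (v s - (x k + u * d k)) <= abs (s - u) * abs (d k)"
  using v(1) by simp
  show "((%s. abs (s - u) * abs (d k)) \<longlongrightarrow> 0) (at u)"
  by (rule tendsto_eq_intros refl | simp)+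
  qed
  have zlim: "((%s. (z k s)(k := v s)) \<longlongrightarrow> line n x d u) (at u)"
  proof (rule tendsto_funI)
  fix i
  have "((%s. x i + s * d i) \<longlongrightarrow> x i + u * d i) (at u)"
  by (intro tendsto_intros)
  then show "((%s. ((z k s)(k := v s)) i) \<longlongrightarrow> line n x d u i) (at u)"
  using vlim k by (cases "i = k"; cases "i < k") (auto simp: z_def line_def restrict_def)
  qed
  have "((%s. pder k f ((z k s)(k := v s))) \<longlongrightarrow> pder k f (line n x d u)) (at u)"
  by (rule continuous_on_tendsto_compose[OF pc[OF k] zlim]) (simp_all add: fun_upd_Rn zR k)
  then have "((%s. d k * pder k f ((z k s)(k := v s))) \<longlongrightarrow> pder k f (line n x d u) * d k) (at u)"
  by (auto intro!: tendsto_eq_intros)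
  moreover have "f (z (Suc k) u) - f (z k u) = 0" by (simp add: v(2))
  ultimately show ?thesis
  unfolding has_field_derivative_iff
  by (rule_tac Lim_transform_eventually) (auto simp: eventually_at_filter v(2))
 qed
 show ?thesis
  by (subst tele[THEN ext], rule DERIV_cong[OF DERIV_add[OF DERIV_const DERIV_sum]], rule der) simp_all
qed

text \<open>\<open>C2_Rn\<close> without the bounds: Ito's formula is also applied to powers of a
  coordinate and to products of coordinates, which are unbounded.\<close>

definition C2_loc :: "nat => ((nat => real) => real) => bool" where
 "C2_loc n f \<longleftrightarrow> continuous_on (Rn n) f &
  (\<forall>i<n. (\<forall>x\<in>Rn n. pdifferentiable i f x) & continuous_on (Rn n) (pder i f) &
  (\<forall>j<n. (\<forall>x\<in>Rn n. pdifferentiable j (pder i f) x) &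
  continuous_on (Rn n) (pder j (pder i f))))"

lemma C2_Rn_imp_C2_loc: "f : C2_Rn n ==> C2_loc n f"
 by (auto simp: C2_Rn_def C2_loc_def Cb_def)

lemma C2_locD:
 assumes "C2_loc n f"
 shows "continuous_on (Rn n) f"
  and "!!i x. i < n ==> x : Rn n ==> pdifferentiable i f x"
  and "!!i. i < n ==> continuous_on (Rn n) (pder i f)"
  and "!!i j x. i < n ==> j < n ==> x : Rn n ==> pdifferentiable j (pder i f) x"
  and "!!i j. i < n ==> j < n ==> continuous_on (Rn n) (pder j (pder i f))"
 using assms by (auto simp: C2_loc_def)

definition box :: "nat => real => (nat => real) set" where
 "box n K = {x : Rn n. \<forall>i<n. abs (x i) <= K}"

text \<open>The box is a product of compact factors: an interval at each index below n and the
  single point \<open>undefined\<close> elsewhere.\<close>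

lemma compact_box: "compact (box n K)"
proof -
 have eq: "box n K = PiE UNIV (%i. if i < n then {-K..K} else {undefined})"
  (is "_ = ?R")
 proof (rule set_eqI)
  fix x :: "nat => real"
  have "x : ?R \<longleftrightarrow> (ALL i. (i < n --> abs (x i) <= K) & (\<not> i < n --> x i = undefined))"
  unfolding PiE_iff by (auto simp: abs_le_iff split: if_splits)
  then show "x : box n K \<longleftrightarrow> x : ?R"
  by (auto simp: box_def extensional_def)
 qed
 have "compactin (product_topology (%_. euclidean) UNIV) (box n K)"
  unfolding eq compactin_PiE by auto
 then show ?thesis by (simp add: euclidean_product_topology)
qed

text \<open>The metric on functions is a series with weights \<open>(1/2)^n\<close>, and 2 is the
  sum of the weights. Smallness in every coordinate thus controls the metric.\<close>

lemma dist_fun_less: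
 fixes x y :: "nat => real"
 assumes "!!i. abs (x i - y i) <= delta"
 shows "dist x y <= 2 * delta"
proof -
 have "dist x y <= (\<Sum>n. (1/2)^n * delta)"
  unfolding dist_fun_def
 proof (rule suminf_le)
  show "summable (%n. (1 / 2) ^ n * min (dist (x (from_nat n)) (y (from_nat n))) 1)"
  by (rule summable_comparison_test'[of "%n. (1/2)^n"]) (auto simp: summable_geometric_iff)
  show "summable (%n. (1 / 2) ^ n * delta)"
  by (intro summable_mult2) (simp add: summable_geometric_iff)
  show "(1 / 2) ^ n * min (dist (x (from_nat n)) (y (from_nat n))) 1 <= (1 / 2) ^ n * delta" for n
  using assms[of "from_nat n"] by (intro mult_left_mono) (auto simp: dist_real_def)
 qed
 also have "... = 2 * delta"
  by (subst suminf_mult2[symmetric]) (auto simp: summable_geometric_iff suminf_geometric)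
 finally show ?thesis .
qed

lemma box_uniformly_continuous:
 fixes g :: "(nat => real) => real"
 assumes "continuous_on (Rn n) g" "\<epsilon> > 0"
 obtains delta where "delta > 0"
  "!!x y. x : box n K ==> y : box n K ==> (!!i. i < n ==> abs (x i - y i) <= delta) ==> abs (g x - g y) < \<epsilon>"
proof -
 have "uniformly_continuous_on (box n K) g"
  by (intro compact_uniformly_continuous compact_box continuous_on_subset[OF assms(1)])
  (auto simp: box_def)
 then obtain d where d: "d > 0" "!!x y. x : box n K ==> y : box n K ==> dist y x < d ==> dist (g y) (g x) < \<epsilon>"
  using assms(2) unfolding uniformly_continuous_on_def by metis
 show ?thesis
 \<comment> \<open>Coordinates within d / 4 give distance at most d / 2, which is strictly below
   d.\<close>
 proof (rule that[of "d/4"])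
  fix x y assume xy: "x : box n K" "y : box n K" "!!i. i < n ==> abs (x i - y i) <= d/4"
  have "abs (x i - y i) <= d/4" for i
  using xy d(1) by (cases "i < n") (auto simp: box_def extensional_def)
  then have "dist x y <= 2 * (d/4)" by (rule dist_fun_less)
  then have "dist x y < d" using d(1) by simp
  then show "abs (g x - g y) < \<epsilon>" using d(2)[of y x] xy by (simp add: dist_real_def)
 qed (use d in simp)
qed

lemma box_bounded:
 fixes g :: "(nat => real) => real"
 assumes "continuous_on (Rn n) g"
 obtains B where "B >= 0" "!!x. x : box n K ==> abs (g x) <= B"
proof -
 have "compact (g ` box n K)"
  by (intro compact_continuous_image compact_box continuous_on_subset[OF assms]) (auto simp: box_def)
 then obtain B where "!!v. v : g ` box n K ==> norm v <= B"
  using compact_imp_bounded bounded_iff by metis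
 then show ?thesis by (intro that[of "max B 0"]) force+
qed

text \<open>Two regimes. If all increments are at most delta, uniform continuity of the second
  derivatives on the compact box gives the \<epsilon> term. Otherwise the sum D of the squared
  increments is at least \<open>delta^2\<close>, and a bound linear in D is at most a multiple of
  \<open>D^2 / delta^2\<close>. The split suits sums over fine partitions, where the D add up to
  something bounded while the \<open>D^2\<close> vanish.\<close>

lemma taylor_box:
 assumes f: "C2_loc n f" and \<epsilon>: "\<epsilon> > 0"
 obtains C where "C >= 0"
  "!!x y. x : box n K ==> y : box n K ==>
  abs (f y - f x - (SUM i<n. pder i f x * (y i - x i))
  - 1/2 * (SUM i<n. SUM j<n. pder j (pder i f) x * (y i - x i) * (y j - x j)))
  <= \<epsilon> * (SUM i<n. (y i - x i)^2) + C * (SUM i<n. (y i - x i)^2)^2"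
proof -
 let ?H = "%i j. pder j (pder i f)"
 note fD = C2_locD[OF f]
 \<comment> \<open>\<open>bound\<close> below turns a bound b on the Hessian differences into
   \<open>b / 2 * n * D\<close>, so e must absorb the factor n; the \<open>+ 1\<close> covers n =
   0.\<close>
 define e where "e = \<epsilon> / (real n + 1)"
 have e: "e > 0" using \<epsilon> by (simp add: e_def)
 have "\<exists>delta>0. \<forall>i<n. \<forall>j<n. \<forall>x\<in>box n K. \<forall>y\<in>box n K.
  (\<forall>i<n. abs (x i - y i) <= delta) --> abs (?H i j x - ?H i j y) < e"
 proof -
  have "\<exists>delta>0. i < n --> j < n --> (\<forall>x\<in>box n K. \<forall>y\<in>box n K.
  (\<forall>i<n. abs (x i - y i) <= delta) --> abs (?H i j x - ?H i j y) < e)" for i j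
  proof (cases "i < n & j < n")
  case True
  then obtain delta where "delta > 0" "!!x y. x : box n K ==> y : box n K ==>
  (!!i. i < n ==> abs (x i - y i) <= delta) ==> abs (?H i j x - ?H i j y) < e"
  using box_uniformly_continuous[OF fD(5) e, of i j K] by metis
  then show ?thesis by blast
  qed (auto intro: exI[of _ 1])
  then obtain dl where dl: "!!i j. dl i j > (0::real)"
  "!!i j. i < n ==> j < n ==> (\<forall>x\<in>box n K. \<forall>y\<in>box n K.
  (\<forall>k<n. abs (x k - y k) <= dl i j) --> abs (?H i j x - ?H i j y) < e)" by metis
  define delta where "delta = Min (insert 1 ((%(i, j). dl i j) ` ({..<n} \<times> {..<n})))"
  have "delta > 0" unfolding delta_def using dl(1) by (subst Min_gr_iff) auto
  moreover have "delta <= dl i j" if "i < n" "j < n" for i j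
  unfolding delta_def using that by (intro Min_le) auto
  ultimately show ?thesis using dl(2) by (intro exI[of _ delta]) (meson order_trans)
 qed
 then obtain delta where delta: "delta > 0" and unif: "!!i j x y. i < n ==> j < n ==> x : box n K ==> y : box n K ==>
  (!!k. k < n ==> abs (x k - y k) <= delta) ==> abs (?H i j x - ?H i j y) < e"
  by metis
 have "EX B. i < n --> j < n --> (\<forall>x\<in>box n K. abs (?H i j x) <= B)" for i j
  using box_bounded[OF fD(5), of i j K] by metis
 then obtain Bf where Bf: "!!i j x. i < n ==> j < n ==> x : box n K ==> abs (?H i j x) <= Bf i j" by metis
 define B where "B = (SUM i<n. SUM j<n. abs (Bf i j))"
 have B: "abs (?H i j x) <= B" if "i < n" "j < n" "x : box n K" for i j x
 proof -
  have "abs (Bf i j) <= (SUM j<n. abs (Bf i j))" using that by (intro member_le_sum) auto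
  also have "... <= B" unfolding B_def
  using that by (intro member_le_sum[of i "{..<n}" "%i. SUM j<n. abs (Bf i j)"]) (auto intro: sum_nonneg)
  finally show ?thesis using Bf[OF that] by linarith
 qed
 have B0: "B >= 0" by (auto simp: B_def intro!: sum_nonneg)
 show ?thesis
 \<comment> \<open>In the far regime the Hessian differences are at most 2 B, which
   \<open>bound\<close> turns into \<open>B * n * D\<close>.\<close>
 proof (rule that[of "B * n / delta^2"])
  fix x y assume x: "x : box n K" and y: "y : box n K"
  define d where "d i = y i - x i" for i
  define D where "D = (SUM i<n. (d i)^2)"
  have D0: "D >= 0" by (simp add: D_def sum_nonneg)
  have l0: "line n x d 0 = x" using x by (auto simp: line_def box_def extensional_def)
  have l1: "line n x d 1 = y" using y by (auto simp: line_def box_def extensional_def d_def)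
  have lb: "line n x d t : box n K" if "0 <= t" "t <= 1" for t
  proof -
  have "abs (x i + t * d i) <= K" if "i < n" for i
  proof -
  have "x i + t * d i = (1 - t) * x i + t * y i" by (simp add: d_def algebra_simps)
  also have "abs ... <= (1 - t) * abs (x i) + t * abs (y i)"
  using \<open>0 <= t\<close> \<open>t <= 1\<close> by (intro order_trans[OF abs_triangle_ineq]) (simp add: abs_mult)
  also have "... <= (1 - t) * K + t * K"
  using x y that \<open>0 <= t\<close> \<open>t <= 1\<close> by (intro add_mono mult_left_mono) (auto simp: box_def)
  finally show ?thesis by (simp add: algebra_simps)
  qed
  then show ?thesis by (simp add: box_def line_def)
  qed
  \<comment> \<open>The function and its first two derivatives along the segment from x to y, in the
    form that Maclaurin's theorem expects.\<close>
  define phi where "phi m s = (if m = 0 then f (line n x d s)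
  else if m = 1 then (SUM i<n. pder i f (line n x d s) * d i)
  else (SUM i<n. (SUM j<n. ?H i j (line n x d s) * d j) * d i))" for m :: nat and s
  have "DERIV (phi m) t :> phi (Suc m) t" if "m < 2" for m t
  proof -
  have "m = 0 | m = 1" using that by auto
  then show ?thesis
  unfolding phi_def[abs_def]
  using chain_rule_line[OF fD(2,3)] chain_rule_line[OF fD(4,5)]
  by (auto intro!: DERIV_sum DERIV_cmult_right)
  qed
  then obtain t where t: "0 < t" "t < 1" "phi 0 1 = (SUM m<2. phi m 0 / fact m * 1 ^ m) + phi 2 t / fact 2 * 1 ^ 2"
  using Maclaurin[of 1 2 phi "phi 0"] by auto
  let ?Q = "%z. (SUM i<n. SUM j<n. ?H i j z * d i * d j)"
  have Q: "phi 2 s = ?Q (line n x d s)" for s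
  by (simp add: phi_def sum_distrib_left sum_distrib_right algebra_simps)
  have "f y - f x - (SUM i<n. pder i f x * d i) - 1/2 * ?Q x = 1/2 * (?Q (line n x d t) - ?Q x)"
  using t(3) unfolding Q[symmetric] Q[of 0, unfolded l0, symmetric]
  by (simp add: numeral_2_eq_2 phi_def l0 l1 field_simps)
  also have "... = 1/2 * (SUM i<n. SUM j<n. (?H i j (line n x d t) - ?H i j x) * d i * d j)"
  by (simp add: sum_subtractf left_diff_distrib)
  finally have eq: "f y - f x - (SUM i<n. pder i f x * d i) - 1/2 * ?Q x = ..." .
  have bound: "abs (1/2 * (SUM i<n. SUM j<n. (?H i j (line n x d t) - ?H i j x) * d i * d j)) <= b / 2 * n * D"
  if b: "!!i j. i < n ==> j < n ==> abs (?H i j (line n x d t) - ?H i j x) <= b" "b >= 0" for b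
  proof -
  have "abs (SUM i<n. SUM j<n. (?H i j (line n x d t) - ?H i j x) * d i * d j) <= (SUM i<n. SUM j<n. b * abs (d i) * abs (d j))"
  using b by (intro sum_abs[THEN order_trans] sum_mono) (auto simp: abs_mult intro!: mult_right_mono)
  also have "... = b * (SUM i<n. 1 * abs (d i))^2"
  proof -
  have "(SUM i<n. 1 * abs (d i))^2 = (SUM i<n. SUM j<n. abs (d i) * abs (d j))"
  by (simp add: power2_eq_square sum_product)
  then show ?thesis by (simp add: sum_distrib_left mult.assoc)
  qed
  also have "... <= b * ((SUM i<n. 1\<^sup>2) * (SUM i<n. abs (d i)^2))"
  by (intro mult_left_mono Cauchy_Schwarz_ineq_sum b)
  finally show ?thesis by (simp add: D_def algebra_simps)
  qed
  have "abs (f y - f x - (SUM i<n. pder i f x * d i) - 1/2 * ?Q x) <= \<epsilon> * D + B * n / delta^2 * D^2"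
  proof (cases "\<forall>i<n. abs (d i) <= delta")
  case True
  have "abs (?H i j (line n x d t) - ?H i j x) <= e" if "i < n" "j < n" for i j
  proof (rule less_imp_le, rule unif[OF that lb x])
  fix k assume "k < n"
  then have "abs (t * d k) <= 1 * delta" using True t unfolding abs_mult by (intro mult_mono) auto
  then show "abs (line n x d t k - x k) <= delta" using \<open>k < n\<close> by (simp add: line_def)
  qed (use t in auto)
  from bound[OF this] have "abs (f y - f x - (SUM i<n. pder i f x * d i) - 1/2 * ?Q x) <= e / 2 * n * D"
  unfolding eq using e by simp
  also have "... <= \<epsilon> * D" using \<epsilon> D0 by (intro mult_right_mono) (auto simp: e_def field_simps)
  also have "... <= \<epsilon> * D + B * n / delta^2 * D^2" using B0 by simp
  finally show ?thesis .
  next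
  case False
  then obtain i where i: "i < n" "abs (d i) > delta" by auto
  have "delta^2 <= abs (d i)^2" using i delta by (intro power_mono) auto
  also have "... <= D" unfolding D_def using i member_le_sum[of i "{..<n}" "%i. (d i)^2"] by simp
  finally have D1: "1 <= D / delta^2" using delta by simp
  have "abs (?H i j (line n x d t) - ?H i j x) <= 2 * B" if "i < n" "j < n" for i j
  using B[OF that lb, of t] B[OF that x] t by linarith
  from bound[OF this] have "abs (f y - f x - (SUM i<n. pder i f x * d i) - 1/2 * ?Q x) <= B * n * D * 1"
  unfolding eq using B0 by simp
  also have "... <= B * n * D * (D / delta^2)" using B0 D0 D1 by (intro mult_left_mono) auto
  also have "... <= \<epsilon> * D + B * n / delta^2 * D^2" using \<epsilon> D0 by (simp add: power2_eq_square mult.assoc)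
  finally show ?thesis .
  qed
  then show "abs (f y - f x - (SUM i<n. pder i f x * (y i - x i))
  - 1/2 * (SUM i<n. SUM j<n. ?H i j x * (y i - x i) * (y j - x j)))
  <= \<epsilon> * (SUM i<n. (y i - x i)^2) + B * n / delta^2 * (SUM i<n. (y i - x i)^2)^2"
  by (simp add: d_def D_def)
 qed (use B0 in simp)
qed

section \<open>Martingales as identities of expectations\<close>

lemma subset_adapt:
 assumes "prob_space P" "subalgebra P F"
 shows "sigma_finite_subalgebra P F"
proof -
 interpret prob_space P by fact
 interpret finite_measure_subalgebra P F by standard fact
 show ?thesis by unfold_locales
qed

locale filtered_prob_space = prob_space P for P :: "'a measure" +
 fixes F :: "real => 'a measure"
 assumes sub: "!!t. subalgebra P (F t)"
  and sets_mono: "!!s t. s <= t ==> sets (F s) \<subseteq> sets (F t)"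
begin

lemma space_F: "space (F t) = space P"
 using sub by (auto simp: subalgebra_def)

lemma F_P: "f : measurable (F t) N ==> f : measurable P N"
 using measurable_from_subalg sub by blast

lemma F_mono: "s <= t ==> f : measurable (F s) N ==> f : measurable (F t) N"
 using sets_mono[of s t] space_F by (auto simp: measurable_def)

text \<open>Conditional expectations in integrated form. Such identities survive dominated
  convergence and Fubini directly, with no choice of versions.\<close>

definition mgle :: "(real => 'a => real) => bool" where
 "mgle X \<longleftrightarrow> (\<forall>t\<ge>0. X t : bmeas (F t) & integrable P (X t)) &
  (ALL s t A. 0 <= s --> s <= t --> A : sets (F s) -->
  (LINT w|P. indicator A w * X t w) = (LINT w|P. indicator A w * X s w))"

lemma martingale_iff_mgle:
 assumes "filtration (space P) F"
 shows "martingale P F X \<longleftrightarrow> mgle X"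
proof
 assume m: "martingale P F X"
 then have X: "!!t. t >= 0 ==> X t : bmeas (F t)" "!!t. t >= 0 ==> integrable P (X t)"
  and ce: "!!s t. 0 <= s ==> s <= t ==> AE w in P. real_cond_exp P (F s) (X t) w = X s w"
  by (auto simp: martingale_def adapted_def)
 have "(LINT w|P. indicator A w * X t w) = (LINT w|P. indicator A w * X s w)"
  if st: "0 <= s" "s <= t" "A : sets (F s)" for s t A
 proof -
  interpret S: sigma_finite_subalgebra P "F s" by (rule subset_adapt[OF prob_space_axioms sub])
  have "(LINT w|P. indicator A w * X t w) = (\<integral>w\<in>A. real_cond_exp P (F s) (X t) w \<partial>P)"
  using S.real_cond_exp_intA[OF X(2) st(3), of t] st by (simp add: set_lebesgue_integral_def)
  also have "... = (LINT w|P. indicator A w * X s w)"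
  proof -
  have "A : sets P" using sub[of s] st by (auto simp: subalgebra_def)
  moreover have "X s : bmeas P" by (rule F_P[OF X(1)[OF st(1)]])
  moreover have "AE w in P. ind A w *\<^sub>R real_cond_exp P (F s) (X t) w = ind A w * X s w"
  using ce[OF st(1,2)] by eventually_elim simp
  ultimately show ?thesis
  unfolding set_lebesgue_integral_def by (intro integral_cong_AE) simp_all
  qed
  finally show ?thesis .
 qed
 then show "mgle X" using X unfolding mgle_def by blast
next
 assume m: "mgle X"
 then have X: "!!t. t >= 0 ==> X t : bmeas (F t)" "!!t. t >= 0 ==> integrable P (X t)"
  by (auto simp: mgle_def)
 have "AE w in P. real_cond_exp P (F s) (X t) w = X s w" if "0 <= s" "s <= t" for s t
 proof -
  interpret S: sigma_finite_subalgebra P "F s" by (rule subset_adapt[OF prob_space_axioms sub])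
  show ?thesis
  proof (rule S.real_cond_exp_charact)
  fix A assume "A : sets (F s)"
  then show "(\<integral>w\<in>A. X t w \<partial>P) = (\<integral>w\<in>A. X s w \<partial>P)"
  using m that unfolding mgle_def set_lebesgue_integral_def real_scaleR_def by blast
  qed (use X that in auto)
 qed
 then show "martingale P F X"
  using assms sub X unfolding martingale_def adapted_def by blast
qed

lemma mgleD:
 assumes "mgle X" "t >= 0"
 shows "X t : bmeas (F t)" "integrable P (X t)" "X t : bmeas P"
 using assms F_P unfolding mgle_def by blast+

text \<open>Passing through \<open>real_cond_exp\<close> admits unbounded weights Y, provided the
  two products are integrable. Such weights occur in Doob's inequality for powers and in the
  integration by parts for the bracket.\<close>

lemma mgle_mult:
 assumes m: "mgle X" and st: "0 <= s" "s <= t" and Y: "Y : bmeas (F s)"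
  and i: "integrable P (%w. Y w * X t w)" "integrable P (%w. Y w * X s w)"
 shows "(LINT w|P. Y w * X t w) = (LINT w|P. Y w * X s w)"
proof -
 interpret S: sigma_finite_subalgebra P "F s" by (rule subset_adapt[OF prob_space_axioms sub])
 have "AE w in P. real_cond_exp P (F s) (X t) w = X s w"
 proof (rule S.real_cond_exp_charact)
  fix A assume "A : sets (F s)"
  then show "(\<integral>w\<in>A. X t w \<partial>P) = (\<integral>w\<in>A. X s w \<partial>P)"
  using m st unfolding mgle_def set_lebesgue_integral_def real_scaleR_def by blast
 qed (use mgleD[OF m] st in auto)
 moreover have "(LINT w|P. Y w * real_cond_exp P (F s) (X t) w) = (LINT w|P. Y w * X t w)"
  using st mgleD[OF m] by (intro S.real_cond_exp_intg(2) i(1) Y) auto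
 moreover have "(LINT w|P. Y w * real_cond_exp P (F s) (X t) w) = (LINT w|P. Y w * X s w)"
  using calculation(1) F_P[OF Y] mgleD(3)[OF m, of s] st
  by (intro integral_cong_AE borel_measurable_times) auto
 ultimately show ?thesis by simp
qed

lemma integrable_bounded_mult:
 fixes Y X :: "'a => real"
 assumes "Y : bmeas P" "!!w. w : space P ==> abs (Y w) <= c" "integrable P X"
 shows "integrable P (%w. Y w * X w)"
proof (rule bib_bound[of P "%w. c * X w"])
 show "AE w in P. norm (Y w * X w) <= norm (c * X w)"
 proof (rule AE_I2)
  fix w assume "w : space P"
  then have "abs (Y w) <= abs c" using assms(2)[of w] by linarith
  then show "norm (Y w * X w) <= norm (c * X w)" by (simp add: abs_mult mult_right_mono)
 qed
qed (use assms in auto)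

lemma mgle_mult_bounded:
 assumes m: "mgle X" and st: "0 <= s" "s <= t" and Y: "Y : bmeas (F s)"
  and b: "!!w. w : space P ==> abs (Y w) <= c"
 shows "(LINT w|P. Y w * (X t w - X s w)) = 0"
proof -
 have i: "integrable P (%w. Y w * X t w)" "integrable P (%w. Y w * X s w)"
  using st by (auto intro!: integrable_bounded_mult[OF F_P[OF Y] b] mgleD[OF m])
 show ?thesis using mgle_mult[OF m st Y i] i by (simp add: right_diff_distrib)
qed

lemma mgleI:
 assumes "!!t. t >= 0 ==> X t : bmeas (F t)" "!!t. t >= 0 ==> integrable P (X t)"
  and "!!s t A. 0 <= s ==> s <= t ==> A : sets (F s) ==> (LINT w|P. indicator A w * (X t w - X s w)) = 0"
 shows "mgle X"
 unfolding mgle_def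
proof (intro conjI allI impI)
 fix s t A assume st: "0 <= s" "s <= t" "A : sets (F s)"
 then have A: "A : sets P" using sub[of s] by (auto simp: subalgebra_def)
 have "integrable P (%w. indicator A w * X t w)" "integrable P (%w. indicator A w * X s w)"
  using assms(2) st A integrable_mult_indicator[OF A, of "X t"] integrable_mult_indicator[OF A, of "X s"] by auto
 then show "(LINT w|P. indicator A w * X t w) = (LINT w|P. indicator A w * X s w)"
  using assms(3)[OF st] by (simp add: right_diff_distrib)
qed (use assms in auto)

lemma mgle_indicator:
 assumes m: "mgle X" and st: "0 <= s" "s <= t" and A: "A : sets (F s)"
 shows "(LINT w|P. indicator A w * (X t w - X s w)) = 0"
 by (rule mgle_mult_bounded[OF m st, of _ 1]) (use A in \<open>auto simp: indicator_def\<close>)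

lemma mgle_add: "mgle X ==> mgle Y ==> mgle (%t w. X t w + Y t w)"
proof -
 assume a: "mgle X" "mgle Y"
 have i: "integrable P (%w. indicator A w * (X t w - X s w))" "integrable P (%w. indicator A w * (Y t w - Y s w))"
  if "0 <= s" "s <= t" "A : sets (F s)" for s t A
 proof -
  have "A : sets P" using sub[of s] that by (auto simp: subalgebra_def)
  then show "integrable P (%w. indicator A w * (X t w - X s w))" "integrable P (%w. indicator A w * (Y t w - Y s w))"
  using mgleD[OF a(1), of s] mgleD[OF a(1), of t] mgleD[OF a(2), of s] mgleD[OF a(2), of t] that
  by (auto intro!: integrable_bounded_mult[where c = 1] simp: indicator_def)
 qed
 have e: "indicator A w * (X t w + Y t w - (X s w + Y s w)) = indicator A w * (X t w - X s w) + indicator A w * (Y t w - Y s w)" for A s t w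
  by (simp add: algebra_simps)
 show ?thesis
 proof (rule mgleI)
  fix s t :: real and A assume st: "0 <= s" "s <= t" "A : sets (F s)"
  show "(LINT w|P. indicator A w * (X t w + Y t w - (X s w + Y s w))) = 0"
  unfolding e using bi_add[OF i[OF st]]
  mgle_indicator[OF a(1) st] mgle_indicator[OF a(2) st] by simp
 qed (use mgleD[OF a(1)] mgleD[OF a(2)] in auto)
qed

lemma mgle_cmult: "mgle X ==> mgle (%t w. c * X t w)"
proof -
 assume a: "mgle X"
 have e: "indicator A w * (c * X t w - c * X s w) = c * (indicator A w * (X t w - X s w))" for A s t w
  by (simp add: algebra_simps)
 show ?thesis
  by (rule mgleI) (use mgleD[OF a] in \<open>auto simp: e mgle_indicator[OF a]\<close>)
qed

lemma mgle_diff: "mgle X ==> mgle Y ==> mgle (%t w. X t w - Y t w)"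
 using mgle_add[of X "%t w. (-1) * Y t w"] mgle_cmult[of Y "-1"] by simp

lemma mgle_const: 
 assumes "C : bmeas (F 0)" "integrable P C"
 shows "mgle (%t. C)"
 by (rule mgleI) (simp_all add: F_mono[OF _ assms(1)] assms(2))

lemma mgle_cong:
 assumes "!!t w. t >= 0 ==> w : space P ==> X t w = Y t w"
 shows "mgle X \<longleftrightarrow> mgle Y"
proof -
 have *: "mgle Y'" if "mgle X'" "!!t w. t >= 0 ==> w : space P ==> X' t w = Y' t w" for X' Y'
  unfolding mgle_def
 proof (intro conjI allI impI)
  fix t :: real assume "0 <= t"
  show "Y' t : bmeas (F t)"
  using mgleD(1)[OF that(1) \<open>0 <= t\<close>] measurable_cong[of "F t" "X' t" "Y' t" borel]
  that(2)[OF \<open>0 <= t\<close>] by (simp add: space_F)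
  show "integrable P (Y' t)"
  using mgleD(2)[OF that(1) \<open>0 <= t\<close>] that(2)[OF \<open>0 <= t\<close>]
  bib_cong[of P P "X' t" "Y' t"] by simp
 next
  fix s t A assume st: "0 <= s" "s <= t" "A : sets (F s)"
  have "(LINT w|P. indicator A w * X' t w) = (LINT w|P. indicator A w * X' s w)"
  using that(1) st unfolding mgle_def by blast
  moreover have "(LINT w|P. indicator A w * X' u w) = (LINT w|P. indicator A w * Y' u w)" if "u >= 0" for u
  using \<open>!!t w. t >= 0 ==> w : space P ==> X' t w = Y' t w\<close> that
  by (intro bi_cong) simp_all
  ultimately show "(LINT w|P. indicator A w * Y' t w) = (LINT w|P. indicator A w * Y' s w)"
  using st by simp
 qed
 show ?thesis
 proof
  assume "mgle X" then show "mgle Y" by (rule *) (rule assms)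
 next
  assume "mgle Y" then show "mgle X" by (rule *) (rule assms[symmetric])
 qed
qed

end

section \<open>Doob's maximal inequality for powers of a nonnegative martingale\<close>

lemma power_convex_bound:
 fixes a b :: real
 assumes "0 <= a" "0 <= b"
 shows "real (Suc p) * a ^ p * (b - a) <= b ^ Suc p - a ^ Suc p"
proof (induction p)
 case (Suc p)
 have "b * (real (Suc p) * a ^ p * (b - a)) <= b * (b ^ Suc p - a ^ Suc p)"
  using Suc assms by (intro mult_left_mono)
 moreover have "0 <= (real (Suc p)) * a ^ p * (b - a)^2" using assms by simp
 ultimately show ?case by (simp add: algebra_simps power2_eq_square)
qed simp

text \<open>A crude Young inequality by comparing a with b. It only serves to show that mixed
  products are integrable, so its constant need not be sharp.\<close>

lemma young_power:
 fixes a b :: real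
 assumes "0 <= a" "0 <= b"
 shows "a ^ p * b <= a ^ Suc p + b ^ Suc p"
proof (cases "a <= b")
 case True
 then have "a ^ p * b <= b ^ p * b" using assms by (intro mult_right_mono power_mono)
 also have "... <= a ^ Suc p + b ^ Suc p" using assms by simp
 finally show ?thesis .
next
 case False
 then have "a ^ p * b <= a ^ p * a" using assms by (intro mult_left_mono) auto
 also have "... <= a ^ Suc p + b ^ Suc p" using assms by simp
 finally show ?thesis .
qed

lemma abs_mult_le_squares: "abs (u * v) <= u^2 + (v::real)^2"
proof -
 have "0 <= (abs u - abs v)^2" by simp
 also have "... = u^2 + v^2 - 2 * abs (u * v)" by (simp add: power2_diff abs_mult)
 finally show ?thesis using abs_ge_zero[of "u * v"] by linarith
qed

lemma power2_sum_le: "(u + v)^2 <= 2 * (u^2 + (v::real)^2)"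
 using zero_le_power2[of "u - v"] by (simp add: power2_eq_square algebra_simps)

lemma Max_image_Suc:
 fixes f :: "nat => real"
 shows "Max (f ` {..Suc k}) = max (Max (f ` {..k})) (f (Suc k))"
 by (simp add: atMost_Suc max.commute)

text \<open>Pathwise form of Doob's \<open>L^2\<close> inequality: the sum is a discrete stochastic integral.\<close>

lemma pathwise_doob:
 fixes y :: "nat => real"
 defines "S \<equiv> %k. Max (y ` {..k})"
 assumes "!!k. y k >= 0"
 shows "(S n)^2 <= 2 * (S n * y n) - 2 * (SUM k<n. S k * (y (Suc k) - y k))"
proof (induction n)
 case 0
 then show ?case by (simp add: S_def power2_eq_square)
next
 case (Suc n)
 have S: "S (Suc n) = max (S n) (y (Suc n))" unfolding S_def by (rule Max_image_Suc)
 have "(S (Suc n))^2 - (S n)^2 <= 2 * ((S (Suc n) - S n) * y (Suc n))"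
 proof (cases "S n <= y (Suc n)")
  case True
  have "(y (Suc n) - S n) * (y (Suc n) + S n) <= (y (Suc n) - S n) * (y (Suc n) + y (Suc n))"
  using True by (intro mult_left_mono) auto
  with True show ?thesis by (simp add: S max_def algebra_simps power2_eq_square)
 qed (simp add: S max_def)
 with Suc show ?case by (simp add: algebra_simps)
qed

context filtered_prob_space
begin

text \<open>Take expectations in \<open>pathwise_doob\<close>: the discrete integral has nonnegative
  mean by \<open>sm\<close>. Then \<open>2 * S * Y <= S^2 / 2 + 2 * Y^2\<close> lets half of the
  mean of \<open>S^2\<close> be absorbed on the left, which leaves the factor 4.\<close>

lemma doob_L2_discrete:
 fixes Y :: "nat => 'a => real"
 defines "S \<equiv> %k w. Max ((%i. Y i w) ` {..k})"
 assumes Ym: "!!k. Y k : bmeas P"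
  and Y0: "!!k w. 0 <= Y k w"
  and Y2: "!!k. integrable P (%w. (Y k w)^2)"
  and sm: "!!k. 0 <= (LINT w|P. S k w * (Y (Suc k) w - Y k w))"
 shows "integrable P (%w. (S n w)^2)" "(LINT w|P. (S n w)^2) <= 4 * (LINT w|P. (Y n w)^2)"
proof -
 have Sm[measurable]: "S k : bmeas P" for k
  unfolding S_def by (rule borel_measurable_Max) (use Ym in auto)
 note [measurable] = Ym
 have S0: "0 <= S k w" for k w
 proof -
  have "Y 0 w <= S k w" unfolding S_def by (rule Max_ge) auto
  then show ?thesis using Y0[of 0 w] by linarith
 qed
 have SY: "(S k w)^2 <= (SUM i<=k. (Y i w)^2)" for k w
 proof -
  have "S k w : (%i. Y i w) ` {..k}" unfolding S_def by (rule Max_in) auto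
  then obtain i where "i <= k" "S k w = Y i w" by auto
  then show ?thesis using member_le_sum[of i "{..k}" "%i. (Y i w)^2"] by simp
 qed
 have S2: "integrable P (%w. (S k w)^2)" for k
  by (rule bib_bound[of P "%w. SUM i<=k. (Y i w)^2"])
  (use Y2 SY in \<open>auto intro!: AE_I2 simp: sum_nonneg\<close>)
 then show "integrable P (%w. (S n w)^2)" .
 have SYi: "integrable P (%w. S k w * Y j w)" for k j
 proof (rule bib_bound[of P "%w. (S k w)^2 + (Y j w)^2"])
  show "AE w in P. norm (S k w * Y j w) <= norm ((S k w)^2 + (Y j w)^2)"
  using abs_mult_le_squares by simp
 qed (use S2 Y2 in auto)
 have "(LINT w|P. (S n w)^2) <= (LINT w|P. 2 * (S n w * Y n w) - 2 * (SUM k<n. S k w * (Y (Suc k) w - Y k w)))"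
 proof (rule integral_mono)
  show "(S n w)^2 <= 2 * (S n w * Y n w) - 2 * (SUM k<n. S k w * (Y (Suc k) w - Y k w))" for w
  using pathwise_doob[of "%i. Y i w" n] Y0 unfolding S_def by simp
 qed (use S2 SYi in \<open>auto simp: right_diff_distrib\<close>)
 also have "... = 2 * (LINT w|P. S n w * Y n w) - 2 * (SUM k<n. \<integral>w. S k w * (Y (Suc k) w - Y k w) \<partial>P)"
  using SYi by (subst bi_diff) (auto simp: right_diff_distrib)
 also have "... <= 2 * (LINT w|P. S n w * Y n w)"
  using sm by (simp add: sum_nonneg)
 also have "... <= (LINT w|P. (S n w)^2 / 2 + 2 * (Y n w)^2)"
 proof -
  have "2 * (S n w * Y n w) <= (S n w)^2 / 2 + 2 * (Y n w)^2" for w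
  using zero_le_power2[of "S n w - 2 * Y n w"] unfolding power2_diff
  by (simp add: power_mult_distrib)
  then have "(LINT w|P. 2 * (S n w * Y n w)) <= (LINT w|P. (S n w)^2 / 2 + 2 * (Y n w)^2)"
  using S2 Y2 SYi by (intro integral_mono) auto
  then show ?thesis by simp
 qed
 also have "... = (LINT w|P. (S n w)^2) / 2 + 2 * (LINT w|P. (Y n w)^2)"
  using S2 Y2 by simp
 finally show "(LINT w|P. (S n w)^2) <= 4 * (LINT w|P. (Y n w)^2)" by simp
qed

text \<open>The discrete inequality is applied to \<open>Z ^ Suc p\<close> on equidistant grids of
  \<open>{0..T}\<close>. Its bound does not depend on the grid, the grid maxima converge to the
  supremum by continuity of the paths, and Fatou's lemma transfers the bound.\<close>

lemma doob_power:
 assumes Z: "mgle Z" and Z0: "!!t w. 0 <= Z t w"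
  and Zc: "!!w. w : space P ==> continuous_on {0..} (%t. Z t w)"
  and Zp: "!!t. 0 <= t ==> integrable P (%w. Z t w ^ (2 * Suc p))" and T: "T >= 0"
 shows "(%w. SUP t\<in>{0..T}. Z t w) : bmeas P"
  "integrable P (%w. (SUP t\<in>{0..T}. Z t w) ^ (2 * Suc p))"
proof -
 let ?q = "Suc p"
 define D where "D w = (SUP t\<in>{0..T}. Z t w)" for w
 \<comment> \<open>Beyond index \<open>Suc m\<close> the grid stays at T, because the discrete lemma
   speaks of infinite sequences.\<close>
 define g where "g m k = T * min 1 (real k / real (Suc m))" for m k
 have g0: "0 <= g m k" "g m k <= T" for m k
  using T by (auto simp: g_def intro: mult_left_le)
 have gmono: "g m k <= g m (Suc k)" for m k
  unfolding g_def using T by (intro mult_left_mono min.mono) (auto intro!: divide_right_mono)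
 define M where "M m k w = Max ((%i. Z (g m i) w) ` {..k})" for m k w
 note [measurable] = mgleD(3)[OF Z]
 have Zg[measurable]: "Z (g m i) : bmeas P" for m i
  using g0 by (intro mgleD[OF Z])
 have M[measurable]: "M m k : bmeas P" for m k
  unfolding M_def by (rule borel_measurable_Max) auto
 have M0: "0 <= M m k w" for m k w
 proof -
  have "Z (g m 0) w <= M m k w" unfolding M_def by (rule Max_ge) auto
  then show ?thesis using Z0[of "g m 0" w] by linarith
 qed
 define S where "S m k w = Max ((%i. Z (g m i) w ^ ?q) ` {..k})" for m k w
 have SM: "S m k w = M m k w ^ ?q" for m k w
 proof (induction k)
  case (Suc k)
  have "max (M m k w) (Z (g m (Suc k)) w) ^ ?q = max (M m k w ^ ?q) (Z (g m (Suc k)) w ^ ?q)"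
  using M0[of m k w] Z0[of "g m (Suc k)" w] power_mono[of "M m k w" "Z (g m (Suc k)) w" ?q]
  power_mono[of "Z (g m (Suc k)) w" "M m k w" ?q] by (auto simp: max_def)
  then show ?case using Suc unfolding S_def M_def by (simp only: Max_image_Suc)
 qed (simp add: S_def M_def)
 have SF: "S m k : bmeas (F (g m k))" for m k
 proof -
  have "g m i <= g m k" if "i <= k" for i
  using gmono by (rule lift_Suc_mono_le[of "g m", OF _ that])
  then have "(%w. Z (g m i) w ^ ?q) : bmeas (F (g m k))" if "i <= k" for i
  using F_mono[of "g m i" "g m k" "Z (g m i)" borel] mgleD(1)[OF Z g0(1)[of m i]] that
  by (intro borel_measurable_power) auto
  then show ?thesis unfolding S_def by (intro borel_measurable_Max) auto
 qed
 have YI: "integrable P (%w. (Z (g m k) w ^ ?q)^2)" for m k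
  using Zp[OF g0(1), of m k] by (subst power_mult[symmetric], subst mult.commute)
 have S2: "integrable P (%w. (S m k w)^2)" for m k
 proof (rule bib_bound[of P "%w. SUM i<=k. (Z (g m i) w ^ ?q)^2"])
  have "(S m k w)^2 <= (SUM i<=k. (Z (g m i) w ^ ?q)^2)" for w
  proof -
  have "S m k w : (%i. Z (g m i) w ^ ?q) ` {..k}" unfolding S_def by (rule Max_in) auto
  then obtain i where "i <= k" "S m k w = Z (g m i) w ^ ?q" by auto
  then show ?thesis using member_le_sum[of i "{..k}" "%i. (Z (g m i) w ^ ?q)^2"] by simp
  qed
  then show "AE w in P. norm ((S m k w)^2) <= norm (SUM i<=k. (Z (g m i) w ^ ?q)^2)"
  by (auto simp: sum_nonneg)
 qed (use YI in \<open>auto simp: SM\<close>)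
 \<comment> \<open>Submartingale property of \<open>Z ^ Suc p\<close> with weight S: by the tangent
   inequality \<open>power_convex_bound\<close> the increment of the power dominates a multiple of
   the increment of Z that is known at the earlier time, and the weighted mean of the latter is
   zero.\<close>
 have sub_S: "0 <= (LINT w|P. S m k w * (Z (g m (Suc k)) w ^ ?q - Z (g m k) w ^ ?q))" for m k
 proof -
  let ?a = "%w. Z (g m k) w" and ?b = "%w. Z (g m (Suc k)) w"
  let ?V = "%w. real ?q * (S m k w * ?a w ^ p)"
  note bd = abs_mult_le_squares
  have i1: "integrable P (%w. S m k w * (?a w ^ p * Z (g m j) w))" for j
  proof (rule bib_bound[of P "%w. (S m k w)^2 + 2 * ((?a w ^ ?q)^2 + (Z (g m j) w ^ ?q)^2)"])
  show "AE w in P. norm (S m k w * (?a w ^ p * Z (g m j) w)) <= norm ((S m k w)^2 + 2 * ((?a w ^ ?q)^2 + (Z (g m j) w ^ ?q)^2))"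
  proof (rule AE_I2)
  fix w
  have "(?a w ^ p * Z (g m j) w)^2 <= (?a w ^ ?q + Z (g m j) w ^ ?q)^2"
  using Z0 by (intro power_mono young_power mult_nonneg_nonneg) auto
  also have "... <= 2 * ((?a w ^ ?q)^2 + (Z (g m j) w ^ ?q)^2)"
  by (rule power2_sum_le)
  finally show "norm (S m k w * (?a w ^ p * Z (g m j) w)) <= norm ((S m k w)^2 + 2 * ((?a w ^ ?q)^2 + (Z (g m j) w ^ ?q)^2))"
  using bd[of "S m k w" "?a w ^ p * Z (g m j) w"] by simp
  qed
  qed (use S2 YI in \<open>auto simp: SM\<close>)
  have i2: "integrable P (%w. S m k w * Z (g m j) w ^ ?q)" for j
  by (rule bib_bound[of P "%w. (S m k w)^2 + (Z (g m j) w ^ ?q)^2"])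
  (use S2 YI bd in \<open>auto simp: SM\<close>)
  have "(LINT w|P. ?V w * ?b w) = (LINT w|P. ?V w * ?a w)"
  proof (rule mgle_mult[OF Z g0(1) gmono])
  show "?V : bmeas (F (g m k))"
  using SF[of m k] mgleD(1)[OF Z g0(1)[of m k]] by measurable
  show "integrable P (%w. ?V w * ?b w)" "integrable P (%w. ?V w * ?a w)"
  using integrable_mult_right[OF i1[of "Suc k"], of "real ?q"] integrable_mult_right[OF i1[of k], of "real ?q"]
  by (simp_all add: mult.assoc)
  qed
  moreover have "integrable P (%w. ?V w * Z (g m j) w)" for j
  using integrable_mult_right[OF i1[of j], of "real ?q"] by (simp add: mult.assoc)
  ultimately have "0 = (LINT w|P. ?V w * (?b w - ?a w))"
  by (simp add: right_diff_distrib)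
  also have "... <= (LINT w|P. S m k w * (?b w ^ ?q - ?a w ^ ?q))"
  proof (rule integral_mono)
  fix w
  have "S m k w * (real ?q * ?a w ^ p * (?b w - ?a w)) <= S m k w * (?b w ^ ?q - ?a w ^ ?q)"
  using M0 Z0 by (intro mult_left_mono power_convex_bound) (auto simp: SM)
  then show "?V w * (?b w - ?a w) <= S m k w * (?b w ^ ?q - ?a w ^ ?q)"
  by (simp only: mult_ac)
  qed (use \<open>!!j. integrable P (%w. ?V w * Z (g m j) w)\<close> i2 in \<open>auto simp: right_diff_distrib simp del: power_Suc\<close>)
  finally show ?thesis .
 qed
 note doob = doob_L2_discrete[of "%k w. Z (g m k) w ^ ?q" "Suc m" for m, folded S_def]
 have gm: "g m (Suc m) = T" for m by (simp add: g_def)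
 define E where "E = 4 * (LINT w|P. (Z T w ^ ?q)^2)"
 have ES: "(LINT w|P. (S m (Suc m) w)^2) <= E" for m
  using doob(2)[OF _ _ YI sub_S, of m] Z0 unfolding gm E_def by simp
 have Zbdd: "bdd_above ((%t. Z t w) ` {0..T})" and attain: "\<exists>t\<in>{0..T}. D w = Z t w"
  if w: "w : space P" for w
 proof -
  have c: "continuous_on {0..T} (%t. Z t w)" by (rule continuous_on_subset[OF Zc[OF w]]) auto
  then show "bdd_above ((%t. Z t w) ` {0..T})"
  by (intro bounded_imp_bdd_above compact_imp_bounded compact_continuous_image) auto
  obtain t where t: "t : {0..T}" "!!u. u : {0..T} ==> Z u w <= Z t w"
  using continuous_attains_sup[OF _ _ c] T by auto
  have "D w = Z t w" unfolding D_def by (rule cSup_eq_maximum) (use t in auto)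
  with t show "\<exists>t\<in>{0..T}. D w = Z t w" by auto
 qed
 have MD: "(%m. M m (Suc m) w) ~~> D w" if w: "w : space P" for w
 proof -
  obtain t where t: "t : {0..T}" "D w = Z t w" using attain[OF w] by auto
  have le: "M m (Suc m) w <= D w" for m
  unfolding M_def D_def using g0 by (intro Max.boundedI) (auto intro!: cSUP_upper Zbdd w)
  show ?thesis
  proof (cases "T = 0")
  case True
  then have "g m k = 0" for m k by (simp add: g_def)
  then have "M m (Suc m) w = Z 0 w" for m unfolding M_def by (simp add: image_constant_conv)
  then show ?thesis using t True by simp
  next
  case False
  \<comment> \<open>Index of the last grid point not after t, a time at which the supremum is
    attained.\<close>
  define k where "k m = nat \<lfloor>t / T * real (Suc m)\<rfloor>" for m
  have tT: "0 <= t / T" "t / T <= 1" using t T False by auto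
  have km: "real (k m) <= t / T * real (Suc m)" "t / T * real (Suc m) - 1 <= real (k m)" for m
  proof -
  have "0 <= t / T * real (Suc m)" using tT by (intro mult_nonneg_nonneg) auto
  then have "real (k m) = of_int \<lfloor>t / T * real (Suc m)\<rfloor>" unfolding k_def by simp
  then show "real (k m) <= t / T * real (Suc m)" "t / T * real (Suc m) - 1 <= real (k m)"
  by linarith+
  qed
  have kS: "k m <= Suc m" for m
  proof -
  have "t / T * real (Suc m) <= real (Suc m)" using tT by (intro mult_left_le_one_le) auto
  then show ?thesis using km(1)[of m] by linarith
  qed
  have gk: "abs (g m (k m) - t) <= T / real (Suc m)" for m
  proof -
  have "real (k m) / real (Suc m) <= 1" using kS[of m] by simp
  then have "g m (k m) = T * (real (k m) / real (Suc m))" by (simp add: g_def min_def)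
  moreover have "T * (real (k m) / real (Suc m)) <= T * (t / T)"
  using km(1)[of m] T by (intro mult_left_mono) (auto simp: field_simps)
  moreover have "T * (t / T - 1 / real (Suc m)) <= T * (real (k m) / real (Suc m))"
  proof (rule mult_left_mono[OF _ T])
  have "(t / T * real (Suc m) - 1) / real (Suc m) <= real (k m) / real (Suc m)"
  using km(2)[of m] by (rule divide_right_mono) simp
  then show "t / T - 1 / real (Suc m) <= real (k m) / real (Suc m)"
  by (simp add: diff_divide_distrib)
  qed
  ultimately show ?thesis using T False by (simp add: right_diff_distrib)
  qed
  have "(%m. g m (k m)) ~~> t"
  proof (rule LIM_zero_cancel, rule Lim_null_comparison)
  show "\<forall>\<^sub>F m in sequentially. norm (g m (k m) - t) <= T / real (Suc m)" using gk by simp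
  show "(%m. T / real (Suc m)) ~~> 0"
  by (rule LIMSEQ_Suc) (rule lim_const_over_n)
  qed
  then have l: "(%m. Z (g m (k m)) w) ~~> D w"
  unfolding t(2) using t(1) g0 by (intro continuous_on_tendsto_compose[OF Zc[OF w]]) auto
  show ?thesis
  proof (rule tendsto_sandwich[OF _ _ l tendsto_const])
  show "\<forall>\<^sub>F m in sequentially. Z (g m (k m)) w <= M m (Suc m) w"
  unfolding M_def using kS by (intro always_eventually allI Max_ge) auto
  qed (use le in auto)
  qed
 qed
 show Dm: "D : bmeas P"
  by (rule borel_measurable_LIMSEQ_real[OF MD]) auto
 have "(\<integral>\<^sup>+w. ennreal (D w ^ (2 * ?q)) \<partial>P) = (\<integral>\<^sup>+w. liminf (%m. ennreal ((S m (Suc m) w)^2)) \<partial>P)"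
 proof (rule nn_integral_cong)
  fix w assume w: "w : space P"
  have "(%m. ennreal ((S m (Suc m) w)^2)) ~~> ennreal ((D w ^ ?q)^2)"
  unfolding SM by (intro tendsto_ennrealI tendsto_power MD w)
  moreover have "D w ^ (2 * ?q) = (D w ^ ?q)^2" by (subst mult.commute) (rule power_mult)
  ultimately show "ennreal (D w ^ (2 * ?q)) = liminf (%m. ennreal ((S m (Suc m) w)^2))"
  by (simp only:) (rule lim_imp_Liminf[symmetric], simp)
 qed
 also have "... <= liminf (%m. \<integral>\<^sup>+w. ennreal ((S m (Suc m) w)^2) \<partial>P)"
  by (rule nn_integral_liminf) (simp add: SM)
 also have "... <= ennreal E"
 proof -
  have "(\<integral>\<^sup>+w. ennreal ((S m (Suc m) w)^2) \<partial>P) <= ennreal E" for m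
  using ES[of m] by (subst nn_integral_eq_integral[OF S2]) (auto intro: ennreal_leI)
  then have "liminf (%m. \<integral>\<^sup>+w. ennreal ((S m (Suc m) w)^2) \<partial>P) <= liminf (%m. ennreal E)"
  by (intro Liminf_mono always_eventually allI)
  then show ?thesis by (simp add: Liminf_const)
 qed
 finally have "(\<integral>\<^sup>+w. ennreal (D w ^ (2 * ?q)) \<partial>P) < \<infinity>" by (auto intro: le_less_trans)
 moreover have "0 <= D w ^ (2 * ?q)" for w unfolding power_mult by simp
 ultimately show "integrable P (%w. D w ^ (2 * ?q))"
  using Dm by (intro integrableI_nonneg) auto
qed

end

section \<open>Processes composed with functions on \<open>Rn n\<close>, time integrals and Riemann
  sums\<close>

lemma Rn_comp_measurable:
 fixes g :: "(nat => real) => real"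
 assumes g: "continuous_on (Rn n) g" and x: "!!i. i < n ==> x i : bmeas N"
 shows "(%w. g (\<lambda>i\<in>{..<n}. x i w)) : bmeas N"
proof -
 have "(%w. \<lambda>i\<in>{..<n}. x i w) : bmeas N"
 proof (rule measurable_coordinatewise_then_product)
  show "(%w. (\<lambda>i\<in>{..<n}. x i w) i) : bmeas N" for i
  using x by (cases "i < n") (auto simp: restrict_def)
 qed
 then have "(%w. \<lambda>i\<in>{..<n}. x i w) : N \<rightarrow>\<^sub>M restrict_space borel (Rn n)"
  by (intro measurable_restrict_space2) auto
 from measurable_comp[OF this borel_measurable_continuous_on_restrict[OF g]] show ?thesis
  by (simp add: comp_def)
qed

lemma Rn_comp_continuous:
 fixes g :: "(nat => real) => real"
 assumes g: "continuous_on (Rn n) g" and x: "!!i. i < n ==> continuous_on S (x i)"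
 shows "continuous_on S (%t. g (\<lambda>i\<in>{..<n}. x i t))"
proof (rule continuous_on_compose2[OF g])
 show "continuous_on S (%t. \<lambda>i\<in>{..<n}. x i t)"
 proof (rule continuous_on_coordinatewise_then_product)
  show "continuous_on S (%t. (\<lambda>i\<in>{..<n}. x i t) i)" for i
  using x by (cases "i < n") (auto simp: restrict_def)
 qed
qed auto

lemma set_integrable_bounded_Icc:
 fixes beta :: "real => real"
 assumes "beta : bmeas borel" "!!u. abs (beta u) <= c"
 shows "set_integrable lborel {s..t} beta"
 unfolding set_integrable_def
proof (rule bib_bound[of _ "%u. indicator {s..t} u * c"])
 show "integrable lborel (%u. ind {s..t} u * c)"
  by (intro integrable_mult_left integrable_real_indicator) (auto simp: emeasure_lborel_Icc_eq)
 show "AE x in lborel. norm (ind {s..t} x *\<^sub>R beta x) <= norm (ind {s..t} x * c)"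
 proof (rule AE_I2)
  fix x
  have "abs (beta x) <= abs c" using assms(2)[of x] by linarith
  then show "norm (ind {s..t} x *\<^sub>R beta x) <= norm (ind {s..t} x * c)"
  by (simp add: indicator_def)
 qed
qed (use assms(1) in measurable)

lemma set_integral_bounded_Icc:
 fixes beta :: "real => real"
 assumes "beta : bmeas borel" "!!u. u : {s..t} ==> abs (beta u) <= c" "s <= t"
 shows "abs (LBINT u:{s..t}. beta u) <= c * (t - s)"
proof -
 have "norm (LBINT u:{s..t}. beta u) <= (LBINT u. ind {s..t} u * c)"
  unfolding set_lebesgue_integral_def
 proof (rule bi_norm_bound_integral)
  have i: "integrable lborel (%u. ind {s..t} u * c)"
  by (intro integrable_mult_left integrable_real_indicator) (auto simp: emeasure_lborel_Icc_eq)
  then show "integrable lborel (%u. ind {s..t} u * c)" .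
  show n: "norm (ind {s..t} x *\<^sub>R beta x) <= ind {s..t} x * c" for x
  using assms(2)[of x] by (auto simp: indicator_def)
  show "integrable lborel (%x. ind {s..t} x *\<^sub>R beta x)"
  proof (rule bib_bound[OF i])
  show "AE x in lborel. norm (ind {s..t} x *\<^sub>R beta x) <= norm (ind {s..t} x * c)"
  using order_trans[OF n abs_ge_self] by auto
  qed (use assms(1) in measurable)
 qed
 then show ?thesis using assms(3) by (simp add: mult.commute)
qed

lemma set_integral_split_Icc:
 fixes beta :: "real => real"
 assumes "set_integrable lborel {a..c} beta" "a <= b" "b <= c"
 shows "(LBINT u:{a..c}. beta u) = (LBINT u:{a..b}. beta u) + (LBINT u:{b..c}. beta u)"
proof -
 have eq: "{a..c} = {a..b} \<union> {b..c}" using assms by auto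
 show ?thesis
  unfolding eq
 proof (rule set_integral_Un_AE)
  show "AE x in lborel. \<not> (x : {a..b} & x : {b..c})"
  using AE_lborel_singleton[of b] by eventually_elim auto
 qed (use assms in \<open>auto intro: set_integrable_subset\<close>)
qed

lemma grid_mesh_limit: "(%m. (t - s) / real (Suc m)) ~~> 0"
 by (rule LIMSEQ_Suc) (rule lim_const_over_n)

text \<open>With \<open>Suc m\<close> equal steps the mesh never divides by zero and index
  \<open>Suc m\<close> is exactly t. Later indices are not capped at t.\<close>

definition grid :: "real => real => nat => nat => real" where
 "grid s t m k = s + real k * ((t - s) / real (Suc m))"

lemma grid_0 [simp]: "grid s t m 0 = s" by (simp add: grid_def)
lemma grid_last [simp]: "grid s t m (Suc m) = t" by (simp add: grid_def)
lemma grid_step: "grid s t m (Suc k) = grid s t m k + (t - s) / real (Suc m)"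
 by (simp add: grid_def add_divide_distrib distrib_right)
lemma grid_mono: "s <= t ==> k <= l ==> grid s t m k <= grid s t m l"
 unfolding grid_def by (intro add_left_mono mult_right_mono) auto
lemma grid_ge: "s <= t ==> s <= grid s t m k"
 using grid_mono[of s t 0 k m] by simp
lemma grid_le: "s <= t ==> k <= Suc m ==> grid s t m k <= t"
 using grid_mono[of s t k "Suc m" m] by simp

lemma set_integral_grid:
 fixes beta :: "real => real"
 assumes "beta : bmeas borel" "!!u. abs (beta u) <= c" "s <= t"
 shows "(LBINT u:{s..t}. beta u) = (SUM k<Suc m. LBINT u:{grid s t m k..grid s t m (Suc k)}. beta u)"
proof -
 have "(SUM k<j. LBINT u:{grid s t m k..grid s t m (Suc k)}. beta u) = (LBINT u:{s..grid s t m j}. beta u)" for j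
 proof (induction j)
  case 0
  then show ?case using set_integral_bounded_Icc[of beta s s c] assms by simp
 next
  case (Suc j)
  then show ?case
  using set_integral_split_Icc[of s "grid s t m (Suc j)" beta "grid s t m j"] assms
  by (simp add: set_integrable_bounded_Icc[OF assms(1,2)] grid_ge grid_mono)
 qed
 from this[of "Suc m"] show ?thesis by simp
qed

lemma uniform_on_grid:
 fixes q :: "real => real"
 assumes q: "continuous_on UNIV q" and "s <= t" "eta > 0"
 shows "EX N. \<forall>m\<ge>N. \<forall>k<Suc m. \<forall>u\<in>{grid s t m k..grid s t m (Suc k)}. abs (q u - q (grid s t m k)) <= eta"
proof -
 have "uniformly_continuous_on {s..t} q"
  by (intro compact_uniformly_continuous continuous_on_subset[OF q]) auto
 then obtain d where d: "d > 0" "!!x y. x : {s..t} ==> y : {s..t} ==> dist y x < d ==> dist (q y) (q x) < eta"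
  using assms(3) unfolding uniformly_continuous_on_def by metis
 have "\<forall>\<^sub>F m in sequentially. (t - s) / real (Suc m) < d"
  using grid_mesh_limit[of t s] d(1) by (rule order_tendstoD)
 then obtain N where N: "!!m. m >= N ==> (t - s) / real (Suc m) < d"
  by (auto simp: eventually_sequentially)
 show ?thesis
 proof (intro exI[of _ N] allI impI ballI)
  fix m k u assume m: "N <= m" and k: "k < Suc m" and u: "u : {grid s t m k..grid s t m (Suc k)}"
  have "grid s t m k : {s..t}" using grid_ge grid_le assms k by auto
  moreover have "u : {s..t}"
  using u grid_ge[of s t m k] grid_le[of s t "Suc k" m] assms(2) k by auto
  moreover have "dist u (grid s t m k) < d"
  using u N[OF m] by (auto simp: dist_real_def grid_step)
  ultimately show "abs (q u - q (grid s t m k)) <= eta"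
  using d(2)[of "grid s t m k" u] by (simp add: dist_real_def)
 qed
qed

text \<open>Only q is continuous; beta is merely bounded and measurable, so the sums contain
  integrals of beta over the cells instead of values. The error on a cell is governed by the
  oscillation of q there, which is small by uniform continuity.\<close>

lemma riemann_limit:
 fixes q beta :: "real => real"
 assumes q: "continuous_on UNIV q" and beta: "beta : bmeas borel" "!!u. abs (beta u) <= c"
  and qb: "!!u. abs (q u) <= K" and st: "s <= t"
 shows "(%m. SUM k<Suc m. q (grid s t m k) * (LBINT u:{grid s t m k..grid s t m (Suc k)}. beta u))
  ~~> (LBINT u:{s..t}. q u * beta u)"
proof (rule LIMSEQ_I)
 fix e :: real assume e: "0 < e"
 have c0: "0 <= c" using beta(2)[of 0] by linarith
 have qm: "q : bmeas borel" by (rule borel_measurable_continuous_onI[OF q])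
 \<comment> \<open>The \<open>+ 1\<close> keeps the denominator positive when
   \<open>c * (t - s)\<close> is 0, and the factor 2 makes the final inequality strict.\<close>
 define eta where "eta = e / (2 * (c * (t - s) + 1))"
 have eta: "eta > 0" using e c0 st by (auto simp: eta_def intro!: divide_pos_pos add_nonneg_pos)
 obtain N where N: "!!m k u. m >= N ==> k < Suc m ==> u : {grid s t m k..grid s t m (Suc k)} ==> abs (q u - q (grid s t m k)) <= eta"
  using uniform_on_grid[OF q st eta] by metis
 have pb: "abs (q u * beta u) <= K * c" for u
  using qb beta(2) c0 order_trans[OF abs_ge_zero qb] by (auto simp: abs_mult intro!: mult_mono)
 have pm: "(%u. q u * beta u) : bmeas borel" using qm beta(1) by measurable
 have "abs ((SUM k<Suc m. q (grid s t m k) * (LBINT u:{grid s t m k..grid s t m (Suc k)}. beta u)) - (LBINT u:{s..t}. q u * beta u)) < e"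
  if m: "m >= N" for m
 proof -
  let ?I = "%k. {grid s t m k..grid s t m (Suc k)}"
  let ?d = "(t - s) / real (Suc m)"
  have eq: "q (grid s t m k) * (LBINT u:?I k. beta u) - (LBINT u:?I k. q u * beta u)
  = (LBINT u:?I k. (q (grid s t m k) - q u) * beta u)" for k
  proof -
  have "set_integrable lborel (?I k) (%u. q (grid s t m k) * beta u)"
  using set_integrable_bounded_Icc[OF beta] by (rule set_integrable_mult_right)
  then show ?thesis
  using set_integral_diff(2)[of lborel "?I k" "%u. q (grid s t m k) * beta u" "%u. q u * beta u"]
  set_integrable_bounded_Icc[OF pm pb] by (simp add: left_diff_distrib)
  qed
  have "abs (LBINT u:?I k. (q (grid s t m k) - q u) * beta u) <= (eta * c) * (grid s t m (Suc k) - grid s t m k)"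
  if k: "k < Suc m" for k
  proof (rule set_integral_bounded_Icc)
  show "abs ((q (grid s t m k) - q u) * beta u) <= eta * c" if "u : ?I k" for u
  using N[OF m k that] beta(2)[of u] eta by (auto simp: abs_mult abs_minus_commute intro!: mult_mono)
  qed (use qm beta(1) grid_mono[OF st, of k "Suc k" m] in auto)
  then have b: "abs (LBINT u:?I k. (q (grid s t m k) - q u) * beta u) <= (eta * c) * ?d" if "k < Suc m" for k
  using that by (simp add: grid_step)
  have "abs (SUM k<Suc m. LBINT u:?I k. (q (grid s t m k) - q u) * beta u) <= (SUM k<Suc m. (eta * c) * ?d)"
  by (rule order_trans[OF sum_abs]) (rule sum_mono, rule b, simp)
  also have "... = eta * (c * (t - s))" by simp
  also have "... <= eta * (c * (t - s) + 1)" using eta by (intro mult_left_mono) auto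
  also have "... = e / 2"
  proof -
  have "c * (t - s) + 1 ~= 0" using c0 st mult_nonneg_nonneg[of c "t - s"] by linarith
  from nonzero_mult_divide_mult_cancel_right[OF this, of e 2]
  have "e / (2 * (c * (t - s) + 1)) * (c * (t - s) + 1) = e / 2"
  by (simp only: times_divide_eq_left)
  then show ?thesis by (simp only: eta_def)
  qed
  also have "... < e" using e by simp
  finally show ?thesis
  unfolding set_integral_grid[OF pm pb st, of m] sum_subtractf[symmetric] eq .
 qed
 then show "EX N. \<forall>m\<ge>N. norm ((SUM k<Suc m. q (grid s t m k) * (LBINT u:{grid s t m k..grid s t m (Suc k)}. beta u)) - (LBINT u:{s..t}. q u * beta u)) < e"
  by auto
qed

section \<open>Optional stopping\<close>

context filtered_prob_space
begin

text \<open>Optional stopping by a discrete stochastic integral: whether tau exceeds a grid time is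
  known at that time, the left end of the next cell, so every term has mean zero. As the grid is
  refined the sums converge to the stopped increment, dominated by \<open>2 * D w\<close>.\<close>

lemma stopped_increment:
 fixes tau :: "'a => real"
 assumes U: "mgle U" and Uc: "!!w. w : space P ==> continuous_on {0..} (%u. U u w)"
  and st: "0 <= s" "s <= t"
  and D: "integrable P D" "!!u w. w : space P ==> 0 <= u ==> u <= t ==> abs (U u w) <= D w"
  and tau0: "!!w. w : space P ==> 0 <= tau w"
  and tau: "!!u. 0 <= u ==> {w : space P. u < tau w} : sets (F u)"
  and Y: "Y : bmeas (F s)" "!!w. w : space P ==> abs (Y w) <= c"
 shows "(LINT w|P. Y w * (U (min t (tau w)) w - U (min s (tau w)) w)) = 0"
proof -
 let ?g = "grid s t"
 define I where "I m k w = ind {w : space P. ?g m k < tau w} w" for m k w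
 define J where "J m n w = (SUM k<n. I m k w * (U (?g m (Suc k)) w - U (?g m k) w))" for m n w
 have g0: "0 <= ?g m k" for m k using grid_ge[OF st(2), of m k] st(1) by linarith
 have Im: "I m k : bmeas (F (?g m k))" for m k
  unfolding I_def using tau[OF g0] by (intro borel_measurable_indicator)
 have Ym: "Y : bmeas (F (?g m k))" for m k
  by (rule F_mono[OF grid_ge[OF st(2)] Y(1)])
 have E0: "(LINT w|P. Y w * J m (Suc m) w) = 0" for m
 proof -
  have YIm: "(%w. Y w * I m k w) : bmeas (F (?g m k))" for k
  using Ym Im by (intro borel_measurable_times)
  have YIb: "abs (Y w * I m k w) <= c" if "w : space P" for w k
  using Y(2)[OF that] by (auto simp: I_def indicator_def)
  have inc: "integrable P (%w. U (?g m (Suc k)) w - U (?g m k) w)" for k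
  by (intro bib_diff mgleD[OF U g0])
  have i: "integrable P (%w. Y w * I m k w * (U (?g m (Suc k)) w - U (?g m k) w))" for k
  by (rule integrable_bounded_mult[OF F_P[OF YIm] YIb inc])
  have z: "(LINT w|P. Y w * I m k w * (U (?g m (Suc k)) w - U (?g m k) w)) = 0" for k
  by (rule mgle_mult_bounded[OF U g0 grid_mono[OF st(2)] YIm YIb]) auto
  have "(LINT w|P. Y w * J m (Suc m) w) = (LINT w|P. (SUM k<Suc m. Y w * I m k w * (U (?g m (Suc k)) w - U (?g m k) w)))"
  unfolding J_def sum_distrib_left mult.assoc ..
  also have "... = 0" using i z by (subst bi_sum) auto
  finally show ?thesis .
 qed
 \<comment> \<open>The sum telescopes up to j, the first grid index at or after tau, or n if tau has
   not been reached.\<close>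
 have key: "\<exists>j\<le>n. J m n w = U (?g m j) w - U s w & (j = n | tau w <= ?g m j) & (j = 0 | ?g m (j - 1) < tau w)"
  if w: "w : space P" for m n w
 proof (induction n)
  case 0
  then show ?case by (simp add: J_def)
 next
  case (Suc n)
  then obtain j where j: "j <= n" "J m n w = U (?g m j) w - U s w" "j = n | tau w <= ?g m j" "j = 0 | ?g m (j - 1) < tau w"
  by auto
  have JS: "J m (Suc n) w = J m n w + I m n w * (U (?g m (Suc n)) w - U (?g m n) w)" by (simp add: J_def)
  show ?case
  proof (cases "?g m n < tau w")
  case True
  have "j = n"
  proof (rule ccontr)
  assume "j ~= n"
  then have "tau w <= ?g m n" using j(3) grid_mono[OF st(2) j(1), of m] by linarith
  then show False using True by simp
  qed
  then show ?thesis using True w j JS by (intro exI[of _ "Suc n"]) (simp add: I_def)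
  next
  case False
  then have "J m (Suc n) w = J m n w" using JS by (simp add: I_def)
  moreover have "tau w <= ?g m j" using False j(3) by auto
  ultimately show ?thesis using j by (intro exI[of _ j]) auto
  qed
 qed
 have bnd: "abs (J m (Suc m) w) <= 2 * D w" if w: "w : space P" for m w
 proof -
  obtain j where "j <= Suc m" "J m (Suc m) w = U (?g m j) w - U s w" using key[OF w, of "Suc m" m] by auto
  then show ?thesis
  using D(2)[OF w g0, of m j] D(2)[OF w st] grid_le[OF st(2), of j m] by auto
 qed
 have lim: "(%m. J m (Suc m) w) ~~> U (min t (tau w)) w - U (min s (tau w)) w" if w: "w : space P" for w
 proof (cases "tau w <= s")
  case True
  then have "I m k w = 0" for m k using grid_ge[OF st(2), of m k] by (auto simp: I_def)
  then have "J m n w = 0" for m n by (simp add: J_def)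
  moreover have "min t (tau w) = tau w" "min s (tau w) = tau w" using True st by auto
  ultimately show ?thesis by simp
 next
  case False
  obtain j where j: "!!m. j m <= Suc m" "!!m. J m (Suc m) w = U (?g m (j m)) w - U s w"
  "!!m. j m = Suc m | tau w <= ?g m (j m)" "!!m. j m = 0 | ?g m (j m - 1) < tau w"
  using key[OF w, of "Suc m" m for m] by metis
  have j0: "j m ~= 0" for m
  proof
  assume "j m = 0"
  then show False using j(3)[of m] False by simp
  qed
  have close: "abs (?g m (j m) - min t (tau w)) <= (t - s) / real (Suc m)" for m
  proof -
  have "?g m (j m) = ?g m (j m - 1) + (t - s) / real (Suc m)"
  using grid_step[of s t m "j m - 1"] j0[of m] by simp
  moreover have "?g m (j m) <= t" using grid_le[OF st(2) j(1)] .
  moreover have "min t (tau w) <= ?g m (j m)" using j(3)[of m] by auto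
  moreover have "0 <= (t - s) / real (Suc m)" using st by simp
  ultimately show ?thesis using j(4)[of m] j0[of m] by auto
  qed
  have "(%m. ?g m (j m)) ~~> min t (tau w)"
  by (rule LIM_zero_cancel, rule Lim_null_comparison[OF _ grid_mesh_limit[of t s]])
  (use close in auto)
  then have "(%m. U (?g m (j m)) w) ~~> U (min t (tau w)) w"
  by (rule continuous_on_tendsto_compose[OF Uc[OF w]]) (use g0 tau0[OF w] st in auto)
  then show ?thesis using False unfolding j(2) by (auto intro!: tendsto_intros simp: min_def)
 qed
 have Jm: "J m n : bmeas P" for m n
  unfolding J_def using F_P[OF Im] mgleD(3)[OF U g0]
  by (intro borel_measurable_sum borel_measurable_times borel_measurable_diff)
 have Lm: "(%w. U (min t (tau w)) w - U (min s (tau w)) w) : bmeas P"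
  by (rule borel_measurable_LIMSEQ_real[OF lim Jm])
 have YP: "Y : bmeas P" by (rule F_P[OF Y(1)])
 have "(%m. \<integral>w. Y w * J m (Suc m) w \<partial>P) ~~> (LINT w|P. Y w * (U (min t (tau w)) w - U (min s (tau w)) w))"
 proof (rule integral_dominated_convergence[where w = "%w. abs c * (2 * D w)"])
  show "AE w in P. (%m. Y w * J m (Suc m) w) ~~> Y w * (U (min t (tau w)) w - U (min s (tau w)) w)"
  using lim by (auto intro!: AE_I2 tendsto_mult_left)
  show "AE w in P. norm (Y w * J m (Suc m) w) <= abs c * (2 * D w)" for m
  proof (rule AE_I2)
  fix w assume w: "w : space P"
  have "abs (Y w) <= abs c" using Y(2)[OF w] by linarith
  then show "norm (Y w * J m (Suc m) w) <= abs c * (2 * D w)"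
  using bnd[OF w, of m] unfolding real_norm_def abs_mult by (intro mult_mono) auto
  qed
 qed (use YP Jm Lm D(1) in auto)
 then show ?thesis unfolding E0 using LIMSEQ_unique tendsto_const by blast
qed

end

section \<open>Integrals against finite measures, bounded continuous functions and C^2 test
  functions\<close>

lemma sets_meas_of [simp, measurable_cong]: "sets (meas_of nu) = sets borel"
 using meas_of[of nu] by simp

lemma space_meas_of [simp]: "space (meas_of nu) = UNIV"
 using sets_eq_imp_space_eq[OF sets_meas_of] by simp

lemma finite_measure_meas_of: "finite_measure (meas_of nu)"
 using meas_of[of nu] by simp

definition mass :: "fmeasure => real" where
 "mass = pairing (%_. 1)"

lemma mass_eq: "mass nu = measure (meas_of nu) UNIV"
 by (simp add: mass_def pairing_def)

lemma mass_nonneg: "0 <= mass nu"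
 by (simp add: mass_eq)

lemma integrable_meas_of:
 fixes f :: "real => real"
 assumes "f : bmeas borel" "!!x. abs (f x) <= K"
 shows "integrable (meas_of nu) f"
proof -
 interpret finite_measure "meas_of nu" by (rule finite_measure_meas_of)
 show ?thesis using assms by (intro integrable_const_bound[of _ K]) auto
qed

lemma pairing_bound:
 assumes "f : bmeas borel" "!!x. abs (f x) <= K"
 shows "abs (pairing f nu) <= K * mass nu"
proof -
 interpret finite_measure "meas_of nu" by (rule finite_measure_meas_of)
 have "abs (pairing f nu) <= (LINT x|(meas_of nu). K)"
  unfolding pairing_def real_norm_def[symmetric]
  by (rule bi_norm_bound_integral)
  (use assms in \<open>auto intro: integrable_meas_of\<close>)
 then show ?thesis by (simp add: mass_eq mult.commute)
qed

lemma Cb_bounded: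
 assumes "f : Cb S"
 obtains K where "0 <= K" "!!x. x : S ==> abs (f x) <= K"
proof -
 obtain K where "\<forall>y\<in>f ` S. norm y <= K" using assms by (auto simp: Cb_def bounded_iff)
 then show ?thesis by (intro that[of "max K 0"]) force+
qed

lemma CbE:
 assumes "f : Cb UNIV"
 obtains K where "0 <= K" "!!x. abs (f x) <= K"
 using Cb_bounded[OF assms] by (metis UNIV_I)

lemma CbI:
 fixes f :: "'a::topological_space => real"
 assumes "continuous_on S f" "!!x. x : S ==> abs (f x) <= K"
 shows "f : Cb S"
 using assms by (auto simp: Cb_def bounded_iff)

lemma Cb_continuous: "f : Cb S ==> continuous_on S f"
 by (simp add: Cb_def)

lemma Cb_measurable: "f : Cb UNIV ==> f : bmeas (borel :: real measure)"
 by (rule borel_measurable_continuous_onI) (rule Cb_continuous)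

lemma Cb_integrable: "f : Cb UNIV ==> integrable (meas_of nu) f"
 by (meson CbE Cb_measurable integrable_meas_of)

lemma Cb_const: "(%_. c) : Cb S"
 by (rule CbI[of _ _ "abs c"]) auto

lemma Cb_add: "f : Cb S ==> g : Cb S ==> (%x. f x + g x) : Cb S"
proof -
 assume fg: "f : Cb S" "g : Cb S"
 obtain K where "!!x. x : S ==> abs (f x) <= K" using Cb_bounded[OF fg(1)] by metis
 moreover obtain L where "!!x. x : S ==> abs (g x) <= L" using Cb_bounded[OF fg(2)] by metis
 ultimately have "abs (f x + g x) <= K + L" if "x : S" for x
  using that by (meson abs_triangle_ineq add_mono order_trans)
 then show ?thesis by (rule CbI[OF continuous_on_add[OF fg[THEN Cb_continuous]]])
qed

lemma Cb_mult: "f : Cb S ==> g : Cb S ==> (%x. f x * g x) : Cb S"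
proof -
 assume fg: "f : Cb S" "g : Cb S"
 obtain K where K: "0 <= K" "!!x. x : S ==> abs (f x) <= K" using Cb_bounded[OF fg(1)] by metis
 obtain L where L: "!!x. x : S ==> abs (g x) <= L" using Cb_bounded[OF fg(2)] by metis
 have "abs (f x * g x) <= K * L" if "x : S" for x
  unfolding abs_mult using K L that by (intro mult_mono) auto
 then show ?thesis by (rule CbI[OF continuous_on_mult[OF fg[THEN Cb_continuous]]])
qed

lemma Cb_cmult: "f : Cb S ==> (%x. c * f x) : Cb S"
 by (rule Cb_mult[OF Cb_const])

lemma Cb_diff: "f : Cb S ==> g : Cb S ==> (%x. f x - g x) : Cb S"
 using Cb_add[of f S "%x. (-1) * g x"] Cb_cmult[of g S "-1"] by simp

lemma Cb_power2: "f : Cb S ==> (%x. (f x)^2) : Cb S"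
 using Cb_mult[of f S f] by (simp add: power2_eq_square)

lemma Cb_sum: "(!!i. i : I ==> f i : Cb S) ==> (%x. \<Sum>i\<in>I. f i x) : Cb S"
 by (induction I rule: infinite_finite_induct) (auto intro: Cb_const Cb_add)

lemma pairing_add: "f : Cb UNIV ==> g : Cb UNIV ==> pairing (%x. f x + g x) nu = pairing f nu + pairing g nu"
 by (simp add: pairing_def Cb_integrable)

lemma pairing_diff: "f : Cb UNIV ==> g : Cb UNIV ==> pairing (%x. f x - g x) nu = pairing f nu - pairing g nu"
 by (simp add: pairing_def Cb_integrable)

lemma pairing_cmult: "pairing (%x. c * f x) nu = c * pairing f nu"
 by (simp add: pairing_def)

lemma continuous_pairing: "f : Cb UNIV ==> continuous_on UNIV (pairing f)"
 unfolding continuous_on_open_vimage[OF open_UNIV]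
 by (auto simp: open_fmeasure_def intro!: generate_topology.Basis)

text \<open>Measurability into this \<sigma>-algebra can be tested pairing by pairing, which for the
  Borel \<sigma>-algebra would require a countable base of the weak topology. It is contained in
  \<open>borel\<close>, so evaluation of a path stays measurable.\<close>

definition pair_sigma :: "fmeasure measure" where
 "pair_sigma = sigma UNIV {pairing f -` V | f V. f : Cb UNIV & open V}"

lemma space_pair_sigma [simp]: "space pair_sigma = UNIV"
 by (simp add: pair_sigma_def space_measure_of_conv)

lemma sets_pair_sigma: "sets pair_sigma = sigma_sets UNIV {pairing f -` V | f V. f : Cb UNIV & open V}"
 unfolding pair_sigma_def by (rule sets_measure_of) auto

lemma measurable_pair_sigmaI:
 assumes "!!f. f : Cb UNIV ==> (%x. pairing f (X x)) : bmeas N"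
 shows "X : N \<rightarrow>\<^sub>M pair_sigma"
 unfolding pair_sigma_def
proof (rule measurable_measure_of)
 fix A assume "A : {pairing f -` V | f V. f : Cb UNIV & open V}"
 then obtain f V where fV: "f : Cb UNIV" "open V" "A = pairing f -` V" by auto
 have "(%x. pairing f (X x)) -` V \<inter> space N : sets N"
  using assms[OF fV(1)] fV(2) by (rule measurable_sets[OF _ borel_open])
 then show "X -` A \<inter> space N : sets N" using fV(3) by (simp add: vimage_def)
qed auto

lemma measurable_pairing [measurable]: "f : Cb UNIV ==> pairing f : bmeas pair_sigma"
 by (rule borel_measurableI) (auto simp: sets_pair_sigma)

lemma mass_measurable [measurable]: "mass : bmeas pair_sigma"
 unfolding mass_def by (rule measurable_pairing[OF Cb_const])

lemma measurable_borel_pair_sigma: "X : N \<rightarrow>\<^sub>M borel ==> X : N \<rightarrow>\<^sub>M pair_sigma"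
 by (rule measurable_pair_sigmaI)
  (metis borel_measurable_continuous_onI continuous_pairing measurable_compose)

text \<open>Round u down to multiples of \<open>1 / Suc m\<close>. The rounded time takes countably
  many values, so the composed map is measurable, and continuity in u recovers X in the
  limit.\<close>

lemma caratheodory_measurable:
 fixes X :: "real => 'w => real"
 assumes X: "!!u. X u : bmeas N"
  and c: "!!w. w : space N ==> continuous_on UNIV (%u. X u w)"
 shows "(%(w, u). X u w) : bmeas (N \<Otimes>\<^sub>M borel)"
proof -
 define g where "g m u = real_of_int \<lfloor>u * real (Suc m)\<rfloor> / real (Suc m)" for m u
 have gl: "(%m. g m u) ~~> u" for u
 proof (rule LIM_zero_cancel, rule Lim_null_comparison)
  show "\<forall>\<^sub>F m in sequentially. norm (g m u - u) <= 1 / real (Suc m)"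
  proof (intro always_eventually allI)
  fix m
  have "g m u - u = (real_of_int \<lfloor>u * real (Suc m)\<rfloor> - u * real (Suc m)) / real (Suc m)"
  by (simp add: g_def diff_divide_distrib del: of_nat_Suc)
  also have "norm ... <= 1 / real (Suc m)"
  unfolding real_norm_def abs_divide by (intro frac_le) (linarith | simp)+
  finally show "norm (g m u - u) <= 1 / real (Suc m)" .
  qed
  show "(%m. 1 / real (Suc m)) ~~> 0" by (rule LIMSEQ_Suc) (rule lim_const_over_n)
 qed
 have m: "(%z. X (g m (snd z)) (fst z)) : bmeas (N \<Otimes>\<^sub>M borel)" for m
  unfolding g_def
 proof (rule measurable_compose_countable[of "%i z. X (real_of_int i / real (Suc m)) (fst z)" _ _ "%z. \<lfloor>snd z * real (Suc m)\<rfloor>"])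
  show "(%z. X (real_of_int i / real (Suc m)) (fst z)) : bmeas (N \<Otimes>\<^sub>M borel)" for i
  by (rule measurable_compose[OF measurable_fst X])
  show "(%z. \<lfloor>snd z * real (Suc m)\<rfloor>) : N \<Otimes>\<^sub>M borel \<rightarrow>\<^sub>M count_space UNIV"
  by measurable
 qed
 have "(%z. X (snd z) (fst z)) : bmeas (N \<Otimes>\<^sub>M borel)"
 proof (rule borel_measurable_LIMSEQ_real[OF _ m])
  fix z assume "z : space (N \<Otimes>\<^sub>M (borel :: real measure))"
  then have "fst z : space N" by (auto simp: space_pair_measure)
  from c[OF this] show "(%m. X (g m (snd z)) (fst z)) ~~> X (snd z) (fst z)"
  by (rule continuous_on_tendsto_compose[OF _ gl]) auto
 qed
 then show ?thesis by (simp add: case_prod_beta')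
qed

lemma C2_realD:
 assumes "phi : C2_real"
 shows "phi : Cb UNIV" "deriv phi : Cb UNIV" "deriv (deriv phi) : Cb UNIV"
  "(phi has_rd deriv phi x) (at x)" "(deriv phi has_rd deriv (deriv phi) x) (at x)"
 using assms by (auto simp: C2_real_def DERIV_deriv_iff_field_differentiable)

lemma C2_realI:
 assumes "!!x. (phi has_rd phi' x) (at x)" "!!x. (phi' has_rd phi'' x) (at x)"
  and "phi : Cb UNIV" "phi' : Cb UNIV" "phi'' : Cb UNIV"
 shows "phi : C2_real" "deriv phi = phi'" "deriv (deriv phi) = phi''"
proof -
 show 1: "deriv phi = phi'" using assms(1) by (intro ext DERIV_imp_deriv)
 then show 2: "deriv (deriv phi) = phi''" using assms(2) by (intro ext DERIV_imp_deriv) auto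
 have "ALL x. phi field_differentiable at x" "ALL x. phi' field_differentiable at x"
  using assms(1,2) by (auto simp: field_differentiable_def)
 then show "phi : C2_real" using assms(3-5) 1 2 by (simp add: C2_real_def)
qed

lemma C2_real_const: "(%_. c) : C2_real"
 by (rule C2_realI[of _ "%_. 0" "%_. 0"]) (auto intro: Cb_const)

lemma C2_real_add:
 assumes "phi : C2_real" "psi : C2_real"
 shows "(%x. phi x + psi x) : C2_real" "deriv (%x. phi x + psi x) = (%x. deriv phi x + deriv psi x)"
  "deriv (deriv (%x. phi x + psi x)) = (%x. deriv (deriv phi) x + deriv (deriv psi) x)"
 using C2_realI[OF DERIV_add[OF C2_realD(4)[OF assms(1)] C2_realD(4)[OF assms(2)]]
  DERIV_add[OF C2_realD(5)[OF assms(1)] C2_realD(5)[OF assms(2)]]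
  Cb_add[OF C2_realD(1)[OF assms(1)] C2_realD(1)[OF assms(2)]]
  Cb_add[OF C2_realD(2)[OF assms(1)] C2_realD(2)[OF assms(2)]]
  Cb_add[OF C2_realD(3)[OF assms(1)] C2_realD(3)[OF assms(2)]]]
 by blast+

lemma C2_real_diff:
 assumes "phi : C2_real" "psi : C2_real"
 shows "(%x. phi x - psi x) : C2_real" "deriv (%x. phi x - psi x) = (%x. deriv phi x - deriv psi x)"
  "deriv (deriv (%x. phi x - psi x)) = (%x. deriv (deriv phi) x - deriv (deriv psi) x)"
 using C2_realI[OF DERIV_diff[OF C2_realD(4)[OF assms(1)] C2_realD(4)[OF assms(2)]]
  DERIV_diff[OF C2_realD(5)[OF assms(1)] C2_realD(5)[OF assms(2)]]
  Cb_diff[OF C2_realD(1)[OF assms(1)] C2_realD(1)[OF assms(2)]]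
  Cb_diff[OF C2_realD(2)[OF assms(1)] C2_realD(2)[OF assms(2)]]
  Cb_diff[OF C2_realD(3)[OF assms(1)] C2_realD(3)[OF assms(2)]]]
 by blast+

lemma C2_real_mult:
 assumes "phi : C2_real" "psi : C2_real"
 shows "(%x. phi x * psi x) : C2_real"
proof (rule C2_realI(1))
 show "((%x. phi x * psi x) has_rd (phi x * deriv psi x + deriv phi x * psi x)) (at x)" for x
  using DERIV_mult'[OF C2_realD(4)[OF assms(1)] C2_realD(4)[OF assms(2)]] .
 show "((%x. phi x * deriv psi x + deriv phi x * psi x) has_rd
  ((phi x * deriv (deriv psi) x + deriv phi x * deriv psi x) + (deriv phi x * deriv psi x + deriv (deriv phi) x * psi x))) (at x)" for x
  by (intro DERIV_add DERIV_mult' C2_realD assms)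
qed (intro Cb_add Cb_mult C2_realD assms)+

section \<open>The kernel h, its correlation function and the covariance form\<close>

locale kernel =
 fixes h :: "real => real"
 assumes h_diff: "!!x. h field_differentiable at x"
  and h_C1: "continuous_on UNIV (deriv h)"
  and h_L2: "integrable lborel (%x. (h x)^2)"
  and h'_L2: "integrable lborel (%x. (deriv h x)^2)"
begin

lemma h_der: "(h has_rd deriv h x) (at x)"
 using h_diff by (simp add: DERIV_deriv_iff_field_differentiable)

lemma h_cont: "continuous_on UNIV h"
 using h_der by (meson DERIV_continuous continuous_at_imp_continuous_on)

lemma h_meas [measurable]: "h : bmeas borel"
 by (rule borel_measurable_continuous_onI[OF h_cont])

text \<open>The derivative \<open>2 * h * deriv h\<close> of \<open>h^2\<close> is dominated by the
  integrable function \<open>h^2 + (deriv h)^2\<close>, so all increments of \<open>h^2\<close> are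
  bounded by C.\<close>

lemma h_bounded: "h : Cb UNIV"
proof -
 define C where "C = (LBINT x. (h x)^2 + (deriv h x)^2)"
 have [measurable]: "deriv h : bmeas borel" by (rule borel_measurable_continuous_onI[OF h_C1])
 have main: "abs ((h b)^2 - (h a)^2) <= C" if "a <= b" for a b
 proof -
  have "(LBINT x. indicator {a..b} x *\<^sub>R (2 * h x * deriv h x)) = (h b)^2 - (h a)^2"
  proof (rule integral_FTC_atLeastAtMost[OF that])
  fix x
  have "((%x. (h x)^2) has_rd 2 * h x * deriv h x) (at x)"
  by (auto intro!: derivative_eq_intros h_der)
  then show "((%x. (h x)^2) has_vector_derivative 2 * h x * deriv h x) (at x within {a..b})"
  by (simp add: has_real_derivative_iff_has_vector_derivative has_vector_derivative_at_within)
  show "continuous_on {a..b} (%x. 2 * h x * deriv h x)"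
  by (intro continuous_intros continuous_on_subset[OF h_cont] continuous_on_subset[OF h_C1]) auto
  qed
  moreover have "norm (LBINT x. indicator {a..b} x *\<^sub>R (2 * h x * deriv h x)) <= C"
  unfolding C_def
  proof (rule bi_norm_bound_integral)
  show i: "integrable lborel (%x. (h x)^2 + (deriv h x)^2)" using h_L2 h'_L2 by simp
  have "2 * abs (h x * deriv h x) <= (h x)^2 + (deriv h x)^2" for x
  proof -
  have "0 <= (abs (h x) - abs (deriv h x))^2" by simp
  then show ?thesis by (simp add: power2_diff abs_mult)
  qed
  then show n: "norm (indicator {a..b} x *\<^sub>R (2 * h x * deriv h x)) <= (h x)^2 + (deriv h x)^2" for x
  by (auto simp: indicator_def abs_mult mult.assoc)
  show "integrable lborel (%x. indicator {a..b} x *\<^sub>R (2 * h x * deriv h x))"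
  proof (rule bib_bound[OF i])
  show "AE x in lborel. norm (indicator {a..b} x *\<^sub>R (2 * h x * deriv h x)) <= norm ((h x)^2 + (deriv h x)^2)"
  using order_trans[OF n abs_ge_self] by (auto intro!: AE_I2)
  qed measurable
  qed
  ultimately show ?thesis by simp
 qed
 have C0: "0 <= C" using main[of 0 0] by simp
 have "abs (h x) <= 1 + ((h 0)^2 + C)" for x
 proof -
  have "(h x)^2 <= (h 0)^2 + C" using main[of 0 x] main[of x 0] by (cases "0 <= x") auto
  moreover have "abs (h x) <= 1 + (h x)^2"
  proof -
  have "0 <= (abs (h x) - 1)^2" by simp
  then have "2 * abs (h x) <= 1 + (h x)^2" unfolding power2_diff by simp
  then show ?thesis by simp
  qed
  ultimately show ?thesis by linarith
 qed
 then show ?thesis by (intro CbI[OF h_cont])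
qed

definition H2 where "H2 = (LBINT x. (h x)^2)"

lemma H2_nonneg: "0 <= H2" by (simp add: H2_def)

lemma shift_L2: "integrable lborel (%z. (h (z - x))^2)" "(LBINT z. (h (z - x))^2) = H2"
 using lborel_integrable_real_affine[OF h_L2, of 1 "-x"] lborel_integral_real_affine[of 1 "%z. (h z)^2" "-x"]
 by (simp_all add: H2_def)

lemma hh_bound: "abs (h (z - x) * h (z - y)) <= (h (z - x))^2 + (h (z - y))^2"
proof -
 have "0 <= (abs (h (z - x)) - abs (h (z - y)))^2" by simp
 then have "2 * abs (h (z - x) * h (z - y)) <= (h (z - x))^2 + (h (z - y))^2"
  by (simp add: power2_diff abs_mult)
 then show ?thesis using abs_ge_zero[of "h (z - x) * h (z - y)"] by linarith
qed

lemma rho_eq: "rho h (x - y) = (LBINT z. h (z - x) * h (z - y))"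
 unfolding rho_def
 using lborel_integral_real_affine[of 1 "%z. h (z - (x - y)) * h z" "-y"] by (simp add: algebra_simps)

lemma rho_bound: "abs (rho h x) <= 2 * H2"
proof -
 have i: "integrable lborel (%z. (h (z - x))^2 + (h (z - 0))^2)"
  by (intro bib_add shift_L2)
 have "norm (LBINT z. h (z - x) * h (z - 0)) <= (LBINT z. (h (z - x))^2 + (h (z - 0))^2)"
 proof (rule bi_norm_bound_integral[OF _ i])
  show "norm (h (z - x) * h (z - 0)) <= (h (z - x))^2 + (h (z - 0))^2" for z
  unfolding real_norm_def by (rule hh_bound)
  then show "integrable lborel (%z. h (z - x) * h (z - 0))"
  by (intro bib_bound[OF i]) (auto intro!: AE_I2 intro: order_trans[OF _ abs_ge_self])
 qed
 also have "... = (LBINT z. (h (z - x))^2) + (LBINT z. (h (z - 0))^2)"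
  by (rule bi_add) (rule shift_L2)+
 also have "... = 2 * H2" by (simp only: shift_L2)
 finally show ?thesis using rho_eq[of x 0] by simp
qed

lemma rho_measurable [measurable]: "rho h : bmeas borel"
 unfolding rho_def[abs_def] by (rule lborel.borel_measurable_lebesgue_integral) measurable

lemma hu_Cb: "u : Cb UNIV ==> (%x. h (z - x) * u x) : Cb UNIV"
proof (rule Cb_mult)
 obtain K where "!!x. abs (h x) <= K" using CbE[OF h_bounded] by metis
 then show "(%x. h (z - x)) : Cb UNIV"
  by (intro CbI[of _ _ K] continuous_on_compose2[OF h_cont] continuous_intros) auto
qed

text \<open>The bilinear form behind the second term of the generator. The bracket contains the same
  form written as an integral over z.\<close>

definition covar :: "(real => real) => (real => real) => fmeasure => real" where
 "covar u v nu = (LINT (x, y)|(meas2 nu). rho h (x - y) * (u x * v y))"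

text \<open>By \<open>rho_eq\<close> the value \<open>rho h (x - y)\<close> is the inner product of
  the translates of h by x and by y, and Fubini pulls the z-integral out. This is the bridge between
  generator and bracket, and the source of symmetry and nonnegativity of the form.\<close>

lemma covar_eq:
 assumes u: "u : Cb UNIV" and v: "v : Cb UNIV"
 shows "covar u v nu = (LBINT z. pairing (%x. h (z - x) * u x) nu * pairing (%x. h (z - x) * v x) nu)"
proof -
 let ?N = "meas_of nu"
 interpret N: finite_measure ?N by (rule finite_measure_meas_of)
 interpret NN: pair_sigma_finite ?N ?N ..
 interpret NN': finite_measure "?N \<Otimes>\<^sub>M ?N"
  by (rule finite_measure_pair_measure) (rule finite_measure_meas_of)+
 interpret L: pair_sigma_finite "?N \<Otimes>\<^sub>M ?N" lborel ..
 note [measurable] = Cb_measurable[OF u] Cb_measurable[OF v]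
 obtain Ku where Ku: "0 <= Ku" "!!x. abs (u x) <= Ku" using CbE[OF u] by metis
 obtain Kv where Kv: "0 <= Kv" "!!x. abs (v x) <= Kv" using CbE[OF v] by metis
 let ?q = "%p z. h (z - fst p) * h (z - snd p) * (u (fst p) * v (snd p))"
 \<comment> \<open>Translation invariance makes the z-integral equal to \<open>H2\<close> for every
   p, so Fubini only needs the finite total mass of the product measure.\<close>
 have sq: "integrable ((?N \<Otimes>\<^sub>M ?N) \<Otimes>\<^sub>M lborel) (%(p, z). (h (z - f p))^2)"
  if [measurable]: "f : bmeas (?N \<Otimes>\<^sub>M ?N)" for f
 proof (rule L.Fubini_integrable)
  show "AE x in ?N \<Otimes>\<^sub>M ?N. integrable lborel (%y. case (x, y) of (p, z) => (h (z - f p))^2)"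
  by (simp add: shift_L2)
  show "integrable (?N \<Otimes>\<^sub>M ?N) (%x. LBINT y. norm (case (x, y) of (p, z) => (h (z - f p))^2))"
  by (simp add: shift_L2)
 qed measurable
 have int: "integrable ((?N \<Otimes>\<^sub>M ?N) \<Otimes>\<^sub>M lborel) (%(p, z). ?q p z)"
 proof (rule bib_bound)
  show "integrable ((?N \<Otimes>\<^sub>M ?N) \<Otimes>\<^sub>M lborel) (%x. (Ku * Kv) * ((case x of (p, z) => (h (z - fst p))^2) + (case x of (p, z) => (h (z - snd p))^2)))"
  by (intro integrable_mult_right bib_add sq) measurable
  show "AE x in (?N \<Otimes>\<^sub>M ?N) \<Otimes>\<^sub>M lborel. norm (case x of (p, z) => ?q p z) \<le>
  norm ((Ku * Kv) * ((case x of (p, z) => (h (z - fst p))^2) + (case x of (p, z) => (h (z - snd p))^2)))"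
  proof (rule AE_I2, clarify)
  fix x y z
  have "abs (u x * v y) <= Ku * Kv" using Ku Kv by (auto simp: abs_mult intro!: mult_mono)
  then have "abs (h (z - x) * h (z - y)) * abs (u x * v y) <= ((h (z - x))^2 + (h (z - y))^2) * (Ku * Kv)"
  by (intro mult_mono hh_bound) auto
  then show "norm (?q (x, y) z) <= norm ((Ku * Kv) * ((h (z - fst (x, y)))^2 + (h (z - snd (x, y)))^2))"
  using Ku Kv by (simp add: abs_mult mult_ac)
  qed
 qed measurable
 have "covar u v nu = (LINT p|(?N \<Otimes>\<^sub>M ?N). (LBINT z. ?q p z))"
  unfolding covar_def by (intro bi_cong refl) (auto simp: rho_eq)
 also have "... = (LBINT z. (LINT p|(?N \<Otimes>\<^sub>M ?N). ?q p z))"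
  by (rule L.Fubini_integral[OF int, symmetric])
 also have "... = (LBINT z. pairing (%x. h (z - x) * u x) nu * pairing (%x. h (z - x) * v x) nu)"
 proof (intro bi_cong refl)
  fix z
  let ?f = "%x. h (z - x) * u x" and ?g = "%x. h (z - x) * v x"
  obtain A where A: "0 <= A" "!!x. abs (?f x) <= A" using CbE[OF hu_Cb[OF u, of z]] by metis
  obtain B where B: "0 <= B" "!!x. abs (?g x) <= B" using CbE[OF hu_Cb[OF v, of z]] by metis
  have i: "integrable (?N \<Otimes>\<^sub>M ?N) (%(x, y). ?f x * ?g y)"
  proof (rule NN'.integrable_const_bound[of _ "A * B"])
  show "AE x in ?N \<Otimes>\<^sub>M ?N. norm (case x of (x, y) => ?f x * ?g y) <= A * B"
  using A B unfolding case_prod_beta' real_norm_def abs_mult[of "?f _" "?g _"] by (auto intro!: AE_I2 mult_mono)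
  qed measurable
  have "(LINT p|(?N \<Otimes>\<^sub>M ?N). ?q p z) = (\<integral>(x, y). ?f x * ?g y \<partial>(?N \<Otimes>\<^sub>M ?N))"
  by (intro bi_cong refl) (auto simp: mult_ac)
  also have "... = (LINT x|?N. (LINT y|?N. ?f x * ?g y))"
  using NN.integral_fst'[OF i] by simp
  also have "... = pairing ?f nu * pairing ?g nu" by (simp add: pairing_def)
  finally show "(LINT p|(?N \<Otimes>\<^sub>M ?N). ?q p z) = pairing ?f nu * pairing ?g nu" .
 qed
 finally show ?thesis .
qed

lemma covar_sym: "u : Cb UNIV ==> v : Cb UNIV ==> covar u v nu = covar v u nu"
 by (simp add: covar_eq mult.commute)

lemma covar_integrable:
 assumes u: "u : Cb UNIV" and v: "v : Cb UNIV"
 shows "integrable (meas2 nu) (%p. rho h (fst p - snd p) * (u (fst p) * v (snd p)))"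
proof -
 interpret NN': finite_measure "meas2 nu"
  by (rule finite_measure_pair_measure) (rule finite_measure_meas_of)+
 note [measurable] = Cb_measurable[OF u] Cb_measurable[OF v]
 obtain Ku where Ku: "0 <= Ku" "!!x. abs (u x) <= Ku" using CbE[OF u] by metis
 obtain Kv where Kv: "0 <= Kv" "!!x. abs (v x) <= Kv" using CbE[OF v] by metis
 show ?thesis
 proof (rule NN'.integrable_const_bound[of _ "2 * H2 * (Ku * Kv)"])
  show "AE x in meas2 nu. norm (rho h (fst x - snd x) * (u (fst x) * v (snd x))) <= 2 * H2 * (Ku * Kv)"
  using Ku Kv rho_bound H2_nonneg by (auto intro!: AE_I2 mult_mono simp: abs_mult)
 qed measurable
qed

lemma covar_add_left:
 "u : Cb UNIV ==> u' : Cb UNIV ==> v : Cb UNIV ==> covar (%x. u x + u' x) v nu = covar u v nu + covar u' v nu"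
 using covar_integrable[of u v nu] covar_integrable[of u' v nu]
 by (simp add: covar_def case_prod_beta' distrib_left distrib_right)

lemma covar_cmult_left: "covar (%x. c * u x) v nu = c * covar u v nu"
proof -
 have "covar (%x. c * u x) v nu = (LINT p|(meas2 nu). c * (rho h (fst p - snd p) * (u (fst p) * v (snd p))))"
  by (simp add: covar_def case_prod_beta' mult_ac)
 then show ?thesis by (simp add: covar_def case_prod_beta')
qed

lemma covar_diff_left:
 assumes "u : Cb UNIV" "u' : Cb UNIV" "v : Cb UNIV"
 shows "covar (%x. u x - u' x) v nu = covar u v nu - covar u' v nu"
 using covar_add_left[of u "%x. (-1) * u' x" v nu] covar_cmult_left[of "-1" u' v nu] assms Cb_cmult[of u' UNIV "-1"] by simp

lemma covar_bound:
 assumes u: "u : bmeas borel" "!!x. abs (u x) <= Ku" and v: "v : bmeas borel" "!!x. abs (v x) <= Kv"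
 shows "abs (covar u v nu) <= 2 * H2 * (Ku * Kv) * (mass nu)^2"
proof -
 interpret N: finite_measure "meas_of nu" by (rule finite_measure_meas_of)
 interpret NN': finite_measure "meas2 nu"
  by (rule finite_measure_pair_measure) (rule finite_measure_meas_of)+
 note [measurable] = u(1) v(1)
 have K0: "0 <= Ku" "0 <= Kv" using u(2)[of 0] v(2)[of 0] by linarith+
 have b: "norm (rho h (fst x - snd x) * (u (fst x) * v (snd x))) <= 2 * H2 * (Ku * Kv)" for x
  using u v rho_bound H2_nonneg K0 by (auto intro!: mult_mono simp: abs_mult)
 have "norm (LINT p|(meas2 nu). rho h (fst p - snd p) * (u (fst p) * v (snd p))) \<le>
  (LINT p|(meas2 nu). 2 * H2 * (Ku * Kv))"
  by (rule bi_norm_bound_integral)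
  (use b in \<open>auto intro!: NN'.integrable_const_bound[of _ "2 * H2 * (Ku * Kv)"] AE_I2\<close>)
 also have "... = 2 * H2 * (Ku * Kv) * measure (meas2 nu) (UNIV \<times> UNIV)"
  by (simp add: space_pair_measure)
 also have "measure (meas2 nu) (UNIV \<times> UNIV) = (mass nu)^2"
  unfolding mass_eq measure_def power2_eq_square
  by (subst N.emeasure_pair_measure_Times) (auto simp: enn2real_mult)
 finally show ?thesis by (simp add: covar_def case_prod_beta')
qed

text \<open>The pairings in \<open>covar_eq\<close> are jointly measurable in (nu, z): they are
  continuous in z by dominated convergence and measurable in nu for fixed z.\<close>

lemma covar_measurable:
 assumes u: "u : Cb UNIV" and v: "v : Cb UNIV"
 shows "covar u v : bmeas pair_sigma"
proof -
 have m: "(%(nu, z). pairing (%x. h (z - x) * u x) nu) : bmeas (pair_sigma \<Otimes>\<^sub>M borel)" if u: "u : Cb UNIV" for u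
 proof (rule caratheodory_measurable)
  show "pairing (%x. h (z - x) * u x) : bmeas pair_sigma" for z
  by (rule measurable_pairing[OF hu_Cb[OF u]])
  fix nu
  interpret N: finite_measure "meas_of nu" by (rule finite_measure_meas_of)
  obtain Ku where Ku: "0 <= Ku" "!!x. abs (u x) <= Ku" using CbE[OF u] by metis
  obtain Kh where Kh: "0 <= Kh" "!!x. abs (h x) <= Kh" using CbE[OF h_bounded] by metis
  show "continuous_on UNIV (%z. pairing (%x. h (z - x) * u x) nu)"
  unfolding continuous_on_sequentially comp_def pairing_def
  proof (intro ballI allI impI)
  fix z :: "nat => real" and a assume "(ALL n. z n : UNIV) & z ~~> a"
  then have z: "z ~~> a" by simp
  show "(%n. \<integral>x. h (z n - x) * u x \<partial>meas_of nu) ~~> (LINT x|(meas_of nu). h (a - x) * u x)"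
  proof (rule integral_dominated_convergence[where w = "%_. Kh * Ku"])
  show "AE x in meas_of nu. (%n. h (z n - x) * u x) ~~> h (a - x) * u x"
  by (intro AE_I2 tendsto_mult_right continuous_on_tendsto_compose[OF h_cont] tendsto_diff z tendsto_const) auto
  show "AE x in meas_of nu. norm (h (z n - x) * u x) <= Kh * Ku" for n
  using Kh Ku by (auto intro!: AE_I2 mult_mono simp: abs_mult)
  qed (use Cb_measurable[OF hu_Cb[OF u]] in auto)
  qed
 qed
 have eq: "sets (pair_sigma \<Otimes>\<^sub>M lborel) = sets (pair_sigma \<Otimes>\<^sub>M (borel :: real measure))"
  by (intro sets_pair_measure_cong) auto
 have "(%(nu, z). pairing (%x. h (z - x) * u x) nu * pairing (%x. h (z - x) * v x) nu) : bmeas (pair_sigma \<Otimes>\<^sub>M lborel)"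
  unfolding measurable_cong_sets[OF eq refl]
  using borel_measurable_times[OF m[OF u] m[OF v]] by (simp add: case_prod_beta')
 then have "(%nu. LBINT z. pairing (%x. h (z - x) * u x) nu * pairing (%x. h (z - x) * v x) nu) : bmeas pair_sigma"
  by (rule lborel.borel_measurable_lebesgue_integral)
 then show ?thesis using covar_eq[OF u v] by (simp add: fun_eq_iff[symmetric] cong: measurable_cong)
qed

end

section \<open>Ito's formula for bounded processes\<close>

lemma abs_integral_le:
 fixes f g :: "'a => real"
 assumes "integrable M f" "integrable M g" "!!x. x : space M ==> abs (f x) <= g x"
 shows "abs (\<integral>x. f x \<partial>M) <= (LINT x|M. g x)"
proof -
 have "abs (\<integral>x. f x \<partial>M) <= (LINT x|M. abs (f x))" by (rule integral_abs_bound)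
 also have "... <= (LINT x|M. g x)" using assms by (intro integral_mono) auto
 finally show ?thesis .
qed

lemma mult_le_weighted_squares:
 fixes u v eta :: real
 assumes "eta > 0"
 shows "u * v <= u^2 / eta + eta * v^2"
proof -
 have "(u / sqrt eta) * (sqrt eta * v) <= (u / sqrt eta)^2 + (sqrt eta * v)^2"
  using abs_mult_le_squares[of "u / sqrt eta" "sqrt eta * v"] by linarith
 then show ?thesis using assms by (simp add: power_divide power_mult_distrib)
qed

context filtered_prob_space
begin

text \<open>An algebra of random variables whose closure rules \<open>Bd_intros\<close> settle the
  integrability questions of the bounded Ito formula.\<close>

definition Bd :: "('a => real) set" where
 "Bd = {f. f : bmeas P & (EX B. \<forall>w\<in>space P. abs (f w) <= B)}"

lemma BdI: "f : bmeas P ==> (!!w. w : space P ==> abs (f w) <= B) ==> f : Bd"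
 by (auto simp: Bd_def)

lemma BdE:
 assumes "f : Bd"
 obtains B where "B >= 0" "!!w. w : space P ==> abs (f w) <= B"
proof -
 obtain B where "\<forall>w\<in>space P. abs (f w) <= B" using assms by (auto simp: Bd_def)
 then show ?thesis by (intro that[of "max B 0"]) force+
qed

lemma Bd_measurable: "f : Bd ==> f : bmeas P" by (simp add: Bd_def)

lemma Bd_integrable: "f : Bd ==> integrable P f"
 by (auto simp: Bd_def intro!: integrable_const_bound AE_I2)

lemma Bd_const: "(%w. c) : Bd" by (rule BdI[of _ "abs c"]) auto

lemma Bd_add: "f : Bd ==> g : Bd ==> (%w. f w + g w) : Bd"
proof -
 assume fg: "f : Bd" "g : Bd"
 obtain B C where "!!w. w : space P ==> abs (f w) <= B" "!!w. w : space P ==> abs (g w) <= C"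
  using BdE[OF fg(1)] BdE[OF fg(2)] by metis
 then show ?thesis using fg[THEN Bd_measurable] 
  by (intro BdI[of _ "B + C"]) (auto intro: order_trans[OF abs_triangle_ineq] add_mono)
qed

lemma Bd_mult: "f : Bd ==> g : Bd ==> (%w. f w * g w) : Bd"
proof -
 assume fg: "f : Bd" "g : Bd"
 obtain B where B: "B >= 0" "!!w. w : space P ==> abs (f w) <= B" using BdE[OF fg(1)] by metis
 obtain C where C: "C >= 0" "!!w. w : space P ==> abs (g w) <= C" using BdE[OF fg(2)] by metis
 show ?thesis using fg[THEN Bd_measurable] B C
  by (intro BdI[of _ "B * C"]) (auto simp: abs_mult intro: mult_mono)
qed

lemma Bd_uminus: "f : Bd ==> (%w. - f w) : Bd"
 using Bd_mult[OF Bd_const[of "-1"], of f] by simp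

lemma Bd_diff: "f : Bd ==> g : Bd ==> (%w. f w - g w) : Bd"
 using Bd_add[OF _ Bd_uminus] by fastforce

lemma Bd_power: "f : Bd ==> (%w. f w ^ k) : Bd"
 by (induction k) (auto intro: Bd_const Bd_mult)

lemma Bd_sum: "(!!i. i : I ==> f i : Bd) ==> (%w. \<Sum>i\<in>I. f i w) : Bd"
 by (induction I rule: infinite_finite_induct) (auto intro: Bd_const Bd_add)

lemmas Bd_intros = Bd_const Bd_add Bd_diff Bd_mult Bd_power Bd_sum

lemma Bd_drift:
 fixes s t :: real
 assumes "(%(w, u). beta u w) : bmeas (P \<Otimes>\<^sub>M borel)"
  and "!!u w. w : space P ==> abs (beta u w) <= c" and "s <= t"
 shows "(%w. LBINT u:{s..t}. beta u w) : Bd"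
proof (rule BdI)
 have eq: "sets (P \<Otimes>\<^sub>M lborel) = sets (P \<Otimes>\<^sub>M (borel :: real measure))"
  by (intro sets_pair_measure_cong) auto
 have "(%z. ind {s..t} (snd z) *\<^sub>R beta (snd z) (fst z)) : bmeas (P \<Otimes>\<^sub>M borel)"
  by (intro borel_measurable_scaleR measurable_compose[OF measurable_snd borel_measurable_indicator])
  (use assms(1) in \<open>auto simp: case_prod_beta'\<close>)
 then have "(%(w, u). ind {s..t} u *\<^sub>R beta u w) : bmeas (P \<Otimes>\<^sub>M lborel)"
  unfolding measurable_cong_sets[OF eq refl] by (simp add: case_prod_beta')
 then show "(%w. LBINT u:{s..t}. beta u w) : bmeas P"
  unfolding set_lebesgue_integral_def by (rule lborel.borel_measurable_lebesgue_integral)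
 show "abs (LBINT u:{s..t}. beta u w) <= c * (t - s)" if "w : space P" for w
  using measurable_Pair2[OF assms(1) that] assms(2)[OF that] assms(3)
  by (intro set_integral_bounded_Icc) auto
qed

end

text \<open>The stopped coordinates in abstract form. The process is known only through
  \<open>m1\<close>, the drift of each coordinate, and \<open>m2\<close>, the drift of each product,
  given by the product rule with covariance density a. These two families of expectations suffice
  for Ito's formula; no martingale part is named.\<close>

locale bounded_ito = filtered_prob_space P F for P :: "'a measure" and F +
 fixes n :: nat and X :: "nat => real => 'a => real"
  and b :: "nat => real => 'a => real" and a :: "nat => nat => real => 'a => real"
  and K c :: real
 assumes K0: "0 <= K" and c0: "0 <= c"
  and Xm: "!!i u. i < n ==> 0 <= u ==> X i u : bmeas (F u)"
  and XM: "!!i. i < n ==> (%(w, u). X i u w) : bmeas (P \<Otimes>\<^sub>M borel)"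
  and Xc: "!!i w. i < n ==> w : space P ==> continuous_on UNIV (%u. X i u w)"
  and Xb: "!!i u w. i < n ==> w : space P ==> abs (X i u w) <= K"
  and bm: "!!i. i < n ==> (%(w, u). b i u w) : bmeas (P \<Otimes>\<^sub>M borel)"
  and bb: "!!i u w. i < n ==> w : space P ==> abs (b i u w) <= c"
  and am: "!!i j. i < n ==> j < n ==> (%(w, u). a i j u w) : bmeas (P \<Otimes>\<^sub>M borel)"
  and ab: "!!i j u w. i < n ==> j < n ==> w : space P ==> abs (a i j u w) <= c"
  and m1: "!!i s t Y. i < n ==> 0 <= s ==> s <= t ==> Y : bmeas (F s) ==> Y : Bd ==>
  (LINT w|P. Y w * (X i t w - X i s w - (LBINT u:{s..t}. b i u w))) = 0"
  and m2: "!!i j s t Y. i < n ==> j < n ==> 0 <= s ==> s <= t ==> Y : bmeas (F s) ==> Y : Bd ==>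
  (LINT w|P. Y w * (X i t w * X j t w - X i s w * X j s w -
  (LBINT u:{s..t}. X i u w * b j u w + X j u w * b i u w + a i j u w))) = 0"
begin

text \<open>The drift of the product of the coordinates i and j as it stands in \<open>m2\<close>;
  it is bounded by \<open>R\<close>.\<close>

definition "r i j u w = X i u w * b j u w + X j u w * b i u w + a i j u w"
definition "L beta s t w = (LBINT u:{s..t}. beta u w)"
definition "xv u w = (\<lambda>i\<in>{..<n}. X i u w)"
definition "R = 2 * K * c + c"

lemma XP: "i < n ==> 0 <= u ==> X i u : Bd"
 by (rule BdI[OF F_P[OF Xm] Xb])

lemma rm: "i < n ==> j < n ==> (%(w, u). r i j u w) : bmeas (P \<Otimes>\<^sub>M borel)"
proof -
 assume [simp]: "i < n" "j < n"
 have [measurable]: "(%z. X i (snd z) (fst z)) : bmeas (P \<Otimes>\<^sub>M borel)"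
  "(%z. X j (snd z) (fst z)) : bmeas (P \<Otimes>\<^sub>M borel)"
  "(%z. b i (snd z) (fst z)) : bmeas (P \<Otimes>\<^sub>M borel)"
  "(%z. b j (snd z) (fst z)) : bmeas (P \<Otimes>\<^sub>M borel)"
  "(%z. a i j (snd z) (fst z)) : bmeas (P \<Otimes>\<^sub>M borel)"
  using XM[of i] XM[of j] bm[of i] bm[of j] am[of i j] by (simp_all add: case_prod_beta')
 show ?thesis unfolding r_def case_prod_beta' by measurable
qed

lemma rb: "i < n ==> j < n ==> w : space P ==> abs (r i j u w) <= R"
proof -
 assume i: "i < n" "j < n" "w : space P"
 have "abs (X i u w * b j u w) <= K * c" "abs (X j u w * b i u w) <= K * c"
  unfolding abs_mult using Xb[of i w u] Xb[of j w u] bb[of i w u] bb[of j w u] i K0 by (auto intro!: mult_mono)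
 moreover have "abs (a i j u w) <= c" using ab i by simp
 ultimately show ?thesis unfolding r_def R_def by linarith
qed

lemma L_Bd:
 "i < n ==> s <= t ==> L (b i) s t : Bd"
 "i < n ==> j < n ==> s <= t ==> L (r i j) s t : Bd"
 unfolding L_def[abs_def] by (rule Bd_drift[OF bm bb], assumption+) (rule Bd_drift[OF rm rb], assumption+)

lemma L_bound:
 assumes "w : space P" "s <= t"
 shows "i < n ==> abs (L (b i) s t w) <= c * (t - s)"
  and "i < n ==> j < n ==> abs (L (r i j) s t w) <= R * (t - s)"
 using measurable_Pair2[OF bm assms(1)] measurable_Pair2[OF rm assms(1)] bb rb assms
 by (auto simp: L_def intro!: set_integral_bounded_Icc)

text \<open>Compensator of the product of two increments over [s, t]: the drift of the product
  without the two terms in which one factor is frozen at s.\<close>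

definition "V i j s t w = L (r i j) s t w - X i s w * L (b j) s t w - X j s w * L (b i) s t w"

lemma V_Bd: "i < n ==> j < n ==> 0 <= s ==> s <= t ==> V i j s t : Bd"
 unfolding V_def[abs_def] by (intro Bd_intros L_Bd XP) auto

lemma V_bound:
 assumes "i < n" "j < n" "w : space P" "0 <= s" "s <= t"
 shows "abs (V i j s t w) <= (R + 2 * K * c) * (t - s)"
proof -
 have "abs (X i s w * L (b j) s t w) <= K * (c * (t - s))" "abs (X j s w * L (b i) s t w) <= K * (c * (t - s))"
  unfolding abs_mult using assms Xb L_bound K0 by (auto intro!: mult_mono)
 then show ?thesis using L_bound(2)[of w s t i j] assms unfolding V_def by (simp add: algebra_simps)
qed

text \<open>Expand the product of increments as the increment of the product minus the two terms
  with one coordinate frozen at s. A frozen coordinate is bounded and known at time s, so it joins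
  the weight Y.\<close>

lemma increment_product:
 assumes ij: "i < n" "j < n" and st: "0 <= s" "s <= t" and Y: "Y : bmeas (F s)" "Y : Bd"
 shows "(LINT w|P. Y w * ((X i t w - X i s w) * (X j t w - X j s w))) = (LINT w|P. Y w * V i j s t w)"
proof -
 have t0: "0 <= t" using st by simp
 note XB = XP[OF ij(1) st(1)] XP[OF ij(2) st(1)] XP[OF ij(1) t0] XP[OF ij(2) t0]
 note LB = L_Bd(1)[OF ij(1) st(2)] L_Bd(1)[OF ij(2) st(2)] L_Bd(2)[OF ij st(2)]
 let ?A = "%w. Y w * (X i t w * X j t w - X i s w * X j s w - L (r i j) s t w)"
 let ?B = "%w. Y w * X i s w * (X j t w - X j s w - L (b j) s t w)"
 let ?C = "%w. Y w * X j s w * (X i t w - X i s w - L (b i) s t w)"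
 have eq: "Y w * ((X i t w - X i s w) * (X j t w - X j s w)) = ?A w - ?B w - ?C w + Y w * V i j s t w" for w
  unfolding V_def by (simp add: algebra_simps)
 have "?A : Bd" "?B : Bd" "?C : Bd" "(%w. Y w * V i j s t w) : Bd"
  using XB LB Y(2) V_Bd[OF ij st] by (auto intro!: Bd_intros)
 then have i: "integrable P ?A" "integrable P ?B" "integrable P ?C" "integrable P (%w. Y w * V i j s t w)"
  by (auto intro: Bd_integrable)
 have A: "integral\<^sup>L P ?A = 0" using m2[OF ij st Y] by (simp add: L_def r_def)
 have B: "integral\<^sup>L P ?B = 0"
  using m1[OF ij(2) st, of "%w. Y w * X i s w"] Y Xm[OF ij(1) st(1)] Bd_mult[OF Y(2) XB(1)] by (simp add: L_def)
 have C: "integral\<^sup>L P ?C = 0"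
  using m1[OF ij(1) st, of "%w. Y w * X j s w"] Y Xm[OF ij(2) st(1)] Bd_mult[OF Y(2) XB(2)] by (simp add: L_def)
 show ?thesis unfolding eq using i A B C by simp
qed

definition "C1 = real n * (R + 2 * K * c)"

lemma R0: "0 <= R" using K0 c0 by (simp add: R_def)
lemma C10: "0 <= C1" using K0 c0 R0 by (simp add: C1_def)

text \<open>Diagonal case of \<open>increment_product\<close>: the bound \<open>V_bound\<close>
  makes the mean squared increment of order t - s, uniformly over nonnegative weights.\<close>

lemma increment_square_bound:
 assumes st: "0 <= s" "s <= t" and Y: "Y : bmeas (F s)" "Y : Bd" "!!w. 0 <= Y w"
 shows "(LINT w|P. Y w * (SUM i<n. (X i t w - X i s w)^2)) <= C1 * (t - s) * (LINT w|P. Y w)"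
proof -
 have t0: "0 <= t" using st by simp
 have i1: "(%w. Y w * ((X i t w - X i s w) * (X i t w - X i s w))) : Bd" if "i < n" for i
  using XP[OF that st(1)] XP[OF that t0] Y(2) by (intro Bd_intros)
 have i2: "(%w. Y w * V i i s t w) : Bd" if "i < n" for i
  using V_Bd[OF that that st] Y(2) by (intro Bd_intros)
 have "(LINT w|P. Y w * (SUM i<n. (X i t w - X i s w)^2)) =
  (SUM i<n. \<integral>w. Y w * ((X i t w - X i s w) * (X i t w - X i s w)) \<partial>P)"
  unfolding sum_distrib_left power2_eq_square
  by (rule bi_sum) (use i1 Bd_integrable in auto)
 also have "... = (SUM i<n. \<integral>w. Y w * V i i s t w \<partial>P)"
  by (intro sum.cong refl increment_product st Y) auto
 also have "... <= (SUM i<n. (R + 2 * K * c) * (t - s) * (LINT w|P. Y w))"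
 proof (rule sum_mono)
  fix i assume i: "i : {..<n}"
  have "(LINT w|P. Y w * V i i s t w) <= (LINT w|P. Y w * ((R + 2 * K * c) * (t - s)))"
  proof (rule integral_mono)
  show "integrable P (%w. Y w * V i i s t w)" using i2 i Bd_integrable by simp
  show "integrable P (%w. Y w * ((R + 2 * K * c) * (t - s)))"
  using Bd_integrable[OF Y(2)] by simp
  show "Y w * V i i s t w <= Y w * ((R + 2 * K * c) * (t - s))" if "w : space P" for w
  using V_bound[of i i w s t] i that st Y(3) by (intro mult_left_mono) auto
  qed
  then show "(LINT w|P. Y w * V i i s t w) <= (R + 2 * K * c) * (t - s) * (LINT w|P. Y w)"
  by (simp add: mult.commute)
 qed
 also have "... = C1 * (t - s) * (LINT w|P. Y w)" by (simp add: C1_def)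
 finally show ?thesis .
qed

definition "D s t m k w = (SUM i<n. (X i (grid s t m (Suc k)) w - X i (grid s t m k) w)^2)"

text \<open>Each of the n coordinates moves by at most 2 K, so \<open>kappa\<close> bounds
  \<open>D\<close>.\<close>

definition "kappa = 4 * K^2 * real n"

lemma D0: "0 <= D s t m k w" by (simp add: D_def sum_nonneg)

lemma D_bound: assumes "w : space P" shows "D s t m k w <= kappa"
proof -
 have "D s t m k w <= (SUM i<n. 4 * K^2)"
  unfolding D_def
 proof (rule sum_mono)
  fix i assume "i : {..<n}"
  then have "abs (X i (grid s t m (Suc k)) w - X i (grid s t m k) w) <= 2 * K"
  using Xb[of i w "grid s t m (Suc k)"] Xb[of i w "grid s t m k"] assms by auto
  then have "(X i (grid s t m (Suc k)) w - X i (grid s t m k) w)^2 <= (2 * K)^2"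
  by (rule abs_le_square_iff[THEN iffD1, OF order_trans]) simp
  then show "(X i (grid s t m (Suc k)) w - X i (grid s t m k) w)^2 <= 4 * K^2" by simp
 qed
 then show ?thesis by (simp add: kappa_def mult.commute)
qed

context
 fixes s t :: real assumes st: "0 <= s" "s <= t"
begin

lemma gr0: "0 <= grid s t m k" using grid_ge[OF st(2), of m k] st(1) by linarith

lemma D_meas: "D s t m k : bmeas (F (grid s t m (Suc k)))"
 unfolding D_def[abs_def]
 using F_mono[OF grid_mono[OF st(2), of k "Suc k" m] Xm[OF _ gr0]] Xm[OF _ gr0]
 by (intro borel_measurable_sum borel_measurable_power borel_measurable_diff) auto

lemma D_Bd: "D s t m k : Bd"
 unfolding D_def[abs_def] by (intro Bd_intros XP gr0) auto

lemma ED: "(LINT w|P. D s t m k w) <= C1 * ((t - s) / real (Suc m))"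
 using increment_square_bound[of "grid s t m k" "grid s t m (Suc k)" "%_. 1"] gr0[of m k] grid_mono[OF st(2), of k "Suc k" m]
 by (simp add: D_def Bd_const grid_step prob_space)

text \<open>The earlier square \<open>D s t m k\<close> is bounded and known at the start of the
  later cell, so it serves as a weight there.\<close>

lemma EDD: "k < l ==> (LINT w|P. D s t m k w * D s t m l w) <= (C1 * ((t - s) / real (Suc m)))^2"
proof -
 assume kl: "k < l"
 have "(LINT w|P. D s t m k w * D s t m l w) <= C1 * ((t - s) / real (Suc m)) * (LINT w|P. D s t m k w)"
  using increment_square_bound[of "grid s t m l" "grid s t m (Suc l)" "D s t m k"]
  gr0[of m l] grid_mono[OF st(2), of l "Suc l" m] F_mono[OF grid_mono[OF st(2), of "Suc k" l m] D_meas] kl D_Bd D0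
  unfolding D_def[of s t m l] by (simp add: grid_step)
 also have "... <= C1 * ((t - s) / real (Suc m)) * (C1 * ((t - s) / real (Suc m)))"
  using C10 st by (intro mult_left_mono ED) auto
 finally show ?thesis by (simp add: power2_eq_square)
qed

definition "CC = kappa * C1 * (t - s) + (C1 * (t - s))^2"

lemma ES: "(LINT w|P. (SUM k<Suc m. D s t m k w)) <= C1 * (t - s)"
proof -
 have "(LINT w|P. (SUM k<Suc m. D s t m k w)) = (SUM k<Suc m. \<integral>w. D s t m k w \<partial>P)"
  by (rule bi_sum) (rule Bd_integrable[OF D_Bd])
 also have "... <= (SUM k<Suc m. C1 * ((t - s) / real (Suc m)))" by (intro sum_mono ED)
 also have "... = C1 * (t - s)" by simp
 finally show ?thesis .
qed

text \<open>The discrete quadratic variation is bounded in L^2 uniformly in m: off the diagonal by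
  \<open>EDD\<close>, on the diagonal by \<open>D_bound\<close>. The two parts give the two summands
  of \<open>CC\<close>.\<close>

lemma ES2: "(LINT w|P. (SUM k<Suc m. D s t m k w)^2) <= CC"
proof -
 let ?d = "C1 * ((t - s) / real (Suc m))"
 have d0: "0 <= ?d" using C10 st by simp
 have k0: "0 <= kappa" by (simp add: kappa_def)
 have DDB: "(%w. D s t m k w * D s t m l w) : Bd" for k l by (intro Bd_intros D_Bd)
 have dd: "(LINT w|P. D s t m k w * D s t m l w) <= (if l = k then kappa * ?d else 0) + ?d^2" for k l
 proof -
  consider "k < l" | "l < k" | "k = l" by linarith
  then show ?thesis
  proof cases
  case 1 then show ?thesis using EDD[of k l m] by simp
  next
  case 2 then show ?thesis using EDD[of l k m] by (simp add: mult.commute)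
  next
  case 3
  have "(LINT w|P. D s t m k w * D s t m k w) <= (LINT w|P. kappa * D s t m k w)"
  by (rule integral_mono) (use DDB D_Bd D0 D_bound in \<open>auto intro!: Bd_integrable mult_right_mono Bd_intros\<close>)
  also have "... = kappa * (LINT w|P. D s t m k w)" by simp
  also have "... <= kappa * ?d" by (rule mult_left_mono[OF ED k0])
  also have "... <= kappa * ?d + ?d^2" by simp
  finally show ?thesis using 3 by simp
  qed
 qed
 have "(LINT w|P. (SUM k<Suc m. D s t m k w)^2) = (SUM k<Suc m. SUM l<Suc m. \<integral>w. D s t m k w * D s t m l w \<partial>P)"
  unfolding power2_eq_square sum_product
  by (subst bi_sum, intro bib_sum Bd_integrable DDB,
  intro sum.cong refl bi_sum Bd_integrable DDB)
 also have "... <= (SUM k<Suc m. SUM l<Suc m. (if l = k then kappa * ?d else 0) + ?d^2)"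
  by (intro sum_mono dd)
 also have "... = (SUM k<Suc m. kappa * ?d) + (SUM k<Suc m. SUM l<Suc m. ?d^2)"
  unfolding sum.distrib by (subst sum.delta) (auto intro!: sum.cong)
 also have "... = kappa * C1 * (t - s) + (real (Suc m) * ?d)^2"
  by (simp add: power2_eq_square mult_ac)
 also have "real (Suc m) * ?d = C1 * (t - s)" by simp
 finally show ?thesis by (simp add: CC_def)
qed

text \<open>The sum of the \<open>D^2\<close> is at most the largest D times the sum of the D. The
  largest D tends to 0 pathwise and boundedly by uniform continuity of the paths, the sum is bounded
  in L^2, and a weighted inequality of squares separates the two factors.\<close>

lemma sum_D2_limit: "(%m. \<integral>w. (SUM k<Suc m. (D s t m k w)^2) \<partial>P) ~~> 0"
proof -
 define Mx where "Mx m w = Max ((%k. D s t m k w) ` {..m})" for m w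
 have Mxm: "Mx m : bmeas P" for m
  unfolding Mx_def[abs_def] by (rule borel_measurable_Max) (use D_Bd Bd_measurable in auto)
 have DM: "D s t m k w <= Mx m w" if "k < Suc m" for m k w
  unfolding Mx_def using that by (intro Max_ge) auto
 have M0: "0 <= Mx m w" for m w using DM[of 0 m w] D0[of s t m 0 w] by linarith
 have Mk: "Mx m w <= kappa" if "w : space P" for m w
  unfolding Mx_def using D_bound[OF that] by (intro Max.boundedI) auto
 have MB: "Mx m : Bd" for m using M0 Mk Mxm by (intro BdI[of _ kappa]) (auto simp: abs_of_nonneg)
 have Mlim: "(%m. Mx m w) ~~> 0" if w: "w : space P" for w
 proof (rule LIMSEQ_I)
  fix e :: real assume e: "0 < e"
  define eta where "eta = sqrt (e / (2 * (real n + 1)))"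
  have eta: "eta > 0" using e by (simp add: eta_def)
  have aux: "0 <= e * real n" using e by simp
  have eta2: "real n * eta^2 < e" using e by (simp add: eta_def field_simps) (use aux e in linarith)
  have "ALL i. EX N. i < n --> (\<forall>m\<ge>N. \<forall>k<Suc m. \<forall>u\<in>{grid s t m k..grid s t m (Suc k)}. abs (X i u w - X i (grid s t m k) w) <= eta)"
  using uniform_on_grid[OF Xc[OF _ w] st(2) eta] by blast
  then obtain N where N: "!!i m k u. i < n ==> m >= N i ==> k < Suc m ==> u : {grid s t m k..grid s t m (Suc k)} ==> abs (X i u w - X i (grid s t m k) w) <= eta"
  by metis
  define N' where "N' = (SUM i<n. N i)"
  have NN: "N i <= N'" if "i < n" for i unfolding N'_def using that by (intro member_le_sum) auto
  have "Mx m w < e" if m: "m >= N'" for m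
  proof -
  have "D s t m k w <= real n * eta^2" if k: "k <= m" for k
  proof -
  have "D s t m k w <= (SUM i<n. eta^2)"
  unfolding D_def
  proof (rule sum_mono)
  fix i assume i: "i : {..<n}"
  have "abs (X i (grid s t m (Suc k)) w - X i (grid s t m k) w) <= abs eta"
  using N[of i m k "grid s t m (Suc k)"] i NN[of i] m k grid_mono[OF st(2), of k "Suc k" m] eta by auto
  then show "(X i (grid s t m (Suc k)) w - X i (grid s t m k) w)^2 <= eta^2"
  by (simp only: abs_le_square_iff)
  qed
  then show ?thesis by simp
  qed
  then have "Mx m w <= real n * eta^2" unfolding Mx_def by (intro Max.boundedI) auto
  then show ?thesis using eta2 by simp
  qed
  then show "EX no. \<forall>m\<ge>no. norm (Mx m w - 0) < e" using M0 by (auto simp: abs_of_nonneg)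
 qed
 have EM: "(%m. \<integral>w. (Mx m w)^2 \<partial>P) ~~> (LINT w|P. 0)"
 proof (rule integral_dominated_convergence[where w = "%_. kappa^2"])
  show "AE w in P. (%m. (Mx m w)^2) ~~> 0"
  using tendsto_power[OF Mlim, of _ 2] by (auto intro!: AE_I2)
  show "AE w in P. norm ((Mx m w)^2) <= kappa^2" for m
  using M0 Mk by (auto intro!: AE_I2 power_mono)
 qed (use Mxm in auto)
 show ?thesis
 proof (rule LIMSEQ_I)
  fix e :: real assume e: "0 < e"
  have CC0: "0 <= CC" using C10 st by (simp add: CC_def kappa_def)
  \<comment> \<open>Makes \<open>eta * CC\<close> at most e / 2; m is then taken so large that the
    other term is below e / 2.\<close>
  define eta where "eta = e / (2 * (CC + 1))"
  have eta: "eta > 0" using e CC0 by (simp add: eta_def)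
  have etaC: "eta * CC <= e / 2" using e CC0 by (simp add: eta_def field_simps)
  have "\<forall>\<^sub>F m in sequentially. (LINT w|P. (Mx m w)^2) < eta * (e / 2)"
  using EM e eta by (intro order_tendstoD(2)[OF EM]) simp
  then obtain N where N: "!!m. m >= N ==> (LINT w|P. (Mx m w)^2) < eta * (e / 2)"
  by (auto simp: eventually_sequentially)
  have "(LINT w|P. (SUM k<Suc m. (D s t m k w)^2)) < e" if m: "m >= N" for m
  proof -
  let ?S = "%w. SUM k<Suc m. D s t m k w"
  have SB: "?S : Bd" by (intro Bd_intros D_Bd)
  have "(LINT w|P. (SUM k<Suc m. (D s t m k w)^2)) <= (LINT w|P. (Mx m w)^2 / eta + eta * (?S w)^2)"
  proof (rule integral_mono)
  show "integrable P (%w. SUM k<Suc m. (D s t m k w)^2)"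
  by (intro Bd_integrable Bd_intros D_Bd)
  show "integrable P (%w. (Mx m w)^2 / eta + eta * (?S w)^2)"
  unfolding divide_inverse by (intro Bd_integrable Bd_intros D_Bd MB)
  fix w
  have "(SUM k<Suc m. (D s t m k w)^2) <= (SUM k<Suc m. Mx m w * D s t m k w)"
  unfolding power2_eq_square by (intro sum_mono mult_right_mono DM D0) auto
  also have "... = Mx m w * ?S w" by (simp only: sum_distrib_left)
  also have "... <= (Mx m w)^2 / eta + eta * (?S w)^2" by (rule mult_le_weighted_squares[OF eta])
  finally show "(SUM k<Suc m. (D s t m k w)^2) <= (Mx m w)^2 / eta + eta * (?S w)^2" .
  qed
  also have "... = (LINT w|P. (Mx m w)^2) / eta + eta * (LINT w|P. (?S w)^2)"
  using Bd_integrable[OF Bd_power[OF MB, of m 2]] Bd_integrable[OF Bd_power[OF SB, of 2]] by simp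
  also have "... <= (LINT w|P. (Mx m w)^2) / eta + eta * CC"
  using ES2[of m] eta by (intro add_left_mono mult_left_mono) auto
  also have "... < e / 2 + eta * CC"
  using N[OF m] eta by (simp add: field_simps)
  also have "... <= e" using etaC by simp
  finally show ?thesis .
  qed
  moreover have "0 <= (LINT w|P. (SUM k<Suc m. (D s t m k w)^2))" for m
  by (intro integral_nonneg_AE) (auto simp: sum_nonneg)
  ultimately show "EX no. \<forall>m\<ge>no. norm ((LINT w|P. (SUM k<Suc m. (D s t m k w)^2)) - 0) < e"
  by (auto simp: abs_of_nonneg)
 qed
qed

lemma xv_box: "w : space P ==> xv u w : box n K"
 using Xb by (auto simp: box_def xv_def)

text \<open>Along a partition the increment of f is a sum of quadratic Taylor polynomials
  \<open>T\<close> and remainders \<open>Rm\<close>. In the mean against weights known at the left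
  end of a cell, \<open>T\<close> equals \<open>Jk\<close>, by \<open>m1\<close> and
  \<open>increment_product\<close>. The sums of the \<open>Jk\<close> are Riemann sums for the drift
  J. The remainders are controlled by \<open>taylor_box\<close> through the sums of D and of
  \<open>D^2\<close>; the former carries an arbitrarily small factor and the latter
  vanishes.\<close>

lemma ito:
 assumes f: "C2_loc n f" and Y: "Y : bmeas (F s)" "Y : Bd"
 shows "(LINT w|P. Y w * (f (xv t w) - f (xv s w) - (LBINT u:{s..t}.
  (SUM i<n. pder i f (xv u w) * b i u w) +
  1/2 * (SUM i<n. SUM j<n. pder j (pder i f) (xv u w) * a i j u w)))) = 0"
proof -
 define p where "p i u w = pder i f (xv u w)" for i u w
 define H where "H i j u w = pder j (pder i f) (xv u w)" for i j u w
 note fD = C2_locD[OF f]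
 let ?g = "grid s t"
 have t0: "0 <= t" using st by simp
 have comp_c: "continuous_on UNIV (%u. q (xv u w))" if "continuous_on (Rn n) q" "w : space P" for q :: "_ => real" and w
  unfolding xv_def by (rule Rn_comp_continuous[OF that(1)]) (use Xc that in auto)
 have comp_m: "(%w. q (xv u w)) : bmeas (F u)" if "continuous_on (Rn n) q" "0 <= u" for q :: "_ => real" and u
  unfolding xv_def by (rule Rn_comp_measurable[OF that(1)]) (use Xm that in auto)
 have comp_b: "(%w. q (xv u w)) : Bd" if q: "continuous_on (Rn n) q" "0 <= u" for q :: "_ => real" and u
 proof -
  obtain B where "!!x. x : box n K ==> abs (q x) <= B" using box_bounded[OF q(1), of K] by metis
  then show ?thesis using F_P[OF comp_m[OF q]] xv_box by (intro BdI) auto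
 qed
 have "\<exists>B\<ge>0. \<forall>i<n. \<forall>j<n. \<forall>x\<in>box n K. abs (pder i f x) <= B & abs (pder j (pder i f) x) <= B"
 proof -
  have "\<exists>B\<ge>0. i < n --> (\<forall>x\<in>box n K. abs (pder i f x) <= B)" for i
  using box_bounded[OF fD(3), of i K] by (metis order_refl)
  then obtain B1 where B1: "!!i. 0 <= B1 i" "!!i x. i < n ==> x : box n K ==> abs (pder i f x) <= B1 i" by metis
  have "\<exists>B\<ge>0. i < n --> j < n --> (\<forall>x\<in>box n K. abs (pder j (pder i f) x) <= B)" for i j
  using box_bounded[OF fD(5), of i j K] by (metis order_refl)
  then obtain B2 where B2: "!!i j. 0 <= B2 i j" "!!i j x. i < n ==> j < n ==> x : box n K ==> abs (pder j (pder i f) x) <= B2 i j" by metis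
  define B where "B = (SUM i<n. B1 i + (SUM j<n. B2 i j))"
  have le: "B1 i + (SUM j<n. B2 i j) <= B" if "i < n" for i
  unfolding B_def using that B1(1) B2(1)
  by (intro member_le_sum[of i "{..<n}" "%i. B1 i + (SUM j<n. B2 i j)"]) (auto intro!: add_nonneg_nonneg sum_nonneg)
  have le2: "B2 i j <= (SUM j<n. B2 i j)" if "j < n" for i j
  using that B2(1) by (intro member_le_sum) auto
  have le3: "0 <= (SUM j<n. B2 i j)" for i using B2(1) by (intro sum_nonneg) auto
  have "abs (pder i f x) <= B & abs (pder j (pder i f) x) <= B"
  if "i < n" "j < n" "x : box n K" for i j x
  using B1(2)[OF that(1,3)] B2(2)[OF that] le[OF that(1)] le2[OF that(2), of i] le3[of i] B1(1)[of i] by linarith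
  moreover have "0 <= B" unfolding B_def using B1(1) B2(1) by (intro sum_nonneg add_nonneg_nonneg) auto
  ultimately show ?thesis by blast
 qed
 then obtain B where B0: "0 <= B" and B: "!!i j x. i < n ==> j < n ==> x : box n K ==> abs (pder i f x) <= B & abs (pder j (pder i f) x) <= B"
  by metis
 have pc: "continuous_on UNIV (%u. p i u w)" and Hc: "j < n ==> continuous_on UNIV (%u. H i j u w)"
  if "i < n" "w : space P" for i j w
  using comp_c fD(3,5) that by (auto simp: p_def H_def)
 have pb: "abs (p i u w) <= B" and Hb: "j < n ==> abs (H i j u w) <= B" if "i < n" "w : space P" for i j u w
  using B[OF that(1) _ xv_box[OF that(2)]] that(1) by (auto simp: p_def H_def)
 have pBd: "p i u : Bd" "p i u : bmeas (F u)" if "i < n" "0 <= u" for i u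
  using comp_b comp_m fD(3) that by (auto simp: p_def[abs_def])
 have HBd: "H i j u : Bd" "H i j u : bmeas (F u)" if "i < n" "j < n" "0 <= u" for i j u
  using comp_b comp_m fD(5) that by (auto simp: H_def[abs_def])
 have fBd: "(%w. f (xv u w)) : Bd" if "0 <= u" for u
  using comp_b[OF fD(1) that] .
 define \<Delta> where "\<Delta> m k i w = X i (?g m (Suc k)) w - X i (?g m k) w" for m k i w
 define T where "T m k w = (SUM i<n. p i (?g m k) w * \<Delta> m k i w) + 1/2 * (SUM i<n. SUM j<n. H i j (?g m k) w * (\<Delta> m k i w * \<Delta> m k j w))" for m k w
 define Jk where "Jk m k w = (SUM i<n. p i (?g m k) w * L (b i) (?g m k) (?g m (Suc k)) w)
  + 1/2 * (SUM i<n. SUM j<n. H i j (?g m k) w * V i j (?g m k) (?g m (Suc k)) w)" for m k w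
 define J where "J w = (LBINT u:{s..t}. (SUM i<n. p i u w * b i u w) + 1/2 * (SUM i<n. SUM j<n. H i j u w * a i j u w))" for w
 have gle: "?g m k <= ?g m (Suc k)" for m k by (rule grid_mono[OF st(2)]) simp
 have \<Delta>Bd: "\<Delta> m k i : Bd" if "i < n" for m k i
  unfolding \<Delta>_def[abs_def] using that by (intro Bd_intros XP gr0)
 have TBd: "T m k : Bd" for m k
  unfolding T_def[abs_def] by (intro Bd_intros pBd HBd \<Delta>Bd gr0) auto
 have JkBd: "Jk m k : Bd" for m k
  unfolding Jk_def[abs_def] by (intro Bd_intros pBd HBd V_Bd L_Bd gr0 gle) auto
 have YF: "Y : bmeas (F (?g m k))" for m k
  by (rule F_mono[OF grid_ge[OF st(2)] Y(1)])
 have A1: "(LINT w|P. Y w * (p i (?g m k) w * \<Delta> m k i w)) = (LINT w|P. Y w * (p i (?g m k) w * L (b i) (?g m k) (?g m (Suc k)) w))"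
  if i: "i < n" for m k i
 proof -
  have bd: "(%w. Y w * p i (?g m k) w) : Bd" by (intro Bd_intros Y pBd i gr0)
  have "(LINT w|P. Y w * p i (?g m k) w * (\<Delta> m k i w - L (b i) (?g m k) (?g m (Suc k)) w)) = 0"
  unfolding \<Delta>_def L_def
  by (rule m1[OF i gr0 gle _ bd]) (intro borel_measurable_times YF pBd i gr0)
  moreover have "(%w. Y w * (p i (?g m k) w * \<Delta> m k i w)) : Bd" "(%w. Y w * (p i (?g m k) w * L (b i) (?g m k) (?g m (Suc k)) w)) : Bd"
  by (intro Bd_intros Y pBd i gr0 \<Delta>Bd L_Bd gle)+
  ultimately show ?thesis
  by (simp add: right_diff_distrib Bd_integrable mult.assoc)
 qed
 have A2: "(LINT w|P. Y w * (H i j (?g m k) w * (\<Delta> m k i w * \<Delta> m k j w))) = (LINT w|P. Y w * (H i j (?g m k) w * V i j (?g m k) (?g m (Suc k)) w))"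
  if ij: "i < n" "j < n" for m k i j
 proof -
  have bd: "(%w. Y w * H i j (?g m k) w) : Bd" by (intro Bd_intros Y HBd ij gr0)
  show ?thesis
  using increment_product[OF ij gr0 gle _ bd] HBd(2)[OF ij gr0, of m k] YF[of m k]
  unfolding \<Delta>_def by (simp add: mult.assoc)
 qed
 have i1: "integrable P (%w. Y w * (p i (?g m k) w * \<Delta> m k i w))" "integrable P (%w. Y w * (p i (?g m k) w * L (b i) (?g m k) (?g m (Suc k)) w))"
  if "i < n" for m k i
  using that by (intro Bd_integrable Bd_intros Y pBd gr0 \<Delta>Bd L_Bd gle; simp)+
 have i2: "integrable P (%w. Y w * (H i j (?g m k) w * (\<Delta> m k i w * \<Delta> m k j w)))" "integrable P (%w. Y w * (H i j (?g m k) w * V i j (?g m k) (?g m (Suc k)) w))"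
  if "i < n" "j < n" for m k i j
  using that by (intro Bd_integrable Bd_intros Y HBd gr0 \<Delta>Bd V_Bd gle; simp)+
 have split: "(LINT w|P. Y w * ((SUM i<n. alpha i w) + 1/2 * (SUM i<n. SUM j<n. gamma i j w)))
  = (SUM i<n. \<integral>w. Y w * alpha i w \<partial>P) + 1/2 * (SUM i<n. SUM j<n. \<integral>w. Y w * gamma i j w \<partial>P)"
  if "!!i. i < n ==> integrable P (%w. Y w * alpha i w)" "!!i j. i < n ==> j < n ==> integrable P (%w. Y w * gamma i j w)"
  for alpha gamma
 proof -
  have "(LINT w|P. Y w * ((SUM i<n. alpha i w) + 1/2 * (SUM i<n. SUM j<n. gamma i j w))) =
  (LINT w|P. (SUM i<n. Y w * alpha i w) + 1/2 * (SUM i<n. SUM j<n. Y w * gamma i j w))"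
  by (intro bi_cong refl) (simp add: distrib_left sum_distrib_left mult_ac)
  also have "... = (LINT w|P. (SUM i<n. Y w * alpha i w)) + 1/2 * (LINT w|P. (SUM i<n. SUM j<n. Y w * gamma i j w))"
  using that by (subst bi_add) (auto intro!: bib_sum)
  also have "(LINT w|P. (SUM i<n. Y w * alpha i w)) = (SUM i<n. \<integral>w. Y w * alpha i w \<partial>P)"
  using that by (intro bi_sum) auto
  also have "(LINT w|P. (SUM i<n. SUM j<n. Y w * gamma i j w)) = (SUM i<n. SUM j<n. \<integral>w. Y w * gamma i j w \<partial>P)"
  using that by (subst bi_sum)
  (auto intro!: bib_sum bi_sum sum.cong)
  finally show ?thesis .
 qed
 have ETJ: "(LINT w|P. Y w * T m k w) = (LINT w|P. Y w * Jk m k w)" for m k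
 proof -
  have "(LINT w|P. Y w * T m k w) = (SUM i<n. \<integral>w. Y w * (p i (?g m k) w * \<Delta> m k i w) \<partial>P)
  + 1/2 * (SUM i<n. SUM j<n. \<integral>w. Y w * (H i j (?g m k) w * (\<Delta> m k i w * \<Delta> m k j w)) \<partial>P)"
  unfolding T_def by (rule split) (rule i1 i2; assumption)+
  also have "... = (SUM i<n. \<integral>w. Y w * (p i (?g m k) w * L (b i) (?g m k) (?g m (Suc k)) w) \<partial>P)
  + 1/2 * (SUM i<n. SUM j<n. \<integral>w. Y w * (H i j (?g m k) w * V i j (?g m k) (?g m (Suc k)) w) \<partial>P)"
  by (intro arg_cong2[where f = "(+)"] arg_cong2[where f = "(*)"] sum.cong refl A1 A2) auto
  also have "... = (LINT w|P. Y w * Jk m k w)"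
  unfolding Jk_def by (rule split[symmetric]) (rule i1 i2; assumption)+
  finally show ?thesis .
 qed
 define Rm where "Rm m k w = f (xv (?g m (Suc k)) w) - f (xv (?g m k) w) - T m k w" for m k w
 have RBd: "Rm m k : Bd" for m k
  unfolding Rm_def[abs_def] by (intro Bd_diff fBd TBd gr0)
 have tele: "f (xv t w) - f (xv s w) = (SUM k<Suc m. Rm m k w) + (SUM k<Suc m. T m k w)" for m w
 proof -
  have "(SUM k<Suc m. f (xv (?g m (Suc k)) w) - f (xv (?g m k) w)) = f (xv t w) - f (xv s w)"
  by (subst sum_lessThan_telescope) simp
  then show ?thesis by (simp only: Rm_def sum.distrib[symmetric]) (simp add: sum.distrib sum_subtractf)
 qed
 have Em: "(LINT w|P. Y w * (f (xv t w) - f (xv s w))) = (LINT w|P. Y w * (SUM k<Suc m. Rm m k w)) + (LINT w|P. Y w * (SUM k<Suc m. Jk m k w))" for m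
 proof -
  have iT: "integrable P (%w. Y w * T m k w)" and iJ: "integrable P (%w. Y w * Jk m k w)" for k
  by (intro Bd_integrable Bd_mult Y TBd JkBd)+
  have iR: "integrable P (%w. Y w * (SUM k<Suc m. Rm m k w))" "integrable P (%w. Y w * (SUM k<Suc m. T m k w))"
  by (intro Bd_integrable Bd_mult Bd_sum Y TBd RBd)+
  have "(LINT w|P. Y w * (f (xv t w) - f (xv s w))) = (LINT w|P. Y w * (SUM k<Suc m. Rm m k w) + Y w * (SUM k<Suc m. T m k w))"
  unfolding tele[of _ m] by (simp only: distrib_left)
  also have "... = (LINT w|P. Y w * (SUM k<Suc m. Rm m k w)) + (LINT w|P. Y w * (SUM k<Suc m. T m k w))"
  by (rule bi_add[OF iR])
  also have "(LINT w|P. Y w * (SUM k<Suc m. T m k w)) = (SUM k<Suc m. \<integral>w. Y w * T m k w \<partial>P)"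
  unfolding sum_distrib_left by (rule bi_sum) (rule iT)
  also have "... = (LINT w|P. Y w * (SUM k<Suc m. Jk m k w))"
  unfolding ETJ sum_distrib_left by (rule bi_sum[symmetric]) (rule iJ)
  finally show ?thesis .
 qed
 have Jlim: "(%m. SUM k<Suc m. Jk m k w) ~~> J w" if w: "w : space P" for w
 proof -
  let ?h = "%i j u. indicator {s..t} u *\<^sub>R (H i j u w * r i j u w) - indicator {s..t} u *\<^sub>R ((H i j u w * X i u w) * b j u w) - indicator {s..t} u *\<^sub>R ((H i j u w * X j u w) * b i u w)"
  let ?l = "%i j. (LBINT u:{s..t}. H i j u w * r i j u w) - (LBINT u:{s..t}. (H i j u w * X i u w) * b j u w) - (LBINT u:{s..t}. (H i j u w * X j u w) * b i u w)"
  have bmw: "(%u. b i u w) : bmeas borel" if "i < n" for i using measurable_Pair2[OF bm[OF that] w] by simp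
  have rmw: "(%u. r i j u w) : bmeas borel" if "i < n" "j < n" for i j using measurable_Pair2[OF rm[OF that] w] by simp
  have Xmw: "(%u. X i u w) : bmeas borel" if "i < n" for i using Xc[OF that w] by (rule borel_measurable_continuous_onI)
  have Hmw: "(%u. H i j u w) : bmeas borel" if "i < n" "j < n" for i j using Hc[OF that(1) w that(2)] by (rule borel_measurable_continuous_onI)
  have pmw: "(%u. p i u w) : bmeas borel" if "i < n" for i using pc[OF that w] by (rule borel_measurable_continuous_onI)
  have HXc: "continuous_on UNIV (%u. H i j u w * X l u w)" if "i < n" "j < n" "l < n" for i j l
  using Hc[OF that(1) w that(2)] Xc[OF that(3) w] by (intro continuous_intros)
  have HXb: "abs (H i j u w * X l u w) <= B * K" if "i < n" "j < n" "l < n" for i j l u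
  using Hb[OF that(1) w that(2)] Xb[OF that(3) w] B0 by (auto simp: abs_mult intro!: mult_mono)
  have R1: "(%m. SUM k<Suc m. p i (?g m k) w * L (b i) (?g m k) (?g m (Suc k)) w) ~~> (LBINT u:{s..t}. p i u w * b i u w)" if "i < n" for i
  unfolding L_def by (rule riemann_limit[OF pc[OF that w] bmw[OF that] bb[OF that w] pb[OF that w] st(2)])
  \<comment> \<open>The values of X frozen inside \<open>V\<close> become values along the path in
    the limit, so the limit integrand is H times \<open>r - X i b j - X j b i\<close>, which is H
    times a by \<open>Ha\<close> below.\<close>
  have R2: "(%m. SUM k<Suc m. H i j (?g m k) w * V i j (?g m k) (?g m (Suc k)) w) ~~>
  ?l i j"
  if ij: "i < n" "j < n" for i j
  proof -
  have "(%m. (SUM k<Suc m. H i j (?g m k) w * L (r i j) (?g m k) (?g m (Suc k)) w)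
  - (SUM k<Suc m. (H i j (?g m k) w * X i (?g m k) w) * L (b j) (?g m k) (?g m (Suc k)) w)
  - (SUM k<Suc m. (H i j (?g m k) w * X j (?g m k) w) * L (b i) (?g m k) (?g m (Suc k)) w)) ~~>
  ?l i j"
  unfolding L_def
  by (intro tendsto_diff riemann_limit[OF Hc[OF ij(1) w ij(2)] rmw[OF ij] rb[OF ij w] Hb[OF ij(1) w ij(2)] st(2)]
  riemann_limit[OF HXc[OF ij ij(1)] bmw[OF ij(2)] bb[OF ij(2) w] HXb[OF ij ij(1)] st(2)]
  riemann_limit[OF HXc[OF ij ij(2)] bmw[OF ij(1)] bb[OF ij(1) w] HXb[OF ij ij(2)] st(2)])
  moreover have "H i j (?g m k) w * V i j (?g m k) (?g m (Suc k)) w =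
  H i j (?g m k) w * L (r i j) (?g m k) (?g m (Suc k)) w
  - (H i j (?g m k) w * X i (?g m k) w) * L (b j) (?g m k) (?g m (Suc k)) w
  - (H i j (?g m k) w * X j (?g m k) w) * L (b i) (?g m k) (?g m (Suc k)) w" for m k
  unfolding V_def by (simp add: right_diff_distrib mult.assoc)
  ultimately show ?thesis by (simp only: sum_subtractf)
  qed
  have lim: "(%m. (SUM i<n. SUM k<Suc m. p i (?g m k) w * L (b i) (?g m k) (?g m (Suc k)) w)
  + 1/2 * (SUM i<n. SUM j<n. SUM k<Suc m. H i j (?g m k) w * V i j (?g m k) (?g m (Suc k)) w)) ~~>
  (SUM i<n. LBINT u:{s..t}. p i u w * b i u w) + 1/2 * (SUM i<n. SUM j<n.
  ?l i j)"
  by (intro tendsto_add tendsto_mult_left tendsto_sum R1 R2) auto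
  have swap: "(SUM k<Suc m. Jk m k w) = (SUM i<n. SUM k<Suc m. p i (?g m k) w * L (b i) (?g m k) (?g m (Suc k)) w)
  + 1/2 * (SUM i<n. SUM j<n. SUM k<Suc m. H i j (?g m k) w * V i j (?g m k) (?g m (Suc k)) w)" for m
  proof -
  have "(SUM k<Suc m. SUM i<n. SUM j<n. H i j (?g m k) w * V i j (?g m k) (?g m (Suc k)) w)
  = (SUM i<n. SUM j<n. SUM k<Suc m. H i j (?g m k) w * V i j (?g m k) (?g m (Suc k)) w)"
  by (subst sum.swap, rule sum.cong[OF refl], rule sum.swap)
  moreover have "(SUM k<Suc m. SUM i<n. p i (?g m k) w * L (b i) (?g m k) (?g m (Suc k)) w) = (SUM i<n. SUM k<Suc m. p i (?g m k) w * L (b i) (?g m k) (?g m (Suc k)) w)"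
  by (rule sum.swap)
  ultimately show ?thesis unfolding Jk_def sum.distrib sum_distrib_left[symmetric] by simp
  qed
  have S1: "set_integrable lborel {s..t} (%u. p i u w * b i u w)" if "i < n" for i
  by (rule set_integrable_bounded_Icc[of _ "B * c"])
  (use pmw bmw pb bb that w B0 c0 in \<open>auto simp: abs_mult intro!: mult_mono\<close>)
  have S2: "set_integrable lborel {s..t} (%u. H i j u w * r i j u w)" if "i < n" "j < n" for i j
  by (rule set_integrable_bounded_Icc[of _ "B * R"])
  (use Hmw rmw Hb rb that w B0 R0 in \<open>auto simp: abs_mult intro!: mult_mono\<close>)
  have S3: "set_integrable lborel {s..t} (%u. (H i j u w * X l u w) * b l' u w)" if "i < n" "j < n" "l < n" "l' < n" for i j l l'
  proof (rule set_integrable_bounded_Icc[of _ "B * K * c"])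
  show "abs (H i j u w * X l u w * b l' u w) <= B * K * c" for u
  using HXb[OF that(1-3), of u] bb[OF that(4) w, of u] B0 K0 unfolding abs_mult[of _ "b l' u w"] by (intro mult_mono) auto
  qed (use Hmw Xmw bmw that in auto)
  have Ha: "H i j u w * a i j u w = H i j u w * r i j u w - (H i j u w * X i u w) * b j u w - (H i j u w * X j u w) * b i u w" for i j u
  unfolding r_def by (simp add: algebra_simps)
  note S1 = S1[unfolded set_integrable_def] and S2 = S2[unfolded set_integrable_def] and S3 = S3[unfolded set_integrable_def]
  have "J w = (LBINT u. (SUM i<n. indicator {s..t} u *\<^sub>R (p i u w * b i u w)) + 1/2 * (SUM i<n. SUM j<n.
  ?h i j u))"
  unfolding J_def set_lebesgue_integral_def Ha
  by (intro bi_cong refl) (simp add: indicator_def)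
  also have "... = (LBINT u. (SUM i<n. indicator {s..t} u *\<^sub>R (p i u w * b i u w))) + 1/2 * (LBINT u. SUM i<n. SUM j<n.
  ?h i j u)"
  proof -
  have "integrable lborel (%u. SUM i<n. indicator {s..t} u *\<^sub>R (p i u w * b i u w))"
  by (intro bib_sum S1) simp
  moreover have "integrable lborel (%u. SUM i<n. SUM j<n. ?h i j u)"
  by (intro bib_sum bib_diff S2 S3) simp_all
  ultimately show ?thesis
  by (simp only: bi_add integrable_mult_right integral_mult_right_zero)
  qed
  also have "(LBINT u. (SUM i<n. indicator {s..t} u *\<^sub>R (p i u w * b i u w))) = (SUM i<n. LBINT u:{s..t}. p i u w * b i u w)"
  unfolding set_lebesgue_integral_def by (rule bi_sum) (use S1 in auto)
  also have "(LBINT u. SUM i<n. SUM j<n.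
  ?h i j u)
  = (SUM i<n. SUM j<n. ?l i j)"
  proof -
  have one: "(LBINT u. ?h i j u)
  = ?l i j"
  if ij: "i < n" "j < n" for i j
  unfolding set_lebesgue_integral_def
  using S2[OF ij] S3[OF ij ij(1) ij(2)] S3[OF ij ij(2) ij(1)]
  by (simp only: bi_diff bib_diff)
  have two: "integrable lborel (%u. ?h i j u)"
  if ij: "i < n" "j < n" for i j
  using S2[OF ij] S3[OF ij ij(1) ij(2)] S3[OF ij ij(2) ij(1)]
  by (intro bib_diff)
  show ?thesis
  by (subst bi_sum, rule bib_sum, rule two, simp, simp,
  rule sum.cong[OF refl], subst bi_sum, rule two, simp, simp, rule sum.cong[OF refl], rule one) auto
  qed
  finally show ?thesis using lim unfolding swap by simp
 qed
 let ?cc = "(real n * (B * c) + real n * (real n * (B * (R + 2 * K * c))))"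
 have Jb: "abs (SUM k<Suc m. Jk m k w) <= ?cc * (t - s)"
  if w: "w : space P" for m w
 proof -
  let ?d = "(t - s) / real (Suc m)"
  have d0: "0 <= ?d" using st by simp
  have gd: "?g m (Suc k) - ?g m k = ?d" for k by (simp add: grid_step)
  have "abs (Jk m k w) <= ?cc * ?d" for k
  proof -
  have "abs (SUM i<n. p i (?g m k) w * L (b i) (?g m k) (?g m (Suc k)) w) <= (SUM i<n. B * (c * ?d))"
  proof (intro order_trans[OF sum_abs] sum_mono)
  fix i assume i: "i : {..<n}"
  show "abs (p i (?g m k) w * L (b i) (?g m k) (?g m (Suc k)) w) <= B * (c * ?d)"
  unfolding abs_mult
  using pb[OF _ w, of i "?g m k"] L_bound(1)[OF w gle, of i m k, unfolded gd] B0 i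
  by (intro mult_mono) simp_all
  qed
  moreover have "abs (SUM i<n. SUM j<n. H i j (?g m k) w * V i j (?g m k) (?g m (Suc k)) w) <= (SUM i<n. SUM j<n. B * ((R + 2 * K * c) * ?d))"
  proof (intro order_trans[OF sum_abs] sum_mono)
  fix i j assume ij: "i : {..<n}" "j : {..<n}"
  show "abs (H i j (?g m k) w * V i j (?g m k) (?g m (Suc k)) w) <= B * ((R + 2 * K * c) * ?d)"
  unfolding abs_mult
  using Hb[OF _ w, of i j "?g m k"] V_bound[OF _ _ w gr0 gle, of i j m k, unfolded gd] B0 ij
  by (intro mult_mono) simp_all
  qed
  moreover have "0 <= (SUM i<n. SUM j<n. B * ((R + 2 * K * c) * ?d))"
  using B0 R0 K0 c0 d0 by (intro sum_nonneg mult_nonneg_nonneg add_nonneg_nonneg) auto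
  ultimately have "abs (Jk m k w) <= (SUM i<n. B * (c * ?d)) + (SUM i<n. SUM j<n. B * ((R + 2 * K * c) * ?d))"
  unfolding Jk_def by linarith
  moreover have "(SUM i<n. B * (c * d)) + (SUM i<n. SUM j<n. B * ((R + 2 * K * c) * d))
  = ?cc * d" for d
  by (simp add: algebra_simps)
  ultimately show ?thesis by (simp only:)
  qed
  then have "(SUM k<Suc m. abs (Jk m k w)) <= (SUM k<Suc m. ?cc * ?d)"
  by (intro sum_mono)
  also have "... = ?cc * (t - s)" by simp
  finally show ?thesis using sum_abs[of "%k. Jk m k w" "{..<Suc m}"] by linarith
 qed
 have YP: "Y : bmeas P" by (rule Bd_measurable[OF Y(2)])
 obtain cY where cY: "cY >= 0" "!!w. w : space P ==> abs (Y w) <= cY" using BdE[OF Y(2)] by metis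
 define BJ where "BJ = ?cc * (t - s)"
 have Jmeas: "J : bmeas P"
  by (rule borel_measurable_LIMSEQ_real[OF Jlim]) (use JkBd Bd_measurable Bd_sum in auto)
 have JBd: "J : Bd"
 proof (rule BdI[OF Jmeas])
  show "abs (J w) <= BJ" if "w : space P" for w
  unfolding BJ_def using Jb[OF that] by (intro LIMSEQ_le_const2[OF tendsto_rabs[OF Jlim[OF that]]]) auto
 qed
 have EJ: "(%m. \<integral>w. Y w * (SUM k<Suc m. Jk m k w) \<partial>P) ~~> (LINT w|P. Y w * J w)"
 proof (rule integral_dominated_convergence[where w = "%_. cY * BJ"])
  show "AE w in P. (%m. Y w * (SUM k<Suc m. Jk m k w)) ~~> Y w * J w"
  using Jlim by (auto intro!: AE_I2 tendsto_mult_left)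
  show "AE w in P. norm (Y w * (SUM k<Suc m. Jk m k w)) <= cY * BJ" for m
  using cY Jb[folded BJ_def] by (auto intro!: AE_I2 mult_mono simp: abs_mult)
  show "(%w. Y w * (SUM k<Suc m. Jk m k w)) : bmeas P" for m
  by (intro borel_measurable_times YP borel_measurable_sum Bd_measurable JkBd)
 qed (use YP Jmeas in auto)
 define A where "A = (LINT w|P. Y w * (f (xv t w) - f (xv s w))) - (LINT w|P. Y w * J w)"
 have "abs A <= e" if e: "e > 0" for e
 proof -
  \<comment> \<open>Chosen so that the linear term contributes at most e; the \<open>+ 1\<close>
    keeps the denominator positive.\<close>
  define \<epsilon> where "\<epsilon> = e / (cY * (C1 * (t - s)) + 1)"
  have pos: "cY * (C1 * (t - s)) + 1 > 0" using cY C10 st by (intro add_nonneg_pos mult_nonneg_nonneg) auto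
  have \<epsilon>: "\<epsilon> > 0" using e pos by (simp add: \<epsilon>_def)
  obtain C where C: "C >= 0" "!!x y. x : box n K ==> y : box n K ==>
  abs (f y - f x - (SUM i<n. pder i f x * (y i - x i))
  - 1/2 * (SUM i<n. SUM j<n. pder j (pder i f) x * (y i - x i) * (y j - x j)))
  <= \<epsilon> * (SUM i<n. (y i - x i)^2) + C * (SUM i<n. (y i - x i)^2)^2"
  by (rule taylor_box[OF f \<epsilon>, of K]) (rule that)
  have Rb: "abs (Rm m k w) <= \<epsilon> * D s t m k w + C * (D s t m k w)^2" if w: "w : space P" for m k w
  proof -
  have x: "xv u w i = X i u w" if "i < n" for i u using that by (simp add: xv_def)
  have eq: "Rm m k w = f (xv (?g m (Suc k)) w) - f (xv (?g m k) w) - (SUM i<n. pder i f (xv (?g m k) w) * (xv (?g m (Suc k)) w i - xv (?g m k) w i))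
  - 1/2 * (SUM i<n. SUM j<n. pder j (pder i f) (xv (?g m k) w) * (xv (?g m (Suc k)) w i - xv (?g m k) w i) * (xv (?g m (Suc k)) w j - xv (?g m k) w j))"
  unfolding Rm_def T_def p_def H_def \<Delta>_def by (simp add: x mult.assoc)
  have Dq: "D s t m k w = (SUM i<n. (xv (?g m (Suc k)) w i - xv (?g m k) w i)^2)"
  unfolding D_def by (simp add: x)
  show ?thesis unfolding eq Dq by (rule C(2)[OF xv_box[OF w] xv_box[OF w]])
  qed
  have bound: "abs (\<integral>w. Y w * (SUM k<Suc m. Rm m k w) \<partial>P) <= cY * (\<epsilon> * (C1 * (t - s)) + C * (LINT w|P. (SUM k<Suc m. (D s t m k w)^2)))" for m
  proof -
  have i1: "integrable P (%w. SUM k<Suc m. D s t m k w)" "integrable P (%w. SUM k<Suc m. (D s t m k w)^2)"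
  by (intro Bd_integrable Bd_intros D_Bd)+
  have "abs (\<integral>w. Y w * (SUM k<Suc m. Rm m k w) \<partial>P) <= (LINT w|P. cY * (\<epsilon> * (SUM k<Suc m. D s t m k w) + C * (SUM k<Suc m. (D s t m k w)^2)))"
  proof (rule abs_integral_le)
  show "integrable P (%w. Y w * (SUM k<Suc m. Rm m k w))"
  by (intro Bd_integrable Bd_mult Bd_sum Y RBd)
  show "integrable P (%w. cY * (\<epsilon> * (SUM k<Suc m. D s t m k w) + C * (SUM k<Suc m. (D s t m k w)^2)))"
  using i1 by simp
  fix w assume w: "w : space P"
  have "abs (SUM k<Suc m. Rm m k w) <= (SUM k<Suc m. \<epsilon> * D s t m k w + C * (D s t m k w)^2)"
  by (rule order_trans[OF sum_abs]) (intro sum_mono Rb w)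
  also have "... = \<epsilon> * (SUM k<Suc m. D s t m k w) + C * (SUM k<Suc m. (D s t m k w)^2)"
  by (simp only: sum.distrib sum_distrib_left)
  finally show "abs (Y w * (SUM k<Suc m. Rm m k w)) <= cY * (\<epsilon> * (SUM k<Suc m. D s t m k w) + C * (SUM k<Suc m. (D s t m k w)^2))"
  unfolding abs_mult using cY w by (intro mult_mono) auto
  qed
  also have "... = cY * (\<epsilon> * (LINT w|P. (SUM k<Suc m. D s t m k w)) + C * (LINT w|P. (SUM k<Suc m. (D s t m k w)^2)))"
  using i1 by simp
  also have "... <= cY * (\<epsilon> * (C1 * (t - s)) + C * (LINT w|P. (SUM k<Suc m. (D s t m k w)^2)))"
  using ES[of m] cY(1) \<epsilon> by (intro mult_left_mono add_right_mono) auto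
  finally show ?thesis .
  qed
  have lim1: "(%m. cY * (\<epsilon> * (C1 * (t - s)) + C * (LINT w|P. (SUM k<Suc m. (D s t m k w)^2)))) ~~> cY * (\<epsilon> * (C1 * (t - s)) + C * 0)"
  by (intro tendsto_intros sum_D2_limit)
  have "(%m. (LINT w|P. Y w * (f (xv t w) - f (xv s w))) - (LINT w|P. Y w * (SUM k<Suc m. Jk m k w))) ~~> A"
  unfolding A_def by (intro tendsto_intros EJ)
  then have lim2: "(%m. abs (\<integral>w. Y w * (SUM k<Suc m. Rm m k w) \<partial>P)) ~~> abs A"
  proof -
  have "(LINT w|P. Y w * (SUM k<Suc m. Rm m k w)) = (LINT w|P. Y w * (f (xv t w) - f (xv s w))) - (LINT w|P. Y w * (SUM k<Suc m. Jk m k w))" for m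
  using Em[of m] by linarith
  then show ?thesis using \<open>_ ~~> A\<close> by (simp only: tendsto_rabs)
  qed
  have "abs A <= cY * (\<epsilon> * (C1 * (t - s)) + C * 0)"
  by (rule LIMSEQ_le[OF lim2 lim1]) (use bound in auto)
  also have "... = \<epsilon> * (cY * (C1 * (t - s)))" by simp
  also have "... <= \<epsilon> * (cY * (C1 * (t - s)) + 1)" using \<epsilon> by (intro mult_left_mono) auto
  also have "... = e" using pos unfolding \<epsilon>_def by simp
  finally show ?thesis .
 qed
 then have "abs A <= 0 + e" if "e > 0" for e using that by simp
 then have "abs A <= 0" by (rule field_le_epsilon)
 then have "A = 0" by simp
 moreover have "integrable P (%w. Y w * (f (xv t w) - f (xv s w)))" "integrable P (%w. Y w * J w)"
  by (intro Bd_integrable Bd_mult Bd_diff fBd Y JBd t0 st)+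
 ultimately have "(LINT w|P. Y w * (f (xv t w) - f (xv s w)) - Y w * J w) = 0"
  by (simp add: A_def)
 then show ?thesis unfolding J_def p_def H_def by (simp only: right_diff_distrib)
qed

end

end

section \<open>Path functionals: adaptedness, polynomial growth in the mass and the martingale
  property \<open>MP\<close>\<close>

lemma path_eval_measurable:
 assumes "0 <= s" "s <= t"
 shows "(%w. w s) : pfilt t \<rightarrow>\<^sub>M borel"
proof (rule measurableI)
 fix A :: "fmeasure set" assume A: "A : sets borel"
 have sp: "space (pfilt t) = space path_space"
  by (simp add: path_filtration_def space_measure_of_conv)
 have "{w : space path_space. w s : A} : {{w : space path_space. w s : B} | s B. 0 <= s & s <= t & B : sets borel}"
  using assms A by blast
 then have "{w : space path_space. w s : A} : sets (pfilt t)"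
  unfolding path_filtration_def by (subst sets_measure_of) (auto intro: sigma_sets.Basic)
 moreover have "(%w. w s) -` A \<inter> space (pfilt t) = {w : space path_space. w s : A}"
  unfolding sp by auto
 ultimately show "(%w. w s) -` A \<inter> space (pfilt t) : sets (pfilt t)" by simp
qed simp

locale path_setting = kernel h for h +
 fixes \<sigma> :: "real => real" and \<mu> :: fmeasure and Q :: "(real => fmeasure) measure"
 assumes \<sigma>_Cb: "\<sigma> : Cb UNIV" and \<sigma>_nonneg: "!!x. 0 <= \<sigma> x"
  and Q_prob: "prob_space Q" and Q_sets: "sets Q = sets path_space"
begin

lemma space_Q: "space Q = space path_space"
 using Q_sets by (rule sets_eq_imp_space_eq)

sublocale filtered_prob_space Q pfilt
proof (intro filtered_prob_space.intro filtered_prob_space_axioms.intro Q_prob)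
 show "subalgebra Q (pfilt t)" for t
  using subalgebra_path_filtration[of t] Q_sets space_Q by (simp add: subalgebra_def)
 show "sets (pfilt s) \<subseteq> sets (pfilt t)" if "s <= t" for s t
  using filtration.sets_F_mono[OF filtration_path_filtration that] .
qed

lemma filtration_Q: "filtration (space Q) pfilt"
 using filtration_path_filtration by (simp add: space_Q)

lemma path_continuous: "w : space Q ==> continuous_on {0..} w"
 by (simp add: space_Q space_path_space)

lemma pairing_path_continuous:
 assumes "w : space Q" "f : Cb UNIV"
 shows "continuous_on {0..} (%t. pairing f (w t))"
 by (rule continuous_on_compose2[OF continuous_pairing[OF assms(2)] path_continuous[OF assms(1)]]) auto

lemma eval_pair_sigma:
 assumes "0 <= s" "s <= t"
 shows "(%w. w s) : pfilt t \<rightarrow>\<^sub>M pair_sigma"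
 by (rule measurable_borel_pair_sigma[OF path_eval_measurable[OF assms]])

lemma functional_adapted:
 fixes g :: "fmeasure => real"
 assumes "g : bmeas pair_sigma" "0 <= s" "s <= t"
 shows "(%w. g (w s)) : bmeas (pfilt t)"
 by (rule measurable_compose[OF eval_pair_sigma[OF assms(2,3)] assms(1)])

text \<open>Progressive measurability. Clipping the time at t keeps the map measurable for
  \<open>pfilt t\<close>, which makes time integrals up to t adapted; clipping at 0 is needed
  because paths are \<open>undefined\<close> at negative times.\<close>

lemma joint_measurable_upto:
 fixes g :: "fmeasure => real"
 assumes g: "g : bmeas pair_sigma" and t: "0 <= t"
 shows "(%(w, u). g (w (max 0 (min u t)))) : bmeas (pfilt t \<Otimes>\<^sub>M borel)"
proof -
 have "(%z. (fst z) (max 0 (min (snd z) t))) : pfilt t \<Otimes>\<^sub>M borel \<rightarrow>\<^sub>M pair_sigma"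
 proof (rule measurable_pair_sigmaI)
  fix f :: "real => real" assume f: "f : Cb UNIV"
  have "(%(w, u). pairing f (w (max 0 (min u t)))) : bmeas (pfilt t \<Otimes>\<^sub>M borel)"
  proof (rule caratheodory_measurable)
  show "(%w. pairing f (w (max 0 (min u t)))) : bmeas (pfilt t)" for u
  using t by (intro functional_adapted measurable_pairing f) auto
  fix w assume "w : space (pfilt t)"
  then have "w : space Q" by (simp add: space_F)
  then show "continuous_on UNIV (%u. pairing f (w (max 0 (min u t))))"
  by (intro continuous_on_compose2[OF pairing_path_continuous[OF _ f]] continuous_intros) auto
  qed
  then show "(%z. pairing f ((fst z) (max 0 (min (snd z) t)))) : bmeas (pfilt t \<Otimes>\<^sub>M borel)"
  by (simp add: case_prod_beta')
 qed
 from measurable_compose[OF this g] show ?thesis by (simp add: case_prod_beta')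
qed

lemma joint_measurable:
 fixes g :: "fmeasure => real"
 assumes g: "g : bmeas pair_sigma"
 shows "(%(w, u). g (w (max 0 u))) : bmeas (Q \<Otimes>\<^sub>M borel)"
proof -
 have "(%z. (fst z) (max 0 (snd z))) : Q \<Otimes>\<^sub>M borel \<rightarrow>\<^sub>M pair_sigma"
 proof (rule measurable_pair_sigmaI)
  fix f :: "real => real" assume f: "f : Cb UNIV"
  have "(%(w, u). pairing f (w (max 0 u))) : bmeas (Q \<Otimes>\<^sub>M borel)"
  proof (rule caratheodory_measurable)
  show "(%w. pairing f (w (max 0 u))) : bmeas Q" for u
  by (rule F_P[OF functional_adapted[OF measurable_pairing[OF f], of _ "max 0 u"]]) auto
  fix w assume "w : space Q"
  then show "continuous_on UNIV (%u. pairing f (w (max 0 u)))"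
  by (intro continuous_on_compose2[OF pairing_path_continuous[OF _ f]] continuous_intros) auto
  qed
  then show "(%z. pairing f ((fst z) (max 0 (snd z)))) : bmeas (Q \<Otimes>\<^sub>M borel)"
  by (simp add: case_prod_beta')
 qed
 from measurable_compose[OF this g] show ?thesis by (simp add: case_prod_beta')
qed

lemma path_measurable:
 fixes g :: "fmeasure => real"
 assumes "g : bmeas pair_sigma" "w : space Q"
 shows "(%u. g (w (max 0 u))) : bmeas borel"
 using measurable_Pair2[OF joint_measurable[OF assms(1)] assms(2)] by simp

lemma drift_clip:
 fixes g :: "fmeasure => real" and s t :: real
 assumes "0 <= s"
 shows "(LBINT u:{s..t}. g (w u)) = (LBINT u:{s..t}. g (w (max 0 u)))"
 unfolding set_lebesgue_integral_def
proof (intro bi_cong refl)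
 fix u
 have "max 0 u = u" if "u : {s..t}" using that assms by simp
 then show "ind {s..t} u *\<^sub>R g (w u) = ind {s..t} u *\<^sub>R g (w (max 0 u))"
  by (simp add: indicator_def)
qed

lemma drift_adapted:
 fixes g :: "fmeasure => real"
 assumes g: "g : bmeas pair_sigma" and st: "0 <= s" "s <= t"
 shows "(%w. LBINT u:{s..t}. g (w u)) : bmeas (pfilt t)"
proof -
 have t: "0 <= t" using st by simp
 have eq: "sets (pfilt t \<Otimes>\<^sub>M lborel) = sets (pfilt t \<Otimes>\<^sub>M (borel :: real measure))"
  by (intro sets_pair_measure_cong) auto
 have "(%z. ind {s..t} (snd z) *\<^sub>R g ((fst z) (max 0 (min (snd z) t)))) : bmeas (pfilt t \<Otimes>\<^sub>M borel)"
  by (intro borel_measurable_scaleR measurable_compose[OF measurable_snd borel_measurable_indicator])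
  (use joint_measurable_upto[OF g t] in \<open>auto simp: case_prod_beta'\<close>)
 then have "(%(w, u). ind {s..t} u *\<^sub>R g (w (max 0 (min u t)))) : bmeas (pfilt t \<Otimes>\<^sub>M lborel)"
  unfolding measurable_cong_sets[OF eq refl] by (simp add: case_prod_beta')
 then have "(%w. LBINT u. ind {s..t} u *\<^sub>R g (w (max 0 (min u t)))) : bmeas (pfilt t)"
  by (rule lborel.borel_measurable_lebesgue_integral[where f = "%w u. ind {s..t} u *\<^sub>R g (w (max 0 (min u t)))"])
 moreover have "(LBINT u:{s..t}. g (w u)) = (LBINT u. ind {s..t} u *\<^sub>R g (w (max 0 (min u t))))" for w
  unfolding set_lebesgue_integral_def
 proof (intro bi_cong refl)
  fix u
  have "max 0 (min u t) = u" if "u : {s..t}" using that st by simp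
  then show "ind {s..t} u *\<^sub>R g (w u) = ind {s..t} u *\<^sub>R g (w (max 0 (min u t)))"
  by (simp add: indicator_def)
 qed
 ultimately show ?thesis by simp
qed

text \<open>Powers of this running supremum dominate the functionals and time integrals below on a
  whole time interval, which is why moments are stated for it.\<close>

definition D :: "real => (real => fmeasure) => real" where
 "D T w = (SUP t\<in>{0..T}. mass (w t))"

lemma mass_path_continuous: "w : space Q ==> continuous_on {0..} (%t. mass (w t))"
 unfolding mass_def by (rule pairing_path_continuous[OF _ Cb_const])

lemma mass_le_D:
 assumes "w : space Q" "0 <= u" "u <= T"
 shows "mass (w u) <= D T w"
proof -
 have "bdd_above ((%t. mass (w t)) ` {0..T})"
  by (intro bounded_imp_bdd_above compact_imp_bounded compact_continuous_image
  continuous_on_subset[OF mass_path_continuous[OF assms(1)]]) auto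
 then show ?thesis unfolding D_def using assms by (intro cSUP_upper) auto
qed

lemma D_nonneg: "w : space Q ==> 0 <= T ==> 0 <= D T w"
 using mass_le_D[of w 0 T] mass_nonneg[of "w 0"] by simp

lemma D_mono: "w : space Q ==> 0 <= s ==> s <= t ==> D s w <= D t w"
 unfolding D_def by (rule cSUP_least) (use mass_le_D[of w _ t, unfolded D_def] in auto)

text \<open>The constant is explicit because limits need one constant for a whole sequence. The
  summand 1 admits bounded functionals and makes growth of different orders comparable.\<close>

definition tame :: "nat => real => (fmeasure => real) => bool" where
 "tame p c g \<longleftrightarrow> g : bmeas pair_sigma & 0 <= c & (ALL nu. abs (g nu) <= c * (1 + mass nu ^ p))"

lemma tameI: "g : bmeas pair_sigma ==> 0 <= c ==> (!!nu. abs (g nu) <= c * (1 + mass nu ^ p)) ==> tame p c g"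
 by (simp add: tame_def)

lemma tameD:
 assumes "tame p c g"
 shows "g : bmeas pair_sigma" "0 <= c" "abs (g nu) <= c * (1 + mass nu ^ p)"
 using assms by (auto simp: tame_def)

lemma tame_add: "tame p c f ==> tame p d g ==> tame p (c + d) (%nu. f nu + g nu)"
proof (rule tameI)
 assume fg: "tame p c f" "tame p d g"
 show "(%nu. f nu + g nu) : bmeas pair_sigma" "0 <= c + d"
  using tameD(1,2)[OF fg(1)] tameD(1,2)[OF fg(2)] by auto
 show "abs (f nu + g nu) <= (c + d) * (1 + mass nu ^ p)" for nu
  unfolding distrib_right[of c d]
  by (rule order_trans[OF abs_triangle_ineq add_mono[OF fg[THEN tameD(3)]]])
qed

lemma tame_cmult: "tame p c f ==> tame p (abs k * c) (%nu. k * f nu)"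
proof (rule tameI)
 assume f: "tame p c f"
 show "(%nu. k * f nu) : bmeas pair_sigma" "0 <= abs k * c"
  using tameD[OF f] by (auto intro!: mult_nonneg_nonneg)
 show "abs (k * f nu) <= abs k * c * (1 + mass nu ^ p)" for nu
  unfolding abs_mult mult.assoc by (rule mult_left_mono[OF tameD(3)[OF f] abs_ge_zero])
qed

lemma tame_mono:
 assumes "tame p c f" "p <= q" shows "tame q (2 * c) f"
proof (rule tameI)
 fix nu
 have "mass nu ^ p <= 1 + mass nu ^ q"
 proof (cases "mass nu <= 1")
  case True then show ?thesis using power_le_one[OF mass_nonneg True, of p] zero_le_power[OF mass_nonneg, of nu q] by linarith
 next
  case False then show ?thesis using power_increasing[OF assms(2), of "mass nu"] by linarith
 qed
 then have "1 + mass nu ^ p <= 1 + (1 + mass nu ^ q)" by (rule add_left_mono)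
 also have "... <= 2 * (1 + mass nu ^ q)" using zero_le_power[OF mass_nonneg, of nu q] by simp
 finally have "1 + mass nu ^ p <= 2 * (1 + mass nu ^ q)" .
 then have "c * (1 + mass nu ^ p) <= c * (2 * (1 + mass nu ^ q))" by (rule mult_left_mono[OF _ tameD(2)[OF assms(1)]])
 also have "... = 2 * c * (1 + mass nu ^ q)" by (simp only: mult_ac)
 finally show "abs (f nu) <= 2 * c * (1 + mass nu ^ q)" using tameD(3)[OF assms(1), of nu] by (rule order_trans[rotated])
qed (use tameD[OF assms(1)] in auto)

lemma tame_mult:
 assumes f: "tame p c f" and g: "tame q d g"
 shows "tame (p + q) (3 * (c * d)) (%nu. f nu * g nu)"
proof (rule tameI)
 fix nu
 let ?m = "mass nu"
 have m: "0 <= ?m ^ k" for k using mass_nonneg by simp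
 have le: "?m ^ k <= 1 + ?m ^ (p + q)" if "k <= p + q" for k
 proof (cases "?m <= 1")
  case True then show ?thesis using power_le_one[OF mass_nonneg True, of k] m[of "p + q"] by linarith
 next
  case False then show ?thesis using power_increasing[OF that, of ?m] by linarith
 qed
 have "abs (f nu * g nu) <= (c * (1 + ?m ^ p)) * (d * (1 + ?m ^ q))"
  unfolding abs_mult using tameD[OF f] tameD[OF g] m by (intro mult_mono mult_nonneg_nonneg add_nonneg_nonneg) auto
 also have "... = (c * d) * (1 + ?m ^ p + ?m ^ q + ?m ^ (p + q))"
  by (simp add: algebra_simps power_add)
 \<comment> \<open>Each of the two middle powers is at most 1 plus the top power, whence 3.\<close>
 also have "... <= (c * d) * (3 * (1 + ?m ^ (p + q)))"
  using le[of p] le[of q] tameD(2)[OF f] tameD(2)[OF g] by (intro mult_left_mono) auto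
 finally show "abs (f nu * g nu) <= 3 * (c * d) * (1 + ?m ^ (p + q))" by (simp add: mult_ac)
qed (use tameD[OF f] tameD[OF g] in auto)

lemma tame_diff: "tame p c f ==> tame p d g ==> tame p (c + d) (%nu. f nu - g nu)"
 using tame_add[of p c f d "%nu. (-1) * g nu"] tame_cmult[of p d g "-1"] by simp

lemma tame_path_bound:
 assumes g: "tame p c g" and w: "w : space Q" and u: "0 <= u" "u <= T"
 shows "abs (g (w u)) <= c * (1 + D T w ^ p)"
proof -
 have "c * (1 + mass (w u) ^ p) <= c * (1 + D T w ^ p)"
  using mass_le_D[OF w u] mass_nonneg tameD(2)[OF g] by (intro mult_left_mono add_left_mono power_mono) auto
 then show ?thesis using tameD(3)[OF g, of "w u"] by linarith
qed

lemma tame_drift_integrable: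
 assumes g: "tame p c g" and w: "w : space Q" and st: "0 <= s"
 shows "set_integrable lborel {s..t} (%u. g (w u))"
proof -
 let ?B = "c * (1 + D t w ^ p)"
 let ?g = "%u. if u : {s..t} then g (w (max 0 u)) else 0"
 have "set_integrable lborel {s..t} ?g"
 proof (rule set_integrable_bounded_Icc)
  show "?g : bmeas borel"
  using path_measurable[OF tameD(1)[OF g] w] by measurable
  show "abs (?g u) <= abs ?B" for u
  proof (cases "u : {s..t}")
  case True
  then have "max 0 u = u" "0 <= u" "u <= t" using st by auto
  then show ?thesis using tame_path_bound[OF g w, of u t] True by simp
  qed (simp only: if_False abs_zero abs_ge_zero)
 qed
 moreover have "ind {s..t} u *\<^sub>R ?g u = ind {s..t} u *\<^sub>R g (w u)" for u
 proof -
  have "max 0 u = u" if "u : {s..t}" using that st by simp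
  then show ?thesis by (simp add: indicator_def)
 qed
 ultimately show ?thesis unfolding set_integrable_def by (simp only:)
qed

lemma tame_drift_bound:
 assumes g: "tame p c g" and w: "w : space Q" and st: "0 <= s" "s <= t"
 shows "abs (LBINT u:{s..t}. g (w u)) <= c * (1 + D t w ^ p) * (t - s)"
 unfolding drift_clip[OF st(1)]
proof (rule set_integral_bounded_Icc[OF path_measurable[OF tameD(1)[OF g] w] _ st(2)])
 show "abs (g (w (max 0 u))) <= c * (1 + D t w ^ p)" if "u : {s..t}" for u
  using tame_path_bound[OF g w, of u t] st that by (auto simp: max_def)
qed

lemma tame_drift_split:
 assumes g: "tame p c g" and w: "w : space Q" and st: "0 <= s" "s <= t"
 shows "(LBINT u:{0..t}. g (w u)) = (LBINT u:{0..s}. g (w u)) + (LBINT u:{s..t}. g (w u))"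
 by (rule set_integral_split_Icc[OF tame_drift_integrable[OF g w] st]) simp

lemma tame_drift_continuous:
 assumes g: "tame p c g" and w: "w : space Q"
 shows "continuous_on {0..} (%t. LBINT u:{0..t}. g (w u))"
proof -
 have "\<exists>delta>0. \<forall>y\<in>{0..}. dist y x < delta --> dist (LBINT u:{0..y}. g (w u)) (LBINT u:{0..x}. g (w u)) < e"
  if x: "0 <= x" and e: "0 < e" for x e :: real
 proof -
  define B where "B = c * (1 + D (x + 1) w ^ p)"
  have B0: "0 <= B" using tameD(2)[OF g] D_nonneg[OF w, of "x + 1"] x by (simp add: B_def)
  have main: "abs ((LBINT u:{0..b}. g (w u)) - (LBINT u:{0..a}. g (w u))) <= B * (b - a)"
  if "0 <= a" "a <= b" "b <= x + 1" for a b
  proof -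
  have "c * (1 + D b w ^ p) <= B" unfolding B_def
  using that tameD(2)[OF g] D_mono[OF w, of b "x + 1"] D_nonneg[OF w, of b]
  by (intro mult_left_mono add_left_mono power_mono) auto
  then have "c * (1 + D b w ^ p) * (b - a) <= B * (b - a)" using that by (intro mult_right_mono) auto
  then show ?thesis using tame_drift_bound[OF g w that(1,2)] tame_drift_split[OF g w that(1,2)] by simp
  qed
  define delta where "delta = min 1 (e / (B + 1))"
  have d: "delta > 0" using e B0 by (simp add: delta_def)
  have dB: "B * r < e" if "0 <= r" "r < delta" for r
  proof -
  have "B * r <= (B + 1) * r" using that by (intro mult_right_mono) auto
  also have "... < (B + 1) * (e / (B + 1))" using that B0 by (intro mult_strict_left_mono) (auto simp: delta_def)
  also have "... = e" using B0 by simp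
  finally show ?thesis .
  qed
  show ?thesis
  proof (intro exI[of _ delta] conjI d ballI impI)
  fix y assume y: "y : {0..}" "dist y x < delta"
  then have y': "abs (y - x) < delta" "y <= x + 1" by (auto simp: dist_real_def delta_def)
  show "dist (LBINT u:{0..y}. g (w u)) (LBINT u:{0..x}. g (w u)) < e"
  proof (cases "x <= y")
  case True
  then show ?thesis using main[of x y] dB[of "y - x"] y' x by (auto simp: dist_real_def)
  next
  case False
  then show ?thesis using main[of y x] dB[of "x - y"] y' y by (auto simp: dist_real_def)
  qed
  qed
 qed
 then show ?thesis unfolding continuous_on_iff by auto
qed

text \<open>The martingale problem for a single pair of functionals, with g in place of the
  generator applied to f. The initial value is kept; \<open>martingale_problem_MP\<close> and
  \<open>MP_continuous_martingale\<close> pass between the two forms.\<close>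

definition MP :: "(fmeasure => real) => (fmeasure => real) => bool" where
 "MP f g \<longleftrightarrow> mgle (%t w. f (w t) - (LBINT u:{0..t}. g (w u)))"

text \<open>Measurability of \<open>D T\<close> is part of the notion, since it is a supremum over
  uncountably many times.\<close>

definition moment :: "nat => bool" where
 "moment p \<longleftrightarrow> (\<forall>T\<ge>0. D T : bmeas Q & integrable Q (%w. D T w ^ p))"

lemma momentD:
 assumes "moment p" "0 <= T"
 shows "integrable Q (%w. c * (1 + D T w ^ p))"
 using assms by (auto simp: moment_def)

lemma tame_increment_bound:
 assumes f: "tame p c f" and g: "tame p d g" and w: "w : space Q" and st: "0 <= s" "s <= t"
 shows "abs (f (w t) - f (w s) - (LBINT u:{s..t}. g (w u))) <= (2 * c + d * (t - s)) * (1 + D t w ^ p)"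
 using tame_path_bound[OF f w, of t t] tame_path_bound[OF f w, of s t] tame_drift_bound[OF g w st] st
 by (simp add: algebra_simps)

lemma tame_path_integrable:
 assumes f: "tame p c f" and m: "moment p" and t: "0 <= t"
 shows "integrable Q (%w. f (w t))"
proof (rule bib_bound[OF momentD[OF m t, of c]])
 show "(%w. f (w t)) : bmeas Q"
  by (rule F_P[OF functional_adapted[OF tameD(1)[OF f] t order_refl]])
 show "AE w in Q. norm (f (w t)) <= norm (c * (1 + D t w ^ p))"
  using tame_path_bound[OF f _ t order_refl] by (auto intro!: AE_I2 intro: order_trans[OF _ abs_ge_self])
qed

lemma tame_drift_path_integrable:
 assumes g: "tame p d g" and m: "moment p" and st: "0 <= s" "s <= t"
 shows "integrable Q (%w. LBINT u:{s..t}. g (w u))"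
proof (rule bib_bound[OF integrable_mult_left[OF momentD[OF m, of t d], of "t - s"]])
 show "(%w. LBINT u:{s..t}. g (w u)) : bmeas Q"
  by (rule F_P[OF drift_adapted[OF tameD(1)[OF g] st]])
 show "AE w in Q. norm (LBINT u:{s..t}. g (w u)) <= norm (d * (1 + D t w ^ p) * (t - s))"
  using tame_drift_bound[OF g _ st] by (auto intro!: AE_I2 intro: order_trans[OF _ abs_ge_self])
qed (use st in auto)

lemma MP_iff:
 assumes f: "tame p c f" and g: "tame p d g" and m: "moment p"
 shows "MP f g \<longleftrightarrow> (ALL s t A. 0 <= s --> s <= t --> A : sets (pfilt s) -->
  (LINT w|Q. indicator A w * (f (w t) - f (w s) - (LBINT u:{s..t}. g (w u)))) = 0)"
proof -
 let ?X = "%t w. f (w t) - (LBINT u:{0..t}. g (w u))"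
 have eq: "?X t w - ?X s w = f (w t) - f (w s) - (LBINT u:{s..t}. g (w u))"
  if "w : space Q" "0 <= s" "s <= t" for s t w
  using tame_drift_split[OF g that] by simp
 have int: "(LINT w|Q. indicator A w * (?X t w - ?X s w)) = (LINT w|Q. indicator A w * (f (w t) - f (w s) - (LBINT u:{s..t}. g (w u))))"
  if "0 <= s" "s <= t" for s t A
  using eq[OF _ that] by (intro bi_cong refl) simp
 show ?thesis
 proof
  assume MP: "MP f g"
  show "ALL s t A. 0 <= s --> s <= t --> A : sets (pfilt s) -->
  (LINT w|Q. indicator A w * (f (w t) - f (w s) - (LBINT u:{s..t}. g (w u)))) = 0"
  proof (intro allI impI)
  fix s t A assume st: "0 <= s" "s <= t" "A : sets (pfilt s)"
  show "(LINT w|Q. indicator A w * (f (w t) - f (w s) - (LBINT u:{s..t}. g (w u)))) = 0"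
  unfolding int[OF st(1,2), symmetric] by (rule mgle_indicator[OF MP[unfolded MP_def] st])
  qed
 next
  assume *: "ALL s t A. 0 <= s --> s <= t --> A : sets (pfilt s) -->
  (LINT w|Q. indicator A w * (f (w t) - f (w s) - (LBINT u:{s..t}. g (w u)))) = 0"
  show "MP f g"
  unfolding MP_def
  proof (rule mgleI)
  show "?X t : bmeas (pfilt t)" if "0 <= t" for t
  using functional_adapted[OF tameD(1)[OF f] that order_refl] drift_adapted[OF tameD(1)[OF g] order_refl that]
  by (rule borel_measurable_diff)
  show "integrable Q (?X t)" if "0 <= t" for t
  using tame_path_integrable[OF f m that] tame_drift_path_integrable[OF g m order_refl that]
  by (rule bib_diff)
  fix s t A assume st: "0 <= s" "s <= t" "A : sets (pfilt s)"
  show "(LINT w|Q. indicator A w * (?X t w - ?X s w)) = 0"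
  unfolding int[OF st(1,2)] using * st by blast
  qed
 qed
qed

lemma MP_add:
 assumes "MP f g" "MP f' g'" "tame p c g" "tame p c' g'"
 shows "MP (%nu. f nu + f' nu) (%nu. g nu + g' nu)"
proof -
 have "mgle (%t w. (f (w t) - (LBINT u:{0..t}. g (w u))) + (f' (w t) - (LBINT u:{0..t}. g' (w u))))"
  using assms unfolding MP_def by (intro mgle_add)
 then show ?thesis
  unfolding MP_def
  by (rule mgle_cong[THEN iffD1, rotated])
  (simp add: tame_drift_integrable[OF assms(3)] tame_drift_integrable[OF assms(4)])
qed

lemma MP_cmult:
 assumes "MP f g"
 shows "MP (%nu. k * f nu) (%nu. k * g nu)"
 using mgle_cmult[of "%t w. f (w t) - (LBINT u:{0..t}. g (w u))" k] assms
 unfolding MP_def by (simp add: right_diff_distrib)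

text \<open>Pointwise limits suffice, given common growth constants: dominated convergence is used
  once in time on each path and once over the paths, with a multiple of \<open>1 + D t w ^ p\<close>
  as the dominating variable.\<close>

lemma MP_limit:
 assumes f: "!!k. tame p c (f k)" and g: "!!k. tame p d (g k)" and m: "moment p"
  and MP: "!!k. MP (f k) (g k)"
  and fl: "!!nu. (%k. f k nu) ~~> F nu" and gl: "!!nu. (%k. g k nu) ~~> G nu"
 shows "tame p c F" "tame p d G" "MP F G"
proof -
 show F: "tame p c F"
 proof (rule tameI)
  show "F : bmeas pair_sigma"
  by (rule borel_measurable_LIMSEQ_real[OF fl]) (rule tameD(1)[OF f])
  show "abs (F nu) <= c * (1 + mass nu ^ p)" for nu
  using tameD(3)[OF f] by (intro LIMSEQ_le_const2[OF tendsto_rabs[OF fl]]) auto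
 qed (rule tameD(2)[OF f])
 show G: "tame p d G"
 proof (rule tameI)
  show "G : bmeas pair_sigma"
  by (rule borel_measurable_LIMSEQ_real[OF gl]) (rule tameD(1)[OF g])
  show "abs (G nu) <= d * (1 + mass nu ^ p)" for nu
  using tameD(3)[OF g] by (intro LIMSEQ_le_const2[OF tendsto_rabs[OF gl]]) auto
 qed (rule tameD(2)[OF g])
 show "MP F G"
  unfolding MP_iff[OF F G m]
 proof (intro allI impI)
  fix s t A assume st: "0 <= s" "s <= t" and A: "A : sets (pfilt s)"
  have t: "0 <= t" using st by simp
  have AQ: "A : sets Q" using A sub[of s] by (auto simp: subalgebra_def)
  let ?I = "%f g w. f (w t) - f (w s) - (LBINT u:{s..t}. g (w u))"
  have meas: "(%w. indicator A w * ?I f g w) : bmeas Q" if "tame p c f" "tame p d g" for f g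
  using AQ F_P[OF functional_adapted[OF tameD(1)[OF that(1)] t order_refl]]
  F_P[OF functional_adapted[OF tameD(1)[OF that(1)] st(1) order_refl]]
  F_P[OF drift_adapted[OF tameD(1)[OF that(2)] st]]
  by (intro borel_measurable_times borel_measurable_diff borel_measurable_indicator)
  have dl: "(%k. LBINT u:{s..t}. g k (w u)) ~~> (LBINT u:{s..t}. G (w u))" if w: "w : space Q" for w
  proof -
  have e: "(LBINT u:{s..t}. q (w u)) = (LBINT u:{s..t}. q (w (max 0 u)))" for q :: "fmeasure => real"
  by (rule drift_clip[OF st(1)])
  have "(%k. LBINT u:{s..t}. g k (w (max 0 u))) ~~> (LBINT u:{s..t}. G (w (max 0 u)))"
  unfolding set_lebesgue_integral_def
  proof (rule integral_dominated_convergence[where w = "%u. indicator {s..t} u * (d * (1 + D t w ^ p))"])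
  show "integrable lborel (%u. ind {s..t} u * (d * (1 + D t w ^ p)))"
  by (intro integrable_mult_left integrable_real_indicator) (auto simp: emeasure_lborel_Icc_eq)
  show "AE u in lborel. (%k. ind {s..t} u *\<^sub>R g k (w (max 0 u))) ~~> ind {s..t} u *\<^sub>R G (w (max 0 u))"
  by (intro AE_I2 tendsto_scaleR tendsto_const gl)
  show "AE u in lborel. norm (ind {s..t} u *\<^sub>R g k (w (max 0 u))) <= indicator {s..t} u * (d * (1 + D t w ^ p))" for k
  using tame_path_bound[OF g w, of _ t k] st by (auto intro!: AE_I2 simp: indicator_def max_def)
  qed (use path_measurable[OF tameD(1)[OF g] w] path_measurable[OF tameD(1)[OF G] w] in \<open>auto\<close>)
  then show ?thesis using e[of "g _"] e[of G] by simp
  qed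
  have lim: "(%k. \<integral>w. indicator A w * ?I (f k) (g k) w \<partial>Q) ~~> (LINT w|Q. indicator A w * ?I F G w)"
  proof (rule integral_dominated_convergence[where w = "%w. (2 * c + d * (t - s)) * (1 + D t w ^ p)"])
  show "AE w in Q. (%k. indicator A w * ?I (f k) (g k) w) ~~> indicator A w * ?I F G w"
  by (intro AE_I2 tendsto_mult_left tendsto_diff fl dl)
  show "AE w in Q. norm (indicator A w * ?I (f k) (g k) w) <= (2 * c + d * (t - s)) * (1 + D t w ^ p)" for k
  proof (rule AE_I2)
  fix w assume w: "w : space Q"
  have "norm (indicator A w * ?I (f k) (g k) w) <= abs (?I (f k) (g k) w)" by (simp add: indicator_def)
  then show "norm (indicator A w * ?I (f k) (g k) w) <= (2 * c + d * (t - s)) * (1 + D t w ^ p)"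
  using tame_increment_bound[OF f[of k] g[of k] w st] by linarith
  qed
  qed (use meas f g F G momentD[OF m t] in auto)
  have zero: "(LINT w|Q. indicator A w * ?I (f k) (g k) w) = 0" for k
  using MP[of k] st A unfolding MP_iff[OF f g m] by blast
  show "(LINT w|Q. indicator A w * ?I F G w) = 0"
  by (rule LIMSEQ_unique[OF lim[unfolded zero] tendsto_const])
 qed
qed

end

section \<open>Martingale problems for the squares of pairings\<close>

lemma LBINT_self_primitive:
 fixes beta :: "real => real"
 assumes c: "continuous_on {0..} beta" and t: "0 <= t"
 shows "(LBINT u:{0..t}. (LBINT v:{0..u}. beta v) * beta u) = (LBINT v:{0..t}. beta v)^2 / 2"
proof -
 have si: "set_integrable lborel {0..u} beta" for u
  by (rule borel_integrable_compact[unfolded set_integrable_def[symmetric]])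
  (auto intro: continuous_on_subset[OF c])
 have eq: "(LBINT v:{0..u}. beta v) = integral {0..u} beta" for u
  by (rule set_borel_integral_eq_integral(2)[OF si])
 have ct: "continuous_on {0..t} beta" by (rule continuous_on_subset[OF c]) auto
 have d: "((%u. integral {0..u} beta) has_rd beta x) (at x within {0..t})" if "x : {0..t}" for x
  using integral_has_vector_derivative[OF ct that] by (simp add: has_real_derivative_iff_has_vector_derivative)
 have "(LBINT x. indicator {0..t} x *\<^sub>R (integral {0..x} beta * beta x)) = (integral {0..t} beta)^2 / 2 - (integral {0..0} beta)^2 / 2"
 proof (rule integral_FTC_atLeastAtMost[OF t])
  fix x assume "0 <= x" "x <= t"
  then have "((%u. (integral {0..u} beta)^2 / 2) has_rd integral {0..x} beta * beta x) (at x within {0..t})"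
  by (auto intro!: derivative_eq_intros d)
  then show "((%u. (integral {0..u} beta)^2 / 2) has_vector_derivative integral {0..x} beta * beta x) (at x within {0..t})"
  by (simp add: has_real_derivative_iff_has_vector_derivative)
 next
  show "continuous_on {0..t} (%x. integral {0..x} beta * beta x)"
  by (intro continuous_on_mult ct indefinite_integral_continuous_1 integrable_continuous_real)
 qed
 then show ?thesis by (simp only: eq) (simp add: set_lebesgue_integral_def)
qed

text \<open>The uniform bound C on the mean absolute value at each time makes the integrand
  integrable on the product with a bounded time interval.\<close>

lemma (in sigma_finite_measure) drift_fubini:
 fixes g :: "'a => real => real"
 assumes g: "(%(w, u). g w u) : bmeas (M \<Otimes>\<^sub>M borel)" and st: "s <= t"
  and b: "!!u. u : {s..t} ==> integrable M (%w. g w u) & (LINT w|M. abs (g w u)) <= C"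
 shows "integrable M (%w. LBINT u:{s..t}. g w u)"
  and "(LINT w|M. (LBINT u:{s..t}. g w u)) = (LBINT u:{s..t}. (LINT w|M. g w u))"
  and "(LINT w|M. (LBINT u:{s..t}. g w u)) <= C * (t - s)"
proof -
 interpret L: pair_sigma_finite lborel M ..
 let ?f = "%u w. ind {s..t} u * g w u"
 have eq: "sets (lborel \<Otimes>\<^sub>M M) = sets ((borel :: real measure) \<Otimes>\<^sub>M M)" by (intro sets_pair_measure_cong) auto
 have "(%z. g (snd z) (fst z)) : bmeas (borel \<Otimes>\<^sub>M M)"
  using measurable_compose[OF measurable_pair_swap' g] by (simp add: case_prod_beta')
 then have m: "(%(u, w). ?f u w) : bmeas (lborel \<Otimes>\<^sub>M M)"
  unfolding measurable_cong_sets[OF eq refl] case_prod_beta'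
  by (intro borel_measurable_times measurable_compose[OF measurable_fst borel_measurable_indicator]) auto
 have iC: "integrable lborel (%u. ind {s..t} u * c)" for c :: real
  by (intro integrable_mult_left integrable_real_indicator) (auto simp: emeasure_lborel_Icc_eq)
 have i: "integrable (lborel \<Otimes>\<^sub>M M) (%(u, w). ?f u w)"
 proof (rule L.Fubini_integrable[OF m])
  show "integrable lborel (%u. \<integral>w. norm (case (u, w) of (u, w) => ?f u w) \<partial>M)"
  proof (rule bib_bound[OF iC[of C]])
  show "(%u. \<integral>w. norm (case (u, w) of (u, w) => ?f u w) \<partial>M) : bmeas lborel"
  using m by (intro borel_measurable_lebesgue_integral) simp
  show "AE u in lborel. norm (LINT w|M. norm (case (u, w) of (u, w) => ?f u w)) <= norm (ind {s..t} u * C)"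
  using b by (intro AE_I2) (auto simp: indicator_def abs_mult intro: order_trans[OF _ abs_ge_self])
  qed
  show "AE u in lborel. integrable M (%w. case (u, w) of (u, w) => ?f u w)"
  using b by (intro AE_I2) (auto simp: indicator_def)
 qed
 have e: "(LBINT u:{s..t}. g w u) = (LBINT u. ?f u w)" "(LBINT u:{s..t}. (LINT w|M. g w u)) = (LBINT u. \<integral>w. ?f u w \<partial>M)" for w
  by (simp_all add: set_lebesgue_integral_def)
 show "integrable M (%w. LBINT u:{s..t}. g w u)" unfolding e using L.integrable_snd[OF i] .
 show 2: "(LINT w|M. (LBINT u:{s..t}. g w u)) = (LBINT u:{s..t}. (LINT w|M. g w u))"
  unfolding e by (rule L.Fubini_integral[OF i])
 have "(LBINT u. \<integral>w. ?f u w \<partial>M) <= (LBINT u. ind {s..t} u * C)"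
 proof (rule integral_mono[OF L.integrable_fst[OF i] iC])
  fix u
  show "(LINT w|M. ?f u w) <= ind {s..t} u * C"
  using b[of u] order_trans[OF abs_ge_self integral_abs_bound[of M "%w. g w u"]] by (auto simp: indicator_def)
 qed
 then show "(LINT w|M. (LBINT u:{s..t}. g w u)) <= C * (t - s)" unfolding 2 unfolding e(2) using st by (simp add: mult.commute)
qed

context path_setting
begin

text \<open>\<open>tame\<close> with the constant hidden, for closure arguments that never compare
  constants.\<close>

definition tm :: "nat => (fmeasure => real) => bool" where
 "tm p g \<longleftrightarrow> (EX c. tame p c g)"

lemma tmI: "tame p c g ==> tm p g" unfolding tm_def by (rule exI)

lemma tm_add: "tm p f ==> tm p g ==> tm p (%nu. f nu + g nu)"
 unfolding tm_def by (elim exE) (rule exI, rule tame_add)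

lemma tm_cmult: "tm p f ==> tm p (%nu. k * f nu)"
 unfolding tm_def by (elim exE) (rule exI, rule tame_cmult)

lemma tm_mult: "tm p f ==> tm q g ==> tm (p + q) (%nu. f nu * g nu)"
 unfolding tm_def by (elim exE) (rule exI, rule tame_mult)

lemma tm_mono: "tm p f ==> p <= q ==> tm q f"
 unfolding tm_def by (elim exE) (rule exI, rule tame_mono)

lemma tm_measurable: "tm p f ==> f : bmeas pair_sigma"
 by (auto simp: tm_def tame_def)

lemma tm_const: "tm p (%_. k)"
 unfolding tm_def
proof (rule exI, rule tameI)
 show "abs k <= abs k * (1 + mass nu ^ p)" for nu
  using mult_left_mono[of 1 "1 + mass nu ^ p" "abs k"] zero_le_power[OF mass_nonneg, of nu p] by simp
qed auto

lemma tm_sum: "(!!i. i : I ==> tm p (f i)) ==> tm p (%nu. \<Sum>i\<in>I. f i nu)"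
 by (induction I rule: infinite_finite_induct) (auto intro: tm_const tm_add)

lemma tm_pairing: "f : Cb UNIV ==> tm 1 (pairing f)"
proof -
 assume f: "f : Cb UNIV"
 obtain K where K: "0 <= K" "!!x. abs (f x) <= K" using CbE[OF f] by metis
 have "tame 1 K (pairing f)"
 proof (rule tameI)
  fix nu
  have "abs (pairing f nu) <= K * mass nu" by (rule pairing_bound[OF Cb_measurable[OF f] K(2)])
  also have "... <= K * (1 + mass nu ^ 1)" using K by (intro mult_left_mono) auto
  finally show "abs (pairing f nu) <= K * (1 + mass nu ^ 1)" .
 qed (use K f in auto)
 then show ?thesis by (auto simp: tm_def)
qed

lemma tm_covar:
 assumes "u : Cb UNIV" "v : Cb UNIV"
 shows "tm 2 (covar u v)"
proof -
 obtain Ku where Ku: "0 <= Ku" "!!x. abs (u x) <= Ku" using CbE[OF assms(1)] by metis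
 obtain Kv where Kv: "0 <= Kv" "!!x. abs (v x) <= Kv" using CbE[OF assms(2)] by metis
 let ?c = "2 * H2 * (Ku * Kv)"
 have c0: "0 <= ?c" using Ku Kv H2_nonneg by simp
 have "tame 2 ?c (covar u v)"
 proof (rule tameI)
  fix nu
  have "abs (covar u v nu) <= ?c * (mass nu)^2"
  by (rule covar_bound[OF Cb_measurable[OF assms(1)] Ku(2) Cb_measurable[OF assms(2)] Kv(2)])
  also have "... <= ?c * (1 + mass nu ^ 2)" using c0 by (intro mult_left_mono) auto
  finally show "abs (covar u v nu) <= ?c * (1 + mass nu ^ 2)" .
 qed (use c0 covar_measurable[OF assms] in auto)
 then show ?thesis by (auto simp: tm_def)
qed

definition drift :: "(real => real) => fmeasure => real" where
 "drift phi nu = 1/2 * rho h 0 * pairing (deriv (deriv phi)) nu"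

definition \<Gamma> :: "(real => real) => (real => real) => fmeasure => real" where
 "\<Gamma> phi psi nu = pairing (%x. \<sigma> x * (phi x * psi x)) nu + covar (deriv phi) (deriv psi) nu"

lemma tm_drift: "phi : C2_real ==> tm 1 (drift phi)"
 unfolding drift_def[abs_def] by (intro tm_cmult tm_pairing C2_realD)

lemma tm_\<Gamma>: "phi : C2_real ==> psi : C2_real ==> tm 2 (\<Gamma> phi psi)"
 unfolding \<Gamma>_def[abs_def]
 by (intro tm_add tm_mono[OF tm_pairing] tm_covar C2_realD Cb_mult \<sigma>_Cb) auto

lemma tm_path_adapted: "tm p f ==> 0 <= s ==> s <= t ==> (%w. f (w s)) : bmeas (pfilt t)"
 by (rule functional_adapted[OF tm_measurable])

lemma tm_drift_adapted: "tm p g ==> 0 <= s ==> s <= t ==> (%w. LBINT u:{s..t}. g (w u)) : bmeas (pfilt t)"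
 by (rule drift_adapted[OF tm_measurable])

lemma tm_set_integrable: "tm p g ==> w : space Q ==> 0 <= s ==> set_integrable lborel {s..t} (%u. g (w u))"
 unfolding tm_def by (elim exE) (rule tame_drift_integrable)

lemma tm_split: "tm p g ==> w : space Q ==> 0 <= s ==> s <= t ==>
  (LBINT u:{0..t}. g (w u)) = (LBINT u:{0..s}. g (w u)) + (LBINT u:{s..t}. g (w u))"
 unfolding tm_def by (elim exE) (rule tame_drift_split)

lemma MP_add': "MP f g ==> MP f' g' ==> tm p g ==> tm q g' ==> MP (%nu. f nu + f' nu) (%nu. g nu + g' nu)"
proof -
 assume MP: "MP f g" "MP f' g'" and t: "tm p g" "tm q g'"
 have "tm (p + q) g" "tm (p + q) g'" by (rule tm_mono[OF t(1)], simp) (rule tm_mono[OF t(2)], simp)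
 then obtain c c' where "tame (p + q) c g" "tame (p + q) c' g'" unfolding tm_def by (elim exE)
 then show ?thesis by (rule MP_add[OF MP])
qed

lemma MP_diff': "MP f g ==> MP f' g' ==> tm p g ==> tm q g' ==> MP (%nu. f nu - f' nu) (%nu. g nu - g' nu)"
 using MP_add'[of f g "%nu. (-1) * f' nu" "%nu. (-1) * g' nu" p q] MP_cmult[of f' g' "-1"] tm_cmult[of q g' "-1"] by simp

lemma moment_mono: "moment q ==> p <= q ==> moment p"
 unfolding moment_def
proof (intro allI impI conjI)
 fix T :: real assume m: "\<forall>T\<ge>0. D T : bmeas Q & integrable Q (%w. D T w ^ q)" and pq: "p <= q" and T: "0 <= T"
 show Dm: "D T : bmeas Q" using m T by blast
 show "integrable Q (%w. D T w ^ p)"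
 proof (rule bib_bound[of Q "%w. 1 + D T w ^ q"])
  show "AE w in Q. norm (D T w ^ p) <= norm (1 + D T w ^ q)"
  proof (rule AE_I2)
  fix w assume w: "w : space Q"
  have D0: "0 <= D T w" by (rule D_nonneg[OF w T])
  have "D T w ^ p <= 1 + D T w ^ q"
  proof (cases "D T w <= 1")
  case True then show ?thesis using power_le_one[OF D0 True, of p] zero_le_power[OF D0, of q] by linarith
  next
  case False then show ?thesis using power_increasing[OF pq, of "D T w"] by linarith
  qed
  then show "norm (D T w ^ p) <= norm (1 + D T w ^ q)" using D0 by simp
  qed
 qed (use m T Dm in auto)
qed

text \<open>Doob's inequality upgrades moments at fixed times to moments of the running
  supremum.\<close>

lemma moment_from_power:
 assumes Z: "mgle (%t w. mass (w t))"
  and i: "!!t. 0 <= t ==> integrable Q (%w. mass (w t) ^ (2 * Suc p))"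
 shows "moment (2 * Suc p)"
 unfolding moment_def D_def[abs_def]
 using doob_power[OF Z mass_nonneg mass_path_continuous i] by blast

text \<open>The mean of the mass is constant in time, so Fubini gives integrability at linear growth
  without any moment of \<open>D\<close>. This is what is available before \<open>moment 2\<close>
  is known.\<close>

lemma mass_drift_integrable:
 assumes Z: "mgle (%t w. mass (w t))" and g: "tm 1 g" and t: "0 <= t"
 shows "integrable Q (%w. LBINT u:{0..t}. g (w u))"
proof -
 obtain c where c: "tame 1 c g" using g by (auto simp: tm_def)
 have EZ: "(LINT w|Q. mass (w u)) = (LINT w|Q. mass (w 0))" if "0 <= u" for u
  using mgle_mult_bounded[OF Z order_refl that, of "%_. 1" 1] mgleD(2)[OF Z] that by simp
 have "integrable Q (%w. LBINT u:{0..t}. g (w (max 0 u)))"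
 proof (rule drift_fubini(1)[OF joint_measurable[OF tm_measurable[OF g]] t])
  fix u assume "u : {0..t}"
  then have u: "max 0 u = u" "0 <= u" by auto
  have i: "integrable Q (%w. c * (1 + mass (w u)))" using mgleD(2)[OF Z u(2)] by simp
  have gi: "integrable Q (%w. g (w u))"
  using order_trans[OF tameD(3)[OF c] abs_ge_self]
  by (intro bib_bound[OF i] F_P[OF tm_path_adapted[OF g u(2) order_refl]] AE_I2) simp
  have "(LINT w|Q. abs (g (w u))) <= (LINT w|Q. c * (1 + mass (w u)))"
  using gi i tameD(3)[OF c] by (intro integral_mono) auto
  also have "... = c * (1 + (LINT w|Q. mass (w 0)))" using mgleD(2)[OF Z u(2)] EZ[OF u(2)] by (simp add: prob_space)
  finally show "integrable Q (%w. g (w (max 0 u))) & (LINT w|Q. abs (g (w (max 0 u)))) <= c * (1 + (LINT w|Q. mass (w 0)))"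
  unfolding u using gi by blast
 qed
 then show ?thesis unfolding drift_clip[OF order_refl, symmetric] .
qed

lemma C2_one: "(%_. 1) : C2_real" "deriv (%_::real. 1::real) = (%_. 0)"
 by (rule C2_real_const) simp

lemma M_process_eq: "M_process h \<mu> phi t w = pairing phi (w t) - pairing phi \<mu> - (LBINT u:{0..t}. drift phi (w u))"
 unfolding M_process_def drift_def by simp

lemma M_bracket_eq:
 assumes "phi : C2_real" "w : space Q"
 shows "M_bracket h \<sigma> phi t w = (LBINT u:{0..t}. \<Gamma> phi phi (w u))"
proof -
 have "(LBINT z. (pairing (%x. h (z - x) * deriv phi x) nu)^2) = covar (deriv phi) (deriv phi) nu" for nu
  unfolding covar_eq[OF C2_realD(2)[OF assms(1)] C2_realD(2)[OF assms(1)]] power2_eq_square ..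
 moreover have "set_integrable lborel {0..t} (%u. pairing (%x. \<sigma> x * (phi x)^2) (w u))"
  by (rule tm_set_integrable[OF tm_pairing _ order_refl]) (intro Cb_mult Cb_power2 \<sigma>_Cb C2_realD assms)+
 moreover have "set_integrable lborel {0..t} (%u. covar (deriv phi) (deriv phi) (w u))"
  by (rule tm_set_integrable[OF tm_covar _ order_refl]) (intro C2_realD assms)+
 ultimately show ?thesis
  unfolding M_bracket_def \<Gamma>_def by (simp add: power2_eq_square)
qed

lemma covar_self_nonneg: "u : Cb UNIV ==> 0 <= covar u u nu"
 by (subst covar_eq) auto

lemma \<Gamma>_self_nonneg: "phi : C2_real ==> 0 <= \<Gamma> phi phi nu"
 unfolding \<Gamma>_def pairing_def
 by (intro add_nonneg_nonneg covar_self_nonneg C2_realD bi_nonneg) (simp add: \<sigma>_nonneg)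

text \<open>Write \<open>X = M + c + B\<close> with B of finite variation. Expanding the squares,
  the two candidate martingales differ by \<open>2 * c * M + c^2 + 2 * W\<close>, where W is
  \<open>M * B\<close> minus the integral of M against dB. W is a martingale by integration by
  parts, so one candidate is a martingale exactly when the other is.\<close>

lemma quadratic_equivalence:
 assumes phi: "phi : C2_real" and m: "moment 2" and MP: "MP (pairing phi) (drift phi)" and a: "tm 2 a"
 shows "mgle (%t w. (M_process h \<mu> phi t w)^2 - (LBINT u:{0..t}. a (w u))) \<longleftrightarrow>
  MP (%nu. (pairing phi nu)^2) (%nu. 2 * (pairing phi nu * drift phi nu) + a nu)"
proof -
 let ?c = "pairing phi \<mu>"
 define X where "X t w = pairing phi (w t)" for t and w :: "real => fmeasure"
 define B where "B t w = (LBINT u:{0..t}. drift phi (w u))" for t :: real and w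
 define M where "M t w = X t w - ?c - B t w" for t w
 define I where "I t w = (LBINT u:{0..t}. pairing phi (w u) * drift phi (w u))" for t :: real and w
 \<comment> \<open>The parenthesis is the integral of M against dB: substitute
   \<open>M = X - c - B\<close> and use that B integrates against itself to
   \<open>B^2 / 2\<close>.\<close>
 define W where "W t w = M t w * B t w - (I t w - ?c * B t w - (B t w)^2 / 2)" for t w
 have tX: "tm 1 (pairing phi)" by (rule tm_pairing[OF C2_realD(1)[OF phi]])
 note tb = tm_drift[OF phi]
 have tXb: "tm 2 (%nu. pairing phi nu * drift phi nu)" using tm_mult[OF tX tb] by (simp add: numeral_2_eq_2)
 have MQ: "M_process h \<mu> phi t w = M t w" for t w unfolding M_process_eq M_def X_def B_def ..
 have mM: "mgle M"
 proof -
  have "mgle (%t w. (pairing phi (w t) - (LBINT u:{0..t}. drift phi (w u))) - ?c)"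
  by (rule mgle_diff[OF MP[unfolded MP_def] mgle_const]) auto
  then show ?thesis by (rule mgle_cong[THEN iffD1, rotated]) (simp add: M_def X_def B_def)
 qed
 have Mad: "M t : bmeas (pfilt t)" if "0 <= t" for t
  using mgleD(1)[OF mM that] .
 have Bad: "B s : bmeas (pfilt t)" if "0 <= s" "s <= t" for s t
  unfolding B_def[abs_def] using F_mono[OF that(2) tm_drift_adapted[OF tb order_refl that(1)]] .
 have Iad: "I t : bmeas (pfilt t)" if "0 <= t" for t
  unfolding I_def[abs_def] by (rule tm_drift_adapted[OF tXb order_refl that])
 obtain cX where cX: "tame 1 cX (pairing phi)" using tX by (auto simp: tm_def)
 obtain cb where cb: "tame 1 cb (drift phi)" using tb by (auto simp: tm_def)
 have Xb: "abs (X u w) <= cX * (1 + D t w)" and Bb: "abs (B u w) <= cb * (1 + D t w) * t"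
  and bb: "abs (drift phi (w u)) <= cb * (1 + D t w)"
  if "w : space Q" "0 <= u" "u <= t" for u t w
 proof -
  show "abs (X u w) <= cX * (1 + D t w)" unfolding X_def using tame_path_bound[OF cX that] by simp
  show "abs (drift phi (w u)) <= cb * (1 + D t w)" using tame_path_bound[OF cb that] by simp
  have "abs (B u w) <= cb * (1 + D u w ^ 1) * (u - 0)"
  unfolding B_def by (rule tame_drift_bound[OF cb that(1) order_refl that(2)])
  also have "... <= cb * (1 + D t w) * t"
  using that tameD(2)[OF cb] D_mono[OF that] D_nonneg[OF that(1,2)]
  by (intro mult_mono mult_nonneg_nonneg add_nonneg_nonneg) auto
  finally show "abs (B u w) <= cb * (1 + D t w) * t" .
 qed
 define E where "E t = cX + abs ?c + cb * t" for t
 have E0: "0 <= E t" if "0 <= t" for t using that tameD(2)[OF cX] tameD(2)[OF cb] by (simp add: E_def)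
 have Mb: "abs (M u w) <= E t * (1 + D t w)" if "w : space Q" "0 <= u" "u <= t" for u t w
 proof -
  have "0 <= D t w" using D_nonneg[OF that(1)] that by simp
  then have "abs ?c <= abs ?c * (1 + D t w)" using mult_left_mono[of 1 "1 + D t w" "abs ?c"] by simp
  then have "abs (M u w) <= cX * (1 + D t w) + abs ?c * (1 + D t w) + cb * (1 + D t w) * t"
  unfolding M_def using Xb[OF that] Bb[OF that] by linarith
  then show ?thesis by (simp add: E_def algebra_simps)
 qed
 have D2: "integrable Q (%w. k * (1 + D t w)^2)" if "0 <= t" for k t
 proof -
  have "moment 1" by (rule moment_mono[OF m]) simp
  then have "integrable Q (%w. 1 + 2 * D t w + D t w ^ 2)" using m that by (auto simp: moment_def)
  moreover have "1 + 2 * D t w + D t w ^ 2 = (1 + D t w)^2" for w by (simp add: power2_sum)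
  ultimately have "integrable Q (%w. (1 + D t w)^2)" by (simp only:)
  then show ?thesis by (rule integrable_mult_right)
 qed
 have prodb: "abs (x * y) <= (k * l) * (1 + D t w)^2"
  if "abs x <= k * (1 + D t w)" "abs y <= l * (1 + D t w)" for x y k l t and w
 proof -
  have "abs (x * y) <= (k * (1 + D t w)) * (l * (1 + D t w))"
  unfolding abs_mult using that order_trans[OF abs_ge_zero that(1)] by (intro mult_mono) auto
  then show ?thesis by (simp add: power2_eq_square mult_ac)
 qed
 have iprod: "integrable Q (%w. x w * y w)"
  if "x : bmeas Q" "y : bmeas Q" "0 <= t"
  "!!w. w : space Q ==> abs (x w) <= k * (1 + D t w)" "!!w. w : space Q ==> abs (y w) <= l * (1 + D t w)" for x y k l t
 proof (rule bib_bound[OF D2[OF that(3), of "k * l"]])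
  show "AE w in Q. norm (x w * y w) <= norm (k * l * (1 + D t w)^2)"
  proof (rule AE_I2)
  fix w assume "w : space Q"
  then have "abs (x w * y w) <= k * l * (1 + D t w)^2" by (intro prodb that)
  then show "norm (x w * y w) <= norm (k * l * (1 + D t w)^2)" unfolding real_norm_def by linarith
  qed
 qed (use that in auto)
 have bcont: "continuous_on {0..} (%u. drift phi (w u))" if "w : space Q" for w
  unfolding drift_def by (intro continuous_intros pairing_path_continuous[OF that] C2_realD phi)
 have Bcont: "continuous_on {0..} (%u. B u w)" if "w : space Q" for w
  unfolding B_def by (rule tame_drift_continuous[OF cb that])
 have Mcont: "continuous_on {0..} (%u. M u w)" if "w : space Q" for w
  unfolding M_def X_def by (intro continuous_intros pairing_path_continuous[OF that] C2_realD phi Bcont that)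
 have BB: "(LBINT u:{0..t}. B u w * drift phi (w u)) = (B t w)^2 / 2" if "w : space Q" "0 <= t" for t w
  unfolding B_def by (rule LBINT_self_primitive[OF bcont[OF that(1)] that(2)])
 have siB: "set_integrable lborel {s..t} (%u. B u w * drift phi (w u))" if "w : space Q" "0 <= s" for s t w
  by (rule borel_integrable_compact[unfolded set_integrable_def[symmetric]])
  (use that in \<open>auto intro!: continuous_intros continuous_on_subset[OF Bcont] continuous_on_subset[OF bcont]\<close>)
 have mW: "mgle W"
 proof (rule mgleI)
  show "W t : bmeas (pfilt t)" if "0 <= t" for t
  unfolding W_def[abs_def] using Mad[OF that] Bad[OF that order_refl] Iad[OF that] by measurable
  then have WQ: "W t : bmeas Q" if "0 <= t" for t using F_P that by blast
  show "integrable Q (W t)" if t: "0 <= t" for t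
  proof -
  have iI: "integrable Q (I t)"
  using tXb unfolding I_def[abs_def] tm_def by (elim exE) (rule tame_drift_path_integrable[OF _ m order_refl t])
  have BQ: "B t : bmeas Q" "M t : bmeas Q" using F_P[OF Bad[OF t order_refl]] F_P[OF Mad[OF t]] by auto
  have iMB: "integrable Q (%w. M t w * B t w)"
  by (rule iprod[OF BQ(2,1) t, of "E t" "cb * t"]) (use Mb[OF _ t order_refl] Bb[OF _ t order_refl] in \<open>simp_all add: mult_ac\<close>)
  have iBB: "integrable Q (%w. (B t w)^2 / 2)"
  proof -
  have "integrable Q (%w. B t w * B t w)"
  by (rule iprod[OF BQ(1,1) t, of "cb * t" "cb * t"]) (use Bb[OF _ t order_refl] in \<open>simp_all add: mult_ac\<close>)
  then show ?thesis by (simp add: power2_eq_square)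
  qed
  have iB: "integrable Q (B t)"
  unfolding B_def[abs_def] using tame_drift_path_integrable[OF cb moment_mono[OF m] order_refl t] by simp
  show ?thesis unfolding W_def[abs_def]
  by (intro bib_diff iMB iI integrable_mult_right iB iBB)
  qed
  fix s t A assume st: "0 <= s" "s <= t" and A: "A : sets (pfilt s)"
  have t: "0 <= t" using st by simp
  have AQ: "A : sets Q" using A sub[of s] by (auto simp: subalgebra_def)
  let ?J = "%w u. ind A w * ((M t w - M (max 0 u) w) * drift phi (w (max 0 u)))"
  \<comment> \<open>The increment of W splits into \<open>B s\<close> times the increment of M and
    the integral of \<open>M t - M u\<close> against dB(u). The former has mean zero over A. In the
    latter \<open>drift phi (w u)\<close> is known at time u, so the martingale property on [u, t]
    gives mean zero for each u, and Fubini concludes.\<close>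
  have dec: "indicator A w * (W t w - W s w) = indicator A w * B s w * M t w - indicator A w * B s w * M s w + (LBINT u:{s..t}. ?J w u)"
  if w: "w : space Q" for w
  proof -
  have I2: "I t w = I s w + (LBINT u:{s..t}. pairing phi (w u) * drift phi (w u))"
  unfolding I_def by (rule tm_split[OF tXb w st])
  have B2: "B t w = B s w + (LBINT u:{s..t}. drift phi (w u))"
  unfolding B_def by (rule tm_split[OF tb w st])
  have BB2: "(B t w)^2 / 2 = (B s w)^2 / 2 + (LBINT u:{s..t}. B u w * drift phi (w u))"
  unfolding BB[OF w t, symmetric] BB[OF w st(1), symmetric]
  by (rule set_integral_split_Icc[OF siB[OF w order_refl] st])
  note si = tm_set_integrable[OF tb w st(1), of t] tm_set_integrable[OF tXb w st(1), of t] siB[OF w st(1), of t]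
  have "(LBINT u:{s..t}. (M t w - M u w) * drift phi (w u)) =
  (LBINT u:{s..t}. (M t w + ?c) * drift phi (w u) - pairing phi (w u) * drift phi (w u) + B u w * drift phi (w u))"
  unfolding M_def[of _ w] X_def by (simp add: algebra_simps)
  also have "... = (M t w + ?c) * (LBINT u:{s..t}. drift phi (w u)) - (LBINT u:{s..t}. pairing phi (w u) * drift phi (w u)) + (LBINT u:{s..t}. B u w * drift phi (w u))"
  using si by simp
  finally have e: "(LBINT u:{s..t}. (M t w - M u w) * drift phi (w u)) = M t w * (B t w - B s w) - ((I t w - I s w) - ?c * (B t w - B s w) - ((B t w)^2 / 2 - (B s w)^2 / 2))"
  using I2 B2 BB2 by (simp add: algebra_simps)
  have "(LBINT u:{s..t}. ?J w u) = (LBINT u:{s..t}. ind A w * ((M t w - M u w) * drift phi (w u)))"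
  by (rule set_lebesgue_integral_cong) (use st in auto)
  also have "... = indicator A w * (LBINT u:{s..t}. (M t w - M u w) * drift phi (w u))" by simp
  finally have "(LBINT u:{s..t}. ?J w u) = indicator A w * (LBINT u:{s..t}. (M t w - M u w) * drift phi (w u))" .
  then show ?thesis unfolding e W_def by (simp add: algebra_simps)
  qed
  have YB: "(%w. indicator A w * B s w) : bmeas (pfilt s)"
  using A Bad[OF st(1) order_refl] by (intro borel_measurable_times borel_measurable_indicator)
  have iYM: "integrable Q (%w. indicator A w * B s w * M v w)" if v: "0 <= v" "v <= t" for v
  proof (rule bib_bound[OF D2[OF t, of "(cb * t) * E t"]])
  show "(%w. indicator A w * B s w * M v w) : bmeas Q"
  using F_P[OF YB] F_P[OF Mad[OF v(1)]] by (rule borel_measurable_times)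
  show "AE w in Q. norm (indicator A w * B s w * M v w) <= norm ((cb * t) * E t * (1 + D t w)^2)"
  proof (rule AE_I2)
  fix w assume w: "w : space Q"
  have "abs (B s w * M v w) <= ((cb * t) * E t) * (1 + D t w)^2"
  by (rule prodb[OF _ Mb[OF w v]]) (use Bb[OF w st] in \<open>simp add: mult_ac\<close>)
  then show "norm (indicator A w * B s w * M v w) <= norm ((cb * t) * E t * (1 + D t w)^2)"
  by (auto simp: indicator_def)
  qed
  qed
  have first: "(LINT w|Q. indicator A w * B s w * M t w) = (LINT w|Q. indicator A w * B s w * M s w)"
  by (rule mgle_mult[OF mM st YB iYM iYM]) (use st in auto)
  have jM: "(%(w, u). M (max 0 u) w) : bmeas (Q \<Otimes>\<^sub>M borel)"
  proof (rule caratheodory_measurable)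
  show "M (max 0 u) : bmeas Q" for u by (rule F_P[OF Mad]) simp
  show "continuous_on UNIV (%u. M (max 0 u) w)" if "w : space Q" for w
  by (intro continuous_on_compose2[OF Mcont[OF that]] continuous_intros) auto
  qed
  have jJ: "(%(w, u). ?J w u) : bmeas (Q \<Otimes>\<^sub>M borel)"
  unfolding case_prod_beta'
  using jM joint_measurable[OF tm_measurable[OF tb]] measurable_compose[OF measurable_fst F_P[OF Mad[OF t]]]
  measurable_compose[OF measurable_fst borel_measurable_indicator[OF AQ]]
  by (intro borel_measurable_times borel_measurable_diff) (simp_all add: case_prod_beta')
  let ?Y = "%w. (2 * E t) * cb * (1 + D t w)^2"
  have iJ: "integrable Q (%w. ?J w u) & (LINT w|Q. abs (?J w u)) <= (LINT w|Q. ?Y w)" if "u : {s..t}" for u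
  proof -
  have u: "max 0 u = u" "0 <= u" "u <= t" using that st by auto
  have b: "abs (?J w u) <= ?Y w" if w: "w : space Q" for w
  proof -
  have "abs (M t w - M u w) <= (2 * E t) * (1 + D t w)"
  using Mb[OF w t order_refl] Mb[OF w u(2,3)] by linarith
  note p = prodb[OF this bb[OF w u(2,3)]]
  have "abs (?J w u) <= abs ((M t w - M u w) * drift phi (w u))" using u by (simp add: indicator_def)
  also note p
  finally show ?thesis .
  qed
  have i: "integrable Q (%w. ?J w u)"
  by (rule bib_bound[OF D2[OF t]])
  (use measurable_Pair1[OF jJ, of u] order_trans[OF b abs_ge_self] in auto)
  then show ?thesis using D2[OF t] b by (intro conjI integral_mono) auto
  qed
  note fub = drift_fubini[OF jJ st(2) iJ]
  have z: "(LINT w|Q. ?J w u) = 0" if True: "u : {s..t}" for u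
  proof -
  have u: "max 0 u = u" "0 <= u" "u <= t" "s <= u" using True st by auto
  have Y: "(%w. indicator A w * drift phi (w u)) : bmeas (pfilt u)"
  using F_mono[OF u(4) borel_measurable_indicator[OF A]] tm_path_adapted[OF tb u(2) order_refl]
  by (rule borel_measurable_times)
  have i: "integrable Q (%w. indicator A w * drift phi (w u) * M v w)" if v: "0 <= v" "v <= t" for v
  proof (rule bib_bound[OF D2[OF t, of "cb * E t"]])
  show "(%w. indicator A w * drift phi (w u) * M v w) : bmeas Q"
  using F_P[OF Y] F_P[OF Mad[OF v(1)]] by (rule borel_measurable_times)
  show "AE w in Q. norm (indicator A w * drift phi (w u) * M v w) <= norm (cb * E t * (1 + D t w)^2)"
  proof (rule AE_I2)
  fix w assume w: "w : space Q"
  have "abs (drift phi (w u) * M v w) <= (cb * E t) * (1 + D t w)^2"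
  by (rule prodb[OF bb[OF w u(2,3)] Mb[OF w v]])
  then show "norm (indicator A w * drift phi (w u) * M v w) <= norm (cb * E t * (1 + D t w)^2)"
  by (auto simp: indicator_def)
  qed
  qed
  have "(LINT w|Q. indicator A w * drift phi (w u) * M t w) = (LINT w|Q. indicator A w * drift phi (w u) * M u w)"
  by (rule mgle_mult[OF mM u(2,3) Y i i]) (use u t in auto)
  then have "(LINT w|Q. indicator A w * drift phi (w u) * M t w - indicator A w * drift phi (w u) * M u w) = 0"
  using i[OF t order_refl] i[OF u(2,3)] by simp
  moreover have "?J w u = indicator A w * drift phi (w u) * M t w - indicator A w * drift phi (w u) * M u w" for w
  using True u by (simp add: algebra_simps)
  ultimately show ?thesis by (simp only:)
  qed
  have second: "(LINT w|Q. (LBINT u:{s..t}. ?J w u)) = 0"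
  proof (rule trans[OF fub(2)])
  show "(LBINT u:{s..t}. (LINT w|Q. ?J w u)) = 0"
  unfolding set_lebesgue_integral_def by (rule integral_eq_zero_AE) (use z in \<open>auto simp: indicator_def\<close>)
  qed
  have "(LINT w|Q. indicator A w * (W t w - W s w)) =
  (LINT w|Q. indicator A w * B s w * M t w - indicator A w * B s w * M s w + (LBINT u:{s..t}. ?J w u))"
  by (rule bi_cong[OF refl dec])
  also have "... = (LINT w|Q. indicator A w * B s w * M t w - indicator A w * B s w * M s w) + (LINT w|Q. (LBINT u:{s..t}. ?J w u))"
  by (intro bi_add bib_diff iYM fub(1)) (use st in auto)
  also have "(LINT w|Q. indicator A w * B s w * M t w - indicator A w * B s w * M s w) = (LINT w|Q. indicator A w * B s w * M t w) - (LINT w|Q. indicator A w * B s w * M s w)"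
  by (intro bi_diff iYM) (use st in auto)
  finally show "(LINT w|Q. indicator A w * (W t w - W s w)) = 0" unfolding first second by simp
 qed
 define V where "V t w = (M t w)^2 - (LBINT u:{0..t}. a (w u))" for t :: real and w
 define U where "U t w = (pairing phi (w t))^2 - (LBINT u:{0..t}. 2 * (pairing phi (w u) * drift phi (w u)) + a (w u))" for t :: real and w
 define Df where "Df t w = (2 * ?c) * M t w + ?c^2 + 2 * W t w" for t w
 have mD: "mgle Df"
  unfolding Df_def[abs_def] by (intro mgle_add mgle_cmult mM mW mgle_const) auto
 have UV: "U t w = V t w + Df t w" if t: "0 <= t" and w: "w : space Q" for t w
 proof -
  have "(LBINT u:{0..t}. 2 * (pairing phi (w u) * drift phi (w u)) + a (w u)) = 2 * I t w + (LBINT u:{0..t}. a (w u))"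
  unfolding I_def using tm_set_integrable[OF tXb w order_refl, of t] tm_set_integrable[OF a w order_refl, of t] by simp
  moreover have "pairing phi (w t) = M t w + ?c + B t w" by (simp add: M_def X_def)
  ultimately show ?thesis unfolding U_def V_def Df_def W_def by (simp add: power2_eq_square algebra_simps)
 qed
 have "mgle V \<longleftrightarrow> mgle U"
 proof
  assume "mgle V"
  then have "mgle (%t w. V t w + Df t w)" by (rule mgle_add[OF _ mD])
  then show "mgle U" by (rule mgle_cong[THEN iffD1, rotated]) (simp add: UV)
 next
  assume "mgle U"
  then have "mgle (%t w. U t w - Df t w)" by (rule mgle_diff[OF _ mD])
  then show "mgle V" by (rule mgle_cong[THEN iffD1, rotated]) (simp add: UV)
 qed
 then show ?thesis unfolding MP_def MQ V_def U_def .
qed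

end

section \<open>Stopping when the mass reaches a level\<close>

lemma sup_grid_limit:
 fixes q :: "real => real"
 assumes q: "continuous_on UNIV q" and t: "0 <= t"
 shows "(%m. Max ((%k. q (grid 0 t m k)) ` {..Suc m})) ~~> (SUP u\<in>{0..t}. q u)"
proof -
 have c: "continuous_on {0..t} q" by (rule continuous_on_subset[OF q]) simp
 have bdd: "bdd_above (q ` {0..t})"
  by (intro bounded_imp_bdd_above compact_imp_bounded compact_continuous_image c) auto
 obtain x where x: "x : {0..t}" "!!u. u : {0..t} ==> q u <= q x"
  using continuous_attains_sup[OF _ _ c] t by auto
 have S: "(SUP u\<in>{0..t}. q u) = q x" by (rule cSup_eq_maximum) (use x in auto)
 have up: "Max ((%k. q (grid 0 t m k)) ` {..Suc m}) <= q x" for m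
  using grid_ge[OF t] grid_le[OF t] by (intro Max.boundedI) (auto intro!: x(2))
 show ?thesis
  unfolding S
 proof (rule LIMSEQ_I)
  fix e :: real assume e: "0 < e"
  have "0 < e / 2" using e by simp
  from uniform_on_grid[OF q t this] obtain N where N: "!!m k u. m >= N ==> k < Suc m ==> u : {grid 0 t m k..grid 0 t m (Suc k)} ==> abs (q u - q (grid 0 t m k)) <= e / 2"
  by blast
  have "norm (Max ((%k. q (grid 0 t m k)) ` {..Suc m}) - q x) < e" if m: "m >= N" for m
  proof -
  have "\<exists>k<Suc m. x : {grid 0 t m k..grid 0 t m (Suc k)}"
  proof -
  define k where "k = (LEAST k. x <= grid 0 t m k)"
  have kx: "x <= grid 0 t m k" unfolding k_def by (rule LeastI[of _ "Suc m"]) (use x in simp)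
  have kS: "k <= Suc m" unfolding k_def by (rule Least_le) (use x in simp)
  show ?thesis
  proof (cases k)
  case 0
  then have "x = grid 0 t m 0" using kx x by simp
  then show ?thesis using grid_mono[OF t, of 0 "Suc 0" m] by (intro exI[of _ 0]) auto
  next
  case (Suc l)
  then have "\<not> x <= grid 0 t m l" unfolding k_def by (intro not_less_Least) simp
  then show ?thesis using kx kS Suc by (intro exI[of _ l]) auto
  qed
  qed
  then obtain k where k: "k < Suc m" "x : {grid 0 t m k..grid 0 t m (Suc k)}" by blast
  have "q (grid 0 t m k) <= Max ((%k. q (grid 0 t m k)) ` {..Suc m})" using k by (intro Max_ge) auto
  then show ?thesis using N[OF m k] up[of m] e by (simp add: abs_le_iff abs_less_iff)
  qed
  then show "EX no. \<forall>m\<ge>no. norm (Max ((%k. q (grid 0 t m k)) ` {..Suc m}) - q x) < e" by blast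
 qed
qed

context path_setting
begin

text \<open>The supremum over uncountably many times is a limit of maxima over finite grids in
  \<open>{0..t}\<close>, each of them known at time t.\<close>

lemma D_adapted: "0 <= t ==> D t : bmeas (pfilt t)"
proof (rule borel_measurable_LIMSEQ_real)
 assume t: "0 <= t"
 show "(%w. Max ((%k. mass (w (grid 0 t m k))) ` {..Suc m})) : bmeas (pfilt t)" for m
  using grid_ge[OF t] grid_le[OF t] by (intro borel_measurable_Max functional_adapted mass_measurable) auto
 fix w assume "w : space (pfilt t)"
 then have w: "w : space Q" by (simp add: space_F)
 have c: "continuous_on UNIV (%u. mass (w (max 0 u)))"
  by (intro continuous_on_compose2[OF mass_path_continuous[OF w]] continuous_intros) auto
 have "(%m. Max ((%k. mass (w (max 0 (grid 0 t m k)))) ` {..Suc m})) ~~> (SUP u\<in>{0..t}. mass (w (max 0 u)))"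
  by (rule sup_grid_limit[OF c t])
 moreover have "max 0 (grid 0 t m k) = grid 0 t m k" for m k using grid_ge[OF t, of m k] by simp
 moreover have "(SUP u\<in>{0..t}. mass (w (max 0 u))) = D t w"
  unfolding D_def by (intro SUP_cong refl) (auto simp: max_def)
 ultimately show "(%m. Max ((%k. mass (w (grid 0 t m k))) ` {..Suc m})) ~~> D t w" by simp
qed

text \<open>First time the mass reaches K, capped at K. The extra element makes the set nonempty, so
  that \<open>Inf\<close> on the reals is meaningful, and the cap itself grows with K.\<close>

definition tau :: "real => (real => fmeasure) => real" where
 "tau K w = Inf ({t. 0 <= t & K <= mass (w t)} \<union> {K})"

text \<open>Cuts a drift off at the stopping time. Negative times are read as 0, in keeping with the
  clipped paths.\<close>

definition alive :: "real => real => (real => fmeasure) => real" where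
 "alive K u w = (if max 0 u < tau K w then 1 else 0)"

lemma alive_1: "max 0 u < tau K w ==> alive K u w = 1"
 and alive_0: "\<not> max 0 u < tau K w ==> alive K u w = 0"
 unfolding alive_def by (simp_all only: if_True if_False)

context
 fixes K :: real assumes K: "0 < K"
begin

lemma tau_mem: "w : space Q ==> tau K w : {t. 0 <= t & K <= mass (w t)} \<union> {K}"
 unfolding tau_def
proof (rule closed_contains_Inf)
 assume w: "w : space Q"
 have "closed {t. 0 <= t & K <= mass (w t)}"
 proof -
  have c: "continuous_on UNIV (%u. mass (w (max 0 u)))"
  by (intro continuous_on_compose2[OF mass_path_continuous[OF w]] continuous_intros) auto
  have "closed ({0..} \<inter> {t. K <= mass (w (max 0 t))})"
  by (intro closed_Int closed_Collect_le[OF continuous_on_const c]) auto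
  moreover have "{0..} \<inter> {t. K <= mass (w (max 0 t))} = {t. 0 <= t & K <= mass (w t)}"
  by (auto simp: max_def)
  ultimately show ?thesis by simp
 qed
 then show "closed ({t. 0 <= t & K <= mass (w t)} \<union> {K})" by simp
 show "bdd_below ({t. 0 <= t & K <= mass (w t)} \<union> {K})" using K by (intro bdd_belowI[of _ 0]) auto
qed simp

lemma tau_le: "t : {t. 0 <= t & K <= mass (w t)} \<union> {K} ==> tau K w <= t"
 unfolding tau_def using K by (intro cInf_lower bdd_belowI[of _ 0]) auto

lemma tau_nonneg: "w : space Q ==> 0 <= tau K w"
 using tau_mem[of w] K by auto

text \<open>The mass attains its maximum on \<open>{0..u}\<close>, so survival past u can be read
  off the running supremum and becomes an event known at time u.\<close>

lemma tau_iff: "w : space Q ==> 0 <= u ==> u < tau K w \<longleftrightarrow> u < K & D u w < K"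
proof
 assume w: "w : space Q" and u: "0 <= u" and l: "u < tau K w"
 have "continuous_on {0..u} (%t. mass (w t))" by (rule continuous_on_subset[OF mass_path_continuous[OF w]]) auto
 then obtain t where t: "t : {0..u}" "!!v. v : {0..u} ==> mass (w v) <= mass (w t)"
  using continuous_attains_sup[of "{0..u}" "%t. mass (w t)"] u by auto
 have "D u w = mass (w t)" unfolding D_def by (rule cSup_eq_maximum) (use t in auto)
 moreover have "mass (w t) < K"
 proof (rule ccontr)
  assume "\<not> mass (w t) < K"
  then have "tau K w <= t" using t by (intro tau_le) auto
  then show False using l t by simp
 qed
 ultimately show "u < K & D u w < K" using l tau_le[of K w] by auto
next
 assume w: "w : space Q" and u: "0 <= u" and l: "u < K & D u w < K"
 show "u < tau K w"
 proof (rule ccontr)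
  assume "\<not> u < tau K w"
  then have "tau K w <= u" by simp
  moreover from this have "0 <= tau K w & K <= mass (w (tau K w))" using tau_mem[OF w] l by auto
  ultimately show False using mass_le_D[OF w, of "tau K w" u] l by simp
 qed
qed

lemma tau_event: "0 <= u ==> {w : space Q. u < tau K w} : sets (pfilt u)"
proof -
 assume u: "0 <= u"
 have "{w : space Q. u < tau K w} = (if u < K then {w : space (pfilt u). D u w < K} else {})"
  using tau_iff[OF _ u] by (auto simp: space_F)
 also have "... : sets (pfilt u)" using D_adapted[OF u] by simp
 finally show ?thesis .
qed

lemma min_tau_adapted: "0 <= u ==> (%w. min u (tau K w)) : bmeas (pfilt u)"
proof (subst borel_measurable_iff_greater, rule allI)
 fix v assume u: "0 <= u"
 show "{w : space (pfilt u). v < min u (tau K w)} : sets (pfilt u)"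
 proof (cases "0 <= v & v < u")
  case True
  then have "{w : space (pfilt u). v < min u (tau K w)} = {w : space Q. v < tau K w}"
  by (auto simp: space_F)
  then show ?thesis using tau_event[of v] sets_mono[of v u] True by auto
 next
  case False
  then have "{w : space (pfilt u). v < min u (tau K w)} = (if v < u then space (pfilt u) else {})"
  using u tau_nonneg by (fastforce simp: space_F)
  then show ?thesis by simp
 qed
qed

lemma tau_measurable: "tau K : bmeas Q"
proof (subst borel_measurable_iff_greater, rule allI)
 fix v
 show "{w : space Q. v < tau K w} : sets Q"
 proof (cases "0 <= v")
  case True
  then show ?thesis using tau_event[OF True] sub[of v] by (auto simp: subalgebra_def)
 next
  case False
  then have "{w : space Q. v < tau K w} = space Q" using tau_nonneg by fastforce
  then show ?thesis by simp
 qed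
qed

text \<open>Before the stopping time the mass is below K, and continuity extends the bound to that
  time. If the stopping time is 0 nothing lies before it, and the hypothesis on
  \<open>mass (w 0)\<close> takes over.\<close>

lemma mass_stopped_le:
 assumes w: "w : space Q" and H: "mass (w 0) <= K" and t: "0 <= t"
 shows "mass (w (min t (tau K w))) <= K"
proof -
 have below: "mass (w u) < K" if "0 <= u" "u < tau K w" for u
  using tau_iff[OF w that(1)] that mass_le_D[OF w that(1) order_refl] by simp
 show ?thesis
 proof (cases "t < tau K w")
  case True
  then show ?thesis using below[OF t] by simp
 next
  case False
  then have m: "min t (tau K w) = tau K w" by simp
  show ?thesis
  proof (cases "tau K w = 0")
  case True then show ?thesis using H m by simp
  next
  case False
  then have pos: "0 < tau K w" using tau_nonneg[OF w] by simp
  define u where "u n = tau K w - tau K w / real (Suc (Suc n))" for n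
  have u: "0 <= u n" "u n < tau K w" for n using pos by (auto simp: u_def field_simps)
  have "(%n. tau K w - tau K w / real (Suc (Suc n))) ~~> tau K w - 0"
  by (intro tendsto_diff tendsto_const LIMSEQ_Suc lim_const_over_n)
  then have "u ~~> tau K w" by (simp add: u_def[abs_def])
  then have "(%n. mass (w (u n))) ~~> mass (w (tau K w))"
  by (rule continuous_on_tendsto_compose[OF mass_path_continuous[OF w]]) (use u pos in auto)
  then have "mass (w (tau K w)) <= K"
  by (rule LIMSEQ_le_const2) (use below[OF u] in \<open>auto intro: less_imp_le\<close>)
  then show ?thesis using m by simp
  qed
 qed
qed

text \<open>The two integrands differ at most at the single time tau, a null set. This trades a
  random upper limit for a cut-off integrand on a fixed interval.\<close>

lemma stopped_drift:
 assumes g: "tm p g" and w: "w : space Q" and st: "0 <= s" "s <= t"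
 shows "(LBINT u:{0..min t (tau K w)}. g (w u)) - (LBINT u:{0..min s (tau K w)}. g (w u)) =
  (LBINT u:{s..t}. alive K u w * g (w (max 0 u)))"
proof -
 let ?a = "min s (tau K w)" and ?b = "min t (tau K w)"
 have ab: "0 <= ?a" "?a <= ?b" using st tau_nonneg[OF w] by auto
 have "(LBINT u:{0..?b}. g (w u)) - (LBINT u:{0..?a}. g (w u)) = (LBINT u:{?a..?b}. g (w u))"
  using tm_split[OF g w ab] by simp
 also have "... = (LBINT u:{?a..?b}. g (w (max 0 u)))" by (rule drift_clip[OF ab(1)])
 also have "... = (LBINT u:{s..t}. alive K u w * g (w (max 0 u)))"
  unfolding set_lebesgue_integral_def
 proof (rule integral_cong_AE)
  have [measurable]: "(%u. g (w (max 0 u))) : bmeas borel"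
  by (rule path_measurable[OF tm_measurable[OF g] w])
  have [measurable]: "(%u. alive K u w) : bmeas borel" unfolding alive_def by measurable
  show "(%u. ind {?a..?b} u *\<^sub>R g (w (max 0 u))) : bmeas lborel"
  "(%u. ind {s..t} u *\<^sub>R (alive K u w * g (w (max 0 u)))) : bmeas lborel"
  by measurable
  show "AE u in lborel. ind {?a..?b} u *\<^sub>R g (w (max 0 u)) = ind {s..t} u *\<^sub>R (alive K u w * g (w (max 0 u)))"
  using AE_lborel_singleton[of "tau K w"]
  proof eventually_elim
  case (elim u)
  have "u : {?a..?b} \<longleftrightarrow> u : {s..t} & max 0 u < tau K w" using elim st by auto
  then show ?case by (simp add: indicator_def alive_def)
  qed
 qed
 finally show ?thesis .
qed

lemma stopped_MP:
 assumes MP: "MP f g" and f: "tm p f" and g: "tm p g" and m: "moment p"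
  and fc: "!!w. w : space Q ==> continuous_on {0..} (%t. f (w t))"
  and st: "0 <= s" "s <= t" and Y: "Y : bmeas (pfilt s)" "Y : Bd"
 shows "(LINT w|Q. Y w * (f (w (min t (tau K w))) - f (w (min s (tau K w))) - (LBINT u:{s..t}. alive K u w * g (w (max 0 u))))) = 0"
proof -
 let ?U = "%t w. f (w t) - (LBINT u:{0..t}. g (w u))"
 obtain c where c: "tame p c f" using f by (auto simp: tm_def)
 obtain d where d: "tame p d g" using g by (auto simp: tm_def)
 obtain B where B: "!!w. w : space Q ==> abs (Y w) <= B" using BdE[OF Y(2)] by metis
 have t: "0 <= t" using st by simp
 have "(LINT w|Q. Y w * (?U (min t (tau K w)) w - ?U (min s (tau K w)) w)) = 0"
 proof (rule stopped_increment[OF MP[unfolded MP_def] _ st _ _ tau_nonneg tau_event Y(1) B])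
  show "continuous_on {0..} (%u. ?U u w)" if "w : space Q" for w
  by (intro continuous_on_diff fc[OF that] tame_drift_continuous[OF d that])
  show "integrable Q (%w. (c + d * t) * (1 + D t w ^ p))" by (rule momentD[OF m t])
  show "abs (?U u w) <= (c + d * t) * (1 + D t w ^ p)" if w: "w : space Q" and u: "0 <= u" "u <= t" for u w
  proof -
  have "abs (LBINT v:{0..u}. g (w v)) <= d * (1 + D u w ^ p) * (u - 0)"
  by (rule tame_drift_bound[OF d w order_refl u(1)])
  also have "... <= d * (1 + D t w ^ p) * t"
  using tameD(2)[OF d] D_mono[OF w u] D_nonneg[OF w u(1)] u D_nonneg[OF w t]
  by (intro mult_mono mult_nonneg_nonneg add_left_mono power_mono) auto
  finally show ?thesis using tame_path_bound[OF c w u] by (simp add: algebra_simps)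
  qed
 qed
 moreover have "?U (min t (tau K w)) w - ?U (min s (tau K w)) w = f (w (min t (tau K w))) - f (w (min s (tau K w))) - (LBINT u:{s..t}. alive K u w * g (w (max 0 u)))"
  if "w : space Q" for w
  using stopped_drift[OF g that st] by simp
 ultimately show ?thesis
  using bi_cong[of Q Q "%w. Y w * (?U (min t (tau K w)) w - ?U (min s (tau K w)) w)"
  "%w. Y w * (f (w (min t (tau K w))) - f (w (min s (tau K w))) - (LBINT u:{s..t}. alive K u w * g (w (max 0 u))))"] by simp
qed

lemma joint_stopped_measurable:
 fixes g :: "fmeasure => real"
 assumes g: "g : bmeas pair_sigma"
 shows "(%(w, u). g (w (min (max 0 u) (tau K w)))) : bmeas (Q \<Otimes>\<^sub>M borel)"
proof -
 have "(%z. (fst z, min (max 0 (snd z)) (tau K (fst z)))) : Q \<Otimes>\<^sub>M borel \<rightarrow>\<^sub>M Q \<Otimes>\<^sub>M (borel :: real measure)"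
  using measurable_compose[OF measurable_fst tau_measurable] by measurable
 from measurable_compose[OF this joint_measurable[OF g]]
 have "(%z. g ((fst z) (max 0 (min (max 0 (snd z)) (tau K (fst z)))))) : bmeas (Q \<Otimes>\<^sub>M borel)"
  by simp
 moreover have "max 0 (min (max 0 (snd z)) (tau K (fst z))) = min (max 0 (snd z)) (tau K (fst z))"
  if "z : space (Q \<Otimes>\<^sub>M (borel :: real measure))" for z
  using tau_nonneg[of "fst z"] that by (auto simp: space_pair_measure)
 ultimately show ?thesis unfolding case_prod_beta' by (simp cong: measurable_cong)
qed

lemma stopped_adapted:
 fixes g :: "fmeasure => real"
 assumes g: "g : bmeas pair_sigma" and u: "0 <= u"
 shows "(%w. g (w (min u (tau K w)))) : bmeas (pfilt u)"
proof -
 have "(%w. (w, min u (tau K w))) : pfilt u \<rightarrow>\<^sub>M pfilt u \<Otimes>\<^sub>M borel"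
  using min_tau_adapted[OF u] by measurable
 from measurable_compose[OF this joint_measurable_upto[OF g u]]
 have "(%w. g (w (max 0 (min (min u (tau K w)) u)))) : bmeas (pfilt u)" by simp
 moreover have "max 0 (min (min u (tau K w)) u) = min u (tau K w)" if "w : space (pfilt u)" for w
  using tau_nonneg[of w] that u by (auto simp: space_F)
 ultimately show ?thesis by (simp cong: measurable_cong)
qed

lemma joint_cut_measurable:
 fixes g :: "fmeasure => real"
 assumes g: "g : bmeas pair_sigma"
 shows "(%(w, u). alive K u w * g (w (max 0 u))) : bmeas (Q \<Otimes>\<^sub>M borel)"
proof -
 have [measurable]: "(%z. tau K (fst z)) : bmeas (Q \<Otimes>\<^sub>M (borel :: real measure))"
  by (rule measurable_compose[OF measurable_fst tau_measurable])
 have [measurable]: "(%z. g ((fst z) (max 0 (snd z)))) : bmeas (Q \<Otimes>\<^sub>M borel)"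
  using joint_measurable[OF g] by (simp add: case_prod_beta')
 show ?thesis unfolding case_prod_beta' alive_def by measurable
qed

lemma stopped_increment_measurable:
 fixes f g :: "fmeasure => real"
 assumes f: "f : bmeas pair_sigma" and g: "g : bmeas pair_sigma"
  and st: "0 <= s" "s <= t"
 shows "(%w. f (w (min t (tau K w))) - f (w (min s (tau K w)))
  - (LBINT u:{s..t}. alive K u w * g (w (max 0 u)))) : bmeas Q"
proof -
 have t: "0 <= t" using st by simp
 have eqs: "sets (Q \<Otimes>\<^sub>M lborel) = sets (Q \<Otimes>\<^sub>M (borel :: real measure))"
  by (intro sets_pair_measure_cong) auto
 have "(%z. ind {s..t} (snd z) *\<^sub>R (alive K (snd z) (fst z) * g ((fst z) (max 0 (snd z))))) : bmeas (Q \<Otimes>\<^sub>M borel)"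
  by (intro borel_measurable_scaleR measurable_compose[OF measurable_snd borel_measurable_indicator])
  (use joint_cut_measurable[OF g] in \<open>auto simp: case_prod_beta'\<close>)
 then have "(%(w, u). ind {s..t} u *\<^sub>R (alive K u w * g (w (max 0 u)))) : bmeas (Q \<Otimes>\<^sub>M lborel)"
  unfolding measurable_cong_sets[OF eqs refl] by (simp add: case_prod_beta')
 then have "(%w. LBINT u:{s..t}. alive K u w * g (w (max 0 u))) : bmeas Q"
  unfolding set_lebesgue_integral_def
  by (rule lborel.borel_measurable_lebesgue_integral[where f = "%w u. ind {s..t} u *\<^sub>R (alive K u w * g (w (max 0 u)))"])
 then show ?thesis
  by (intro borel_measurable_diff F_P[OF stopped_adapted[OF f]] st t)
qed

lemma cut_bound:
 assumes g: "tame p c g" and w: "w : space Q"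
 shows "abs (alive K u w * g (w (max 0 u))) <= c * (1 + K ^ p)"
proof (cases "max 0 u < tau K w")
 case True
 then have "mass (w (max 0 u)) <= K"
  using tau_iff[OF w, of "max 0 u"] mass_le_D[OF w, of "max 0 u" "max 0 u"] by simp
 then have "c * (1 + mass (w (max 0 u)) ^ p) <= c * (1 + K ^ p)"
  using tameD(2)[OF g] mass_nonneg by (intro mult_left_mono add_left_mono power_mono) auto
 then show ?thesis using alive_1[OF True] tameD(3)[OF g, of "w (max 0 u)"] by simp
next
 case False
 then show ?thesis using alive_0[OF False] tameD(2)[OF g] K by simp
qed

end

end

section \<open>Ito's formula for stopped cylinder functions\<close>

definition pv :: "nat => (nat => real => real) => fmeasure => nat => real" where
 "pv n phi nu = (\<lambda>i\<in>{..<n}. pairing (phi i) nu)"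

lemma pv_measurable:
 fixes q :: "(nat => real) => real"
 assumes "continuous_on (Rn n) q" "!!i. i < n ==> phi i : C2_real"
 shows "(%nu. q (pv n phi nu)) : bmeas pair_sigma"
 unfolding pv_def by (intro Rn_comp_measurable assms measurable_pairing C2_realD)

context path_setting
begin

text \<open>What Ito's formula predicts for the generator on a cylinder function;
  \<open>generator_cylinder\<close> proves that it is the generator.\<close>

definition cylG :: "nat => ((nat => real) => real) => (nat => real => real) => fmeasure => real" where
 "cylG n f phi nu = (SUM i<n. pder i f (pv n phi nu) * drift (phi i) nu) +
  1/2 * (SUM i<n. SUM j<n. pder j (pder i f) (pv n phi nu) * \<Gamma> (phi i) (phi j) nu)"

lemma cylG_measurable:
 assumes f: "C2_loc n f" and phi: "!!i. i < n ==> phi i : C2_real"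
 shows "cylG n f phi : bmeas pair_sigma"
 unfolding cylG_def[abs_def]
 by (intro borel_measurable_add borel_measurable_times borel_measurable_sum borel_measurable_const
  pv_measurable C2_locD[OF f] tm_measurable[OF tm_drift] tm_measurable[OF tm_\<Gamma>] phi) auto

end

text \<open>The bracket side recast as martingale problems for pairings and their squares. In the
  application \<open>moment2\<close> comes from \<open>second_moment\<close>.\<close>

locale solved = path_setting +
 assumes init: "AE w in Q. w 0 = \<mu>"
  and lin: "!!phi. phi : C2_real ==> MP (pairing phi) (drift phi)"
  and quad: "!!phi. phi : C2_real ==>
  MP (%nu. (pairing phi nu)^2) (%nu. 2 * (pairing phi nu * drift phi nu) + \<Gamma> phi phi nu)"
  and moment2: "moment 2"
begin

text \<open>Apply \<open>quad\<close> to the sum and to the difference of phi and psi; bilinearity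
  and symmetry of \<open>\<Gamma>\<close> leave four times the mixed term.\<close>

lemma polarised:
 assumes phi: "phi : C2_real" and psi: "psi : C2_real"
 shows "MP (%nu. pairing phi nu * pairing psi nu)
  (%nu. pairing phi nu * drift psi nu + pairing psi nu * drift phi nu + \<Gamma> phi psi nu)"
proof -
 note P = C2_realD(1)[OF phi] C2_realD(1)[OF psi] and P' = C2_realD(2)[OF phi] C2_realD(2)[OF psi]
  and P'' = C2_realD(3)[OF phi] C2_realD(3)[OF psi]
 let ?p = "%x. phi x + psi x" and ?m = "%x. phi x - psi x"
 let ?G = "%eta nu. 2 * (pairing eta nu * drift eta nu) + \<Gamma> eta eta nu"
 have tG: "tm 2 (?G eta)" if "eta : C2_real" for eta
  using tm_mult[OF tm_pairing[OF C2_realD(1)[OF that]] tm_drift[OF that]]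
  by (intro tm_add tm_cmult tm_\<Gamma> that) (simp add: numeral_2_eq_2)
 have MP: "MP (%nu. (1/4) * ((pairing ?p nu)^2 - (pairing ?m nu)^2)) (%nu. (1/4) * (?G ?p nu - ?G ?m nu))"
  by (intro MP_cmult MP_diff'[OF quad quad tG tG] C2_real_add C2_real_diff phi psi)
 have pp: "pairing ?p nu = pairing phi nu + pairing psi nu" "pairing ?m nu = pairing phi nu - pairing psi nu" for nu
  by (rule pairing_add[OF P] pairing_diff[OF P])+
 have dd: "drift ?p nu = drift phi nu + drift psi nu" "drift ?m nu = drift phi nu - drift psi nu" for nu
  unfolding drift_def C2_real_add(3)[OF phi psi] C2_real_diff(3)[OF phi psi] pairing_add[OF P''] pairing_diff[OF P'']
  by (simp_all add: algebra_simps)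
 have GG: "\<Gamma> ?p ?p nu - \<Gamma> ?m ?m nu = 4 * \<Gamma> phi psi nu" for nu
 proof -
  have a: "(%x. deriv phi x + deriv psi x) : Cb UNIV" "(%x. deriv phi x - deriv psi x) : Cb UNIV"
  by (intro Cb_add Cb_diff P')+
  have c1: "covar (%x. deriv phi x + deriv psi x) (%x. deriv phi x + deriv psi x) nu =
  covar (deriv phi) (deriv phi) nu + 2 * covar (deriv phi) (deriv psi) nu + covar (deriv psi) (deriv psi) nu"
  unfolding covar_add_left[OF P' a(1)] covar_sym[OF P'(1) a(1)] covar_sym[OF P'(2) a(1)]
  unfolding covar_add_left[OF P' P'(1)] covar_add_left[OF P' P'(2)] covar_sym[OF P'(2) P'(1)] by simp
  have c2: "covar (%x. deriv phi x - deriv psi x) (%x. deriv phi x - deriv psi x) nu =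
  covar (deriv phi) (deriv phi) nu - 2 * covar (deriv phi) (deriv psi) nu + covar (deriv psi) (deriv psi) nu"
  unfolding covar_diff_left[OF P' a(2)] covar_sym[OF P'(1) a(2)] covar_sym[OF P'(2) a(2)]
  unfolding covar_diff_left[OF P' P'(1)] covar_diff_left[OF P' P'(2)] covar_sym[OF P'(2) P'(1)] by simp
  have s: "pairing (%x. \<sigma> x * (?p x * ?p x)) nu - pairing (%x. \<sigma> x * (?m x * ?m x)) nu = 4 * pairing (%x. \<sigma> x * (phi x * psi x)) nu"
  proof -
  have "pairing (%x. \<sigma> x * (?p x * ?p x)) nu - pairing (%x. \<sigma> x * (?m x * ?m x)) nu =
  pairing (%x. \<sigma> x * (?p x * ?p x) - \<sigma> x * (?m x * ?m x)) nu"
  by (rule pairing_diff[symmetric]; intro Cb_mult Cb_add Cb_diff \<sigma>_Cb P)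
  also have "(%x. \<sigma> x * (?p x * ?p x) - \<sigma> x * (?m x * ?m x)) = (%x. 4 * (\<sigma> x * (phi x * psi x)))"
  by (rule ext) (simp add: algebra_simps)
  finally show ?thesis by (simp only: pairing_cmult)
  qed
  show ?thesis unfolding \<Gamma>_def C2_real_add(2)[OF phi psi] C2_real_diff(2)[OF phi psi] c1 c2 using s by simp
 qed
 have f: "(%nu. (1/4) * ((pairing ?p nu)^2 - (pairing ?m nu)^2)) = (%nu. pairing phi nu * pairing psi nu)"
  by (rule ext) (simp add: pp power2_eq_square algebra_simps)
 have g: "(1/4) * (?G ?p nu - ?G ?m nu) = pairing phi nu * drift psi nu + pairing psi nu * drift phi nu + \<Gamma> phi psi nu" for nu
  using GG[of nu] unfolding pp dd by (simp add: algebra_simps)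
 show ?thesis using MP unfolding f g .
qed

text \<open>Instance of \<open>bounded_ito\<close> for the stopped pairings: \<open>lin\<close>
  gives \<open>m1\<close>, \<open>polarised\<close> gives \<open>m2\<close>, and up to the level K
  everything is bounded.\<close>

lemma stopped_ito:
 assumes K: "0 < K" "mass \<mu> <= K" and f: "C2_loc n f" and phi: "!!i. i < n ==> phi i : C2_real"
  and st: "0 <= s" "s <= t" and A: "A : sets (pfilt s)"
 shows "(LINT w|Q. indicator A w * (f (pv n phi (w (min t (tau K w)))) - f (pv n phi (w (min s (tau K w))))
  - (LBINT u:{s..t}. alive K u w * cylG n f phi (w (max 0 u))))) = 0"
proof -
 \<comment> \<open>\<open>bounded_ito\<close> wants bounds on the whole space, while the initial
   mass is at most K only almost surely. The factor H removes the exceptional paths, is known at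
   time 0 and equals 1 almost surely.\<close>
 define H where "H w = (if mass (w 0) <= K then 1 else (0::real))" for w :: "real => fmeasure"
 define X where "X i u w = H w * pairing (phi i) (w (min (max 0 u) (tau K w)))" for i u w
 define b where "b i u w = alive K u w * drift (phi i) (w (max 0 u))" for i u w
 define a where "a i j u w = alive K u w * \<Gamma> (phi i) (phi j) (w (max 0 u))" for i j u w
 have m1: "moment 1" by (rule moment_mono[OF moment2]) simp
 have tp: "tm 1 (pairing (phi i))" and td: "tm 1 (drift (phi i))" if "i < n" for i
  using tm_pairing[OF C2_realD(1)[OF phi[OF that]]] tm_drift[OF phi[OF that]] by auto
 have tg: "tm 2 (\<Gamma> (phi i) (phi j))" if "i < n" "j < n" for i j using tm_\<Gamma>[OF phi phi] that by simp
 have "EX c. i < n --> tame 1 c (pairing (phi i))" for i using tp unfolding tm_def by blast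
 then obtain cp where cp: "!!i. i < n ==> tame 1 (cp i) (pairing (phi i))" by metis
 have "EX c. i < n --> tame 1 c (drift (phi i))" for i using td unfolding tm_def by blast
 then obtain cd where cd: "!!i. i < n ==> tame 1 (cd i) (drift (phi i))" by metis
 have "EX c. i < n --> j < n --> tame 2 c (\<Gamma> (phi i) (phi j))" for i j using tg unfolding tm_def by blast
 then obtain cg where cg: "!!i j. i < n ==> j < n ==> tame 2 (cg i j) (\<Gamma> (phi i) (phi j))" by metis
 define C where "C = (SUM i<n. abs (cp i) + abs (cd i) + (SUM j<n. abs (cg i j)))"
 have Ci: "abs (cp i) + abs (cd i) + (SUM j<n. abs (cg i j)) <= C" if "i < n" for i
  unfolding C_def using that
  by (intro member_le_sum[of i "{..<n}" "%i. abs (cp i) + abs (cd i) + (SUM j<n. abs (cg i j))"]) (auto intro!: add_nonneg_nonneg sum_nonneg)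
 have C0: "0 <= C" unfolding C_def by (intro sum_nonneg add_nonneg_nonneg) auto
 have cgC: "cg i j <= C" "cp i <= C" "cd i <= C" if "i < n" "j < n" for i j
 proof -
  have "abs (cg i j) <= (SUM j<n. abs (cg i j))" using that by (intro member_le_sum) auto
  then show "cg i j <= C" "cp i <= C" "cd i <= C" using Ci[OF that(1)] by linarith+
 qed
 have HF: "H : bmeas (pfilt u)" if "0 <= u" for u
  unfolding H_def[abs_def] using functional_adapted[OF mass_measurable order_refl that] by measurable
 have pc: "continuous_on {0..} (%u. pairing (phi i) (w u))" if "w : space Q" "i < n" for w i
  by (rule pairing_path_continuous[OF that(1) C2_realD(1)[OF phi[OF that(2)]]])
 have pm: "pairing (phi i) : bmeas pair_sigma" if "i < n" for i by (rule tm_measurable[OF tp[OF that]])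
 have HB: "H : Bd" by (rule BdI[OF F_P[OF HF[OF order_refl]], of 1]) (simp add: H_def)
 have HH: "H w * H w = H w" for w by (simp add: H_def)
 \<comment> \<open>A path that is still alive had initial mass below K.\<close>
 have cutH: "H w * alive K u w = alive K u w" if w: "w : space Q" for u w
 proof (cases "max 0 u < tau K w")
  case True
  then have "mass (w 0) <= K"
  using tau_iff[OF K(1) w, of "max 0 u"] mass_le_D[OF w, of 0 "max 0 u"] by simp
  then show ?thesis by (simp add: H_def)
 qed (simp add: alive_0)
 interpret I: bounded_ito Q pfilt n X b a "C * (1 + K)" "C * (1 + K) + C * (1 + K ^ 2)"
 proof
  show "0 <= C * (1 + K)" "0 <= C * (1 + K) + C * (1 + K ^ 2)" using C0 K by simp_all
  show "X i u : bmeas (pfilt u)" if "i < n" "0 <= u" for i u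
  unfolding X_def[abs_def] using HF[OF that(2)] stopped_adapted[OF K(1) pm[OF that(1)] that(2)] that(2)
  by (intro borel_measurable_times) (simp_all add: max_absorb2)
  show "(%(w, u). X i u w) : bmeas (Q \<Otimes>\<^sub>M borel)" if "i < n" for i
  unfolding X_def case_prod_beta'
  using joint_stopped_measurable[OF K(1) pm[OF that]] measurable_compose[OF measurable_fst F_P[OF HF[OF order_refl]]]
  by (intro borel_measurable_times) (simp_all add: case_prod_beta')
  show "continuous_on UNIV (%u. X i u w)" if "i < n" "w : space Q" for i w
  unfolding X_def using tau_nonneg[OF K(1) that(2)]
  by (intro continuous_on_mult continuous_on_const continuous_on_compose2[OF pc[OF that(2,1)]] continuous_intros) auto
  show "abs (X i u w) <= C * (1 + K)" if i: "i < n" and w: "w : space Q" for i u w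
  proof (cases "mass (w 0) <= K")
  case True
  have "mass (w (min (max 0 u) (tau K w))) <= K" by (rule mass_stopped_le[OF K(1) w True]) simp
  then have "cp i * (1 + mass (w (min (max 0 u) (tau K w))) ^ 1) <= C * (1 + K)"
  using cgC(2)[OF i i] C0 tameD(2)[OF cp[OF i]] mass_nonneg by (intro mult_mono add_nonneg_nonneg) auto
  then have "abs (pairing (phi i) (w (min (max 0 u) (tau K w)))) <= C * (1 + K)"
  using tameD(3)[OF cp[OF i], of "w (min (max 0 u) (tau K w))"] by linarith
  then show ?thesis using True by (simp add: X_def H_def)
  next
  case False then show ?thesis using C0 K by (simp add: X_def H_def)
  qed
  show "(%(w, u). b i u w) : bmeas (Q \<Otimes>\<^sub>M borel)" if "i < n" for i
  unfolding b_def by (rule joint_cut_measurable[OF K(1) tm_measurable[OF td[OF that]]])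
  show "(%(w, u). a i j u w) : bmeas (Q \<Otimes>\<^sub>M borel)" if "i < n" "j < n" for i j
  unfolding a_def by (rule joint_cut_measurable[OF K(1) tm_measurable[OF tg[OF that]]])
  show "abs (b i u w) <= C * (1 + K) + C * (1 + K ^ 2)" if i: "i < n" and w: "w : space Q" for i u w
  proof -
  have "abs (b i u w) <= cd i * (1 + K ^ 1)" unfolding b_def by (rule cut_bound[OF K(1) cd[OF i] w])
  also have "... <= C * (1 + K)" using cgC(3)[OF i i] K by (simp add: mult_right_mono)
  also have "... <= C * (1 + K) + C * (1 + K ^ 2)" using C0 by simp
  finally show ?thesis .
  qed
  show "abs (a i j u w) <= C * (1 + K) + C * (1 + K ^ 2)" if i: "i < n" and j: "j < n" and w: "w : space Q" for i j u w
  proof -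
  have "abs (a i j u w) <= cg i j * (1 + K ^ 2)" unfolding a_def by (rule cut_bound[OF K(1) cg[OF i j] w])
  also have "... <= C * (1 + K ^ 2)" using cgC(1)[OF i j] by (simp add: mult_right_mono)
  also have "... <= C * (1 + K) + C * (1 + K ^ 2)" using C0 K by simp
  finally show ?thesis .
  qed
 next
  fix i s t Y assume i: "i < n" and st: "0 <= s" "s <= t" and Y: "Y : bmeas (pfilt s)" "Y : Bd"
  let ?E = "%w. pairing (phi i) (w (min t (tau K w))) - pairing (phi i) (w (min s (tau K w))) - (LBINT u:{s..t}. alive K u w * drift (phi i) (w (max 0 u)))"
  have main: "(LINT w|Q. (Y w * H w) * ?E w) = 0"
  by (rule stopped_MP[OF K(1) lin[OF phi[OF i]] tp[OF i] td[OF i] m1 pc[OF _ i] st])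
  (use Y HF[OF st(1)] HB in \<open>auto intro: Bd_mult\<close>)
  have e: "Y w * (X i t w - X i s w - (LBINT u:{s..t}. b i u w)) = (Y w * H w) * ?E w" if w: "w : space Q" for w
  proof -
  have "(LBINT u:{s..t}. b i u w) = (LBINT u:{s..t}. H w * (alive K u w * drift (phi i) (w (max 0 u))))"
  unfolding b_def by (simp only: mult.assoc[symmetric] cutH[OF w])
  also have "... = H w * (LBINT u:{s..t}. alive K u w * drift (phi i) (w (max 0 u)))" by simp
  finally show ?thesis using st by (simp add: X_def algebra_simps)
  qed
  show "(LINT w|Q. Y w * (X i t w - X i s w - (LBINT u:{s..t}. b i u w))) = 0"
  by (rule trans[OF bi_cong[OF refl e] main])
 next
  fix i j s t Y assume i: "i < n" and j: "j < n" and st: "0 <= s" "s <= t" and Y: "Y : bmeas (pfilt s)" "Y : Bd"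
  let ?G = "%nu. pairing (phi i) nu * drift (phi j) nu + pairing (phi j) nu * drift (phi i) nu + \<Gamma> (phi i) (phi j) nu"
  let ?F = "%nu. pairing (phi i) nu * pairing (phi j) nu"
  let ?E = "%w. ?F (w (min t (tau K w))) - ?F (w (min s (tau K w))) - (LBINT u:{s..t}. alive K u w * ?G (w (max 0 u)))"
  have tF: "tm 2 ?F" using tm_mult[OF tp[OF i] tp[OF j]] by (simp add: numeral_2_eq_2)
  have tG: "tm 2 ?G"
  using tm_mult[OF tp[OF i] td[OF j]] tm_mult[OF tp[OF j] td[OF i]] tg[OF i j]
  by (intro tm_add) (simp_all add: numeral_2_eq_2)
  have main: "(LINT w|Q. (Y w * H w) * ?E w) = 0"
  by (rule stopped_MP[OF K(1) polarised[OF phi[OF i] phi[OF j]] tF tG moment2 _ st])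
  (use Y HF[OF st(1)] HB pc[OF _ i] pc[OF _ j] in \<open>auto intro: Bd_mult continuous_on_mult\<close>)
  have e: "Y w * (X i t w * X j t w - X i s w * X j s w - (LBINT u:{s..t}. X i u w * b j u w + X j u w * b i u w + a i j u w)) = (Y w * H w) * ?E w"
  if w: "w : space Q" for w
  proof -
  have e: "X i u w * b j u w + X j u w * b i u w + a i j u w = H w * (alive K u w * ?G (w (max 0 u)))" for u
  proof (cases "max 0 u < tau K w")
  case True
  then have "min (max 0 u) (tau K w) = max 0 u" by simp
  moreover have "H w = 1" using cutH[OF w, of u] alive_1[OF True] by simp
  ultimately show ?thesis unfolding X_def b_def a_def using alive_1[OF True] by simp
  qed (simp add: b_def a_def alive_0)
  have "(LBINT u:{s..t}. X i u w * b j u w + X j u w * b i u w + a i j u w) = H w * (LBINT u:{s..t}. alive K u w * ?G (w (max 0 u)))"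
  unfolding e by simp
  moreover have "X i v w * X j v w = H w * ?F (w (min v (tau K w)))" if "0 <= v" for v
  proof -
  have "X i v w * X j v w = (H w * H w) * ?F (w (min v (tau K w)))" using that by (simp add: X_def)
  then show ?thesis by (simp only: HH)
  qed
  ultimately show ?thesis using st by (simp add: right_diff_distrib)
  qed
  show "(LINT w|Q. Y w * (X i t w * X j t w - X i s w * X j s w - (LBINT u:{s..t}. X i u w * b j u w + X j u w * b i u w + a i j u w))) = 0"
  by (rule trans[OF bi_cong[OF refl e] main])
 qed
 let ?L = "%w. f (pv n phi (w (min t (tau K w)))) - f (pv n phi (w (min s (tau K w))))
  - (LBINT u:{s..t}. alive K u w * cylG n f phi (w (max 0 u)))"
 let ?R = "%w. f (I.xv t w) - f (I.xv s w) - (LBINT u:{s..t}.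
  (SUM i<n. pder i f (I.xv u w) * b i u w) +
  1/2 * (SUM i<n. SUM j<n. pder j (pder i f) (I.xv u w) * a i j u w))"
 have Am: "ind A : bmeas (pfilt s)" using A by (rule borel_measurable_indicator)
 have AB: "ind A : Bd" by (rule BdI[OF F_P[OF Am], of 1]) (simp add: indicator_def)
 have YF: "(%w. ind A w * H w) : bmeas (pfilt s)"
  using Am HF[OF st(1)] by (rule borel_measurable_times)
 have ito: "(LINT w|Q. ind A w * H w * ?R w) = 0"
  by (rule I.ito[OF st f YF Bd_mult[OF AB HB]])
 have eq: "ind A w * H w * ?R w = ind A w * H w * ?L w" for w
 proof (cases "mass (w 0) <= K")
  case True
  have H1: "H w = 1" using True by (simp add: H_def)
  have xv: "I.xv u w = pv n phi (w (min (max 0 u) (tau K w)))" for u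
  unfolding I.xv_def pv_def X_def H1 by simp
  have "(SUM i<n. pder i f (I.xv u w) * b i u w) + 1/2 * (SUM i<n. SUM j<n. pder j (pder i f) (I.xv u w) * a i j u w)
  = alive K u w * cylG n f phi (w (max 0 u))" for u
  proof (cases "max 0 u < tau K w")
  case True
  then have "min (max 0 u) (tau K w) = max 0 u" "alive K u w = 1" using alive_1[OF True] by simp_all
  then show ?thesis unfolding xv b_def a_def cylG_def by simp
  qed (simp add: b_def a_def alive_0)
  then show ?thesis using st unfolding xv by (simp add: max_absorb2)
 qed (simp add: H_def)
 have Lm: "?L : bmeas Q"
  by (rule stopped_increment_measurable[OF K(1) pv_measurable[OF C2_locD(1)[OF f] phi] cylG_measurable[OF f phi] st])
 have "(LINT w|Q. ind A w * ?L w) = (LINT w|Q. ind A w * H w * ?L w)"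
 proof (rule integral_cong_AE)
  show "(%w. ind A w * ?L w) : bmeas Q"
  "(%w. ind A w * H w * ?L w) : bmeas Q"
  by (intro borel_measurable_times F_P[OF Am] F_P[OF HF[OF order_refl]] Lm)+
  show "AE w in Q. ind A w * ?L w = ind A w * H w * ?L w"
  using init
  proof eventually_elim
  case (elim w)
  then have "H w = 1" using K by (simp add: H_def)
  then show ?case by simp
  qed
 qed
 then show ?thesis using ito unfolding eq by simp
qed

end

section \<open>Powers and products of coordinates, and all moments of the mass\<close>

lemma continuous_on_coordinate: "continuous_on S (%x :: nat => real. x i)"
 by (rule continuous_on_subset[OF continuous_on_product_coordinates]) simp

lemma continuous_on_coordinate_fun:
 assumes "continuous_on UNIV (g :: real => real)"
 shows "continuous_on S (%x :: nat => real. g (x i))"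
 by (rule continuous_on_compose2[OF assms continuous_on_coordinate]) simp

lemma pderivative_coordinate:
 "pder j (%x. g (x i)) = (%x. if j = i then deriv g (x i) else 0)"
 by (auto simp: pderivative_def fun_eq_iff)

lemma pdifferentiable_coordinate:
 assumes "!!y. g field_differentiable at y"
 shows "pdifferentiable j (%x. g (x i)) x"
 unfolding pdifferentiable_def using assms by (cases "j = i") auto

lemma C2_loc_power: "C2_loc 1 (%x. x 0 ^ p)"
 and pderivative_power: "pder 0 (%x. x 0 ^ p) = (%x. real p * x 0 ^ (p - 1))"
 and pderivative2_power: "pder 0 (pder 0 (%x. x 0 ^ p)) = (%x. real p * (real (p - 1) * x 0 ^ (p - 2)))"
proof -
 have d: "deriv (%y::real. y ^ q) y = real q * y ^ (q - 1)" for q y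
  by (rule DERIV_imp_deriv) (auto intro!: derivative_eq_intros)
 have fd: "(%y::real. c * y ^ q) field_differentiable at y" for c q y
  by (intro field_differentiable_mult field_differentiable_const field_differentiable_power field_differentiable_ident)
 show 1: "pder 0 (%x. x 0 ^ p) = (%x. real p * x 0 ^ (p - 1))"
  using pderivative_coordinate[of 0 "%y. y ^ p" 0] by (simp add: d)
 have d2: "deriv (%y::real. real p * y ^ (p - 1)) y = real p * (real (p - 1) * y ^ (p - 2))" for y
  by (rule DERIV_imp_deriv) (auto intro!: derivative_eq_intros simp: numeral_2_eq_2)
 show 2: "pder 0 (pder 0 (%x. x 0 ^ p)) = (%x. real p * (real (p - 1) * x 0 ^ (p - 2)))"
  unfolding 1 using pderivative_coordinate[of 0 "%y. real p * y ^ (p - 1)" 0] by (simp add: d2[unfolded One_nat_def])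
 show "C2_loc 1 (%x. x 0 ^ p)"
  unfolding C2_loc_def using pdifferentiable_coordinate[OF fd[of 1 p], of 0 0] pdifferentiable_coordinate[OF fd[of "real p" "p - 1"], of 0 0]
  by (auto simp: 1 2[unfolded 1 One_nat_def] intro!: continuous_intros continuous_on_coordinate)
qed

lemma pderivative_prod:
 fixes S :: "nat set"
 assumes "finite S"
 shows "pder j (%x. \<Prod>i\<in>S. x i) = (%x. if j : S then (\<Prod>i\<in>S - {j}. x i) else 0)"
  and "pdifferentiable j (%x. \<Prod>i\<in>S. x i) x"
proof -
 have eq: "(%u. \<Prod>i\<in>S. (x(j := u)) i) = (if j : S then (%u. u * (\<Prod>i\<in>S - {j}. x i)) else (%u. \<Prod>i\<in>S. x i))" for x :: "nat => real"
 proof (cases "j : S")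
  case True
  have "(\<Prod>i\<in>S. (x(j := u)) i) = u * (\<Prod>i\<in>S - {j}. x i)" for u
  proof -
  have "(\<Prod>i\<in>S - {j}. (x(j := u)) i) = (\<Prod>i\<in>S - {j}. x i)" by (rule prod.cong) auto
  then show ?thesis using prod.remove[OF assms True, of "x(j := u)"] by (simp del: fun_upd_apply) simp
  qed
  then show ?thesis using True by simp
 next
  case False
  then have "(\<Prod>i\<in>S. (x(j := u)) i) = (\<Prod>i\<in>S. x i)" for u by (intro prod.cong) auto
  then show ?thesis using False by simp
 qed
 show "pder j (%x. \<Prod>i\<in>S. x i) = (%x. if j : S then (\<Prod>i\<in>S - {j}. x i) else 0)"
 proof (rule ext)
  fix x
  show "pder j (%x. \<Prod>i\<in>S. x i) x = (if j : S then (\<Prod>i\<in>S - {j}. x i) else 0)"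
  unfolding pderivative_def eq by (auto intro!: DERIV_imp_deriv derivative_eq_intros)
 qed
 show "pdifferentiable j (%x. \<Prod>i\<in>S. x i) x"
  unfolding pdifferentiable_def eq
  by (auto intro!: field_differentiable_mult field_differentiable_const field_differentiable_ident)
qed

lemma C2_loc_prod: "C2_loc n (%x. \<Prod>i<n. x i)"
 unfolding C2_loc_def
proof (intro conjI allI impI ballI)
 have c: "continuous_on (Rn n) (%x. \<Prod>i\<in>S. x i)" for S
  by (intro continuous_on_prod continuous_on_coordinate)
 show "continuous_on (Rn n) (%x. \<Prod>i<n. x i)" by (rule c)
 fix i assume i: "i < n"
 have p: "pder i (%x. \<Prod>i<n. x i) = (%x. \<Prod>l\<in>{..<n} - {i}. x l)"
  using i by (simp add: pderivative_prod(1))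
 show "pdifferentiable i (%x. \<Prod>i<n. x i) x" for x by (rule pderivative_prod(2)) simp
 show "continuous_on (Rn n) (pder i (%x. \<Prod>i<n. x i))" unfolding p by (rule c)
 fix j assume "j < n"
 show "pdifferentiable j (pder i (%x. \<Prod>i<n. x i)) x" for x unfolding p by (rule pderivative_prod(2)) simp
 have "pder j (pder i (%x. \<Prod>i<n. x i)) = (if j : {..<n} - {i} then (%x. \<Prod>l\<in>{..<n} - {i} - {j}. x l) else (%_. 0))"
  unfolding p by (subst pderivative_prod(1)) auto
 then show "continuous_on (Rn n) (pder j (pder i (%x. \<Prod>i<n. x i)))"
  using c by (auto simp: continuous_on_const)
qed

context path_setting
begin

lemma drift_one: "drift (%_. 1) nu = 0"
 by (simp add: drift_def pairing_def)

lemma \<Gamma>_one: "\<Gamma> (%_. 1) (%_. 1) nu = pairing \<sigma> nu"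
 by (simp add: \<Gamma>_def covar_def case_prod_beta')

end

context solved
begin

lemma tau_eventually:
 assumes "w : space Q" "0 <= t"
 shows "\<forall>\<^sub>F k in sequentially. t < tau (real k + mass \<mu> + 1) w"
proof -
 have "\<forall>\<^sub>F k in sequentially. max t (D t w) < real k"
  by (rule filterlim_real_sequentially[unfolded filterlim_at_top_dense, rule_format])
 then show ?thesis
 proof eventually_elim
  case (elim k)
  have K: "0 < real k + mass \<mu> + 1" using mass_nonneg[of \<mu>] by linarith
  show ?case unfolding tau_iff[OF K assms] using elim mass_nonneg[of \<mu>] by auto
 qed
qed

text \<open>On each path the stopped expression equals the unstopped one as soon as K exceeds both t
  and the supremum of the mass. \<open>D\<close> dominates the stopped expressions, so the stopping
  can be removed.\<close>

lemma MP_cyl_of_moment: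
 assumes f: "C2_loc n f" and phi: "!!i. i < n ==> phi i : C2_real"
  and tF: "tm p (%nu. f (pv n phi nu))" and tG: "tm p (cylG n f phi)" and m: "moment p"
 shows "MP (%nu. f (pv n phi nu)) (cylG n f phi)"
proof -
 let ?F = "%nu. f (pv n phi nu)" and ?G = "cylG n f phi"
 obtain c where c: "tame p c ?F" using tF by (auto simp: tm_def)
 obtain d where d: "tame p d ?G" using tG by (auto simp: tm_def)
 show ?thesis
  unfolding MP_iff[OF c d m]
 proof (intro allI impI)
  fix s t A assume st: "0 <= s" "s <= t" and A: "A : sets (pfilt s)"
  have t: "0 <= t" using st by simp
  have AQ: "A : sets Q" using A sub[of s] by (auto simp: subalgebra_def)
  \<comment> \<open>Positive and at least \<open>mass \<mu>\<close>, as \<open>stopped_ito\<close>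
    requires, and tending to infinity.\<close>
  define K where "K k = real k + mass \<mu> + 1" for k
  have K: "0 < K k" "mass \<mu> <= K k" for k using mass_nonneg[of \<mu>] by (auto simp: K_def)
  let ?L = "%k w. ?F (w (min t (tau (K k) w))) - ?F (w (min s (tau (K k) w))) - (LBINT u:{s..t}. alive (K k) u w * ?G (w (max 0 u)))"
  let ?I = "%w. ?F (w t) - ?F (w s) - (LBINT u:{s..t}. ?G (w u))"
  have Lm: "?L k : bmeas Q" for k
  by (rule stopped_increment_measurable[OF K(1) tameD(1)[OF c] tameD(1)[OF d] st])
  have lim: "(%k. ?L k w) ~~> ?I w" if w: "w : space Q" for w
  proof (rule tendsto_eventually)
  show "\<forall>\<^sub>F k in sequentially. ?L k w = ?I w"
  using tau_eventually[OF w t, folded K_def]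
  proof eventually_elim
  case (elim k)
  have "(LBINT u:{s..t}. alive (K k) u w * ?G (w (max 0 u))) = (LBINT u:{s..t}. ?G (w (max 0 u)))"
  unfolding set_lebesgue_integral_def
  proof (rule bi_cong[OF refl])
  fix u
  have "alive (K k) u w = 1" if "u : {s..t}" by (rule alive_1) (use that elim st in auto)
  then show "ind {s..t} u *\<^sub>R (alive (K k) u w * ?G (w (max 0 u))) = ind {s..t} u *\<^sub>R ?G (w (max 0 u))"
  by (simp add: indicator_def)
  qed
  also have "... = (LBINT u:{s..t}. ?G (w u))" by (rule drift_clip[OF st(1), symmetric])
  finally show ?case using elim st by simp
  qed
  qed
  have bd: "abs (?L k w) <= (2 * c + d * (t - s)) * (1 + D t w ^ p)" if w: "w : space Q" for k w
  proof -
  have "abs (?F (w (min v (tau (K k) w)))) <= c * (1 + D t w ^ p)" if "0 <= v" "v <= t" for v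
  by (rule tame_path_bound[OF c w]) (use that tau_nonneg[OF K(1) w, of k] in auto)
  from this[OF t order_refl] this[OF st]
  have "abs (?F (w (min t (tau (K k) w)))) <= c * (1 + D t w ^ p)" "abs (?F (w (min s (tau (K k) w)))) <= c * (1 + D t w ^ p)" .
  moreover have "abs (LBINT u:{s..t}. alive (K k) u w * ?G (w (max 0 u))) <= d * (1 + D t w ^ p) * (t - s)"
  proof (rule set_integral_bounded_Icc[OF _ _ st(2)])
  show "(%u. alive (K k) u w * ?G (w (max 0 u))) : bmeas borel"
  using measurable_Pair2[OF joint_cut_measurable[OF K(1) tameD(1)[OF d]] w] by simp
  fix u assume u: "u : {s..t}"
  then have "max 0 u = u" "0 <= u" "u <= t" using st by auto
  then have "abs (?G (w (max 0 u))) <= d * (1 + D t w ^ p)" using tame_path_bound[OF d w] by simp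
  then show "abs (alive (K k) u w * ?G (w (max 0 u))) <= d * (1 + D t w ^ p)"
  using order_trans[OF abs_ge_zero] by (auto simp: alive_def)
  qed
  ultimately show ?thesis by (simp add: algebra_simps)
  qed
  have zero: "(LINT w|Q. indicator A w * ?L k w) = 0" for k
  by (rule stopped_ito[OF K f phi st A])
  have "(%k. \<integral>w. indicator A w * ?L k w \<partial>Q) ~~> (LINT w|Q. indicator A w * ?I w)"
  proof (rule integral_dominated_convergence[where w = "%w. (2 * c + d * (t - s)) * (1 + D t w ^ p)"])
  show "(%w. indicator A w * ?L k w) : bmeas Q" for k
  by (intro borel_measurable_times borel_measurable_indicator AQ Lm)
  show "(%w. indicator A w * ?I w) : bmeas Q"
  by (intro borel_measurable_times borel_measurable_indicator AQ borel_measurable_LIMSEQ_real[OF lim Lm])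
  show "integrable Q (%w. (2 * c + d * (t - s)) * (1 + D t w ^ p))" by (rule momentD[OF m t])
  show "AE w in Q. (%k. indicator A w * ?L k w) ~~> indicator A w * ?I w"
  by (intro AE_I2 tendsto_mult_left lim)
  show "AE w in Q. norm (indicator A w * ?L k w) <= (2 * c + d * (t - s)) * (1 + D t w ^ p)" for k
  proof (rule AE_I2)
  fix w assume w: "w : space Q"
  have "norm (indicator A w * ?L k w) <= abs (?L k w)" by (simp add: indicator_def)
  then show "norm (indicator A w * ?L k w) <= (2 * c + d * (t - s)) * (1 + D t w ^ p)" using bd[OF w, of k] by linarith
  qed
  qed
  from LIMSEQ_unique[OF this[unfolded zero] tendsto_const] show "(LINT w|Q. indicator A w * ?I w) = 0" .
 qed
qed

lemma mgle_mass: "mgle (%t w. mass (w t))"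
 using lin[OF C2_one(1)] unfolding MP_def drift_one mass_def by simp

text \<open>Ito's formula for the p-th power of the mass: the drift is
  \<open>p * (p - 1) / 2 * mass ^ (p - 2)\<close> times \<open>pairing \<sigma>\<close>, and
  \<open>pairing \<sigma> nu <= L * mass nu\<close> makes it of order p - 1, whose moments are
  bounded by e. The stopped identity bounds the stopped moment uniformly in the level, and Fatou's
  lemma removes the stopping.\<close>

lemma mass_moment_step:
 assumes p: "2 <= p" and T: "0 <= T" and e: "0 <= e"
  and IH: "!!u. 0 <= u ==> u <= T ==> integrable Q (%w. mass (w u) ^ (p - 1)) & (LINT w|Q. mass (w u) ^ (p - 1)) <= e"
 shows "\<exists>e'\<ge>0. ALL u. 0 <= u --> u <= T --> integrable Q (%w. mass (w u) ^ p) & (LINT w|Q. mass (w u) ^ p) <= e'"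
proof -
 let ?f = "%x :: nat => real. x 0 ^ p" and ?one = "%_ :: nat. %_ :: real. 1 :: real"
 obtain L where L: "0 <= L" "!!x. abs (\<sigma> x) <= L" using CbE[OF \<sigma>_Cb] by metis
 define C where "C = 1/2 * (real p * real (p - 1)) * L"
 have C0: "0 <= C" using L by (simp add: C_def)
 have pv1: "pv 1 ?one nu 0 = mass nu" for nu by (simp add: pv_def mass_def)
 have G: "cylG 1 ?f ?one nu = 1/2 * (real p * (real (p - 1) * mass nu ^ (p - 2))) * pairing \<sigma> nu" for nu
  unfolding cylG_def by (simp add: drift_one \<Gamma>_one pderivative2_power[simplified] pv1[simplified])
 have \<sigma>b: "0 <= pairing \<sigma> nu" "pairing \<sigma> nu <= L * mass nu" for nu
 proof -
  show "0 <= pairing \<sigma> nu" unfolding pairing_def by (intro bi_nonneg \<sigma>_nonneg)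
  show "pairing \<sigma> nu <= L * mass nu" using pairing_bound[OF Cb_measurable[OF \<sigma>_Cb] L(2), of nu] by linarith
 qed
 have G0: "0 <= cylG 1 ?f ?one nu" for nu
  unfolding G using \<sigma>b mass_nonneg by (intro mult_nonneg_nonneg) auto
 have GC: "cylG 1 ?f ?one nu <= C * mass nu ^ (p - 1)" for nu
 proof -
  have "cylG 1 ?f ?one nu <= 1/2 * (real p * (real (p - 1) * mass nu ^ (p - 2))) * (L * mass nu)"
  unfolding G using \<sigma>b mass_nonneg by (intro mult_left_mono mult_nonneg_nonneg) auto
  also have "... = C * (mass nu ^ (p - 2) * mass nu)" by (simp add: C_def mult_ac)
  also have "mass nu ^ (p - 2) * mass nu = mass nu ^ (p - 1)"
  using p power_Suc2[of "mass nu" "p - 2"] by (simp add: Suc_diff_Suc numeral_2_eq_2)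
  finally show ?thesis .
 qed
 have Gt: "tame (p - 1) C (cylG 1 ?f ?one)"
 proof (rule tameI)
  show "cylG 1 ?f ?one : bmeas pair_sigma" by (rule cylG_measurable[OF C2_loc_power C2_one(1)])
  show "abs (cylG 1 ?f ?one nu) <= C * (1 + mass nu ^ (p - 1))" for nu
  using G0[of nu] GC[of nu] C0 by (simp add: distrib_left)
 qed (rule C0)
 \<comment> \<open>The initial value plus the time integral of the drift, whose mean is at most C e
   at every time up to T.\<close>
 define e' where "e' = mass \<mu> ^ p + C * e * T"
 have e'0: "0 <= e'" using C0 e T mass_nonneg by (simp add: e'_def)
 have main: "integrable Q (%w. mass (w t) ^ p) & (LINT w|Q. mass (w t) ^ p) <= e'" if t: "0 <= t" "t <= T" for t
 proof -
  define K where "K k = real k + mass \<mu> + 1" for k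
  have K: "0 < K k" "mass \<mu> <= K k" for k using mass_nonneg[of \<mu>] by (auto simp: K_def)
  let ?S = "%k w. mass (w (min t (tau (K k) w))) ^ p"
  have Sm: "?S k : bmeas Q" for k
  by (intro borel_measurable_power F_P[OF stopped_adapted[OF K(1) mass_measurable t(1)]])
  have S: "integrable Q (?S k)" "(LINT w|Q. ?S k w) <= e'" for k
  proof -
  have Sb: "AE w in Q. abs (?S k w) <= K k ^ p"
  using init AE_space
  proof eventually_elim
  case (elim w)
  then have "mass (w 0) <= K k" using K(2)[of k] by simp
  from mass_stopped_le[OF K(1) elim(2) this t(1)]
  have "mass (w (min t (tau (K k) w))) <= K k" .
  from power_mono[OF this mass_nonneg, of p] show ?case by (simp add: mass_nonneg)
  qed
  show iS: "integrable Q (?S k)" using Sb Sm by (intro integrable_const_bound) auto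
  let ?g = "%w u. alive (K k) u w * cylG 1 ?f ?one (w (max 0 u))"
  have gi: "integrable Q (%w. ?g w u) & (LINT w|Q. abs (?g w u)) <= C * e" if "u : {0..t}" for u
  proof -
  have u: "max 0 u = u" "0 <= u" "u <= T" using that t by auto
  have b: "abs (?g w u) <= C * mass (w u) ^ (p - 1)" for w
  using GC[of "w u"] G0[of "w u"] by (auto simp: u alive_def)
  have iC: "integrable Q (%w. C * mass (w u) ^ (p - 1))" using IH[OF u(2,3)] by simp
  have i: "integrable Q (%w. ?g w u)"
  by (rule bib_bound[OF iC])
  (use measurable_Pair1[OF joint_cut_measurable[OF K(1) tameD(1)[OF Gt]], of u k] order_trans[OF b abs_ge_self] in auto)
  have "(LINT w|Q. abs (?g w u)) <= (LINT w|Q. C * mass (w u) ^ (p - 1))" using i iC b by (intro integral_mono) auto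
  also have "... <= C * e" using IH[OF u(2,3)] C0 by (simp add: mult_left_mono)
  finally show ?thesis using i by blast
  qed
  note fub = drift_fubini[OF joint_cut_measurable[OF K(1) tameD(1)[OF Gt]] t(1) gi]
  have z: "(LINT w|Q. indicator (space Q) w * (?S k w - mass (w 0) ^ p - (LBINT u:{0..t}. ?g w u))) = 0"
  proof -
  have "(LINT w|Q. ind (space Q) w * (?f (pv 1 ?one (w (min t (tau (K k) w)))) - ?f (pv 1 ?one (w (min 0 (tau (K k) w))))
  - (LBINT u:{0..t}. alive (K k) u w * cylG 1 ?f ?one (w (max 0 u))))) = 0"
  by (rule stopped_ito[OF K C2_loc_power C2_one(1) order_refl t(1)]) (metis sets.top space_F)
  moreover have "ind (space Q) w * (?f (pv 1 ?one (w (min t (tau (K k) w)))) - ?f (pv 1 ?one (w (min 0 (tau (K k) w))))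
  - (LBINT u:{0..t}. alive (K k) u w * cylG 1 ?f ?one (w (max 0 u)))) =
  indicator (space Q) w * (?S k w - mass (w 0) ^ p - (LBINT u:{0..t}. ?g w u))" if "w : space Q" for w
  using tau_nonneg[OF K(1) that, of k] by (simp only: pv1 min_absorb1)
  ultimately show ?thesis by (simp cong: bi_cong)
  qed
  have AE0: "AE w in Q. mass (w 0) ^ p = mass \<mu> ^ p" using init by eventually_elim simp
  have m0: "(%w. mass (w 0) ^ p) : bmeas Q"
  by (intro borel_measurable_power F_P[OF functional_adapted[OF mass_measurable order_refl order_refl]])
  have i0: "integrable Q (%w. mass (w 0) ^ p)" and E0: "(LINT w|Q. mass (w 0) ^ p) = mass \<mu> ^ p"
  using integral_cong_AE[OF m0 _ AE0] integrable_cong_AE[OF m0 _ AE0] by (auto simp: prob_space)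
  have "(LINT w|Q. ?S k w - mass (w 0) ^ p - (LBINT u:{0..t}. ?g w u)) = 0"
  using z by (simp cong: bi_cong)
  then have "(LINT w|Q. ?S k w) = mass \<mu> ^ p + (LINT w|Q. (LBINT u:{0..t}. ?g w u))"
  using iS i0 fub(1) E0 by simp
  also have "(LINT w|Q. (LBINT u:{0..t}. ?g w u)) <= C * e * (t - 0)" by (rule fub(3))
  also have "... <= C * e * T" using t C0 e by (intro mult_left_mono mult_nonneg_nonneg) auto
  finally show "(LINT w|Q. ?S k w) <= e'" by (simp add: e'_def)
  qed
  have "(\<integral>\<^sup>+w. ennreal (mass (w t) ^ p) \<partial>Q) = (\<integral>\<^sup>+w. liminf (%k. ennreal (?S k w)) \<partial>Q)"
  proof (rule nn_integral_cong)
  fix w assume w: "w : space Q"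
  have "\<forall>\<^sub>F k in sequentially. ennreal (?S k w) = ennreal (mass (w t) ^ p)"
  using tau_eventually[OF w t(1), folded K_def] by eventually_elim simp
  then have "(%k. ennreal (?S k w)) ~~> ennreal (mass (w t) ^ p)" by (rule tendsto_eventually)
  then show "ennreal (mass (w t) ^ p) = liminf (%k. ennreal (?S k w))"
  by (rule lim_imp_Liminf[symmetric, rotated]) simp
  qed
  also have "... <= liminf (%k. \<integral>\<^sup>+w. ennreal (?S k w) \<partial>Q)"
  by (rule nn_integral_liminf) (use Sm in auto)
  also have "... <= ennreal e'"
  proof -
  have "(\<integral>\<^sup>+w. ennreal (?S k w) \<partial>Q) <= ennreal e'" for k
  using S(2)[of k] mass_nonneg by (subst nn_integral_eq_integral[OF S(1)]) (auto intro: ennreal_leI)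
  then have "liminf (%k. \<integral>\<^sup>+w. ennreal (?S k w) \<partial>Q) <= liminf (%k. ennreal e')"
  by (intro Liminf_mono always_eventually allI)
  then show ?thesis by (simp add: Liminf_const)
  qed
  finally have fin: "(\<integral>\<^sup>+w. ennreal (mass (w t) ^ p) \<partial>Q) <= ennreal e'" .
  have mm: "(%w. mass (w t) ^ p) : bmeas Q"
  by (intro borel_measurable_power F_P[OF functional_adapted[OF mass_measurable t(1) order_refl]])
  have i: "integrable Q (%w. mass (w t) ^ p)"
  using le_less_trans[OF fin ennreal_less_top] mass_nonneg by (intro integrableI_nonneg mm) auto
  have "ennreal (LINT w|Q. mass (w t) ^ p) <= ennreal e'"
  using fin mass_nonneg by (subst nn_integral_eq_integral[OF i, symmetric]) auto
  then show ?thesis using i e'0 by simp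
 qed
 show ?thesis by (intro exI[of _ e'] conjI e'0 allI impI main)
qed

text \<open>Orders 0 and 1 are direct, the latter because the mass is a martingale. From order 2 on
  \<open>mass_moment_step\<close> applies, where \<open>p - 2\<close> is not truncated.\<close>

lemma mass_moments:
 assumes T: "0 <= T"
 shows "\<exists>e\<ge>0. ALL u. 0 <= u --> u <= T --> integrable Q (%w. mass (w u) ^ p) & (LINT w|Q. mass (w u) ^ p) <= e"
proof (induction p)
 case 0
 show ?case by (rule exI[of _ 1]) (simp add: prob_space)
next
 case (Suc p)
 show ?case
 proof (cases p)
  case 0
  have "(LINT w|Q. mass (w u)) <= (LINT w|Q. mass (w 0))" if "0 <= u" for u
  using mgle_mult_bounded[OF mgle_mass order_refl that, of "%_. 1" 1] that
  by (simp add: mgleD(2)[OF mgle_mass])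
  then show ?thesis unfolding 0 power_Suc0_right
  by (intro exI[of _ "\<integral>w. mass (w 0) \<partial>Q"] conjI allI impI bi_nonneg mass_nonneg
  mgleD(2)[OF mgle_mass])
 next
  case (Suc q)
  obtain e where "0 <= e" "!!u. 0 <= u ==> u <= T ==> integrable Q (%w. mass (w u) ^ p) & (LINT w|Q. mass (w u) ^ p) <= e"
  using Suc.IH by metis
  then show ?thesis using Suc by (intro mass_moment_step[OF _ T, of "Suc p" e]) auto
 qed
qed

lemma moment_all: "moment p"
proof -
 have "moment (2 * Suc p)"
  by (rule moment_from_power[OF mgle_mass]) (use mass_moments in blast)
 then show ?thesis by (rule moment_mono) simp
qed

lemma MP_cyl:
 assumes "C2_loc n f" "!!i. i < n ==> phi i : C2_real"
  and "tm p (%nu. f (pv n phi nu))" "tm p (cylG n f phi)"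
 shows "MP (%nu. f (pv n phi nu)) (cylG n f phi)"
 by (rule MP_cyl_of_moment[OF assms moment_all])

end

section \<open>Variational derivatives and the generator on cylinder functions\<close>

lemma nn_integral_add_dirac:
 assumes "f : bmeas borel"
 shows "(\<integral>\<^sup>+y. f y \<partial>meas_of (add_dirac nu r x)) = (\<integral>\<^sup>+y. f y \<partial>meas_of nu) + ennreal r * f x"
 using assms
proof (induction rule: borel_measurable_induct)
 case (cong f g)
 then have "f = g" by (simp add: fun_eq_iff)
 then show ?case using cong by simp
next
 case (set A)
 then show ?case by (simp add: emeasure_add_dirac)
next
 case (mult u c)
 then show ?case by (simp add: nn_integral_cmult distrib_left mult_ac)
next
 case (add u v)
 then show ?case by (simp add: nn_integral_add distrib_left ac_simps)
next
 case (seq U)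
 have mc: "(\<integral>\<^sup>+y. (SUP i. U i) y \<partial>N) = (SUP i. \<integral>\<^sup>+y. U i y \<partial>N)" if "sets N = sets borel" for N
  unfolding SUP_apply
  by (rule nn_integral_monotone_convergence_SUP[OF seq.hyps(3)]) (use seq.hyps(1) that in \<open>simp cong: measurable_cong_sets\<close>)
 have "(\<integral>\<^sup>+y. (SUP i. U i) y \<partial>meas_of (add_dirac nu r x)) = (SUP i. (\<integral>\<^sup>+y. U i y \<partial>meas_of nu) + ennreal r * U i x)"
  unfolding mc[OF sets_meas_of] seq.IH ..
 also have "... = (SUP i. \<integral>\<^sup>+y. U i y \<partial>meas_of nu) + (SUP i. ennreal r * U i x)"
  using seq.hyps(3) by (intro ennreal_SUP_add) (auto simp: incseq_def le_fun_def intro!: nn_integral_mono mult_left_mono)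
 also have "... = (\<integral>\<^sup>+y. (SUP i. U i) y \<partial>meas_of nu) + ennreal r * (SUP i. U i) x"
  unfolding mc[OF sets_meas_of] by (simp add: SUP_apply SUP_mult_left_ennreal image_image)
 finally show ?case .
qed

lemma integral_add_dirac:
 fixes g :: "real => real"
 assumes g: "g : bmeas borel" "!!x. abs (g x) <= B" and r: "0 <= r"
 shows "(LINT y|meas_of (add_dirac nu r x). g y) = (LINT y|meas_of nu. g y) + r * g x"
proof -
 have i: "integrable (meas_of nu) g" for nu by (rule integrable_meas_of[OF g])
 have fin: "(\<integral>\<^sup>+y. ennreal (g y) \<partial>meas_of nu) < top" "(\<integral>\<^sup>+y. ennreal (- g y) \<partial>meas_of nu) < top" for nu
  using i[of nu] by (auto simp: real_integrable_def top.not_eq_extremum)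
 \<comment> \<open>\<open>ennreal\<close> truncates negative values, so the positive and the
   negative part of g are followed separately.\<close>
 have e: "enn2real (a + ennreal r * ennreal b) = enn2real a + r * max 0 b" if "a < top" for a b
  using that r by (simp add: enn2real_plus ennreal_mult'[symmetric] ennreal_mult_less_top) (simp add: max_def enn2real_eq_0_iff mult_nonneg_nonpos ennreal_neg)
 have "(\<integral>\<^sup>+y. ennreal (g y) \<partial>meas_of (add_dirac nu r x)) = (\<integral>\<^sup>+y. ennreal (g y) \<partial>meas_of nu) + ennreal r * ennreal (g x)"
  "(\<integral>\<^sup>+y. ennreal (- g y) \<partial>meas_of (add_dirac nu r x)) = (\<integral>\<^sup>+y. ennreal (- g y) \<partial>meas_of nu) + ennreal r * ennreal (- g x)"
  using g(1) by (intro nn_integral_add_dirac; measurable)+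
 then have "(LINT y|meas_of (add_dirac nu r x). g y) = (LINT y|meas_of nu. g y) + (r * max 0 (g x) - r * max 0 (- g x))"
  unfolding real_lebesgue_integral_def[OF i] by (simp only: e[OF fin(1)] e[OF fin(2)])
 also have "r * max 0 (g x) - r * max 0 (- g x) = r * g x" by (simp add: max_def)
 finally show ?thesis .
qed

lemma pairing_add_dirac: "f : Cb UNIV ==> 0 <= r ==> pairing f (add_dirac nu r x) = pairing f nu + r * f x"
 unfolding pairing_def by (meson CbE Cb_measurable integral_add_dirac)

text \<open>Relational form of \<open>vderiv\<close>: \<open>Lim\<close> is total, so rules for sums
  and products need the existence of the limit on record.\<close>

definition has_vderiv :: "(fmeasure => real) => real => fmeasure => real => bool" where
 "has_vderiv F x nu L \<longleftrightarrow> ((%r. (F (add_dirac nu r x) - F nu) / r) \<longlongrightarrow> L) (at_right 0)"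

lemma has_vderiv_imp: "has_vderiv F x nu L ==> vderiv F x nu = L"
 unfolding has_vderiv_def vderiv_def by (rule tendsto_Lim) simp

lemma has_vderiv_sum:
 assumes "!!i. i : I ==> has_vderiv (F i) x nu (L i)"
 shows "has_vderiv (%nu. \<Sum>i\<in>I. F i nu) x nu (\<Sum>i\<in>I. L i)"
 unfolding has_vderiv_def sum_subtractf[symmetric] sum_divide_distrib
 by (intro tendsto_sum assms[unfolded has_vderiv_def])

lemma has_vderiv_mult_right:
 assumes "has_vderiv F x nu L"
 shows "has_vderiv (%nu. F nu * c) x nu (L * c)"
proof -
 have "(F (add_dirac nu r x) * c - F nu * c) / r = (F (add_dirac nu r x) - F nu) / r * c" for r
  by (simp add: left_diff_distrib)
 then show ?thesis using assms unfolding has_vderiv_def by (simp only:) (rule tendsto_mult_right)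
qed

text \<open>Adding mass r at x moves the vector of pairings along the straight line with direction
  \<open>phi i x\<close>, so the chain rule along lines gives the one-sided derivative.\<close>

lemma has_vderiv_cylinder:
 assumes pd: "!!i x. i < n ==> x : Rn n ==> pdifferentiable i f x"
  and pc: "!!i. i < n ==> continuous_on (Rn n) (pder i f)"
  and phi: "!!i. i < n ==> phi i : Cb UNIV"
 shows "has_vderiv (%nu. f (pv n phi nu)) x nu (SUM i<n. pder i f (pv n phi nu) * phi i x)"
proof -
 let ?g = "%s. f (line n (pv n phi nu) (%i. phi i x) s)"
 have l: "line n (pv n phi nu) (%i. phi i x) r = pv n phi (add_dirac nu r x)" if "0 <= r" for r
  using that phi by (auto simp: line_def pv_def fun_eq_iff pairing_add_dirac)
 have l0: "line n (pv n phi nu) (%i. phi i x) 0 = pv n phi nu" by (auto simp: line_def pv_def fun_eq_iff)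
 have "(?g has_rd (SUM i<n. pder i f (pv n phi nu) * phi i x)) (at 0)"
  using chain_rule_line[OF pd pc, where u = 0 and x = "pv n phi nu" and d = "%i. phi i x", unfolded l0] .
 then have "((%r. (?g (0 + r) - ?g 0) / r) \<longlongrightarrow> (SUM i<n. pder i f (pv n phi nu) * phi i x)) (at_right 0)"
  unfolding DERIV_def by (rule tendsto_mono[rotated]) (simp add: at_le)
 moreover have "\<forall>\<^sub>F r in at_right 0. (?g (0 + r) - ?g 0) / r = (f (pv n phi (add_dirac nu r x)) - f (pv n phi nu)) / r"
  using eventually_at_right_less[of 0] by eventually_elim (simp add: l l0)
 ultimately show ?thesis unfolding has_vderiv_def by (rule Lim_transform_eventually)
qed

lemma deriv_sum_coeff:
 assumes "!!i. i : I ==> (g i has_rd g' i x) (at x)"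
 shows "((%u. \<Sum>i\<in>I. c i * g i u) has_rd (\<Sum>i\<in>I. c i * g' i x)) (at x)"
 by (intro DERIV_sum DERIV_cmult assms)

text \<open>Each variational derivative brings down one factor \<open>phi i\<close> at its own
  variable, so the x- and y-derivatives fall on separate factors. Symmetry of \<open>covar\<close>
  reconciles the order of the two indices.\<close>

lemma (in path_setting) generator_cylinder:
 assumes f: "C2_loc n f" and phi: "!!i. i < n ==> phi i : C2_real"
 shows "generator h \<sigma> (%nu. f (pv n phi nu)) nu = cylG n f phi nu"
proof -
 let ?N = "meas_of nu" and ?p = "pv n phi nu"
 interpret NN: finite_measure "?N \<Otimes>\<^sub>M ?N"
  by (rule finite_measure_pair_measure) (rule finite_measure_meas_of)+
 have phib: "!!i. i < n ==> phi i : Cb UNIV" by (rule C2_realD(1)[OF phi])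
 let ?d1 = "%i. pder i f ?p" and ?d2 = "%i j. pder j (pder i f) ?p"
 have v1: "vderiv (%nu. f (pv n phi nu)) x nu = (SUM i<n. pder i f (pv n phi nu) * phi i x)" for x nu
  by (rule has_vderiv_imp[OF has_vderiv_cylinder[OF C2_locD(2,3)[OF f] phib]])
 have v2: "vderiv2 (%nu. f (pv n phi nu)) x y nu = (SUM i<n. (SUM j<n. ?d2 i j * phi j x) * phi i y)" for x y
  unfolding vderiv2_def v1[abs_def]
  by (intro has_vderiv_imp has_vderiv_sum has_vderiv_mult_right has_vderiv_cylinder C2_locD(4,5)[OF f] phib) auto
 have D1: "deriv (deriv (%u. vderiv (%nu. f (pv n phi nu)) u nu)) x = (SUM i<n. ?d1 i * deriv (deriv (phi i)) x)" for x
 proof -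
  have "deriv (%u. vderiv (%nu. f (pv n phi nu)) u nu) = (%u. SUM i<n. ?d1 i * deriv (phi i) u)"
  unfolding v1 by (intro ext DERIV_imp_deriv deriv_sum_coeff C2_realD(4) phi) auto
  then show ?thesis
  by (simp only:) (intro DERIV_imp_deriv deriv_sum_coeff C2_realD(5) phi, auto)
 qed
 have D2: "deriv (%u. deriv (%v. vderiv2 (%nu. f (pv n phi nu)) u v nu) y) x
  = (SUM i<n. SUM j<n. ?d2 i j * (deriv (phi j) x * deriv (phi i) y))" for x y
 proof -
  have "deriv (%v. vderiv2 (%nu. f (pv n phi nu)) u v nu) y = (SUM i<n. deriv (phi i) y * (SUM j<n. ?d2 i j * phi j u))" for u
  proof -
  have "((%v. SUM i<n. (SUM j<n. ?d2 i j * phi j u) * phi i v) has_rd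
  (SUM i<n. (SUM j<n. ?d2 i j * phi j u) * deriv (phi i) y)) (at y)"
  by (intro deriv_sum_coeff C2_realD(4) phi) auto
  then show ?thesis unfolding v2 by (simp only: DERIV_imp_deriv mult.commute)
  qed
  moreover have "((%u. SUM i<n. deriv (phi i) y * (SUM j<n. ?d2 i j * phi j u)) has_rd
  (SUM i<n. deriv (phi i) y * (SUM j<n. ?d2 i j * deriv (phi j) x))) (at x)"
  by (intro deriv_sum_coeff C2_realD(4) phi) auto
  ultimately have "deriv (%u. deriv (%v. vderiv2 (%nu. f (pv n phi nu)) u v nu) y) x =
  (SUM i<n. deriv (phi i) y * (SUM j<n. ?d2 i j * deriv (phi j) x))"
  by (simp only: DERIV_imp_deriv)
  then show ?thesis by (simp add: sum_distrib_left mult_ac)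
 qed
 have T1: "(LINT x|?N. deriv (deriv (%u. vderiv (%nu. f (pv n phi nu)) u nu)) x) = (SUM i<n. ?d1 i * pairing (deriv (deriv (phi i))) nu)"
 proof -
  have "integrable ?N (deriv (deriv (phi i)))" if "i < n" for i
  by (rule Cb_integrable[OF C2_realD(3)[OF phi[OF that]]])
  then show ?thesis unfolding D1 pairing_def by (subst bi_sum) auto
 qed
 have T2: "(LINT (x, y)|(?N \<Otimes>\<^sub>M ?N). rho h (x - y) * deriv (%u. deriv (%v. vderiv2 (%nu. f (pv n phi nu)) u v nu) y) x)
  = (SUM i<n. SUM j<n. ?d2 i j * covar (deriv (phi j)) (deriv (phi i)) nu)"
 proof -
  have i: "integrable (?N \<Otimes>\<^sub>M ?N) (%p. rho h (fst p - snd p) * (deriv (phi j) (fst p) * deriv (phi i) (snd p)))"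
  if "i < n" "j < n" for i j by (intro covar_integrable C2_realD(2) phi that)
  have "(LINT (x, y)|(?N \<Otimes>\<^sub>M ?N). rho h (x - y) * deriv (%u. deriv (%v. vderiv2 (%nu. f (pv n phi nu)) u v nu) y) x)
  = (LINT p|(?N \<Otimes>\<^sub>M ?N). (SUM i<n. SUM j<n. ?d2 i j * (rho h (fst p - snd p) * (deriv (phi j) (fst p) * deriv (phi i) (snd p)))))"
  unfolding D2 case_prod_beta' by (simp add: sum_distrib_left mult_ac)
  also have "... = (SUM i<n. SUM j<n. ?d2 i j * (LINT p|(?N \<Otimes>\<^sub>M ?N). rho h (fst p - snd p) * (deriv (phi j) (fst p) * deriv (phi i) (snd p))))"
  using i by (subst bi_sum) (auto intro!: sum.cong)
  finally show ?thesis unfolding covar_def case_prod_beta' .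
 qed
 have T3: "(LINT x|?N. \<sigma> x * vderiv2 (%nu. f (pv n phi nu)) x x nu)
  = (SUM i<n. SUM j<n. ?d2 i j * pairing (%x. \<sigma> x * (phi j x * phi i x)) nu)"
 proof -
  have i: "integrable ?N (%x. \<sigma> x * (phi j x * phi i x))" if "i < n" "j < n" for i j
  by (intro Cb_integrable Cb_mult \<sigma>_Cb phib that)
  have "(LINT x|?N. \<sigma> x * vderiv2 (%nu. f (pv n phi nu)) x x nu) = (LINT x|?N. (SUM i<n. SUM j<n. ?d2 i j * (\<sigma> x * (phi j x * phi i x))))"
  unfolding v2 by (simp add: sum_distrib_left sum_distrib_right mult_ac)
  also have "... = (SUM i<n. SUM j<n. ?d2 i j * (LINT x|?N. \<sigma> x * (phi j x * phi i x)))"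
  using i by (subst bi_sum) (auto intro!: sum.cong)
  finally show ?thesis unfolding pairing_def .
 qed
 have sym: "\<Gamma> (phi i) (phi j) nu = pairing (%x. \<sigma> x * (phi j x * phi i x)) nu + covar (deriv (phi j)) (deriv (phi i)) nu"
  if "i < n" "j < n" for i j
  unfolding \<Gamma>_def by (simp add: covar_sym[OF C2_realD(2)[OF phi[OF that(1)]] C2_realD(2)[OF phi[OF that(2)]]] mult.commute)
 have "(SUM i<n. SUM j<n. ?d2 i j * \<Gamma> (phi i) (phi j) nu)
  = (SUM i<n. SUM j<n. ?d2 i j * covar (deriv (phi j)) (deriv (phi i)) nu) + (SUM i<n. SUM j<n. ?d2 i j * pairing (%x. \<sigma> x * (phi j x * phi i x)) nu)"
  unfolding sum.distrib[symmetric] distrib_left[symmetric]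
  by (intro sum.cong refl) (simp add: sym add.commute)
 moreover have "1/2 * rho h 0 * (SUM i<n. ?d1 i * pairing (deriv (deriv (phi i))) nu) = (SUM i<n. ?d1 i * drift (phi i) nu)"
  by (simp add: drift_def sum_distrib_left mult_ac)
 ultimately show ?thesis
  unfolding generator_def T1 T2 T3 cylG_def by (simp add: distrib_left add.assoc)
qed

lemma cyl_functional_pv: "cyl_functional n f phi nu = f (pv n phi nu)"
 by (simp add: cyl_functional_def pv_def)

section \<open>Partially integrated functionals and the generator on polynomial functionals\<close>

definition ev :: "nat => nat set => (nat => real) => (nat => real) => nat => real" where
 "ev n I xi z = (\<lambda>i\<in>{..<n}. if i : I then z i else xi i)"

text \<open>Coordinates in I are integrated against nu, the others are frozen at xi. A variational
  derivative at x takes one coordinate out of I and freezes it at x, so sums of such functionals are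
  closed under the derivatives that the generator needs.\<close>

definition Pf :: "nat => ((nat => real) => real) => nat set => (nat => real) => fmeasure => real" where
 "Pf n f I xi nu = (LINT z|PiM I (%_. meas_of nu). f (ev n I xi z))"

lemma ev_Rn [simp]: "ev n I xi z : Rn n"
 by (simp add: ev_def)

lemma product_sigma_finite_meas_of: "product_sigma_finite (%_ :: nat. meas_of nu)"
 by (intro product_sigma_finite.intro finite_measure.axioms(1) finite_measure_meas_of)

lemma
 assumes I: "finite (I :: nat set)"
 shows finite_measure_PiM: "finite_measure (PiM I (%_. meas_of nu))"
  and measure_PiM_space: "measure (PiM I (%_. meas_of nu)) (space (PiM I (%_. meas_of nu))) = mass nu ^ card I"
proof -
 interpret product_sigma_finite "%_ :: nat. meas_of nu" by (rule product_sigma_finite_meas_of)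
 interpret N: finite_measure "meas_of nu" by (rule finite_measure_meas_of)
 have e: "emeasure (PiM I (%_. meas_of nu)) (space (PiM I (%_. meas_of nu))) = ennreal (mass nu ^ card I)"
  using emeasure_PiM[OF I, of "%_. UNIV"] mass_nonneg
  by (simp add: space_PiM N.emeasure_eq_measure mass_eq ennreal_power)
 show "finite_measure (PiM I (%_. meas_of nu))" by (rule finite_measureI) (simp add: e)
 show "measure (PiM I (%_. meas_of nu)) (space (PiM I (%_. meas_of nu))) = mass nu ^ card I"
  using mass_nonneg by (simp add: measure_def e)
qed

lemma ev_measurable:
 assumes f: "f : Cb (Rn n)"
 shows "(%z. f (ev n I xi z)) : bmeas (PiM I (%_. meas_of nu))"
 unfolding ev_def
proof (rule Rn_comp_measurable[OF Cb_continuous[OF f]])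
 fix i
 show "(%z. if i : I then z i else xi i) : bmeas (PiM I (%_. meas_of nu))"
 proof (cases "i : I")
  case True
  have "(%z. z i) : PiM I (%_. meas_of nu) \<rightarrow>\<^sub>M meas_of nu" by (rule measurable_component_singleton[OF True])
  then show ?thesis using True by (simp cong: measurable_cong_sets)
 qed simp
qed

lemma Pf_integrable:
 assumes "finite I" and f: "f : Cb (Rn n)"
 shows "integrable (PiM I (%_. meas_of nu)) (%z. f (ev n I xi z))"
proof -
 interpret finite_measure "PiM I (%_. meas_of nu)" by (rule finite_measure_PiM[OF assms(1)])
 obtain K where "!!x. x : Rn n ==> abs (f x) <= K" using Cb_bounded[OF f] by metis
 then show ?thesis by (intro integrable_const_bound[where B = K] ev_measurable[OF f]) auto
qed

lemma Pf_bound: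
 assumes I: "finite I" and f: "f : Cb (Rn n)" and B: "!!x. x : Rn n ==> abs (f x) <= B"
 shows "abs (Pf n f I xi nu) <= B * mass nu ^ card I"
proof -
 interpret finite_measure "PiM I (%_. meas_of nu)" by (rule finite_measure_PiM[OF I])
 have "abs (Pf n f I xi nu) <= (LINT z|PiM I (%_. meas_of nu). B)"
  unfolding Pf_def by (rule abs_integral_le[OF Pf_integrable[OF I f]]) (auto intro: B)
 then show ?thesis by (simp add: measure_PiM_space[OF I] mult.commute)
qed

lemma Pf_tendsto:
 assumes I: "finite I" and f: "!!k :: nat. f k : Cb (Rn n)" and g: "g : Cb (Rn n)"
  and B: "!!k x. x : Rn n ==> abs (f k x) <= B"
  and lim: "!!z. (%k. f k (ev n I (xi k) z)) ~~> g (ev n I zeta z)"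
 shows "(%k. Pf n (f k) I (xi k) nu) ~~> Pf n g I zeta nu"
proof -
 interpret finite_measure "PiM I (%_. meas_of nu)" by (rule finite_measure_PiM[OF I])
 show ?thesis unfolding Pf_def
  by (rule integral_dominated_convergence[where w = "%_. B"])
  (use B lim in \<open>auto intro!: ev_measurable f g\<close>)
qed

lemma Pf_continuous:
 fixes x :: "nat => 'a::metric_space => real"
 assumes I: "finite I" and f: "f : Cb (Rn n)" and x: "!!i. continuous_on S (x i)"
 shows "continuous_on S (%t. Pf n f I (%i. x i t) nu)"
 unfolding continuous_on_sequentially comp_def
proof (intro allI ballI impI, elim conjE)
 fix s a assume a: "a : S" and s: "ALL k. s k : S" "s ~~> a"
 obtain K where K: "!!x. x : Rn n ==> abs (f x) <= K" using Cb_bounded[OF f] by metis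
 show "(%k. Pf n f I (%i. x i (s k)) nu) ~~> Pf n f I (%i. x i a) nu"
 proof (rule Pf_tendsto[OF I f f K])
  fix z
  have "continuous_on S (%t. if i : I then z i else x i t)" for i
  by (cases "i : I") (auto intro: x)
  then have "continuous_on S (%t. f (ev n I (%i. x i t) z))"
  unfolding ev_def by (rule Rn_comp_continuous[OF Cb_continuous[OF f]])
  then show "(%k. f (ev n I (%i. x i (s k)) z)) ~~> f (ev n I (%i. x i a) z)"
  using s a unfolding continuous_on_sequentially comp_def by blast
 qed
qed

lemma Pf_upd_Cb:
 assumes I: "finite I" and f: "f : Cb (Rn n)"
 shows "(%a. Pf n f I (xi(i := a)) nu) : Cb UNIV"
  and "(%a. Pf n f I (xi(i := a, j := a)) nu) : Cb UNIV"
  and "(%p :: real \<times> real. Pf n f I (xi(i := snd p, j := fst p)) nu) : Cb UNIV"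
proof -
 obtain K where K: "!!x. x : Rn n ==> abs (f x) <= K" using Cb_bounded[OF f] by metis
 note b = Pf_bound[OF I f K]
 have "continuous_on UNIV (%t. if l = i then t else xi l)" for l by (cases "l = i") auto
 then show "(%a. Pf n f I (xi(i := a)) nu) : Cb UNIV" unfolding fun_upd_def
  by (rule CbI[OF Pf_continuous[OF I f] b])
 have "continuous_on UNIV (%t. if l = j then t else if l = i then t else xi l)" for l by (cases "l = i"; cases "l = j") auto
 then show "(%a. Pf n f I (xi(i := a, j := a)) nu) : Cb UNIV" unfolding fun_upd_def
  by (rule CbI[OF Pf_continuous[OF I f] b])
 show "(%p :: real \<times> real. Pf n f I (xi(i := snd p, j := fst p)) nu) : Cb UNIV" unfolding fun_upd_def
 proof (rule CbI[OF Pf_continuous[OF I f] b])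
  fix l show "continuous_on UNIV (%p :: real \<times> real. if l = j then fst p else if l = i then snd p else xi l)"
  by (cases "l = j"; cases "l = i") (auto intro!: continuous_intros)
 qed
qed

lemma Pf_empty: "Pf n f {} xi nu = f (\<lambda>i\<in>{..<n}. xi i)"
 unfolding Pf_def PiM_empty by (subst lebesgue_integral_count_space_finite) (auto simp: ev_def)

lemma Pf_full: "Pf n f {..<n} xi nu = poly_functional n f nu"
 unfolding Pf_def poly_functional_def
proof (rule bi_cong[OF refl])
 fix z assume "z : space (PiM {..<n} (%_. meas_of nu))"
 then have "ev n {..<n} xi z = z" by (auto simp: space_PiM PiE_def ev_def restrict_def extensional_def fun_eq_iff)
 then show "f (ev n {..<n} xi z) = f z" by simp
qed

lemma Pf_insert:
 assumes I: "finite I" "i \<notin> I" and f: "f : Cb (Rn n)"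
 shows "Pf n f (insert i I) xi nu = (LINT a|meas_of nu. Pf n f I (xi(i := a)) nu)"
proof -
 interpret product_sigma_finite "%_ :: nat. meas_of nu" by (rule product_sigma_finite_meas_of)
 have e: "ev n (insert i I) xi (merge {i} I (x, z)) = ev n I (xi(i := x i)) z" for x z
  using I by (auto simp: ev_def merge_def fun_eq_iff)
 have "Pf n f (insert i I) xi nu = (LINT x|PiM {i} (%_. meas_of nu). (LINT z|PiM I (%_. meas_of nu). f (ev n (insert i I) xi (merge {i} I (x, z)))))"
  unfolding Pf_def using product_integral_fold[of "{i}" I "%z. f (ev n (insert i I) xi z)"] I Pf_integrable[of "insert i I", OF _ f]
  by simp
 also have "... = (LINT x|PiM {i} (%_. meas_of nu). Pf n f I (xi(i := x i)) nu)"
  unfolding e Pf_def ..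
 also have "... = (LINT a|meas_of nu. Pf n f I (xi(i := a)) nu)"
  by (rule product_integral_singleton) (use Cb_measurable[OF Pf_upd_Cb(1)[OF I(1) f]] in \<open>simp cong: measurable_cong_sets\<close>)
 finally show ?thesis .
qed

lemma Pf_remove:
 assumes I: "finite I" "i : I" and f: "f : Cb (Rn n)"
 shows "(LINT a|meas_of nu. Pf n f (I - {i}) (xi(i := a)) nu) = Pf n f I xi nu"
 using Pf_insert[of "I - {i}" i f n xi nu] I f by (simp add: insert_absorb)

lemma Pf_expand:
 assumes I: "finite I" and f: "f : Cb (Rn n)"
 shows "\<exists>C\<ge>0. ALL xi r. 0 <= r --> r <= 1 -->
  abs (Pf n f I xi (add_dirac nu r x) - Pf n f I xi nu - r * (\<Sum>i\<in>I. Pf n f (I - {i}) (xi(i := x)) nu)) <= C * r^2"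
 using I
proof (induction I)
 case empty
 show ?case by (rule exI[of _ 0]) (simp add: Pf_empty)
next
 case (insert i I)
 obtain C where C: "0 <= C" and IH: "!!xi r. 0 <= r ==> r <= 1 ==>
  abs (Pf n f I xi (add_dirac nu r x) - Pf n f I xi nu - r * (\<Sum>i\<in>I. Pf n f (I - {i}) (xi(i := x)) nu)) <= C * r^2"
  using insert.IH by blast
 obtain B where B: "0 <= B" "!!x. x : Rn n ==> abs (f x) <= B" using Cb_bounded[OF f] by metis
 define S where "S xi = (\<Sum>j\<in>I. Pf n f (I - {j}) (xi(j := x)) nu)" for xi
 define M where "M = (\<Sum>j\<in>I. B * mass nu ^ card (I - {j}))"
 have M0: "0 <= M" using B mass_nonneg by (simp add: M_def sum_nonneg)
 have SM: "abs (S xi) <= M" for xi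
  unfolding S_def M_def by (rule order_trans[OF sum_abs sum_mono]) (rule Pf_bound[OF _ f B(2)], use insert.hyps in auto)
 have S_eq: "S (xi(i := a)) = (\<Sum>j\<in>I. Pf n f (I - {j}) ((xi(j := x))(i := a)) nu)" for xi a
  unfolding S_def using insert.hyps by (intro sum.cong refl) (metis fun_upd_twist)
 have SCb: "(%a. S (xi(i := a))) : Cb UNIV" for xi
  unfolding S_eq using insert.hyps by (intro Cb_sum Pf_upd_Cb(1) f) auto
 have Sint: "(LINT a|meas_of nu. S (xi(i := a))) = (\<Sum>j\<in>I. Pf n f (insert i I - {j}) (xi(j := x)) nu)" for xi
 proof -
  have "(LINT a|meas_of nu. S (xi(i := a))) = (\<Sum>j\<in>I. LINT a|meas_of nu. Pf n f (I - {j}) ((xi(j := x))(i := a)) nu)"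
  unfolding S_eq by (rule bi_sum) (use insert.hyps in \<open>auto intro!: Cb_integrable Pf_upd_Cb(1) f\<close>)
  also have "... = (\<Sum>j\<in>I. Pf n f (insert i (I - {j})) (xi(j := x)) nu)"
  using insert.hyps by (intro sum.cong refl Pf_insert[symmetric] f) auto
  also have "... = (\<Sum>j\<in>I. Pf n f (insert i I - {j}) (xi(j := x)) nu)"
  using insert.hyps by (intro sum.cong refl) (metis insert_Diff_if singletonD)
  finally show ?thesis .
 qed
 have "abs (Pf n f (insert i I) xi (add_dirac nu r x) - Pf n f (insert i I) xi nu -
  r * (\<Sum>j\<in>insert i I. Pf n f (insert i I - {j}) (xi(j := x)) nu)) <= (C * mass nu + C + M) * r^2"
  if r: "0 <= r" "r <= 1" for xi r
 proof -
  let ?nu = "add_dirac nu r x"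
  let ?A = "%a. Pf n f I (xi(i := a)) ?nu" and ?B = "%a. Pf n f I (xi(i := a)) nu"
  let ?e = "%a. ?A a - ?B a - r * S (xi(i := a))"
  have AB: "?A : Cb UNIV" "?B : Cb UNIV" "(%a. r * S (xi(i := a))) : Cb UNIV"
  by (rule Pf_upd_Cb(1)[OF insert.hyps(1) f])+ (rule Cb_cmult[OF SCb])
  have 1: "Pf n f (insert i I) xi ?nu = pairing ?A nu + r * ?A x"
  using Pf_insert[OF insert.hyps f] pairing_add_dirac[OF AB(1) r(1)] by (simp add: pairing_def)
  have 2: "Pf n f (insert i I) xi nu = pairing ?B nu"
  using Pf_insert[OF insert.hyps f] by (simp add: pairing_def)
  have 3: "(\<Sum>j\<in>insert i I. Pf n f (insert i I - {j}) (xi(j := x)) nu) = ?B x + pairing (%a. S (xi(i := a))) nu"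
  using insert.hyps by (simp add: Sint pairing_def)
  have "pairing ?e nu = pairing ?A nu - pairing ?B nu - r * pairing (%a. S (xi(i := a))) nu"
  using AB by (simp add: pairing_diff pairing_cmult Cb_diff SCb)
  \<comment> \<open>The new remainder: the old one integrated over the new coordinate, r times the
    old one at x, and a second-order term in which the new and an old coordinate both sit at
    x.\<close>
  then have "Pf n f (insert i I) xi ?nu - Pf n f (insert i I) xi nu -
  r * (\<Sum>j\<in>insert i I. Pf n f (insert i I - {j}) (xi(j := x)) nu) = pairing ?e nu + r * ?e x + r * r * S (xi(i := x))"
  unfolding 1 2 3 by (simp add: algebra_simps)
  also have "abs ... <= C * r^2 * mass nu + C * r^2 + M * r^2"
  proof -
  have e: "abs (?e a) <= C * r^2" for a using IH[OF r, of "xi(i := a)"] by (simp add: S_def)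
  have "abs (pairing ?e nu) <= C * r^2 * mass nu"
  by (rule pairing_bound[OF Cb_measurable e]) (intro Cb_diff AB)
  moreover have "abs (r * ?e x) <= C * r^2"
  using mult_mono[OF r(2) e[of x]] r by (simp add: abs_mult)
  moreover have "abs (r * r * S (xi(i := x))) <= M * r^2"
  using mult_left_mono[OF SM[of "xi(i := x)"], of "r * r"] r by (simp add: abs_mult power2_eq_square mult_ac)
  ultimately show ?thesis by linarith
  qed
  finally show ?thesis by (simp add: algebra_simps)
 qed
 moreover have "0 <= C * mass nu + C + M" using C M0 mass_nonneg by simp
 ultimately show ?case by blast
qed

lemma has_vderiv_Pf:
 assumes I: "finite I" and f: "f : Cb (Rn n)"
 shows "has_vderiv (Pf n f I xi) x nu (\<Sum>i\<in>I. Pf n f (I - {i}) (xi(i := x)) nu)"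
proof -
 let ?L = "\<Sum>i\<in>I. Pf n f (I - {i}) (xi(i := x)) nu"
 let ?q = "%r. (Pf n f I xi (add_dirac nu r x) - Pf n f I xi nu) / r"
 obtain C where C: "0 <= C" "!!xi r. 0 <= r ==> r <= 1 ==>
  abs (Pf n f I xi (add_dirac nu r x) - Pf n f I xi nu - r * (\<Sum>i\<in>I. Pf n f (I - {i}) (xi(i := x)) nu)) <= C * r^2"
  using Pf_expand[OF assms] by blast
 have "((%r. ?q r - ?L) \<longlongrightarrow> 0) (at_right 0)"
 proof (rule Lim_null_comparison)
  show "\<forall>\<^sub>F r in at_right 0. norm (?q r - ?L) <= C * r"
  using eventually_at_right_less[of 0] eventually_at_right_real[OF zero_less_one]
  proof eventually_elim
  case (elim r)
  then have r: "0 < r" "r <= 1" by auto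
  have "?q r - ?L = (Pf n f I xi (add_dirac nu r x) - Pf n f I xi nu - r * ?L) / r" using r by (simp add: field_simps)
  then have "norm (?q r - ?L) <= C * r^2 / r" using C(2)[of r xi] r by (simp add: abs_divide divide_right_mono)
  then show ?case using r by (simp add: power2_eq_square)
  qed
  have "((%r. C * r) \<longlongrightarrow> C * 0) (at_right 0)" by (intro tendsto_intros)
  then show "((%r. C * r) \<longlongrightarrow> 0) (at_right 0)" by simp
 qed
 then show ?thesis unfolding has_vderiv_def by (rule LIM_zero_cancel)
qed

lemma vderiv2_Pf:
 assumes I: "finite I" and f: "f : Cb (Rn n)"
 shows "vderiv (Pf n f I xi) x nu = (\<Sum>i\<in>I. Pf n f (I - {i}) (xi(i := x)) nu)"
  and "vderiv2 (Pf n f I xi) x y nu = (\<Sum>i\<in>I. \<Sum>j\<in>I - {i}. Pf n f (I - {i} - {j}) (xi(i := y, j := x)) nu)"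
proof -
 show 1: "vderiv (Pf n f I xi) x nu = (\<Sum>i\<in>I. Pf n f (I - {i}) (xi(i := x)) nu)" for x nu
  by (rule has_vderiv_imp[OF has_vderiv_Pf[OF assms]])
 show "vderiv2 (Pf n f I xi) x y nu = (\<Sum>i\<in>I. \<Sum>j\<in>I - {i}. Pf n f (I - {i} - {j}) (xi(i := y, j := x)) nu)"
  unfolding vderiv2_def 1[abs_def] using I by (intro has_vderiv_imp has_vderiv_sum has_vderiv_Pf f) auto
qed

text \<open>Differentiation under the integral: by the mean value theorem the difference quotients
  are bounded by B, which is integrable for a finite measure.\<close>

lemma has_derivative_integral:
 fixes g g' :: "real => 'a => real"
 assumes M: "finite_measure M" and i: "!!u. integrable M (g u)" and m: "g' v : bmeas M"
  and d: "!!u y. ((%u. g u y) has_rd g' u y) (at u)" and b: "!!u y. abs (g' u y) <= B"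
 shows "((%u. \<integral>y. g u y \<partial>M) has_rd (LINT y|M. g' v y)) (at v)"
 unfolding DERIV_def tendsto_at_iff_sequentially comp_def
proof (intro allI impI)
 interpret finite_measure M by fact
 fix X :: "nat => real" assume X: "ALL k. X k : UNIV - {0}" "X ~~> 0"
 have eq: "((LINT y|M. g (v + X k) y) - (LINT y|M. g v y)) / X k = (LINT y|M. (g (v + X k) y - g v y) / X k)" for k
  using i by simp
 show "(%k. ((LINT y|M. g (v + X k) y) - (LINT y|M. g v y)) / X k) ~~> (LINT y|M. g' v y)"
  unfolding eq
 proof (rule integral_dominated_convergence[where w = "%_. B"])
  show "g' v : bmeas M" by (rule m)
  show "(%y. (g (v + X k) y - g v y) / X k) : bmeas M" for k
  using i by (intro borel_measurable_divide borel_measurable_diff borel_measurable_const borel_measurable_integrable)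
  show "integrable M (%_. B)" by simp
  show "AE y in M. (%k. (g (v + X k) y - g v y) / X k) ~~> g' v y"
  proof (rule AE_I2)
  fix y
  show "(%k. (g (v + X k) y - g v y) / X k) ~~> g' v y"
  using d[of y v] X unfolding DERIV_def tendsto_at_iff_sequentially comp_def by blast
  qed
  show "AE y in M. norm ((g (v + X k) y - g v y) / X k) <= B" for k
  proof (rule AE_I2)
  fix y
  have "norm (g (v + X k) y - g v y) <= B * norm (v + X k - v)"
  by (rule field_differentiable_bound[of UNIV "%u. g u y" "%u. g' u y" B]) (auto intro: d b)
  then show "norm ((g (v + X k) y - g v y) / X k) <= B"
  using X(1) by (simp add: abs_divide divide_le_eq)
  qed
 qed
qed

lemma Pf_has_derivative:
 assumes I: "finite I" "i \<notin> I" and i: "i < n" and f: "f : Cb (Rn n)" and d: "d : Cb (Rn n)"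
  and der: "!!x. x : Rn n ==> ((%u. f (x(i := u))) has_rd d x) (at (x i))"
 shows "((%u. Pf n f I (xi(i := u)) nu) has_rd Pf n d I (xi(i := v)) nu) (at v)"
proof -
 obtain B where B: "!!x. x : Rn n ==> abs (d x) <= B" using Cb_bounded[OF d] by metis
 have e: "ev n I (xi(i := u)) z = (ev n I (xi(i := v)) z)(i := u)" "ev n I (xi(i := v)) z i = v" for u v z
  using I i by (auto simp: ev_def fun_eq_iff)
 show ?thesis unfolding Pf_def
 proof (rule has_derivative_integral[OF finite_measure_PiM[OF I(1)] Pf_integrable[OF I(1) f] ev_measurable[OF d]])
  fix u z
  show "((%u. f (ev n I (xi(i := u)) z)) has_rd d (ev n I (xi(i := u)) z)) (at u)"
  using der[OF ev_Rn, of I "xi(i := u)" z] by (simp only: e(1)[symmetric] e(2))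
  show "abs (d (ev n I (xi(i := u)) z)) <= B" by (rule B) simp
 qed
qed

text \<open>\<open>C2_Rn\<close> with the derivatives carried as data. \<open>pderivative\<close>
  takes values at all functions, while derivatives are only controlled on \<open>Rn n\<close>;
  naming them avoids any statement off that set.\<close>

definition C2_data :: "nat => ((nat => real) => real) => (nat => (nat => real) => real) => (nat => nat => (nat => real) => real) => bool" where
 "C2_data n f d1 d2 \<longleftrightarrow> f : Cb (Rn n) &
  (\<forall>i<n. d1 i : Cb (Rn n) & (\<forall>x\<in>Rn n. ((%u. f (x(i := u))) has_rd d1 i x) (at (x i))) &
  (\<forall>j<n. d2 i j : Cb (Rn n) & (\<forall>x\<in>Rn n. ((%u. d1 i (x(j := u))) has_rd d2 i j x) (at (x j)))))"

lemma C2_dataI: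
 assumes "f : Cb (Rn n)" "!!i. i < n ==> d1 i : Cb (Rn n)" "!!i j. i < n ==> j < n ==> d2 i j : Cb (Rn n)"
  and "!!i x. i < n ==> x : Rn n ==> ((%u. f (x(i := u))) has_rd d1 i x) (at (x i))"
  and "!!i j x. i < n ==> j < n ==> x : Rn n ==> ((%u. d1 i (x(j := u))) has_rd d2 i j x) (at (x j))"
 shows "C2_data n f d1 d2"
 using assms by (simp add: C2_data_def)

lemma C2_dataD:
 assumes "C2_data n f d1 d2"
 shows "f : Cb (Rn n)" "!!i. i < n ==> d1 i : Cb (Rn n)" "!!i j. i < n ==> j < n ==> d2 i j : Cb (Rn n)"
  and "!!i x. i < n ==> x : Rn n ==> ((%u. f (x(i := u))) has_rd d1 i x) (at (x i))"
  and "!!i j x. i < n ==> j < n ==> x : Rn n ==> ((%u. d1 i (x(j := u))) has_rd d2 i j x) (at (x j))"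
 using assms by (simp_all add: C2_data_def)

lemma C2_Rn_C2_data:
 assumes "f : C2_Rn n"
 shows "C2_data n f (%i. pder i f) (%i j. pder j (pder i f))"
proof -
 have p: "((%u. g (x(i := u))) has_rd pder i g x) (at (x i))" if "pdifferentiable i g x" for i g x
  using that by (simp add: pdifferentiable_def pderivative_def DERIV_deriv_iff_field_differentiable)
 have "f : Cb (Rn n)" and A: "i < n ==> (\<forall>x\<in>Rn n. pdifferentiable i f x) & pder i f : Cb (Rn n) &
  (\<forall>j<n. (\<forall>x\<in>Rn n. pdifferentiable j (pder i f) x) & pder j (pder i f) : Cb (Rn n))" for i
  using assms unfolding C2_Rn_def by blast+
 note B = A[THEN conjunct1] A[THEN conjunct2, THEN conjunct1] A[THEN conjunct2, THEN conjunct2, rule_format]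
 show ?thesis
 proof (rule C2_dataI)
  show "f : Cb (Rn n)" by fact
  show "pder i f : Cb (Rn n)" if "i < n" for i by (rule B(2)[OF that])
  show "pder j (pder i f) : Cb (Rn n)" if "i < n" "j < n" for i j
  using B(3)[OF that] by (rule conjunct2)
  show "((%u. f (x(i := u))) has_rd pder i f x) (at (x i))" if "i < n" "x : Rn n" for i x
  by (rule p[OF bspec[OF B(1)[OF that(1)] that(2)]])
  show "((%u. pder i f (x(j := u))) has_rd pder j (pder i f) x) (at (x j))"
  if "i < n" "j < n" "x : Rn n" for i j x
  by (rule p[OF bspec[OF conjunct1[OF B(3)[OF that(1,2)]] that(3)]])
 qed
qed

lemma measure_pair_meas_of:
 "measure (meas2 nu) (space (meas2 nu)) = (mass nu)^2"
proof -
 interpret N: finite_measure "meas_of nu" by (rule finite_measure_meas_of)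
 have "emeasure (meas2 nu) (UNIV \<times> UNIV) = emeasure (meas_of nu) UNIV * emeasure (meas_of nu) UNIV"
  by (rule N.emeasure_pair_measure_Times) auto
 also have "... = ennreal ((mass nu)^2)"
  unfolding N.emeasure_eq_measure mass_eq power2_eq_square by (simp add: ennreal_mult)
 finally show ?thesis by (intro measure_eq_emeasure_eq_ennreal) (auto simp: space_pair_measure)
qed

context path_setting
begin

definition polyG :: "nat => ((nat => real) => real) => (nat => nat => (nat => real) => real) => fmeasure => real" where
 "polyG n f d nu =
  1/2 * rho h 0 * (SUM i<n. Pf n (d i i) {..<n} undefined nu) +
  1/2 * (SUM i<n. \<Sum>j\<in>{..<n} - {i}. LINT p|(meas2 nu).
  rho h (fst p - snd p) * Pf n (d i j) ({..<n} - {i} - {j}) (undefined(i := snd p, j := fst p)) nu) +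
  1/2 * (SUM i<n. \<Sum>j\<in>{..<n} - {i}. LINT x|meas_of nu.
  \<sigma> x * Pf n f ({..<n} - {i} - {j}) (undefined(i := x, j := x)) nu)"

lemma polyG_integrable:
 assumes "finite I" "f : Cb (Rn n)"
 shows "integrable (meas2 nu) (%p. rho h (fst p - snd p) * Pf n f I (xi(i := snd p, j := fst p)) nu)"
  and "integrable (meas_of nu) (%x. \<sigma> x * Pf n f I (xi(i := x, j := x)) nu)"
proof -
 interpret NN: finite_measure "meas2 nu"
  by (rule finite_measure_pair_measure) (rule finite_measure_meas_of)+
 obtain K where K: "0 <= K" "!!p :: real \<times> real. abs (Pf n f I (xi(i := snd p, j := fst p)) nu) <= K"
  using Cb_bounded[OF Pf_upd_Cb(3)[OF assms, of xi i j nu]] by (metis UNIV_I)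
 have m: "(%p :: real \<times> real. Pf n f I (xi(i := snd p, j := fst p)) nu) : bmeas (borel \<Otimes>\<^sub>M borel)"
  unfolding borel_prod by (rule borel_measurable_continuous_onI[OF Cb_continuous[OF Pf_upd_Cb(3)[OF assms]]])
 have eqs: "sets (meas2 nu) = sets (borel \<Otimes>\<^sub>M (borel :: real measure))"
  by (intro sets_pair_measure_cong) auto
 show "integrable (meas2 nu) (%p. rho h (fst p - snd p) * Pf n f I (xi(i := snd p, j := fst p)) nu)"
 proof (rule NN.integrable_const_bound)
  show "AE p in meas2 nu. norm (rho h (fst p - snd p) * Pf n f I (xi(i := snd p, j := fst p)) nu) <= 2 * H2 * K"
  using K rho_bound order_trans[OF abs_ge_zero rho_bound] by (intro AE_I2) (auto simp: abs_mult intro!: mult_mono)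
  show "(%p. rho h (fst p - snd p) * Pf n f I (xi(i := snd p, j := fst p)) nu) : bmeas (meas2 nu)"
  unfolding measurable_cong_sets[OF eqs refl] by (intro borel_measurable_times m) measurable
 qed
 show "integrable (meas_of nu) (%x. \<sigma> x * Pf n f I (xi(i := x, j := x)) nu)"
  by (intro Cb_integrable Cb_mult \<sigma>_Cb Pf_upd_Cb(2) assms)
qed

text \<open>In the first term one slot is frozen at x, and integrating over x restores the full
  integral by \<open>Pf_remove\<close>. In the other two terms a pair of slots stays frozen, at y
  and x or both at x.\<close>

lemma generator_poly:
 assumes C: "C2_data n f d1 d2"
 shows "generator h \<sigma> (poly_functional n f) nu = polyG n f d2 nu"
proof -
 let ?N = "meas_of nu" and ?u = "undefined :: nat => real" and ?I = "{..<n}"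
 note Cb1 = C2_dataD(1)[OF C] and Cb2 = C2_dataD(2)[OF C] and Cb3 = C2_dataD(3)[OF C]
 have pf: "poly_functional n f = Pf n f ?I ?u" by (rule ext) (rule Pf_full[symmetric])
 have v1: "vderiv (poly_functional n f) u nu = (SUM i<n. Pf n f (?I - {i}) (?u(i := u)) nu)" for u
  unfolding pf by (rule vderiv2_Pf(1)) (auto intro: Cb1)
 have v2: "vderiv2 (poly_functional n f) x y nu = (SUM i<n. \<Sum>j\<in>?I - {i}. Pf n f (?I - {i} - {j}) (?u(i := y, j := x)) nu)" for x y
  unfolding pf by (rule vderiv2_Pf(2)) (auto intro: Cb1)
 have D1: "deriv (deriv (%u. vderiv (poly_functional n f) u nu)) x = (SUM i<n. Pf n (d2 i i) (?I - {i}) (?u(i := x)) nu)" for x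
 proof -
  have "deriv (%u. vderiv (poly_functional n f) u nu) = (%u. SUM i<n. Pf n (d1 i) (?I - {i}) (?u(i := u)) nu)"
  unfolding v1 by (intro ext DERIV_imp_deriv DERIV_sum Pf_has_derivative Cb1 Cb2 C2_dataD(4)[OF C]) auto
  then show ?thesis
  by (simp only:) (intro DERIV_imp_deriv DERIV_sum Pf_has_derivative Cb2 Cb3 C2_dataD(5)[OF C], auto)
 qed
 have D2: "deriv (%u. deriv (%v. vderiv2 (poly_functional n f) u v nu) y) x
  = (SUM i<n. \<Sum>j\<in>?I - {i}. Pf n (d2 i j) (?I - {i} - {j}) (?u(i := y, j := x)) nu)" for x y
 proof -
  have "deriv (%v. vderiv2 (poly_functional n f) u v nu) y = (SUM i<n. \<Sum>j\<in>?I - {i}. Pf n (d1 i) (?I - {i} - {j}) (?u(i := y, j := u)) nu)" for u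
  proof -
  have "((%v. Pf n f (?I - {i} - {j}) (?u(i := v, j := u)) nu) has_rd
  Pf n (d1 i) (?I - {i} - {j}) (?u(i := y, j := u)) nu) (at y)" if ij: "i : ?I" "j : ?I - {i}" for i j
  proof -
  \<comment> \<open>\<open>Pf_has_derivative\<close> varies the last update, whereas here slot i was
    updated before slot j.\<close>
  have tw: "?u(j := u, i := v) = ?u(i := v, j := u)" for v using ij by (intro fun_upd_twist) auto
  show ?thesis
  using Pf_has_derivative[of "?I - {i} - {j}" i n f "d1 i" "?u(j := u)" nu y, OF _ _ _ Cb1 Cb2 C2_dataD(4)[OF C]] ij
  unfolding tw by simp
  qed
  then show ?thesis unfolding v2 by (intro DERIV_imp_deriv DERIV_sum)
  qed
  moreover have "((%u. SUM i<n. \<Sum>j\<in>?I - {i}. Pf n (d1 i) (?I - {i} - {j}) (?u(i := y, j := u)) nu) has_rd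
  (SUM i<n. \<Sum>j\<in>?I - {i}. Pf n (d2 i j) (?I - {i} - {j}) (?u(i := y, j := x)) nu)) (at x)"
  by (intro DERIV_sum Pf_has_derivative Cb2 Cb3 C2_dataD(5)[OF C]) auto
  ultimately show ?thesis by (simp only: DERIV_imp_deriv)
 qed
 have T1: "(LINT x|?N. deriv (deriv (%u. vderiv (poly_functional n f) u nu)) x) = (SUM i<n. Pf n (d2 i i) ?I ?u nu)"
 proof -
  have "(LINT x|?N. deriv (deriv (%u. vderiv (poly_functional n f) u nu)) x) = (SUM i<n. LINT x|?N. Pf n (d2 i i) (?I - {i}) (?u(i := x)) nu)"
  unfolding D1 by (rule bi_sum) (intro Cb_integrable Pf_upd_Cb(1) Cb3, auto)
  also have "... = (SUM i<n. Pf n (d2 i i) ?I ?u nu)"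
  by (intro sum.cong refl Pf_remove Cb3) auto
  finally show ?thesis .
 qed
 have T2: "(LINT (x, y)|(?N \<Otimes>\<^sub>M ?N). rho h (x - y) * deriv (%u. deriv (%v. vderiv2 (poly_functional n f) u v nu) y) x)
  = (SUM i<n. \<Sum>j\<in>?I - {i}. LINT p|(?N \<Otimes>\<^sub>M ?N). rho h (fst p - snd p) * Pf n (d2 i j) (?I - {i} - {j}) (?u(i := snd p, j := fst p)) nu)"
 proof -
  have i: "integrable (?N \<Otimes>\<^sub>M ?N) (%p. rho h (fst p - snd p) * Pf n (d2 i j) (?I - {i} - {j}) (?u(i := snd p, j := fst p)) nu)"
  if "i : ?I" "j : ?I - {i}" for i j using that by (intro polyG_integrable Cb3) auto
  show ?thesis unfolding D2 case_prod_beta' sum_distrib_left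
  by (subst bi_sum, intro bib_sum i)
  (auto intro!: sum.cong bi_sum i)
 qed
 have T3: "(LINT x|?N. \<sigma> x * vderiv2 (poly_functional n f) x x nu)
  = (SUM i<n. \<Sum>j\<in>?I - {i}. LINT x|?N. \<sigma> x * Pf n f (?I - {i} - {j}) (?u(i := x, j := x)) nu)"
 proof -
  have i: "integrable ?N (%x. \<sigma> x * Pf n f (?I - {i} - {j}) (?u(i := x, j := x)) nu)" for i j
  by (intro polyG_integrable Cb1) auto
  show ?thesis unfolding v2 sum_distrib_left
  by (subst bi_sum, intro bib_sum i)
  (auto intro!: sum.cong bi_sum i)
 qed
 show ?thesis unfolding generator_def T1 T2 T3 polyG_def ..
qed

text \<open>All data enter under integrals against finite measures, so bounded pointwise convergence
  of f and of its second derivatives is enough.\<close>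

lemma polyG_tendsto:
 assumes f: "!!k :: nat. f k : Cb (Rn n)" "F : Cb (Rn n)" "!!k x. x : Rn n ==> abs (f k x) <= B"
  "!!x. x : Rn n ==> (%k. f k x) ~~> F x"
  and d: "!!k i j. i < n ==> j < n ==> d k i j : Cb (Rn n)" "!!i j. i < n ==> j < n ==> e i j : Cb (Rn n)"
  "!!k i j x. i < n ==> j < n ==> x : Rn n ==> abs (d k i j x) <= B"
  "!!i j x. i < n ==> j < n ==> x : Rn n ==> (%k. d k i j x) ~~> e i j x"
 shows "(%k. polyG n (f k) (d k) nu) ~~> polyG n F e nu"
proof -
 interpret N: finite_measure "meas_of nu" by (rule finite_measure_meas_of)
 interpret NN: finite_measure "meas2 nu"
  by (rule finite_measure_pair_measure) (rule finite_measure_meas_of)+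
 obtain L where L: "0 <= L" "!!x. abs (\<sigma> x) <= L" using CbE[OF \<sigma>_Cb] by metis
 have H: "0 <= 2 * H2" using order_trans[OF abs_ge_zero rho_bound] .
 have pd: "(%k. Pf n (d k i j) I xi nu) ~~> Pf n (e i j) I xi nu" if "i < n" "j < n" "finite I" for i j I xi
  by (rule Pf_tendsto[where B = B]) (use that in \<open>auto intro!: d\<close>)
 have pF: "(%k. Pf n (f k) I xi nu) ~~> Pf n F I xi nu" if "finite I" for I xi
  by (rule Pf_tendsto[where B = B]) (use that in \<open>auto intro!: f\<close>)
 have T2: "(%k. LINT p|(meas2 nu). rho h (fst p - snd p) * Pf n (d k i j) I (undefined(i := snd p, j := fst p)) nu)
  ~~> (LINT p|(meas2 nu). rho h (fst p - snd p) * Pf n (e i j) I (undefined(i := snd p, j := fst p)) nu)"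
  if ij: "i < n" "j < n" and I: "finite I" for i j I
 proof (rule integral_dominated_convergence[where w = "%_. 2 * H2 * (B * mass nu ^ card I)"])
  fix k
  show "AE p in meas2 nu. norm (rho h (fst p - snd p) * Pf n (d k i j) I (undefined(i := snd p, j := fst p)) nu)
  <= 2 * H2 * (B * mass nu ^ card I)"
  unfolding real_norm_def abs_mult using H by (intro AE_I2 mult_mono rho_bound Pf_bound I d ij) auto
 qed (auto intro!: borel_measurable_integrable polyG_integrable I d ij tendsto_mult_left pd)
 have T3: "(%k. LINT x|meas_of nu. \<sigma> x * Pf n (f k) I (undefined(i := x, j := x)) nu)
  ~~> (LINT x|meas_of nu. \<sigma> x * Pf n F I (undefined(i := x, j := x)) nu)" if I: "finite I" for i j I
 proof (rule integral_dominated_convergence[where w = "%_. L * (B * mass nu ^ card I)"])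
  fix k
  show "AE x in meas_of nu. norm (\<sigma> x * Pf n (f k) I (undefined(i := x, j := x)) nu) <= L * (B * mass nu ^ card I)"
  unfolding real_norm_def abs_mult using L by (intro AE_I2 mult_mono Pf_bound I f) auto
 qed (auto intro!: borel_measurable_integrable polyG_integrable I f tendsto_mult_left pF)
 show ?thesis unfolding polyG_def
  by (intro tendsto_add tendsto_mult_left tendsto_sum pd T2 T3) auto
qed

text \<open>Half of the bound \<open>2 * H2\<close> on rho gives \<open>H2\<close> in front of the n
  pure and at most n^2 mixed second derivatives, and L comes from \<sigma>. All powers of the mass
  that occur are at most \<open>1 + mass nu ^ n\<close>.\<close>

lemma polyG_bound:
 assumes f: "f : Cb (Rn n)" "!!x. x : Rn n ==> abs (f x) <= B"
  and d: "!!i j. i < n ==> j < n ==> d i j : Cb (Rn n)" "!!i j x. i < n ==> j < n ==> x : Rn n ==> abs (d i j x) <= B"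
  and B: "0 <= B" and L: "0 <= L" "!!x. abs (\<sigma> x) <= L"
 shows "abs (polyG n f d nu) <= B * (H2 * real n + (H2 + L) * real n * real n) * (1 + mass nu ^ n)"
proof -
 interpret N: finite_measure "meas_of nu" by (rule finite_measure_meas_of)
 interpret NN: finite_measure "meas2 nu"
  by (rule finite_measure_pair_measure) (rule finite_measure_meas_of)+
 have H: "0 <= 2 * H2" using order_trans[OF abs_ge_zero rho_bound] .
 define m where "m = 1 + mass nu ^ n"
 have m0: "0 <= m" using mass_nonneg by (simp add: m_def)
 have le: "mass nu ^ k <= m" if "k <= n" for k
 proof (cases "mass nu <= 1")
  case True
  then show ?thesis using power_le_one[OF mass_nonneg] zero_le_power[OF mass_nonneg] by (simp add: m_def add_increasing2)
 next
  case False
  then have "mass nu ^ k <= mass nu ^ n" using that by (intro power_increasing) auto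
  then show ?thesis by (simp add: m_def)
 qed
 \<comment> \<open>A pair of distinct indices exists only for n at least 2, so \<open>n - 2\<close>
   is not truncated.\<close>
 have c2: "card ({..<n} - {i} - {j}) = n - 2" "2 <= n" if "i < n" "j : {..<n} - {i}" for i j
  using that by (auto simp: card_Diff_singleton_if)
 have T1: "abs (Pf n (d i i) {..<n} undefined nu) <= B * m" if "i < n" for i
 proof -
  have "abs (Pf n (d i i) {..<n} undefined nu) <= B * mass nu ^ card {..<n}"
  by (rule Pf_bound) (use that in \<open>auto intro!: d\<close>)
  also have "... <= B * m" using le[of n] B by (intro mult_left_mono) auto
  finally show ?thesis .
 qed
 have T2: "abs (LINT p|(meas2 nu). rho h (fst p - snd p) * Pf n (d i j) ({..<n} - {i} - {j}) (undefined(i := snd p, j := fst p)) nu)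
  <= 2 * H2 * (B * m)" if ij: "i < n" "j : {..<n} - {i}" for i j
 proof -
  have "abs (LINT p|(meas2 nu). rho h (fst p - snd p) * Pf n (d i j) ({..<n} - {i} - {j}) (undefined(i := snd p, j := fst p)) nu)
  <= (LINT p|(meas2 nu). 2 * H2 * (B * mass nu ^ card ({..<n} - {i} - {j})))"
  proof (rule abs_integral_le[OF polyG_integrable(1)])
  fix p :: "real \<times> real"
  show "abs (rho h (fst p - snd p) * Pf n (d i j) ({..<n} - {i} - {j}) (undefined(i := snd p, j := fst p)) nu) <= 2 * H2 * (B * mass nu ^ card ({..<n} - {i} - {j}))"
  unfolding abs_mult using H ij by (intro mult_mono rho_bound Pf_bound d) auto
  qed (use ij in \<open>auto intro!: d\<close>)
  also have "... = 2 * H2 * (B * (mass nu ^ (n - 2) * mass nu ^ 2))"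
  unfolding c2[OF ij] by (simp add: measure_pair_meas_of)
  also have "mass nu ^ (n - 2) * mass nu ^ 2 = mass nu ^ n" using c2(2)[OF ij] by (simp only: power_add[symmetric] le_add_diff_inverse2)
  also have "2 * H2 * (B * mass nu ^ n) <= 2 * H2 * (B * m)" using H B le by (intro mult_left_mono) auto
  finally show ?thesis .
 qed
 have T3: "abs (LINT x|meas_of nu. \<sigma> x * Pf n f ({..<n} - {i} - {j}) (undefined(i := x, j := x)) nu) <= L * (B * m)"
  if ij: "i < n" "j : {..<n} - {i}" for i j
 proof -
  have "abs (LINT x|meas_of nu. \<sigma> x * Pf n f ({..<n} - {i} - {j}) (undefined(i := x, j := x)) nu)
  <= (LINT x|meas_of nu. L * (B * mass nu ^ card ({..<n} - {i} - {j})))"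
  proof (rule abs_integral_le[OF polyG_integrable(2)])
  fix x
  show "abs (\<sigma> x * Pf n f ({..<n} - {i} - {j}) (undefined(i := x, j := x)) nu) <= L * (B * mass nu ^ card ({..<n} - {i} - {j}))"
  unfolding abs_mult using L by (intro mult_mono Pf_bound f) auto
  qed (use f in auto)
  also have "... = L * (B * (mass nu ^ (n - 2) * mass nu))"
  unfolding c2[OF ij] by (simp add: mass_eq)
  also have "mass nu ^ (n - 2) * mass nu = mass nu ^ (n - 1)"
  using c2(2)[OF ij] power_Suc2[of "mass nu" "n - 2"] by (simp add: Suc_diff_Suc numeral_2_eq_2)
  also have "L * (B * mass nu ^ (n - 1)) <= L * (B * m)" using L B le by (intro mult_left_mono) auto
  finally show ?thesis .
 qed
 have S1: "abs (SUM i<n. Pf n (d i i) {..<n} undefined nu) <= real n * (B * m)"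
 proof -
  have "abs (SUM i<n. Pf n (d i i) {..<n} undefined nu) <= (SUM i<n. B * m)"
  by (intro order_trans[OF sum_abs sum_mono] T1) simp
  then show ?thesis by simp
 qed
 have S: "abs (SUM i<n. \<Sum>j\<in>{..<n} - {i}. g i j) <= real n * real n * K"
  if g: "!!i j. i < n ==> j : {..<n} - {i} ==> abs (g i j) <= K" and K: "0 <= K" for g :: "nat => nat => real" and K
 proof -
  have "abs (\<Sum>j\<in>{..<n} - {i}. g i j) <= real n * K" if i: "i < n" for i
  proof -
  have "abs (\<Sum>j\<in>{..<n} - {i}. g i j) <= real (card ({..<n} - {i})) * K"
  using order_trans[OF sum_abs sum_mono[of "{..<n} - {i}", OF g[OF i]]] by simp
  also have "... <= real n * K" using K i by (intro mult_right_mono) auto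
  finally show ?thesis .
  qed
  then have "abs (SUM i<n. \<Sum>j\<in>{..<n} - {i}. g i j) <= (SUM i<n. real n * K)"
  by (intro order_trans[OF sum_abs sum_mono]) auto
  then show ?thesis by simp
 qed
 have "abs (polyG n f d nu) <= 1/2 * abs (rho h 0) * (real n * (B * m)) + 1/2 * (real n * real n * (2 * H2 * (B * m))) + 1/2 * (real n * real n * (L * (B * m)))"
 proof -
  have a1: "abs (1/2 * rho h 0 * X) <= 1/2 * abs (rho h 0) * K" if "abs X <= K" for X K
  using mult_left_mono[OF that, of "abs (rho h 0)"] by (simp add: abs_mult)
  have a2: "abs (1/2 * X) <= 1/2 * K" if "abs X <= K" for X K :: real
  using that by (simp add: abs_mult)
  have "0 <= 2 * H2 * (B * m)" "0 <= L * (B * m)" using H B L m0 by auto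
  note S2 = S[OF T2 this(1)] and S3 = S[OF T3 this(2)]
  show ?thesis
  unfolding polyG_def
  by (rule order_trans[OF abs_triangle_ineq add_mono[OF order_trans[OF abs_triangle_ineq add_mono[OF a1[OF S1] a2[OF S2]]] a2[OF S3]]])
 qed
 also have "1/2 * abs (rho h 0) * (real n * (B * m)) <= H2 * (real n * (B * m))"
  using rho_bound[of 0] B m0 by (intro mult_right_mono) auto
 also have "H2 * (real n * (B * m)) + 1/2 * (real n * real n * (2 * H2 * (B * m))) + 1/2 * (real n * real n * (L * (B * m)))
  <= B * (H2 * real n + (H2 + L) * real n * real n) * m"
 proof -
  have "0 <= real n * real n * (L * (B * m))" using L B m0 by simp
  then show ?thesis by (simp add: algebra_simps)
 qed
 finally show ?thesis unfolding m_def by simp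
qed

end

section \<open>Bernstein polynomials together with two derivatives\<close>

fun bz :: "nat => (nat => real) => real => real" where
 "bz 0 G t = G 0"
| "bz (Suc n) G t = (1 - t) * bz n G t + t * bz n (%k. G (Suc k)) t"

lemma bz_diff: "bz n (%k. G k - H k) t = bz n G t - bz n H t"
proof (induction n arbitrary: G H)
 case (Suc n)
 show ?case unfolding bz.simps Suc.IH by (simp add: algebra_simps)
qed simp

lemma bz_abs_le:
 assumes "0 <= t" "t <= 1" "!!k. k <= n ==> abs (G k) <= B"
 shows "abs (bz n G t) <= B"
 using assms(3)
proof (induction n arbitrary: G)
 case (Suc n)
 have "abs (bz (Suc n) G t) <= (1 - t) * B + t * B"
  unfolding bz.simps
  by (intro order_trans[OF abs_triangle_ineq] add_mono)
  (use assms(1,2) Suc in \<open>simp_all add: abs_mult mult_left_mono\<close>)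
 then show ?case by (simp add: algebra_simps)
qed simp

text \<open>Differentiate the recursion by the product rule: the terms from the weights combine to a
  forward difference, and the inductive terms have the same shape again.\<close>

lemma bz_deriv: "(bz (Suc n) G has_rd real (Suc n) * bz n (%k. G (Suc k) - G k) t) (at t)"
proof (induction n arbitrary: G)
 case 0
 have "((%t. (1 - t) * G 0 + t * G (Suc 0)) has_rd G (Suc 0) - G 0) (at t)"
  by (auto intro!: derivative_eq_intros)
 then show ?case by simp
next
 case (Suc n)
 have "((%t. (1 - t) * bz (Suc n) G t + t * bz (Suc n) (%k. G (Suc k)) t) has_rd
  (- 1 * bz (Suc n) G t + (1 - t) * (real (Suc n) * bz n (%k. G (Suc k) - G k) t))
  + (1 * bz (Suc n) (%k. G (Suc k)) t + t * (real (Suc n) * bz n (%k. G (Suc (Suc k)) - G (Suc k)) t))) (at t)"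
  by (rule derivative_eq_intros refl Suc.IH | simp del: bz.simps)+
 also have "(- 1 * bz (Suc n) G t + (1 - t) * (real (Suc n) * bz n (%k. G (Suc k) - G k) t))
  + (1 * bz (Suc n) (%k. G (Suc k)) t + t * (real (Suc n) * bz n (%k. G (Suc (Suc k)) - G (Suc k)) t))
  = real (Suc (Suc n)) * bz (Suc n) (%k. G (Suc k) - G k) t"
  using bz_diff[of "Suc n" "%k. G (Suc k)" G t] by (simp add: algebra_simps)
 finally show ?case by (subst bz.simps(2)[abs_def])
qed

lemma Bernstein_Suc_Suc: "Bernstein (Suc n) (Suc k) t = t * Bernstein n k t + (1 - t) * Bernstein n (Suc k) t"
proof (cases "k < n")
 case True
 then have "n - k = Suc (n - Suc k)" by simp
 then show ?thesis unfolding Bernstein_def by (simp add: algebra_simps)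
next
 case False
 then show ?thesis unfolding Bernstein_def by (cases "k = n") (simp_all add: algebra_simps binomial_eq_0)
qed

text \<open>\<open>bz\<close> is de Casteljau's recursion, which makes differentiation and sup
  bounds short inductions. Identified with the usual sum, it inherits the Weierstrass approximation
  theorem.\<close>

lemma bz_Bernstein: "bz n G t = (SUM k<=n. G k * Bernstein n k t)"
proof (induction n arbitrary: G)
 case (Suc n)
 have z: "Bernstein n (Suc n) t = 0" by (simp add: Bernstein_def)
 have 0: "Bernstein (Suc n) 0 t = (1 - t) * Bernstein n 0 t" by (simp add: Bernstein_def)
 have "(SUM k<=Suc n. G k * Bernstein (Suc n) k t) = G 0 * ((1 - t) * Bernstein n 0 t)
  + (SUM k<=n. t * (G (Suc k) * Bernstein n k t) + (1 - t) * (G (Suc k) * Bernstein n (Suc k) t))"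
  unfolding sum.atMost_Suc_shift 0 Bernstein_Suc_Suc by (simp add: algebra_simps)
 also have "... = (1 - t) * (SUM k<=Suc n. G k * Bernstein n k t) + t * (SUM k<=n. G (Suc k) * Bernstein n k t)"
  unfolding sum.atMost_Suc_shift sum.distrib sum_distrib_left[symmetric] by (simp add: algebra_simps)
 also have "(SUM k<=Suc n. G k * Bernstein n k t) = (SUM k<=n. G k * Bernstein n k t)"
  by (simp add: z)
 finally show ?case by (simp add: Suc.IH)
qed (simp add: Bernstein_def)

lemma bz_tendsto:
 assumes v: "continuous_on {0..1} v" and t: "t : {0..1}"
 shows "(%n. bz n (%k. v (real k / real n)) t) ~~> v t"
proof (rule LIMSEQ_I)
 fix e :: real assume "0 < e"
 from Bernstein_Weierstrass[OF v this] obtain N where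
  N: "ALL n x. N <= n & x : {0..1} --> abs (v x - (SUM k<=n. v (real k / real n) * Bernstein n k x)) < e" by blast
 have "norm (bz n (%k. v (real k / real n)) t - v t) < e" if "N <= n" for n
  using N[rule_format, of n t] that t by (simp add: bz_Bernstein abs_minus_commute)
 then show "EX N. \<forall>n\<ge>N. norm (bz n (%k. v (real k / real n)) t - v t) < e" by blast
qed

text \<open>The mean value theorem turns differences at the nodes into derivatives at unknown
  intermediate points. These stay within \<open>2 / Suc n\<close> of k / n, and uniform continuity
  of v absorbs the displacement.\<close>

lemma bz_tendsto_perturbed:
 assumes v: "continuous_on {0..1} v" and t: "t : {0..1}"
  and xi: "!!n k. k <= n ==> xi n k : {0..1} & abs (xi n k - real k / real n) <= 2 / real (Suc n)"
 shows "(%n. bz n (%k. v (xi n k)) t) ~~> v t"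
proof -
 have "(%n. bz n (%k. v (xi n k)) t - bz n (%k. v (real k / real n)) t) ~~> 0"
 proof (rule LIMSEQ_I)
  fix e :: real assume e: "0 < e"
  have "uniformly_continuous_on {0..1} v" by (rule compact_uniformly_continuous[OF v]) simp
  from this[unfolded uniformly_continuous_on_def, rule_format, OF half_gt_zero[OF e]]
  obtain d where d: "0 < d" "\<forall>x\<in>{0..1}. \<forall>y\<in>{0..1}. dist y x < d --> dist (v y) (v x) < e / 2" by blast
  have lim: "(%n. 2 * inverse (real (Suc n))) ~~> 0"
  using tendsto_mult_left[OF LIMSEQ_inverse_real_of_nat, of 2] by (simp del: of_nat_Suc)
  from order_tendstoD(2)[OF this d(1)]
  obtain N where N: "!!n. N <= n ==> 2 / real (Suc n) < d" by (auto simp: eventually_sequentially divide_inverse)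
  have "norm (bz n (%k. v (xi n k)) t - bz n (%k. v (real k / real n)) t - 0) < e" if "N <= n" for n
  proof -
  have "abs (bz n (%k. v (xi n k) - v (real k / real n)) t) <= e / 2"
  proof (rule bz_abs_le)
  fix k assume k: "k <= n"
  have "real k / real n : {0..1}" using k by (cases "n = 0") (auto simp: divide_le_eq)
  moreover have "dist (xi n k) (real k / real n) < d" using xi[OF k] N[OF that] by (simp add: dist_real_def)
  ultimately have "dist (v (xi n k)) (v (real k / real n)) < e / 2" using xi[OF k] by (intro d(2)[rule_format]) auto
  then show "abs (v (xi n k) - v (real k / real n)) <= e / 2" by (simp add: dist_real_def)
  qed (use t in auto)
  then show ?thesis using e unfolding bz_diff by simp
  qed
  then show "EX N. \<forall>n\<ge>N. norm (bz n (%k. v (xi n k)) t - bz n (%k. v (real k / real n)) t - 0) < e" by blast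
 qed
 from tendsto_add[OF this bz_tendsto[OF v t]] show ?thesis by simp
qed

text \<open>The interval of intermediate points of a j-th difference has length
  \<open>j / (n + j)\<close> and contains k / n.\<close>

lemma node_close:
 assumes "k <= n" "0 < j" "j <= 2" "x : {real k / real (n + j) .. real (k + j) / real (n + j)}"
 shows "x : {0..1} & abs (x - real k / real n) <= 2 / real (Suc n)"
proof
 have "0 <= real k / real (n + j)" "real (k + j) / real (n + j) <= 1" using assms by (auto simp: divide_le_eq)
 then show "x : {0..1}" using assms(4) unfolding atLeastAtMost_iff by (blast intro: order_trans)
 have lo: "real k / real (n + j) <= real k / real n"
  using assms by (cases "n = 0") (auto intro!: divide_left_mono)
 have hi: "real k / real n <= real (k + j) / real (n + j)"
 proof (cases "n = 0")
  case False
  have "real k * real j <= real n * real j" using assms(1) by (intro mult_right_mono) auto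
  then show ?thesis using False by (simp add: field_simps)
 qed simp
 have "abs (x - real k / real n) <= real (k + j) / real (n + j) - real k / real (n + j)" using lo hi assms(4) by auto
 also have "... = real j / real (n + j)" by (simp add: diff_divide_distrib[symmetric])
 also have "... <= 2 / real (Suc n)" using assms(2,3) by (intro frac_le) auto
 finally show "abs (x - real k / real n) <= 2 / real (Suc n)" .
qed

lemma bz_cmult: "c * bz n G t = bz n (%k. c * G k) t"
proof (induction n arbitrary: G)
 case (Suc n)
 show ?case unfolding bz.simps Suc.IH[symmetric] by (simp add: algebra_simps)
qed simp

lemma bz_deriv1:
 assumes G: "!!t. (G has_rd G' t) (at t)" and c: "continuous_on {0..1} G'" and t: "t : {0..1}"
  and B: "!!t. t : {0..1} ==> abs (G' t) <= B"
 defines "d1 \<equiv> %n. real (Suc n) * bz n (%k. G (real (Suc k) / real (Suc n)) - G (real k / real (Suc n))) t"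
 shows "d1 ~~> G' t" "abs (d1 n) <= B"
proof -
 define P1 where "P1 n k x \<longleftrightarrow> x : {real k / real (n + 1) .. real (k + 1) / real (n + 1)} &
  real (Suc n) * (G (real (Suc k) / real (Suc n)) - G (real k / real (Suc n))) = G' x" for n k x
 have "EX x. P1 n k x" for n k
 proof -
  have "real k / real (Suc n) < real (Suc k) / real (Suc n)" by (simp add: divide_strict_right_mono)
  then obtain z where "real k / real (Suc n) < z" "z < real (Suc k) / real (Suc n)"
  and "G (real (Suc k) / real (Suc n)) - G (real k / real (Suc n)) = (real (Suc k) / real (Suc n) - real k / real (Suc n)) * G' z"
  using MVT2[of _ _ G G'] G by blast
  then show ?thesis unfolding P1_def by (intro exI[of _ z]) (auto simp: diff_divide_distrib[symmetric])
 qed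
 then have "EX xi. ALL n k. P1 n k (xi n k)" by (intro choice allI)
 then obtain xi where "!!n k. P1 n k (xi n k)" by blast
 note xi = this[unfolded P1_def, THEN conjunct1] this[unfolded P1_def, THEN conjunct2]
 have d1: "d1 = (%n. bz n (%k. G' (xi n k)) t)" unfolding d1_def bz_cmult xi(2) ..
 have near: "k <= n ==> xi n k : {0..1} & abs (xi n k - real k / real n) <= 2 / real (Suc n)" for n k
  by (rule node_close[where j = 1]) (use xi(1) in auto)
 from bz_tendsto_perturbed[OF c t near] show "d1 ~~> G' t" unfolding d1 .
 show "abs (d1 n) <= B" unfolding d1 by (rule bz_abs_le) (use t near B in auto)
qed

text \<open>Two applications of the mean value theorem to the second difference leave the factor
  \<open>Suc n / Suc (Suc n)\<close>, which is at most 1 and tends to 1.\<close>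

lemma bz_deriv2:
 assumes G: "!!t. (G has_rd G' t) (at t)" and G': "!!t. (G' has_rd G'' t) (at t)"
  and c: "continuous_on {0..1} G''" and t: "t : {0..1}" and B: "!!t. t : {0..1} ==> abs (G'' t) <= B"
 defines "d2 \<equiv> %n. real (Suc (Suc n)) * (real (Suc n) * bz n (%k. (G (real (Suc (Suc k)) / real (Suc (Suc n)))
  - G (real (Suc k) / real (Suc (Suc n)))) - (G (real (Suc k) / real (Suc (Suc n))) - G (real k / real (Suc (Suc n))))) t)"
 shows "d2 ~~> G'' t" "abs (d2 n) <= B"
proof -
 define P2 where "P2 n k x \<longleftrightarrow> x : {real k / real (n + 2) .. real (k + 2) / real (n + 2)} &
  real (Suc (Suc n)) * (real (Suc (Suc n)) * ((G (real (Suc (Suc k)) / real (Suc (Suc n)))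
  - G (real (Suc k) / real (Suc (Suc n)))) - (G (real (Suc k) / real (Suc (Suc n))) - G (real k / real (Suc (Suc n)))))) = G'' x" for n k x
 have "EX x. P2 n k x" for n k
 proof -
  define m where "m = real (Suc (Suc n))"
  define a where "a = real k / m"
  define delta where "delta = 1 / m"
  have m: "0 < m" by (simp add: m_def)
  have delta: "0 < delta" using m by (simp add: delta_def)
  have e: "real (Suc k) / m = a + delta" "real (Suc (Suc k)) / m = a + delta + delta" by (simp_all add: a_def delta_def add_divide_distrib)
  have "((%u. G (u + delta) - G u) has_rd G' (u + delta) - G' u) (at u)" for u
  by (intro DERIV_diff G) (use DERIV_shift[of G "G' (u + delta)" u delta] G in simp)
  then obtain z where z: "a < z" "z < a + delta" "(G (a + delta + delta) - G (a + delta)) - (G (a + delta) - G a) = delta * (G' (z + delta) - G' z)"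
  using MVT2[of a "a + delta" "%u. G (u + delta) - G u" "%u. G' (u + delta) - G' u"] delta by auto
  obtain y where y: "z < y" "y < z + delta" "G' (z + delta) - G' z = delta * G'' y"
  using MVT2[of z "z + delta" G' G''] delta G' by auto
  have "m * (m * ((G (a + delta + delta) - G (a + delta)) - (G (a + delta) - G a))) = (m * delta) * (m * delta) * G'' y"
  unfolding z(3) y(3) by (simp only: mult_ac)
  then have "m * (m * ((G (a + delta + delta) - G (a + delta)) - (G (a + delta) - G a))) = G'' y" using m by (simp add: delta_def)
  moreover have "y : {real k / real (n + 2) .. real (k + 2) / real (n + 2)}"
  using z y e by (simp add: a_def m_def)
  ultimately show ?thesis unfolding P2_def m_def[symmetric] a_def[symmetric] e by blast
 qed
 then have "EX zeta. ALL n k. P2 n k (zeta n k)" by (intro choice allI)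
 then obtain zeta where "!!n k. P2 n k (zeta n k)" by blast
 note zeta = this[unfolded P2_def, THEN conjunct1] this[unfolded P2_def, THEN conjunct2]
 have near2: "k <= n ==> zeta n k : {0..1} & abs (zeta n k - real k / real n) <= 2 / real (Suc n)" for n k
  by (rule node_close[where j = 2]) (use zeta(1) in auto)
 have d2: "d2 n = real (Suc n) / real (Suc (Suc n)) * bz n (%k. G'' (zeta n k)) t" for n
 proof -
  have "real (Suc (Suc n)) * (real (Suc n) * X) = real (Suc n) / real (Suc (Suc n)) * (real (Suc (Suc n)) * (real (Suc (Suc n)) * X))" for X
  by (simp del: of_nat_Suc)
  then show ?thesis unfolding d2_def bz_cmult[symmetric] zeta(2)[symmetric] by (simp only: bz_cmult)
 qed
 from tendsto_mult[OF LIMSEQ_n_over_Suc_n[THEN LIMSEQ_Suc] bz_tendsto_perturbed[OF c t near2]]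
 show "d2 ~~> G'' t" unfolding d2 by simp
 have "abs (bz n (%k. G'' (zeta n k)) t) <= B" by (rule bz_abs_le) (use t near2 B in auto)
 moreover have "real (Suc n) / real (Suc (Suc n)) <= 1" by simp
 ultimately show "abs (d2 n) <= B" unfolding d2 abs_mult
  using mult_mono[of "abs (real (Suc n) / real (Suc (Suc n)))" 1 "abs (bz n (%k. G'' (zeta n k)) t)" B] by simp
qed

section \<open>Substitution in one coordinate\<close>

definition U :: "nat => (real => real) => (real => real) => ((nat => real) => real) => (nat => real) => real" where
 "U i theta psi g x = g (x(i := theta (x i))) * psi (x i)"

lemma U_Cb:
 assumes i: "i < n" and g: "g : Cb (Rn n)" and theta: "continuous_on UNIV theta" and psi: "psi : Cb UNIV"
 shows "U i theta psi g : Cb (Rn n)"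
proof -
 obtain K where K: "!!x. x : Rn n ==> abs (g x) <= K" using Cb_bounded[OF g] by metis
 obtain L where L: "!!y. abs (psi y) <= L" using CbE[OF psi] by metis
 have "continuous_on (Rn n) (%x. (x(i := theta (x i))) j)" for j
  by (cases "j = i") (auto intro!: continuous_on_coordinate_fun[OF theta] continuous_on_coordinate)
 then have "continuous_on (Rn n) (%x. x(i := theta (x i)))" by (rule continuous_on_coordinatewise_then_product)
 then have "continuous_on (Rn n) (%x. g (x(i := theta (x i))))"
  by (rule continuous_on_compose2[OF Cb_continuous[OF g]]) (use i in \<open>auto intro: fun_upd_Rn\<close>)
 then have 1: "(%x. g (x(i := theta (x i)))) : Cb (Rn n)" by (rule CbI[where K = K]) (intro K fun_upd_Rn i)
 have 2: "(%x. psi (x i)) : Cb (Rn n)"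
  by (rule CbI[OF continuous_on_coordinate_fun[OF Cb_continuous[OF psi]] L])
 show ?thesis unfolding U_def[abs_def] by (rule Cb_mult[OF 1 2])
qed

lemma U_deriv_same:
 assumes i: "i < n" "x : Rn n"
  and g: "!!x. x : Rn n ==> ((%u. g (x(i := u))) has_rd g' x) (at (x i))"
  and theta: "!!y. (theta has_rd theta' y) (at y)" and psi: "!!y. (psi has_rd psi' y) (at y)"
 shows "((%u. U i theta psi g (x(i := u))) has_rd U i theta (%y. theta' y * psi y) g' x + U i theta psi' g x) (at (x i))"
proof -
 have "((%v. g (x(i := v))) has_rd g' (x(i := theta (x i)))) (at (theta (x i)))"
  using g[of "x(i := theta (x i))"] i by (simp add: fun_upd_Rn)
 from DERIV_mult[OF DERIV_chain2[OF this theta[of "x i"]] psi[of "x i"]]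
 show ?thesis unfolding U_def by (simp add: algebra_simps)
qed

lemma U_deriv_other:
 assumes i: "i < n" "j ~= i" "x : Rn n"
  and g: "!!x. x : Rn n ==> ((%u. g (x(j := u))) has_rd g' x) (at (x j))"
 shows "((%u. U i theta psi g (x(j := u))) has_rd U i theta psi g' x) (at (x j))"
proof -
 have tw: "x(j := u, i := theta (x i)) = x(i := theta (x i), j := u)" for u using i by (intro fun_upd_twist) auto
 have "((%u. g (x(i := theta (x i), j := u))) has_rd g' (x(i := theta (x i)))) (at (x j))"
  using g[of "x(i := theta (x i))"] i by (simp add: fun_upd_Rn)
 from DERIV_cmult_right[OF this, of "psi (x i)"]
 show ?thesis unfolding U_def using i by (simp add: tw)
qed

text \<open>Derivatives of a \<open>U\<close> are again sums of \<open>U\<close> with other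
  multipliers, which is why a multiplier psi belongs to the construction. A constant theta separates
  the variable i; the sine as theta with psi = 1 gives the bounded substitution.\<close>

definition U1 where
 "U1 i theta theta' psi psi' f d1 l = (if l = i then (%x. U i theta (%y. theta' y * psi y) (d1 i) x + U i theta psi' f x) else U i theta psi (d1 l))"

definition U2 where
 "U2 i theta theta' theta'' psi psi' psi'' f d1 d2 l j =
  (if l = i then
  (if j = i then (%x. (U i theta (%y. theta' y * (theta' y * psi y)) (d2 i i) x + U i theta (%y. theta'' y * psi y + theta' y * psi' y) (d1 i) x)
  + (U i theta (%y. theta' y * psi' y) (d1 i) x + U i theta psi'' f x))
  else (%x. U i theta (%y. theta' y * psi y) (d2 i j) x + U i theta psi' (d1 j) x))
  else (if j = i then (%x. U i theta (%y. theta' y * psi y) (d2 l i) x + U i theta psi' (d1 l) x) else U i theta psi (d2 l j)))"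

lemma C2_data_U:
 assumes C: "C2_data n f d1 d2" and i: "i < n"
  and theta: "!!y. (theta has_rd theta' y) (at y)" "!!y. (theta' has_rd theta'' y) (at y)"
  "theta' : Cb UNIV" "theta'' : Cb UNIV"
  and psi: "!!y. (psi has_rd psi' y) (at y)" "!!y. (psi' has_rd psi'' y) (at y)"
  "psi : Cb UNIV" "psi' : Cb UNIV" "psi'' : Cb UNIV"
 shows "C2_data n (U i theta psi f) (U1 i theta theta' psi psi' f d1) (U2 i theta theta' theta'' psi psi' psi'' f d1 d2)"
proof (rule C2_dataI)
 have c: "continuous_on UNIV theta" by (rule DERIV_continuous_on) (rule DERIV_subset[OF theta(1)], simp)
 note CC = C2_dataD(1,2,3)[OF C] Cb_mult Cb_add theta(3,4) psi(3,4,5) U_Cb[OF i _ c] i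
 show "U i theta psi f : Cb (Rn n)" by (intro CC)
 show "U1 i theta theta' psi psi' f d1 l : Cb (Rn n)" if "l < n" for l
  unfolding U1_def using that by (auto intro!: CC)
 show "U2 i theta theta' theta'' psi psi' psi'' f d1 d2 l j : Cb (Rn n)" if "l < n" "j < n" for l j
  unfolding U2_def using that by (auto intro!: CC)
 have w: "((%y. theta' y * psi y) has_rd theta'' y * psi y + theta' y * psi' y) (at y)" for y
  using DERIV_mult[OF theta(2)[of y] psi(1)[of y]] by (simp add: algebra_simps)
 show "((%u. U i theta psi f (x(l := u))) has_rd U1 i theta theta' psi psi' f d1 l x) (at (x l))"
  if l: "l < n" and x: "x : Rn n" for l x
  using U_deriv_same[OF i x C2_dataD(4)[OF C i] theta(1) psi(1)] U_deriv_other[OF i _ x C2_dataD(4)[OF C l], of theta psi]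
  unfolding U1_def by (cases "l = i") auto
 show "((%u. U1 i theta theta' psi psi' f d1 l (x(j := u))) has_rd U2 i theta theta' theta'' psi psi' psi'' f d1 d2 l j x) (at (x j))"
  if l: "l < n" and j: "j < n" and x: "x : Rn n" for l j x
 proof -
  consider "l = i" "j = i" | "l = i" "j ~= i" | "l ~= i" "j = i" | "l ~= i" "j ~= i" by blast
  then show ?thesis
  proof cases
  case 1
  show ?thesis unfolding 1 U1_def U2_def
  using DERIV_add[OF U_deriv_same[OF i x C2_dataD(5)[OF C i i] theta(1) w] U_deriv_same[OF i x C2_dataD(4)[OF C i] theta(1) psi(2)]]
  by simp
  next
  case 2
  show ?thesis using 2(2) unfolding 2(1) U1_def U2_def
  using DERIV_add[OF U_deriv_other[OF i 2(2) x C2_dataD(5)[OF C i j], of theta "%y. theta' y * psi y"]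
  U_deriv_other[OF i 2(2) x C2_dataD(4)[OF C j], of theta psi']]
  by simp
  next
  case 3
  show ?thesis using 3(1) unfolding 3(2) U1_def U2_def
  using U_deriv_same[OF i x C2_dataD(5)[OF C l i] theta(1) psi(1)] by simp
  next
  case 4
  then show ?thesis unfolding U1_def U2_def
  using U_deriv_other[OF i 4(2) x C2_dataD(5)[OF C l j], of theta psi] by simp
  qed
 qed
qed

lemma C2_data_add:
 assumes "C2_data n f d1 d2" "C2_data n g e1 e2"
 shows "C2_data n (%x. f x + g x) (%i x. d1 i x + e1 i x) (%i j x. d2 i j x + e2 i j x)"
 using C2_dataD[OF assms(1)] C2_dataD[OF assms(2)] by (intro C2_dataI Cb_add DERIV_add) auto

lemma C2_real_power: "phi : C2_real ==> (%y. phi y ^ k) : C2_real"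
 by (induction k) (auto intro: C2_real_const C2_real_mult)

lemma
 fixes R :: real
 assumes R: "R ~= 0"
 shows C2_real_sin_half: "(%y. (1 + sin (y / R)) / 2) : C2_real"
  and deriv_sin_half: "((%y. (1 + sin (y / R)) / 2) has_rd cos (y / R) / (2 * R)) (at y)"
  "((%y. cos (y / R) / (2 * R)) has_rd - sin (y / R) / (2 * R * R)) (at y)"
proof -
 show 1: "((%y. (1 + sin (y / R)) / 2) has_rd cos (y / R) / (2 * R)) (at y)" for y
  using R by (auto intro!: derivative_eq_intros)
 show 2: "((%y. cos (y / R) / (2 * R)) has_rd - sin (y / R) / (2 * R * R)) (at y)" for y
  using R by (auto intro!: derivative_eq_intros)
 have sc: "(%y. sin (y / R)) : Cb UNIV" "(%y. cos (y / R)) : Cb UNIV"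
  using R by (auto intro!: CbI[where K = 1] continuous_intros)
 show "(%y. (1 + sin (y / R)) / 2) : C2_real"
 proof (rule C2_realI(1)[OF 1 2])
  show "(%y. (1 + sin (y / R)) / 2) : Cb UNIV" using Cb_cmult[OF Cb_add[OF Cb_const sc(1)], of "1/2" 1] by simp
  show "(%y. cos (y / R) / (2 * R)) : Cb UNIV" using Cb_cmult[OF sc(2), of "1 / (2 * R)"] by simp
  show "(%y. - sin (y / R) / (2 * R * R)) : Cb UNIV" using Cb_cmult[OF sc(1), of "- 1 / (2 * R * R)"] by simp
 qed
qed

lemma C2_real_Bernstein: "phi : C2_real ==> (%y. Bernstein m k (phi y)) : C2_real"
 unfolding Bernstein_def by (intro C2_real_mult C2_real_const C2_real_power C2_real_diff)

text \<open>The separated terms are single basis polynomials in \<open>s y\<close>, but limits are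
  known for \<open>bz\<close> as a whole. Uniqueness of derivatives identifies the two ways of
  differentiating the sum.\<close>

lemma Bernstein_sum_derivs:
 assumes s: "s : C2_real"
 defines "beta \<equiv> %m k y. Bernstein m k (s y)"
 shows "(SUM k<=m. G k * beta m k y) = bz m G (s y)"
  and "(SUM k<=Suc n. G k * deriv (beta (Suc n) k) y) = deriv s y * (real (Suc n) * bz n (%k. G (Suc k) - G k) (s y))"
  and "(SUM k<=Suc (Suc n). G k * deriv (deriv (beta (Suc (Suc n)) k)) y)
  = deriv (deriv s) y * (real (Suc (Suc n)) * bz (Suc n) (%k. G (Suc k) - G k) (s y))
  + (deriv s y)^2 * (real (Suc (Suc n)) * (real (Suc n) * bz n (%k. (G (Suc (Suc k)) - G (Suc k)) - (G (Suc k) - G k)) (s y)))"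
proof -
 note beta = C2_realD(4,5)[OF C2_real_Bernstein[OF s]]
 show 0: "(SUM k<=m. G k * beta m k y) = bz m G (s y)" for m y
  by (simp add: beta_def bz_Bernstein)
 have 1: "(SUM k<=Suc n. G k * deriv (beta (Suc n) k) y) = deriv s y * (real (Suc n) * bz n (%k. G (Suc k) - G k) (s y))" for n y
 proof (rule DERIV_unique)
  show "((%y. SUM k<=Suc n. G k * beta (Suc n) k y) has_rd (SUM k<=Suc n. G k * deriv (beta (Suc n) k) y)) (at y)"
  unfolding beta_def by (intro deriv_sum_coeff beta)
  show "((%y. SUM k<=Suc n. G k * beta (Suc n) k y) has_rd deriv s y * (real (Suc n) * bz n (%k. G (Suc k) - G k) (s y))) (at y)"
  unfolding 0 using DERIV_chain2[OF bz_deriv C2_realD(4)[OF s, of y]] by (simp only: mult.commute)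
 qed
 then show "(SUM k<=Suc n. G k * deriv (beta (Suc n) k) y) = deriv s y * (real (Suc n) * bz n (%k. G (Suc k) - G k) (s y))" .
 show "(SUM k<=Suc (Suc n). G k * deriv (deriv (beta (Suc (Suc n)) k)) y)
  = deriv (deriv s) y * (real (Suc (Suc n)) * bz (Suc n) (%k. G (Suc k) - G k) (s y))
  + (deriv s y)^2 * (real (Suc (Suc n)) * (real (Suc n) * bz n (%k. (G (Suc (Suc k)) - G (Suc k)) - (G (Suc k) - G k)) (s y)))"
 proof (rule DERIV_unique)
  show "((%y. SUM k<=Suc (Suc n). G k * deriv (beta (Suc (Suc n)) k) y) has_rd
  (SUM k<=Suc (Suc n). G k * deriv (deriv (beta (Suc (Suc n)) k)) y)) (at y)"
  unfolding beta_def by (intro deriv_sum_coeff beta)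
  have "((%y. deriv s y * (real (Suc (Suc n)) * bz (Suc n) (%k. G (Suc k) - G k) (s y))) has_rd
  deriv (deriv s) y * (real (Suc (Suc n)) * bz (Suc n) (%k. G (Suc k) - G k) (s y))
  + real (Suc (Suc n)) * (real (Suc n) * bz n (%k. (G (Suc (Suc k)) - G (Suc k)) - (G (Suc k) - G k)) (s y) * deriv s y) * deriv s y) (at y)"
  by (rule DERIV_mult[OF C2_realD(5)[OF s] DERIV_cmult[OF DERIV_chain2[OF bz_deriv C2_realD(4)[OF s]]]])
  moreover have "real (Suc (Suc n)) * (real (Suc n) * X * deriv s y) * deriv s y = (deriv s y)^2 * (real (Suc (Suc n)) * (real (Suc n) * X))" for X
  by (simp only: power2_eq_square mult_ac)
  ultimately show "((%y. SUM k<=Suc (Suc n). G k * deriv (beta (Suc (Suc n)) k) y) has_rd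
  deriv (deriv s) y * (real (Suc (Suc n)) * bz (Suc n) (%k. G (Suc k) - G k) (s y))
  + (deriv s y)^2 * (real (Suc (Suc n)) * (real (Suc n) * bz n (%k. (G (Suc (Suc k)) - G (Suc k)) - (G (Suc k) - G k)) (s y)))) (at y)"
  unfolding 1 by (simp only:)
 qed
qed

lemma Pf_add:
 assumes "finite I" "f : Cb (Rn n)" "g : Cb (Rn n)"
 shows "Pf n (%x. f x + g x) I xi nu = Pf n f I xi nu + Pf n g I xi nu"
 unfolding Pf_def by (intro bi_add Pf_integrable assms)

context path_setting
begin

lemma polyG_add:
 assumes f: "f : Cb (Rn n)" "g : Cb (Rn n)"
  and d: "!!i j. i < n ==> j < n ==> d i j : Cb (Rn n)" "!!i j. i < n ==> j < n ==> e i j : Cb (Rn n)"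
 shows "polyG n (%x. f x + g x) (%i j x. d i j x + e i j x) nu = polyG n f d nu + polyG n g e nu"
proof -
 have 1: "(SUM i<n. Pf n (%x. d i i x + e i i x) {..<n} undefined nu) = (SUM i<n. Pf n (d i i) {..<n} undefined nu) + (SUM i<n. Pf n (e i i) {..<n} undefined nu)"
  unfolding sum.distrib[symmetric] by (intro sum.cong refl Pf_add d) auto
 have 2: "(LINT p|(meas2 nu). rho h (fst p - snd p) * Pf n (%x. d i j x + e i j x) I (undefined(i := snd p, j := fst p)) nu)
  = (LINT p|(meas2 nu). rho h (fst p - snd p) * Pf n (d i j) I (undefined(i := snd p, j := fst p)) nu)
  + (LINT p|(meas2 nu). rho h (fst p - snd p) * Pf n (e i j) I (undefined(i := snd p, j := fst p)) nu)"
  if "i < n" "j < n" "finite I" for i j I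
  unfolding Pf_add[OF that(3) d(1)[OF that(1,2)] d(2)[OF that(1,2)]] distrib_left
  by (intro bi_add polyG_integrable d that)
 have 3: "(LINT x|meas_of nu. \<sigma> x * Pf n (%x. f x + g x) I (undefined(i := x, j := x)) nu)
  = (LINT x|meas_of nu. \<sigma> x * Pf n f I (undefined(i := x, j := x)) nu) + (LINT x|meas_of nu. \<sigma> x * Pf n g I (undefined(i := x, j := x)) nu)"
  if "finite I" for i j I
  unfolding Pf_add[OF that f] distrib_left
  by (intro bi_add polyG_integrable f that)
 have "(SUM i<n. \<Sum>j\<in>{..<n} - {i}. LINT p|(meas2 nu). rho h (fst p - snd p) *
  Pf n (%x. d i j x + e i j x) ({..<n} - {i} - {j}) (undefined(i := snd p, j := fst p)) nu)
  = (SUM i<n. \<Sum>j\<in>{..<n} - {i}. (LINT p|(meas2 nu). rho h (fst p - snd p) *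
  Pf n (d i j) ({..<n} - {i} - {j}) (undefined(i := snd p, j := fst p)) nu) + (LINT p|(meas2 nu). rho h (fst p - snd p) *
  Pf n (e i j) ({..<n} - {i} - {j}) (undefined(i := snd p, j := fst p)) nu))"
  by (intro sum.cong refl 2) auto
 then show ?thesis unfolding polyG_def 1 by (simp add: 3 sum.distrib distrib_left)
qed

lemma tm_eq: "tm p f ==> (!!nu. f nu = g nu) ==> tm p g" for f g :: "fmeasure => real"
 by (metis ext)

lemma tm_prod:
 fixes F :: "'i => fmeasure => real"
 assumes "finite S" "!!i. i : S ==> tm 1 (F i)"
 shows "tm (card S) (%nu. \<Prod>i\<in>S. F i nu)"
 using assms
proof (induction S)
 case (insert i S)
 then have "tm (1 + card S) (%nu. F i nu * (\<Prod>i\<in>S. F i nu))" by (intro tm_mult) auto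
 then show ?case using insert.hyps by simp
qed (simp add: tm_const)

end

section \<open>Functions f whose polynomial functional satisfies the martingale problem\<close>

context solved
begin

text \<open>The growth bounds travel with the martingale property because \<open>MP_add'\<close>
  asks for them; they also carry measurability.\<close>

definition good :: "nat => ((nat => real) => real) => bool" where
 "good n f \<longleftrightarrow> tm n (poly_functional n f) & tm n (generator h \<sigma> (poly_functional n f)) &
  MP (poly_functional n f) (generator h \<sigma> (poly_functional n f))"

lemma good_add:
 assumes f: "good n f" "C2_data n f d1 d2" and g: "good n g" "C2_data n g e1 e2"
 shows "good n (%x. f x + g x)"
proof -
 have p: "poly_functional n (%x. f x + g x) = (%nu. poly_functional n f nu + poly_functional n g nu)"
  unfolding Pf_full[where xi = undefined, symmetric] by (intro ext Pf_add C2_dataD(1)[OF f(2)] C2_dataD(1)[OF g(2)]) simp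
 have G: "generator h \<sigma> (poly_functional n (%x. f x + g x)) =
  (%nu. generator h \<sigma> (poly_functional n f) nu + generator h \<sigma> (poly_functional n g) nu)"
  unfolding generator_poly[OF f(2)] generator_poly[OF g(2)]
  by (rule ext) (simp only: generator_poly[OF C2_data_add[OF f(2) g(2)]], intro polyG_add C2_dataD(1,3)[OF f(2)] C2_dataD(1,3)[OF g(2)])
 show ?thesis using f(1) g(1) unfolding good_def G unfolding p by (blast intro: tm_add MP_add')
qed

lemma good_sum:
 fixes m :: nat
 assumes "!!k. k <= m ==> good n (f k)" "!!k. k <= m ==> C2_data n (f k) (d1 k) (d2 k)"
 shows "good n (%x. SUM k<=m. f k x) &
  C2_data n (%x. SUM k<=m. f k x) (%i x. SUM k<=m. d1 k i x) (%i j x. SUM k<=m. d2 k i j x)"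
 using assms
proof (induction m)
 case (Suc m)
 have "good n (%x. SUM k<=m. f k x) &
  C2_data n (%x. SUM k<=m. f k x) (%i x. SUM k<=m. d1 k i x) (%i j x. SUM k<=m. d2 k i j x)"
  by (rule Suc.IH) (use Suc.prems in auto)
 then show ?case unfolding sum.atMost_Suc
  using good_add[OF _ _ Suc.prems] C2_data_add[OF _ Suc.prems(2)] by blast
qed simp

text \<open>A common bound B gives common growth constants for functional and generator, as
  \<open>MP_limit\<close> requires. Convergence is asked of f and of its second derivatives, the
  data that \<open>polyG\<close> contains.\<close>

lemma good_limit:
 assumes g: "!!k :: nat. good n (f k)" and C: "!!k. C2_data n (f k) (d1 k) (d2 k)" "C2_data n F e1 e2"
  and B: "0 <= B" "!!k x. x : Rn n ==> abs (f k x) <= B" "!!k i j x. i < n ==> j < n ==> x : Rn n ==> abs (d2 k i j x) <= B"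
  and lim: "!!x. x : Rn n ==> (%k. f k x) ~~> F x"
  "!!i j x. i < n ==> j < n ==> x : Rn n ==> (%k. d2 k i j x) ~~> e2 i j x"
 shows "good n F"
proof -
 obtain L where L: "0 <= L" "!!x. abs (\<sigma> x) <= L" using CbE[OF \<sigma>_Cb] by metis
 define c where "c = B * (H2 * real n + (H2 + L) * real n * real n)"
 have "0 <= H2" using order_trans[OF abs_ge_zero rho_bound] by simp
 then have c0: "0 <= c" using B L by (simp add: c_def)
 have tF: "tame n B (poly_functional n (f k))" for k
 proof (rule tameI)
  show "poly_functional n (f k) : bmeas pair_sigma" using g[of k] tm_measurable unfolding good_def by blast
  fix nu
  have "abs (Pf n (f k) {..<n} undefined nu) <= B * mass nu ^ card {..<n}"
  by (rule Pf_bound[OF _ C2_dataD(1)[OF C(1)] B(2)]) auto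
  then show "abs (poly_functional n (f k) nu) <= B * (1 + mass nu ^ n)"
  using B(1) by (simp add: Pf_full distrib_left)
 qed (rule B)
 have tG: "tame n c (generator h \<sigma> (poly_functional n (f k)))" for k
 proof (rule tameI)
  show "generator h \<sigma> (poly_functional n (f k)) : bmeas pair_sigma" using g[of k] tm_measurable unfolding good_def by blast
  show "abs (generator h \<sigma> (poly_functional n (f k)) nu) <= c * (1 + mass nu ^ n)" for nu
  unfolding generator_poly[OF C(1)] c_def
  by (intro polyG_bound C2_dataD(1,3)[OF C(1)] B L)
 qed (rule c0)
 have l1: "(%k. poly_functional n (f k) nu) ~~> poly_functional n F nu" for nu
  unfolding Pf_full[where xi = undefined, symmetric]
  by (rule Pf_tendsto[where B = B, OF _ C2_dataD(1)[OF C(1)] C2_dataD(1)[OF C(2)] B(2)]) (auto intro: lim)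
 have l2: "(%k. generator h \<sigma> (poly_functional n (f k)) nu) ~~> generator h \<sigma> (poly_functional n F) nu" for nu
  unfolding generator_poly[OF C(1)] generator_poly[OF C(2)]
  by (rule polyG_tendsto[where B = B, OF C2_dataD(1)[OF C(1)] C2_dataD(1)[OF C(2)] B(2) lim(1)
  C2_dataD(3)[OF C(1)] C2_dataD(3)[OF C(2)] B(3) lim(2)])
 have "MP (poly_functional n (f k)) (generator h \<sigma> (poly_functional n (f k)))" for k using g by (simp add: good_def)
 from MP_limit[OF tF tG moment_all this l1 l2] show ?thesis unfolding good_def tm_def by blast
qed

end

section \<open>Approximation by functions with separated variables\<close>

lemma rectangle_mean_value:
 assumes C: "C2_data n f d1 d2" and ij: "i < n" "j < n" "i ~= j" and x: "x : Rn n" and h: "0 < h"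
 shows "EX u v. abs (u - x i) <= h & abs (v - x j) <= h &
  f (x(i := x i + h, j := x j + h)) - f (x(i := x i + h)) - (f (x(j := x j + h)) - f x) = h * (h * d2 i j (x(i := u, j := v)))"
proof -
 have R: "x(i := u, j := v) : Rn n" for u v using x ij by (intro fun_upd_Rn)
 have tw: "x(i := u, j := v, i := w) = x(i := w, j := v)" for u v w using ij(3) by auto
 have di: "((%u. f (x(i := u, j := v))) has_rd d1 i (x(i := u, j := v))) (at u)" for u v
  using C2_dataD(4)[OF C ij(1) R, of u v] unfolding tw using ij(3) by simp
 have dj: "((%v. d1 i (x(i := u, j := v))) has_rd d2 i j (x(i := u, j := v))) (at v)" for u v
  using C2_dataD(5)[OF C ij(1,2) R, of u v] by simp
 have "((%u. f (x(i := u, j := x j + h)) - f (x(i := u, j := x j))) has_rd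
  d1 i (x(i := u, j := x j + h)) - d1 i (x(i := u, j := x j))) (at u)" for u
  by (intro DERIV_diff di)
 from MVT2[of "x i" "x i + h", OF _ this] h
 obtain u where u: "x i < u" "u < x i + h" and
  1: "f (x(i := x i + h, j := x j + h)) - f (x(i := x i + h, j := x j)) - (f (x(i := x i, j := x j + h)) - f (x(i := x i, j := x j)))
  = h * (d1 i (x(i := u, j := x j + h)) - d1 i (x(i := u, j := x j)))" by auto
 from MVT2[of "x j" "x j + h", OF _ dj] h
 obtain v where v: "x j < v" "v < x j + h" and
  2: "d1 i (x(i := u, j := x j + h)) - d1 i (x(i := u, j := x j)) = h * d2 i j (x(i := u, j := v))" by auto
 have "x(i := x i + h, j := x j) = x(i := x i + h)" using ij(3) by auto
 then show ?thesis using u v 1 unfolding 2 by (intro exI[of _ u] exI[of _ v]) auto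
qed

text \<open>The rectangle difference is symmetric in i and j, so the two mixed derivatives agree at
  points that shrink to x. Symmetry is needed because separating the variable i differentiates
  \<open>d1 j\<close> in that variable, which produces \<open>d2 j i\<close> where the target has
  \<open>d2 i j\<close>.\<close>

lemma C2_data_sym:
 assumes C: "C2_data n f d1 d2" and ij: "i < n" "j < n" and x: "x : Rn n"
 shows "d2 i j x = d2 j i x"
proof (cases "i = j")
 case False
 define H where "H k = inverse (real (Suc k))" for k
 have H: "0 < H k" for k by (simp add: H_def)
 have H0: "H ~~> 0" unfolding H_def[abs_def] by (rule LIMSEQ_inverse_real_of_nat)
 obtain u v where uv: "!!k. abs (u k - x i) <= H k & abs (v k - x j) <= H k &
  f (x(i := x i + H k, j := x j + H k)) - f (x(i := x i + H k)) - (f (x(j := x j + H k)) - f x) = H k * (H k * d2 i j (x(i := u k, j := v k)))"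
  using rectangle_mean_value[OF C ij False x H] by metis
 obtain u' v' where uv': "!!k. abs (u' k - x j) <= H k & abs (v' k - x i) <= H k &
  f (x(j := x j + H k, i := x i + H k)) - f (x(j := x j + H k)) - (f (x(i := x i + H k)) - f x) = H k * (H k * d2 j i (x(j := u' k, i := v' k)))"
  using rectangle_mean_value[OF C ij(2,1) False[symmetric] x H] by metis
 have lim: "(%k. g (x(a := p k, b := q k))) ~~> g x"
  if g: "g : Cb (Rn n)" and ab: "a < n" "b < n" "a ~= b" and p: "!!k. abs (p k - x a) <= H k" "!!k. abs (q k - x b) <= H k" for g a b p q
 proof -
  have "(%k. r k - c) ~~> 0" if "!!k. abs (r k - c) <= H k" for r c
  by (rule Lim_null_comparison[OF _ H0]) (use that in auto)
  from LIM_zero_cancel[OF this, of p "x a"] LIM_zero_cancel[OF this, of q "x b"] p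
  have pq: "p ~~> x a" "q ~~> x b" by auto
  have "(%k. (x(a := p k, b := q k)) l) ~~> x l" for l using pq ab by (cases "l = b"; cases "l = a") auto
  then have "(%k. x(a := p k, b := q k)) ~~> x" by (rule tendsto_funI)
  then show ?thesis
  by (rule continuous_on_tendsto_compose[OF Cb_continuous[OF g] _ x]) (intro always_eventually allI fun_upd_Rn x ab)
 qed
 have "d2 i j (x(i := u k, j := v k)) = d2 j i (x(j := u' k, i := v' k))" for k
 proof -
  have tw: "x(j := x j + H k, i := x i + H k) = x(i := x i + H k, j := x j + H k)" using False by auto
  have "H k * (H k * d2 i j (x(i := u k, j := v k))) = H k * (H k * d2 j i (x(j := u' k, i := v' k)))"
  using conjunct2[OF conjunct2[OF uv[of k]]] conjunct2[OF conjunct2[OF uv'[of k, unfolded tw]]] by linarith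
  then show ?thesis using H[of k] by simp
 qed
 moreover have "(%k. d2 i j (x(i := u k, j := v k))) ~~> d2 i j x"
  by (rule lim[OF C2_dataD(3)[OF C ij] ij False]) (use uv in auto)
 moreover have "(%k. d2 j i (x(j := u' k, i := v' k))) ~~> d2 j i x"
  by (rule lim[OF C2_dataD(3)[OF C ij(2,1)] ij(2,1) False[symmetric]]) (use uv' in auto)
 ultimately show ?thesis using LIMSEQ_unique by simp
qed simp

lemma C2_data_bound:
 assumes C: "C2_data n f d1 d2"
 obtains B where "0 <= B" "!!x. x : Rn n ==> abs (f x) <= B" "!!i x. i < n ==> x : Rn n ==> abs (d1 i x) <= B"
  "!!i j x. i < n ==> j < n ==> x : Rn n ==> abs (d2 i j x) <= B"
proof -
 let ?S = "f ` Rn n \<union> (\<Union>i<n. d1 i ` Rn n) \<union> (\<Union>i<n. \<Union>j<n. d2 i j ` Rn n)"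
 have "bounded ?S"
  using C2_dataD(1,2,3)[OF C] by (intro bounded_Un[THEN iffD2] conjI bounded_UN ballI) (auto simp: Cb_def)
 then obtain B where "\<forall>y\<in>?S. norm y <= B" unfolding bounded_iff by blast
 then have B: "abs y <= B" if "y : ?S" for y using bspec[OF _ that] by (simp only: real_norm_def)
 have "0 <= abs (f (%_. undefined))" by simp
 also have "... <= B" by (rule B) (auto simp: extensional_def)
 finally have "0 <= B" .
 then show ?thesis by (rule that) (rule B, blast)+
qed

text \<open>\<open>s y\<close> lies in \<open>{0..1}\<close>, so Bernstein polynomials of
  \<open>v (R * (2 * t - 1))\<close> at \<open>s y\<close> approximate
  \<open>v (R * sin (y / R))\<close> together with two y-derivatives. The bounds do not depend on m:
  the factor 2 R of the inner function is cancelled by the bound \<open>1 / (2 * R)\<close> on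
  \<open>deriv s\<close>, and R at least 1 gives the same bound for the second derivative of s.
  Degree \<open>Suc (Suc m)\<close> leaves room for two differentiations.\<close>

lemma bernstein_sin:
 fixes R y :: real
 assumes R: "1 <= R"
 defines "s \<equiv> %y. (1 + sin (y / R)) / 2" and "a \<equiv> %m k. R * (2 * (real k / real m) - 1)"
 defines "beta \<equiv> %m k y. Bernstein m k (s y)"
 shows bernstein_sin0: "continuous_on UNIV v ==> (%m. SUM k<=Suc (Suc m). v (a (Suc (Suc m)) k) * beta (Suc (Suc m)) k y) ~~> v (R * sin (y / R))"
  "(!!u. abs (v u) <= B) ==> abs (SUM k<=Suc (Suc m). v (a (Suc (Suc m)) k) * beta (Suc (Suc m)) k y) <= B"
  and bernstein_sin1: "(!!u. (v has_rd v' u) (at u)) ==> continuous_on UNIV v' ==> (!!u. abs (v' u) <= B) ==>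
  (%m. SUM k<=Suc (Suc m). v (a (Suc (Suc m)) k) * deriv (beta (Suc (Suc m)) k) y) ~~> v' (R * sin (y / R)) * cos (y / R)"
  "(!!u. (v has_rd v' u) (at u)) ==> continuous_on UNIV v' ==> (!!u. abs (v' u) <= B) ==>
  abs (SUM k<=Suc (Suc m). v (a (Suc (Suc m)) k) * deriv (beta (Suc (Suc m)) k) y) <= B"
  and bernstein_sin2: "(!!u. (v has_rd v' u) (at u)) ==> (!!u. (v' has_rd v'' u) (at u)) ==>
  continuous_on UNIV v'' ==> (!!u. abs (v' u) <= B) ==> (!!u. abs (v'' u) <= B) ==>
  (%m. SUM k<=Suc (Suc m). v (a (Suc (Suc m)) k) * deriv (deriv (beta (Suc (Suc m)) k)) y)
  ~~> v'' (R * sin (y / R)) * (cos (y / R) * cos (y / R)) + v' (R * sin (y / R)) * (- sin (y / R) / R)"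
  "(!!u. (v has_rd v' u) (at u)) ==> (!!u. (v' has_rd v'' u) (at u)) ==>
  continuous_on UNIV v'' ==> (!!u. abs (v' u) <= B) ==> (!!u. abs (v'' u) <= B) ==>
  abs (SUM k<=Suc (Suc m). v (a (Suc (Suc m)) k) * deriv (deriv (beta (Suc (Suc m)) k)) y) <= 2 * B"
proof -
 have R0: "R ~= 0" using R by simp
 let ?G = "%v t. v (R * (2 * t - 1))"
 have s: "s : C2_real" unfolding s_def by (rule C2_real_sin_half[OF R0])
 have s1: "deriv s = (%y. cos (y / R) / (2 * R))"
  unfolding s_def by (intro ext DERIV_imp_deriv deriv_sin_half(1)[OF R0])
 have s2: "deriv (deriv s) = (%y. - sin (y / R) / (2 * R * R))"
  unfolding s1 by (intro ext DERIV_imp_deriv deriv_sin_half(2)[OF R0])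
 have st: "s y : {0..1}" 
 proof -
  have "0 <= 1 + sin (y / R)" using sin_ge_minus_one[of "y / R"] by linarith
  then show ?thesis by (simp add: s_def)
 qed
 have Rs: "R * (2 * s y - 1) = R * sin (y / R)" by (simp add: s_def field_simps)
 note S = Bernstein_sum_derivs[OF s]
 have vG: "v (a m k) = ?G v (real k / real m)" for v :: "real => real" and m k by (simp add: a_def)
 have Gc: "continuous_on {0..1} (?G v)" if "continuous_on UNIV v" for v :: "real => real"
  by (rule continuous_on_compose2[OF that]) (auto intro!: continuous_intros)
 have Gd: "(?G v has_rd 2 * R * ?G v' t) (at t)" if "!!u. (v has_rd v' u) (at u)" for v v' :: "real => real" and t
 proof -
  have "((%t. R * (2 * t - 1)) has_rd 2 * R) (at t)" by (auto intro!: derivative_eq_intros)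
  from DERIV_chain2[OF that this] show ?thesis by (simp add: mult_ac)
 qed
 show "(%m. SUM k<=Suc (Suc m). v (a (Suc (Suc m)) k) * beta (Suc (Suc m)) k y) ~~> v (R * sin (y / R))" if "continuous_on UNIV v" for v
  using LIMSEQ_Suc[OF LIMSEQ_Suc[OF bz_tendsto[OF Gc[OF that] st]]] unfolding beta_def S(1) vG Rs .
 show "abs (SUM k<=Suc (Suc m). v (a (Suc (Suc m)) k) * beta (Suc (Suc m)) k y) <= B" if "!!u. abs (v u) <= B" for v m B
  unfolding beta_def S(1) by (rule bz_abs_le) (use st that in auto)
 have D1: "(%m. real (Suc m) * bz m (%k. v (a (Suc m) (Suc k)) - v (a (Suc m) k)) (s y)) ~~> 2 * R * v' (R * sin (y / R))"
  "abs (real (Suc m) * bz m (%k. v (a (Suc m) (Suc k)) - v (a (Suc m) k)) (s y)) <= 2 * R * B"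
  if v: "!!u. (v has_rd v' u) (at u)" "continuous_on UNIV v'" "!!u. abs (v' u) <= B" for v v' m B
 proof -
  have c: "continuous_on {0..1} (%t. 2 * R * ?G v' t)" by (intro continuous_on_mult continuous_on_const Gc v)
  have b: "abs (2 * R * ?G v' t) <= 2 * R * B" for t using v(3) R by (simp add: abs_mult)
  note bz_deriv1[OF Gd[OF v(1)] c st b]
  then show "(%m. real (Suc m) * bz m (%k. v (a (Suc m) (Suc k)) - v (a (Suc m) k)) (s y)) ~~> 2 * R * v' (R * sin (y / R))"
  "abs (real (Suc m) * bz m (%k. v (a (Suc m) (Suc k)) - v (a (Suc m) k)) (s y)) <= 2 * R * B"
  unfolding vG Rs .
 qed
 have cs: "abs (cos (y / R)) <= 1" "abs (sin (y / R)) <= 1" by auto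
 have c1: "abs (deriv s y) <= 1 / (2 * R)" unfolding s1 using cs R by (simp add: abs_divide divide_right_mono)
 have gen: "abs (c * X) <= B" if "abs c <= 1 / (2 * R)" "abs X <= 2 * R * B" for c X B :: real
  using mult_mono[OF that] R by (simp add: abs_mult)
 {
  fix v v' m B
  assume v: "!!u. (v has_rd v' u) (at u)" "continuous_on UNIV v'" "!!u. abs (v' u) <= B"
  show "(%m. SUM k<=Suc (Suc m). v (a (Suc (Suc m)) k) * deriv (beta (Suc (Suc m)) k) y) ~~> v' (R * sin (y / R)) * cos (y / R)"
  using tendsto_mult_left[OF LIMSEQ_Suc[OF D1(1)[OF v]], of "cos (y / R) / (2 * R)"] R0
  unfolding beta_def S(2) s1 by (simp add: mult_ac)
  show "abs (SUM k<=Suc (Suc m). v (a (Suc (Suc m)) k) * deriv (beta (Suc (Suc m)) k) y) <= B"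
  unfolding beta_def S(2) by (rule gen[OF c1 D1(2)[OF v]])
 }
 {
  fix v v' v'' m B
  assume v: "!!u. (v has_rd v' u) (at u)" "!!u. (v' has_rd v'' u) (at u)" "continuous_on UNIV v''"
  "!!u. abs (v' u) <= B" "!!u. abs (v'' u) <= B"
  have v'c: "continuous_on UNIV v'" by (rule DERIV_continuous_on) (rule DERIV_subset[OF v(2)], simp)
  note D = D1[OF v(1) v'c v(4)]
  have d2: "((%t. 2 * R * ?G v' t) has_rd 2 * R * (2 * R * ?G v'' t)) (at t)" for t
  by (intro DERIV_cmult Gd v)
  have c2: "continuous_on {0..1} (%t. 2 * R * (2 * R * ?G v'' t))" by (intro continuous_on_mult continuous_on_const Gc v)
  have b2: "abs (2 * R * (2 * R * ?G v'' t)) <= 2 * R * (2 * R * B)" for t using v(5) R by (simp add: abs_mult)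
  note E = bz_deriv2[OF Gd[OF v(1)] d2 c2 st b2, folded vG]
  have q: "R * (2 * s y - 1) = R * sin (y / R)" by (rule Rs)
  show "(%m. SUM k<=Suc (Suc m). v (a (Suc (Suc m)) k) * deriv (deriv (beta (Suc (Suc m)) k)) y)
  ~~> v'' (R * sin (y / R)) * (cos (y / R) * cos (y / R)) + v' (R * sin (y / R)) * (- sin (y / R) / R)"
  proof -
  have e: "deriv (deriv s) y * (2 * R * v' (R * sin (y / R))) + (deriv s y)^2 * (2 * R * (2 * R * v'' (R * (2 * s y - 1))))
  = v'' (R * sin (y / R)) * (cos (y / R) * cos (y / R)) + v' (R * sin (y / R)) * (- sin (y / R) / R)"
  unfolding s2 Rs unfolding s1 using R0 by (simp add: field_simps power2_eq_square)
  show ?thesis unfolding beta_def S(3) e[symmetric]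
  by (intro tendsto_add tendsto_mult_left LIMSEQ_Suc[OF D(1)] E(1))
  qed
  show "abs (SUM k<=Suc (Suc m). v (a (Suc (Suc m)) k) * deriv (deriv (beta (Suc (Suc m)) k)) y) <= 2 * B"
  proof -
  have "abs (deriv (deriv s) y) <= 1 / (2 * R)"
  proof -
  have "abs (deriv (deriv s) y) <= 1 / (2 * R * R)" unfolding s2 using cs R by (simp add: abs_divide abs_mult divide_right_mono)
  also have "... <= 1 / (2 * R)" using R by (intro divide_left_mono) auto
  finally show ?thesis .
  qed
  from gen[OF this D(2)] have 1: "abs (deriv (deriv s) y * (real (Suc (Suc m)) * bz (Suc m) (%k. v (a (Suc (Suc m)) (Suc k)) - v (a (Suc (Suc m)) k)) (s y))) <= B" .
  from gen[OF c1 gen[OF c1 E(2)]] have 2: "abs ((deriv s y)^2 * (real (Suc (Suc m)) * (real (Suc m) * bz m (%k. v (a (Suc (Suc m)) (Suc (Suc k))) - v (a (Suc (Suc m)) (Suc k))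
  - (v (a (Suc (Suc m)) (Suc k)) - v (a (Suc (Suc m)) k))) (s y)))) <= B"
  unfolding power2_eq_square mult.assoc .
  show ?thesis unfolding beta_def S(3)
  using order_trans[OF abs_triangle_ineq add_mono[OF 1 2]] by (simp only: mult_2)
  qed
 }
qed

text \<open>Freezes the first k coordinates at constants and multiplies by one-variable factors.
  \<open>V 0\<close> is f itself, and on \<open>Rn n\<close> the function \<open>V n\<close> is a
  constant times a product; the approximation climbs back from n to 0.\<close>

primrec V where
 "V 0 a psi f = f"
| "V (Suc k) a psi f = U k (%_. a k) (psi k) (V k a psi f)"

lemma V_eq: "V k a psi f x = f (%i. if i < k then a i else x i) * (\<Prod>i<k. psi i (x i))"
proof (induction k arbitrary: x)
 case (Suc k)
 have "(%i. if i < k then a i else (x(k := a k)) i) = (%i. if i < Suc k then a i else x i)" by (auto simp: fun_eq_iff less_Suc_eq)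
 moreover have "(\<Prod>i<k. psi i ((x(k := a k)) i)) = (\<Prod>i<k. psi i (x i))" by (intro prod.cong) auto
 ultimately show ?case by (simp only: V.simps U_def Suc.IH prod.lessThan_Suc mult.assoc)
qed simp

lemma V_cong: "(!!i. i < k ==> a i = b i) ==> (!!i. i < k ==> psi i = eta i) ==> V k a psi f = V k b eta f"
 by (induction k) simp_all

lemma C2_data_const_subst:
 assumes "C2_data n f d1 d2" "i < n" "psi : C2_real"
 shows "C2_data n (U i (%_. a) psi f) (U1 i (%_. a) (%_. 0) psi (deriv psi) f d1)
  (U2 i (%_. a) (%_. 0) (%_. 0) psi (deriv psi) (deriv (deriv psi)) f d1 d2)"
 by (rule C2_data_U[OF assms(1,2) _ _ _ _ C2_realD(4)[OF assms(3)] C2_realD(5)[OF assms(3)] C2_realD(1,2,3)[OF assms(3)]])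
  (auto intro: Cb_const)

lemma V_C2_data:
 assumes "C2_data n f d1 d2" "!!i. psi i : C2_real" "k <= n"
 shows "EX e1 e2. C2_data n (V k a psi f) e1 e2"
 using assms(3)
proof (induction k)
 case 0
 show ?case using assms(1) by auto
next
 case (Suc k)
 then obtain e1 e2 where e: "C2_data n (V k a psi f) e1 e2" by auto
 have "k < n" using Suc.prems by simp
 from C2_data_const_subst[OF e this assms(2)] show ?case by auto
qed

context path_setting
begin

text \<open>On product functions the polynomial functional is the product of the pairings, a
  cylinder function for the product of all coordinates; its generator is therefore known from
  \<open>generator_cylinder\<close>.\<close>

lemma
 assumes psi: "!!i. psi i : C2_real"
 shows poly_functional_prod: "poly_functional n (%x. \<Prod>i<n. psi i (x i)) = (%nu. \<Prod>i<n. pv n psi nu i)"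
  and generator_prod: "generator h \<sigma> (poly_functional n (%x. \<Prod>i<n. psi i (x i))) = cylG n (%x. \<Prod>i<n. x i) psi"
proof -
 show p: "poly_functional n (%x. \<Prod>i<n. psi i (x i)) = (%nu. (\<Prod>i<n. pv n psi nu i))"
 proof (rule ext)
  fix nu
  interpret product_sigma_finite "%_ :: nat. meas_of nu" by (rule product_sigma_finite_meas_of)
  show "poly_functional n (%x. \<Prod>i<n. psi i (x i)) nu = (\<Prod>i<n. pv n psi nu i)"
  unfolding poly_functional_def
  by (subst product_integral_prod) (auto simp: pv_def pairing_def intro!: Cb_integrable C2_realD psi)
 qed
 show "generator h \<sigma> (poly_functional n (%x. \<Prod>i<n. psi i (x i))) = cylG n (%x. \<Prod>i<n. x i) psi"
  unfolding p by (intro ext generator_cylinder[of n "%x. \<Prod>i<n. x i"] C2_loc_prod psi)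
qed

end

context solved
begin

lemma good_cong: "(!!x. x : Rn n ==> f x = g x) ==> good n f ==> good n g"
proof -
 assume fg: "!!x. x : Rn n ==> f x = g x" and "good n f"
 have "poly_functional n f = poly_functional n g"
  unfolding poly_functional_def
  by (intro ext bi_cong refl fg) (auto simp: space_PiM PiE_def)
 then show ?thesis using \<open>good n f\<close> by (simp add: good_def)
qed

text \<open>Ito's formula for a product of pairings. The growth is of order n: a first derivative
  removes one factor and \<open>drift\<close> restores order 1, a mixed second derivative removes
  two and \<open>\<Gamma>\<close> restores order 2.\<close>

lemma good_prod:
 assumes psi: "!!i. psi i : C2_real"
 shows "good n (%x. \<Prod>i<n. psi i (x i))"
proof -
 let ?f = "%x :: nat => real. \<Prod>i<n. x i"
 note tp = tm_pairing[OF C2_realD(1)[OF psi]]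
 have t1: "tm n (%nu. ?f (pv n psi nu))"
  by (rule tm_eq[OF tm_prod[of "{..<n}" "%i. pairing (psi i)", OF _ tp, simplified]]) (simp add: pv_def)
 have t2: "tm n (cylG n ?f psi)"
 proof -
  have P: "tm (card S) (%nu. \<Prod>l\<in>S. pv n psi nu l)" if "S \<subseteq> {..<n}" for S
  proof (rule tm_eq[OF tm_prod[of S "%i. pairing (psi i)"]])
  show "finite S" using finite_subset[OF that] by simp
  show "(\<Prod>i\<in>S. pairing (psi i) nu) = (\<Prod>l\<in>S. pv n psi nu l)" for nu using that by (intro prod.cong) (auto simp: pv_def)
  qed (rule tp)
  have 1: "tm n (%nu. pder i ?f (pv n psi nu) * drift (psi i) nu)" if i: "i < n" for i
  proof -
  have "tm (card ({..<n} - {i}) + 1) (%nu. (\<Prod>l\<in>{..<n} - {i}. pv n psi nu l) * drift (psi i) nu)"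
  by (intro tm_mult P tm_drift psi) auto
  then show ?thesis using i by (simp add: pderivative_prod(1) card_Diff_singleton)
  qed
  have 2: "tm n (%nu. pder j (pder i ?f) (pv n psi nu) * \<Gamma> (psi i) (psi j) nu)" if i: "i < n" and j: "j < n" for i j
  proof (cases "j = i")
  case True
  then show ?thesis using i by (simp add: pderivative_prod(1) tm_const)
  next
  case False
  have "tm (card ({..<n} - {i} - {j}) + 2) (%nu. (\<Prod>l\<in>{..<n} - {i} - {j}. pv n psi nu l) * \<Gamma> (psi i) (psi j) nu)"
  by (intro tm_mult P tm_\<Gamma> psi) auto
  moreover have "card ({..<n} - {i} - {j}) + 2 = n" using i j False by (simp add: card_Diff_singleton_if)
  ultimately show ?thesis using i j False by (simp add: pderivative_prod(1))
  qed
  show ?thesis unfolding cylG_def[abs_def] by (intro tm_add tm_cmult tm_sum 1 2) auto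
 qed
 note p = poly_functional_prod[of psi n, OF psi] and g = generator_prod[of psi n, OF psi]
 show ?thesis unfolding good_def g unfolding p using t1 t2 MP_cyl[OF C2_loc_prod psi t1 t2] by blast
qed

text \<open>The Bernstein sum in the variable i is a finite sum of \<open>U i\<close> with constant
  substitution, each good by H. Its limit, second derivatives included, is f with the coordinate
  replaced by \<open>theta\<close>.\<close>

lemma good_sin_subst:
 assumes C: "C2_data n f d1 d2" and i: "i < n" and R: "1 <= R"
  and H: "!!a psi. psi : C2_real ==> good n (U i (%_. a) psi f)"
  and B: "!!x. x : Rn n ==> abs (f x) <= B" "!!i x. i < n ==> x : Rn n ==> abs (d1 i x) <= B"
  "!!i j x. i < n ==> j < n ==> x : Rn n ==> abs (d2 i j x) <= B" "0 <= B"
 defines "theta \<equiv> %y. R * sin (y / R)"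
 defines "e1 \<equiv> U1 i theta (%y. cos (y / R)) (%_. 1) (%_. 0) f d1"
  and "e2 \<equiv> U2 i theta (%y. cos (y / R)) (%y. - sin (y / R) / R) (%_. 1) (%_. 0) (%_. 0) f d1 d2"
 shows "good n (U i theta (%_. 1) f) & C2_data n (U i theta (%_. 1) f) e1 e2"
proof
 define s where "s y = (1 + sin (y / R)) / 2" for y
 define beta where "beta m k = (%y. Bernstein m k (s y))" for m k
 define a where "a m k = R * (2 * (real k / real m) - 1)" for m k :: nat
 have R0: "R ~= 0" using R by simp
 have sc: "(%y. sin (y / R)) : Cb UNIV" "(%y. cos (y / R)) : Cb UNIV"
  using R0 by (auto intro!: CbI[where K = 1] continuous_intros)
 show CF: "C2_data n (U i theta (%_. 1) f) e1 e2"
  unfolding e1_def e2_def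
 proof (rule C2_data_U[OF C i])
  show "(theta has_rd cos (y / R)) (at y)" for y unfolding theta_def using R0 by (auto intro!: derivative_eq_intros)
  show "((%y. cos (y / R)) has_rd - sin (y / R) / R) (at y)" for y using R0 by (auto intro!: derivative_eq_intros)
  show "(%y. cos (y / R)) : Cb UNIV" by (rule sc)
  show "(%y. - sin (y / R) / R) : Cb UNIV" using Cb_cmult[OF sc(1), of "- 1 / R"] by simp
 qed (auto intro: Cb_const)
 have beta: "beta m k : C2_real" for m k
  unfolding beta_def s_def by (rule C2_real_Bernstein[OF C2_real_sin_half[OF R0]])
 let ?f = "%m x. SUM k<=Suc (Suc m). U i (%_. a (Suc (Suc m)) k) (beta (Suc (Suc m)) k) f x"
 let ?e = "%m k. U2 i (%_. a (Suc (Suc m)) k) (%_. 0) (%_. 0) (beta (Suc (Suc m)) k) (deriv (beta (Suc (Suc m)) k)) (deriv (deriv (beta (Suc (Suc m)) k))) f d1 d2"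
 note GS = good_sum[OF H[OF beta] C2_data_const_subst[OF C i beta]]
 have bb: "Bernstein m k (s y) = beta m k y" for m k y by (simp add: beta_def)
 note bs = bernstein_sin0[OF R, folded s_def, folded a_def, unfolded bb] bernstein_sin1[OF R, folded s_def, folded beta_def, folded a_def]
  bernstein_sin2[OF R, folded s_def, folded beta_def, folded a_def]
 have dv: "((%u. f (x(i := u))) has_rd d1 i (x(i := u))) (at u)"
  "j < n ==> ((%u. d1 j (x(i := u))) has_rd d2 j i (x(i := u))) (at u)" if "x : Rn n" for x u j
  using C2_dataD(4)[OF C i fun_upd_Rn[OF that i], of u] C2_dataD(5)[OF C _ i fun_upd_Rn[OF that i], of j u] by auto
 have ct: "continuous_on UNIV (%u. g (x(i := u)))" if "g : Cb (Rn n)" "x : Rn n" for g x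
 proof (rule continuous_on_compose2[OF Cb_continuous[OF that(1)]])
  show "continuous_on UNIV (%u. x(i := u))"
  proof (rule continuous_on_coordinatewise_then_product)
  show "continuous_on UNIV (%u. (x(i := u)) j)" for j by (cases "j = i") auto
  qed
 qed (use that i in \<open>auto intro: fun_upd_Rn\<close>)
 have xB: "abs (f (x(i := u))) <= B" "j < n ==> abs (d1 j (x(i := u))) <= B" "j < n ==> l < n ==> abs (d2 j l (x(i := u))) <= B" if "x : Rn n" for x u j l
  using B fun_upd_Rn[OF that i] by auto
 \<comment> \<open>Four cases according to which of l and j equals i: two, one or no derivatives
   fall on the Bernstein factor, matching \<open>bernstein_sin2\<close>,
   \<open>bernstein_sin1\<close> and \<open>bernstein_sin0\<close>.\<close>
 have e_lim: "(%m. SUM k<=Suc (Suc m). ?e m k l j x) ~~> e2 l j x"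
  and e_bd: "abs (SUM k<=Suc (Suc m). ?e m k l j x) <= 2 * B" if lj: "l < n" "j < n" and x: "x : Rn n" for l j x m
 proof -
  have "(%m. SUM k<=Suc (Suc m). ?e m k l j x) ~~> e2 l j x & (ALL m. abs (SUM k<=Suc (Suc m). ?e m k l j x) <= 2 * B)"
  proof (cases "l = i")
  case True
  show ?thesis
  proof (cases "j = i")
  case j: True
  have "(SUM k<=Suc (Suc m). ?e m k l j x) = (SUM k<=Suc (Suc m). f (x(i := a (Suc (Suc m)) k)) * deriv (deriv (beta (Suc (Suc m)) k)) (x i))" for m
  using True j by (simp add: U2_def U_def)
  moreover have "e2 l j x = d2 i i (x(i := R * sin (x i / R))) * (cos (x i / R) * cos (x i / R)) + d1 i (x(i := R * sin (x i / R))) * (- sin (x i / R) / R)"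
  using True j by (simp add: e2_def U2_def U_def theta_def)
  ultimately show ?thesis
  using bs(5)[OF dv(1)[OF x] dv(2)[OF x i] ct[OF C2_dataD(3)[OF C i i] x] xB(2)[OF x i] xB(3)[OF x i i]]
  bs(6)[OF dv(1)[OF x] dv(2)[OF x i] ct[OF C2_dataD(3)[OF C i i] x] xB(2)[OF x i] xB(3)[OF x i i]]
  by (simp only: simp_thms)
  next
  case j: False
  have "(SUM k<=Suc (Suc m). ?e m k l j x) = (SUM k<=Suc (Suc m). d1 j (x(i := a (Suc (Suc m)) k)) * deriv (beta (Suc (Suc m)) k) (x i))" for m
  using True j by (simp add: U2_def U_def)
  moreover have "e2 l j x = d2 j i (x(i := R * sin (x i / R))) * cos (x i / R)"
  using True j C2_data_sym[OF C i lj(2) fun_upd_Rn[OF x i]] by (simp add: e2_def U2_def U_def theta_def)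
  ultimately show ?thesis
  using bs(3)[OF dv(2)[OF x lj(2)] ct[OF C2_dataD(3)[OF C lj(2) i] x] xB(3)[OF x lj(2) i]]
  order_trans[OF bs(4)[OF dv(2)[OF x lj(2)] ct[OF C2_dataD(3)[OF C lj(2) i] x] xB(3)[OF x lj(2) i]], of "2 * B"] B(4)
  by (simp only: simp_thms)
  qed
  next
  case False
  show ?thesis
  proof (cases "j = i")
  case j: True
  have "(SUM k<=Suc (Suc m). ?e m k l j x) = (SUM k<=Suc (Suc m). d1 l (x(i := a (Suc (Suc m)) k)) * deriv (beta (Suc (Suc m)) k) (x i))" for m
  using False j by (simp add: U2_def U_def)
  moreover have "e2 l j x = d2 l i (x(i := R * sin (x i / R))) * cos (x i / R)"
  using False j by (simp add: e2_def U2_def U_def theta_def)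
  ultimately show ?thesis
  using bs(3)[OF dv(2)[OF x lj(1)] ct[OF C2_dataD(3)[OF C lj(1) i] x] xB(3)[OF x lj(1) i]]
  order_trans[OF bs(4)[OF dv(2)[OF x lj(1)] ct[OF C2_dataD(3)[OF C lj(1) i] x] xB(3)[OF x lj(1) i]], of "2 * B"] B(4)
  by (simp only: simp_thms)
  next
  case j: False
  have "(SUM k<=Suc (Suc m). ?e m k l j x) = (SUM k<=Suc (Suc m). d2 l j (x(i := a (Suc (Suc m)) k)) * beta (Suc (Suc m)) k (x i))" for m
  using False j by (simp add: U2_def U_def)
  moreover have "e2 l j x = d2 l j (x(i := R * sin (x i / R)))"
  using False j by (simp add: e2_def U2_def U_def theta_def)
  ultimately show ?thesis
  using bs(1)[OF ct[OF C2_dataD(3)[OF C lj] x]] order_trans[OF bs(2)[of "%u. d2 l j (x(i := u))", OF xB(3)[OF x lj]], of "2 * B"] B(4)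
  by (simp only: simp_thms)
  qed
  qed
  then show "(%m. SUM k<=Suc (Suc m). ?e m k l j x) ~~> e2 l j x" "abs (SUM k<=Suc (Suc m). ?e m k l j x) <= 2 * B" by blast+
 qed
 show "good n (U i theta (%_. 1) f)"
 proof (rule good_limit[where B = "2 * B", OF GS[THEN conjunct1] GS[THEN conjunct2] CF])
  fix x assume x: "x : Rn n"
  show "(%m. ?f m x) ~~> U i theta (%_. 1) f x"
  using bs(1)[OF ct[OF C2_dataD(1)[OF C] x], of "x i"] by (simp add: U_def theta_def del: sum.atMost_Suc)
  show "abs (?f m x) <= 2 * B" for m
  using bs(2)[of "%u. f (x(i := u))" B m "x i", OF xB(1)[OF x]] B(4) unfolding U_def by linarith
 qed (use B(4) e_lim e_bd in auto)
qed

text \<open>As R tends to infinity, \<open>R * sin (y / R)\<close> tends to y, its derivative to 1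
  and its second derivative to 0. For R at least 1 both derivatives are bounded by 1, so the second
  derivatives of the substituted functions stay within 2 B.\<close>

lemma good_coordinate:
 assumes C: "C2_data n f d1 d2" and i: "i < n" and H: "!!a psi. psi : C2_real ==> good n (U i (%_. a) psi f)"
 shows "good n f"
proof -
 obtain B where B: "0 <= B" "!!x. x : Rn n ==> abs (f x) <= B" "!!i x. i < n ==> x : Rn n ==> abs (d1 i x) <= B"
  "!!i j x. i < n ==> j < n ==> x : Rn n ==> abs (d2 i j x) <= B"
  by (rule C2_data_bound[OF C]) (rule that)
 define R where "R k = real (Suc k)" for k
 have R: "1 <= R k" for k by (simp add: R_def)
 let ?theta = "%k y. R k * sin (y / R k)"
 note G = good_sin_subst[OF C i R H B(2,3,4,1)]
 have iR: "(%k. inverse (R k)) ~~> 0" unfolding R_def by (rule LIMSEQ_inverse_real_of_nat)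
 have z: "(%k. y / R k) ~~> 0" for y
  using tendsto_mult_left[OF iR, of y] by (simp add: divide_inverse)
 have c1: "(%k. cos (y / R k)) ~~> 1" for y using tendsto_cos[OF z[of y]] by simp
 have s0: "(%k. - sin (y / R k) / R k) ~~> 0" for y
  using tendsto_mult[OF tendsto_minus[OF tendsto_sin[OF z[of y]]] iR] by (simp add: divide_inverse)
 have theta: "(%k. ?theta k y) ~~> y" for y
 proof -
  have "((%u. sin (u * y)) has_rd y) (at 0)" by (auto intro!: derivative_eq_intros)
  then have "(%k. (sin ((0 + inverse (R k)) * y) - sin (0 * y)) / inverse (R k)) ~~> y"
  unfolding DERIV_def tendsto_at_iff_sequentially comp_def using iR R by (auto simp: R_def)
  then show ?thesis by (simp add: divide_inverse mult.commute)
 qed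
 have lim: "(%k. g (x(i := ?theta k (x i)))) ~~> g x" if g: "g : Cb (Rn n)" and x: "x : Rn n" for g x
 proof -
  have "(%k. (x(i := ?theta k (x i))) l) ~~> x l" for l using theta[of "x i"] by (cases "l = i") auto
  then have "(%k. x(i := ?theta k (x i))) ~~> x" by (rule tendsto_funI)
  then show ?thesis
  by (rule continuous_on_tendsto_compose[OF Cb_continuous[OF g] _ x]) (intro always_eventually allI fun_upd_Rn x i)
 qed
 show ?thesis
 proof (rule good_limit[where B = "2 * B", OF G[THEN conjunct1] G[THEN conjunct2] C])
  show "0 <= 2 * B" using B by simp
  fix x assume x: "x : Rn n"
  note xR = fun_upd_Rn[OF x i]
  show "(%k. U i (?theta k) (%_. 1) f x) ~~> f x" unfolding U_def using lim[OF C2_dataD(1)[OF C] x] by simp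
  show "abs (U i (?theta k) (%_. 1) f x) <= 2 * B" for k
  unfolding U_def using B(2)[OF xR, of "?theta k (x i)"] B(1) by simp
  fix l j assume lj: "l < n" "j < n"
  let ?e = "%k. U2 i (?theta k) (%y. cos (y / R k)) (%y. - sin (y / R k) / R k) (%_. 1) (%_. 0) (%_. 0) f d1 d2 l j x"
  have e: "?e k = (if l = i & j = i then d2 i i (x(i := ?theta k (x i))) * (cos (x i / R k) * cos (x i / R k)) + d1 i (x(i := ?theta k (x i))) * (- sin (x i / R k) / R k)
  else if l = i | j = i then d2 l j (x(i := ?theta k (x i))) * cos (x i / R k) else d2 l j (x(i := ?theta k (x i))))" for k
  by (auto simp: U2_def U_def)
  have l2: "(%k. d2 l j (x(i := ?theta k (x i)))) ~~> d2 l j x" and l1: "(%k. d1 l (x(i := ?theta k (x i)))) ~~> d1 l x"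
  by (intro lim C2_dataD[OF C] lj x)+
  show "?e ~~> d2 l j x"
  proof -
  consider "l = i" "j = i" | "l = i | j = i" "\<not> (l = i & j = i)" | "l ~= i" "j ~= i" by blast
  then show ?thesis
  proof cases
  case 1
  have "(%k. d2 l j (x(i := ?theta k (x i))) * (cos (x i / R k) * cos (x i / R k)) + d1 l (x(i := ?theta k (x i))) * (- sin (x i / R k) / R k))
  ~~> d2 l j x * (1 * 1) + d1 l x * 0"
  by (intro tendsto_add tendsto_mult l1 l2 c1 s0)
  then show ?thesis unfolding e using 1 by simp
  next
  case 2
  then show ?thesis unfolding e using tendsto_mult[OF l2 c1[of "x i"]] by (simp only: if_True if_False mult_1_right)
  next
  case 3
  then show ?thesis unfolding e using l2 by simp
  qed
  qed
  fix k
  have b2: "abs (d2 l j (x(i := ?theta k (x i)))) <= B" and b1: "abs (d1 l (x(i := ?theta k (x i)))) <= B"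
  by (intro B xR lj)+
  have c: "abs (cos (x i / R k)) <= 1" by simp
  have s: "abs (- sin (x i / R k) / R k) <= 1" using R[of k] order_trans[OF abs_sin_le_one[of "x i / R k"] R[of k]] by (simp add: abs_divide divide_le_eq)
  have m: "abs (X * Y) <= B" if "abs X <= B" "abs Y <= 1" for X Y :: real
  using mult_mono[OF that] B(1) by (simp add: abs_mult)
  show "abs (?e k) <= 2 * B"
  proof -
  have "abs (cos (x i / R k) * cos (x i / R k)) <= 1" using mult_mono[OF c c] by (simp add: abs_mult)
  from order_trans[OF abs_triangle_ineq add_mono[OF m[OF b2 this] m[OF b1 s]]] m[OF b2 c] b2 B(1)
  show ?thesis unfolding e by (cases "l = i"; cases "j = i") (simp_all del: minus_divide_left)
  qed
 qed
qed

text \<open>Downward induction on k: goodness with one more coordinate frozen, at any constant and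
  with any factor, is the hypothesis under which \<open>good_coordinate\<close> releases that
  coordinate.\<close>

lemma good_V:
 assumes C: "C2_data n f d1 d2" and n: "1 <= n" and k: "k <= n"
 shows "(!!i. psi i : C2_real) ==> good n (V k a psi f)"
 using k
proof (induction k arbitrary: a psi rule: inc_induct)
 case base
 define c where "c = f (%i. if i < n then a i else undefined)"
 \<comment> \<open>The constant is absorbed into the factor of coordinate 0, which exists because n
   is at least 1.\<close>
 let ?psi = "psi(0 := %y. c * psi 0 y)"
 have psi': "?psi i : C2_real" for i using base.prems C2_real_mult[OF C2_real_const] by auto
 show ?case
 proof (rule good_cong[OF _ good_prod[of ?psi n, OF psi']])
  fix x assume x: "x : Rn n"
  have "(%i. if i < n then a i else x i) = (%i. if i < n then a i else undefined)"
  using x by (auto simp: extensional_def fun_eq_iff)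
  then have "V n a psi f x = c * (\<Prod>i<n. psi i (x i))" by (simp add: V_eq c_def)
  also have "(\<Prod>i<n. psi i (x i)) = psi 0 (x 0) * (\<Prod>i\<in>{..<n} - {0}. psi i (x i))" using n by (intro prod.remove) auto
  also have "c * ... = ?psi 0 (x 0) * (\<Prod>i\<in>{..<n} - {0}. ?psi i (x i))" by simp
  also have "... = (\<Prod>i<n. ?psi i (x i))" using n by (intro prod.remove[symmetric]) auto
  finally show "(\<Prod>i<n. ?psi i (x i)) = V n a psi f x" ..
 qed
next
 case (step k)
 obtain e1 e2 where e: "C2_data n (V k a psi f) e1 e2"
  using V_C2_data[of n f d1 d2 psi k a, OF C step.prems] step.hyps by auto
 show ?case
 proof (rule good_coordinate[OF e])
  show "k < n" using step.hyps by simp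
  fix b eta assume eta: "eta : C2_real"
  have "good n (V (Suc k) (a(k := b)) (psi(k := eta)) f)" using eta step.prems by (intro step.IH) auto
  \<comment> \<open>\<open>V k\<close> reads a and psi only below k.\<close>
  moreover have "V k (a(k := b)) (psi(k := eta)) f = V k a psi f" by (rule V_cong) auto
  ultimately show "good n (U k (%_. b) eta (V k a psi f))" by simp
 qed
qed

lemma good_C2:
 assumes "f : C2_Rn n" "1 <= n"
 shows "good n f"
 using good_V[OF C2_Rn_C2_data[OF assms(1)] assms(2), of 0 "%_ _. 1"] by (simp add: C2_real_const)

end

section \<open>Continuity of polynomial functionals along paths\<close>

lemma Pf_lipschitz:
 assumes I: "finite I" "i \<notin> I" and f: "f : Cb (Rn n)" and L: "0 <= L"
  and lip: "!!i x u v. i < n ==> x : Rn n ==> abs (f (x(i := u)) - f (x(i := v))) <= L * abs (u - v)"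
 shows "abs (Pf n f I (xi(i := a)) nu - Pf n f I (xi(i := b)) nu) <= L * abs (a - b) * mass nu ^ card I"
proof -
 interpret finite_measure "PiM I (%_. meas_of nu)" by (rule finite_measure_PiM[OF I(1)])
 have le: "abs (f (ev n I (xi(i := a)) z) - f (ev n I (xi(i := b)) z)) <= L * abs (a - b)" for z
 proof (cases "i < n")
  case True
  have "ev n I (xi(i := c)) z = (ev n I xi z)(i := c)" for c using I True by (auto simp: ev_def fun_eq_iff)
  then show ?thesis using lip[OF True ev_Rn] by simp
 next
  case False
  then have "ev n I (xi(i := a)) z = ev n I (xi(i := b)) z" by (auto simp: ev_def fun_eq_iff)
  then show ?thesis using L by simp
 qed
 have "Pf n f I (xi(i := a)) nu - Pf n f I (xi(i := b)) nu
  = (LINT z|PiM I (%_. meas_of nu). f (ev n I (xi(i := a)) z) - f (ev n I (xi(i := b)) z))"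
  unfolding Pf_def by (intro bi_diff[symmetric] Pf_integrable I f)
 also have "abs ... <= (LINT z|PiM I (%_. meas_of nu). L * abs (a - b))"
  by (rule abs_integral_le) (auto intro!: bib_diff Pf_integrable I f le)
 also have "... = L * abs (a - b) * mass nu ^ card I"
  by (simp add: measure_PiM_space[OF I(1)] mult.commute)
 finally show ?thesis .
qed

text \<open>The suprema \<open>G k\<close> of the tails of \<open>\<bar>g\<^sub>j - g\<bar>\<close> are Lipschitz, so weak convergence
 applies to them; this replaces tightness and uniform convergence on compact sets.\<close>

lemma Pf_weak_tendsto:
 fixes N :: "nat => fmeasure"
 assumes I: "finite I" and f: "f : Cb (Rn n)" and L: "0 <= L"
  and lip: "!!i x u v. i < n ==> x : Rn n ==> abs (f (x(i := u)) - f (x(i := v))) <= L * abs (u - v)"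
  and N: "!!g. g : Cb UNIV ==> (%k. pairing g (N k)) ~~> pairing g nu"
 shows "(%k. Pf n f I xi (N k)) ~~> Pf n f I xi nu"
 using I
proof (induction I arbitrary: xi)
 case empty
 show ?case by (simp add: Pf_empty)
next
 case (insert i I)
 define g where "g k a = Pf n f I (xi(i := a)) (N k)" for k a
 define g' where "g' a = Pf n f I (xi(i := a)) nu" for a
 obtain B where B: "0 <= B" "!!x. x : Rn n ==> abs (f x) <= B" using Cb_bounded[OF f] by metis
 have mc: "(%k. mass (N k)) ~~> mass nu" unfolding mass_def by (rule N[OF Cb_const])
 obtain M0 where "!!k. abs (mass (N k)) <= M0"
  using convergent_imp_Bseq[OF convergentI[OF mc]] by (auto simp: Bseq_def)
 define M where "M = max M0 (mass nu) ^ card I"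
 have M: "mass (N k) ^ card I <= M" "mass nu ^ card I <= M" for k
  unfolding M_def using \<open>\<bar>mass (N k)\<bar> <= M0\<close> mass_nonneg by (auto intro!: power_mono simp: le_max_iff_disj)
 have M0: "0 <= M" using M(2) zero_le_power[OF mass_nonneg, of nu "card I"] by linarith
 have gl: "(%k. g k a) ~~> g' a" for a unfolding g_def g'_def by (rule insert.IH)
 have lip1: "abs (g k a - g k b) <= L * M * abs (a - b)" "abs (g' a - g' b) <= L * M * abs (a - b)" for k a b
 proof -
  have "abs (Pf n f I (xi(i := a)) kappa - Pf n f I (xi(i := b)) kappa) <= L * M * abs (a - b)" if "mass kappa ^ card I <= M" for kappa
  using order_trans[OF Pf_lipschitz[OF insert.hyps f L lip] mult_left_mono[OF that, of "L * abs (a - b)"]] L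
  by (simp add: mult_ac)
  from this[OF M(1)] this[OF M(2)] show "abs (g k a - g k b) <= L * M * abs (a - b)" "abs (g' a - g' b) <= L * M * abs (a - b)"
  unfolding g_def g'_def .
 qed
 have bd: "abs (g k a) <= B * M" "abs (g' a) <= B * M" for k a
  unfolding g_def g'_def using insert.hyps B M
  by (auto intro!: order_trans[OF Pf_bound[OF _ f B(2)]] mult_left_mono)
 have dbd: "abs (g j a - g' a) <= 2 * (B * M)" for j a using bd(1)[of j a] bd(2)[of a] by linarith
 define G where "G k a = (SUP j\<in>{k..}. abs (g j a - g' a))" for k a
 have bdd: "bdd_above ((%j. abs (g j a - g' a)) ` {k..})" for k a
  by (rule bdd_aboveI2[where M = "2 * (B * M)"]) (rule dbd)
 have G_ge: "abs (g j a - g' a) <= G k a" if "k <= j" for j k a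
  unfolding G_def by (rule cSUP_upper[OF _ bdd]) (use that in simp)
 have G_le: "G k a <= c" if "!!j. k <= j ==> abs (g j a - g' a) <= c" for k a c
  unfolding G_def by (rule cSUP_least) (use that in auto)
 have G0: "0 <= G k a" for k a using G_ge[of k k a] by linarith
 have Gb: "abs (G k a) <= 2 * (B * M)" for k a using G_le[OF dbd] G0[of k a] by simp
 have GL1: "G k a <= G k b + 2 * (L * M) * abs (a - b)" for k a b
 proof (rule G_le)
  fix j assume "k <= j"
  then show "abs (g j a - g' a) <= G k b + 2 * (L * M) * abs (a - b)"
  using G_ge[of k j b] lip1(1)[of j a b] lip1(2)[of a b] by linarith
 qed
 have GCb: "G k : Cb UNIV" for k
 proof (rule CbI[OF _ Gb])
  have "(2 * (L * M))-lipschitz_on UNIV (G k)"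
  proof (rule lipschitz_onI)
  show "dist (G k a) (G k b) <= 2 * (L * M) * dist a b" for a b
  using GL1[of k a b] GL1[of k b a] by (simp add: dist_real_def abs_minus_commute abs_le_iff)
  qed (use L M0 in simp)
  then show "continuous_on UNIV (G k)" by (rule lipschitz_on_continuous_on)
 qed
 have Gl: "(%k. G k a) ~~> 0" for a
 proof (rule LIMSEQ_I)
  fix e :: real assume e: "0 < e"
  obtain K where K: "!!j. K <= j ==> norm (g j a - g' a) < e / 2" using LIMSEQ_D[OF gl, of "e / 2" a] e by auto
  have "norm (G k a - 0) < e" if "K <= k" for k
  proof -
  have "G k a <= e / 2" by (rule G_le) (use K that in \<open>auto intro!: less_imp_le\<close>)
  then show ?thesis using G0[of k a] e by simp
  qed
  then show "EX K. \<forall>k\<ge>K. norm (G k a - 0) < e" by blast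
 qed
 have PG: "(%k. pairing (G k) nu) ~~> 0"
 proof -
  interpret finite_measure "meas_of nu" by (rule finite_measure_meas_of)
  have "(%k. LINT a|meas_of nu. G k a) ~~> (LINT a|meas_of nu. 0)"
  by (rule integral_dominated_convergence[where w = "%_. 2 * (B * M)"])
  (use Gl Gb in \<open>auto intro!: borel_measurable_integrable Cb_integrable GCb\<close>)
  then show ?thesis by (simp add: pairing_def)
 qed
 have gCb: "g k : Cb UNIV" "g' : Cb UNIV" for k
  unfolding g_def[abs_def] g'_def[abs_def] by (intro Pf_upd_Cb(1) insert.hyps f)+
 have e1: "Pf n f (insert i I) xi (N k) = pairing (g k) (N k)" "Pf n f (insert i I) xi nu = pairing g' nu" for k
  unfolding pairing_def g_def g'_def by (intro Pf_insert insert.hyps f)+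
 show ?case unfolding e1
 proof (rule LIMSEQ_I)
  fix e :: real assume e: "0 < e"
  then have e3: "0 < e / 3" by simp
  \<comment> \<open>The order of the limits: k is fixed with \<open>pairing (G k) nu\<close> small,
    and weak convergence then makes \<open>pairing (G k) (N j)\<close> small for large j.\<close>
  obtain k where k: "pairing (G k) nu < e / 3" using eventually_happens'[OF sequentially_bot order_tendstoD(2)[OF PG e3]] by blast
  have "\<forall>\<^sub>F j in sequentially. pairing (G k) (N j) < e / 3" by (rule order_tendstoD(2)[OF N[OF GCb] k])
  moreover have "\<forall>\<^sub>F j in sequentially. dist (pairing g' (N j)) (pairing g' nu) < e / 3" by (rule tendstoD[OF N[OF gCb(2)] e3])
  ultimately have "\<forall>\<^sub>F j in sequentially. norm (pairing (g j) (N j) - pairing g' nu) < e"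
  using eventually_ge_at_top[of k]
  proof eventually_elim
  case (elim j)
  have "abs (pairing (%a. g j a - g' a) (N j)) <= pairing (G k) (N j)"
  unfolding pairing_def by (rule abs_integral_le) (auto intro!: Cb_integrable Cb_diff gCb GCb G_ge elim)
  then have "abs (pairing (g j) (N j) - pairing g' (N j)) <= pairing (G k) (N j)" using gCb by (simp add: pairing_diff)
  then show ?case using elim(1,2) e unfolding dist_real_def real_norm_def by linarith
  qed
  then show "EX K. \<forall>j\<ge>K. norm (pairing (g j) (N j) - pairing g' nu) < e" by (simp add: eventually_sequentially)
 qed
qed

lemma C2_data_lipschitz:
 assumes C: "C2_data n f d1 d2" and B: "!!i x. i < n ==> x : Rn n ==> abs (d1 i x) <= B" and i: "i < n" "x : Rn n"
 shows "abs (f (x(i := u)) - f (x(i := v))) <= B * abs (u - v)"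
proof -
 have "norm (f (x(i := u)) - f (x(i := v))) <= B * norm (u - v)"
 proof (rule field_differentiable_bound[of UNIV "%u. f (x(i := u))" "%u. d1 i (x(i := u))"])
  show "((%u. f (x(i := u))) has_rd d1 i (x(i := y))) (at y within UNIV)" for y
  using C2_dataD(4)[OF C i(1) fun_upd_Rn[OF i(2,1)], of y] by simp
  show "norm (d1 i (x(i := y))) <= B" for y using B[OF i(1) fun_upd_Rn[OF i(2,1)]] by simp
 qed auto
 then show ?thesis by simp
qed

lemma (in path_setting) poly_path_continuous:
 assumes f: "f : C2_Rn n" and w: "w : space Q"
 shows "continuous_on {0..} (%t. poly_functional n f (w t))"
 unfolding continuous_on_sequentially comp_def
proof (intro allI ballI impI, elim conjE)
 fix s :: "nat => real" and a assume s: "a : {0..}" "ALL k. s k : {0..}" "s ~~> a"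
 note C = C2_Rn_C2_data[OF f]
 obtain B where B: "0 <= B" "!!i x. i < n ==> x : Rn n ==> abs (pder i f x) <= B"
  by (rule C2_data_bound[OF C]) (rule that)
 have "(%k. Pf n f {..<n} undefined (w (s k))) ~~> Pf n f {..<n} undefined (w a)"
 proof (rule Pf_weak_tendsto[OF _ C2_dataD(1)[OF C] B(1)])
  show "abs (f (x(i := u)) - f (x(i := v))) <= B * abs (u - v)" if "i < n" "x : Rn n" for i x u v
  by (rule C2_data_lipschitz[OF C B(2) that])
  show "(%k. pairing g (w (s k))) ~~> pairing g (w a)" if "g : Cb UNIV" for g
  using pairing_path_continuous[OF w that] s unfolding continuous_on_sequentially comp_def by blast
 qed simp
 then show "(%k. poly_functional n f (w (s k))) ~~> poly_functional n f (w a)" unfolding Pf_full .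
qed

section \<open>A countable determining family of test functions\<close>

lemma abs_arctan_le: "abs (arctan y) <= pi / 2"
 using arctan_bounded[of y] by linarith

text \<open>A smooth step near q. The slope \<open>k^2\<close> beats the shift k, and the shift
  sends the value at q itself to the lower limit. Rational q keep the family countable, so almost
  sure equalities of pairings can be collected.\<close>

definition step_arctan :: "nat => rat => real => real" where
 "step_arctan k q x = arctan ((real k)^2 * (x - real_of_rat q) - real k)"

lemma step_arctan_C2: "step_arctan k q : C2_real"
proof -
 let ?l = "%x. (real k)^2 * (x - real_of_rat q) - real k"
 have l: "(?l has_rd (real k)\<^sup>2) (at x)" for x by (auto intro!: derivative_eq_intros)
 let ?d = "%x. (real k)^2 * inverse (1 + (?l x)^2)"
 let ?e = "%x. - ((real k)^2 * (real k)^2) * (2 * ?l x * (inverse (1 + (?l x)^2))^2)"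
 have p: "1 + y^2 ~= 0" for y :: real by (simp add: add_nonneg_eq_0_iff)
 have c: "continuous_on UNIV ?l" by (intro continuous_intros)
 have i: "abs (inverse (1 + y^2)) <= 1" for y :: real by (simp add: inverse_le_1_iff)
 show ?thesis unfolding step_arctan_def[abs_def]
 proof (rule C2_realI(1)[of _ ?d ?e])
  show "((%x. arctan (?l x)) has_rd ?d x) (at x)" for x
  using DERIV_chain2[OF DERIV_arctan l] by (simp add: mult.commute)
  show "(?d has_rd ?e x) (at x)" for x
  proof -
  have "((%x. 1 + (?l x)^2) has_rd 2 * ?l x * (real k)^2) (at x)"
  by (rule DERIV_cong[OF DERIV_add[OF DERIV_const DERIV_power[OF l, of 2]]]) (simp add: algebra_simps)
  from DERIV_cmult[OF DERIV_inverse_fun[OF this p], of "(real k)^2"] show ?thesis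
  by (simp add: power2_eq_square mult_ac)
  qed
  show "(%x. arctan (?l x)) : Cb UNIV"
  by (rule CbI[OF _ abs_arctan_le]) (intro continuous_intros)
  show "?d : Cb UNIV"
  by (intro Cb_cmult CbI[where K = 1] i) (auto intro!: continuous_intros simp: p)
  show "?e : Cb UNIV"
  proof (intro Cb_cmult CbI[where K = 1])
  show "continuous_on UNIV (%x. 2 * ?l x * (inverse (1 + (?l x)^2))^2)" by (auto intro!: continuous_intros simp: p)
  fix x
  let ?y = "?l x"
  have "abs (2 * z) <= 1 + z^2" for z :: real using zero_le_power2[of "abs z - 1"] by (simp add: power2_eq_square algebra_simps abs_mult)
  moreover have "0 < 1 + z^2" for z :: real by (simp add: add_pos_nonneg)
  ultimately have "abs (2 * z) * inverse (1 + z^2) <= 1" for z :: real by (simp only: divide_inverse[symmetric] pos_divide_le_eq mult_1)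
  from this[of ?y] have "abs (2 * ?y) * inverse (1 + ?y^2) <= 1" .
  from mult_mono[OF this i[of ?y]] show "abs (2 * ?y * (inverse (1 + ?y^2))^2) <= 1"
  by (simp add: abs_mult power2_eq_square mult_ac)
  qed
 qed
qed

text \<open>Points q within \<open>1 / (Suc k)^2\<close> to the right of c make the steps converge
  to \<open>pi * indicator {c<..} x - pi / 2\<close> at every x, including c. Hence the measures
  agree on open half-lines once equal masses cancel the constant.\<close>

lemma fmeasure_eqI:
 assumes m: "mass nu = mass kappa" and eq: "!!k q. pairing (step_arctan k q) nu = pairing (step_arctan k q) kappa"
 shows "nu = kappa"
proof -
 have "measure (meas_of nu) {c<..} = measure (meas_of kappa) {c<..}" for c
 proof -
  have "EX q. real_of_rat q < c + 1 / (real (Suc k))^2 & c < real_of_rat q" for k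
  using of_rat_dense[of c "c + 1 / (real (Suc k))^2"] by auto
  then obtain q where q: "!!k. real_of_rat (q k) < c + 1 / (real (Suc k))^2 & c < real_of_rat (q k)" by metis
  let ?f = "%k. step_arctan (Suc k) (q k)" and ?g = "%x. pi * indicator {c<..} x - pi / 2 :: real"
  have lim: "(%k. ?f k x) ~~> ?g x" for x
  proof (cases "c < x")
  case True
  have "filterlim (%k. (real (Suc k))^2 * (x - real_of_rat (q k)) - real (Suc k)) at_top sequentially"
  proof (rule filterlim_at_top_mono)
  show "\<forall>\<^sub>F k in sequentially. ((x - c) * real (Suc k) - 1) * real (Suc k) - 1 <= (real (Suc k))^2 * (x - real_of_rat (q k)) - real (Suc k)"
  proof (rule always_eventually, rule allI)
  fix k
  have "(real (Suc k))^2 * real_of_rat (q k) <= (real (Suc k))^2 * (c + 1 / (real (Suc k))^2)"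
  using q[of k] by (intro mult_left_mono) auto
  also have "... = (real (Suc k))^2 * c + 1" by (simp add: distrib_left del: of_nat_Suc)
  finally show "((x - c) * real (Suc k) - 1) * real (Suc k) - 1 <= (real (Suc k))^2 * (x - real_of_rat (q k)) - real (Suc k)"
  by (simp add: power2_eq_square algebra_simps del: of_nat_Suc)
  qed
  have r: "filterlim (%k. real (Suc k)) at_top sequentially"
  by (rule filterlim_compose[OF filterlim_real_sequentially filterlim_Suc])
  have "filterlim (%k. (-1) + (x - c) * real (Suc k)) at_top sequentially"
  by (rule filterlim_tendsto_add_at_top[OF tendsto_const filterlim_tendsto_pos_mult_at_top[OF tendsto_const _ r]]) (use True in simp)
  from filterlim_tendsto_add_at_top[OF tendsto_const[of "-1"] filterlim_at_top_mult_at_top[OF this r]]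
  show "filterlim (%k. ((x - c) * real (Suc k) - 1) * real (Suc k) - 1) at_top sequentially" by (simp add: algebra_simps del: of_nat_Suc)
  qed
  from filterlim_compose[OF tendsto_arctan_at_top this] True show ?thesis unfolding step_arctan_def by simp
  next
  case False
  have "filterlim (%k. (real (Suc k))^2 * (x - real_of_rat (q k)) - real (Suc k)) at_bot sequentially"
  proof (rule filterlim_at_bot_mono)
  show "filterlim (%k. - real (Suc k)) at_bot sequentially"
  unfolding filterlim_uminus_at_top[symmetric] by (rule filterlim_compose[OF filterlim_real_sequentially filterlim_Suc])
  show "\<forall>\<^sub>F k in sequentially. (real (Suc k))^2 * (x - real_of_rat (q k)) - real (Suc k) <= - real (Suc k)"
  proof (rule always_eventually, rule allI)
  fix k
  have "x - real_of_rat (q k) <= 0" using q[of k] False by linarith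
  then show "(real (Suc k))^2 * (x - real_of_rat (q k)) - real (Suc k) <= - real (Suc k)" by (simp add: mult_nonneg_nonpos)
  qed
  qed
  from filterlim_compose[OF tendsto_arctan_at_bot this] False show ?thesis unfolding step_arctan_def by simp
  qed
  have "(%k. pairing (?f k) eta) ~~> pi * measure (meas_of eta) {c<..} - pi / 2 * mass eta" for eta
  proof -
  interpret finite_measure "meas_of eta" by (rule finite_measure_meas_of)
  have "(%k. LINT x|meas_of eta. ?f k x) ~~> (LINT x|meas_of eta. ?g x)"
  proof (rule integral_dominated_convergence[where w = "%_. pi / 2"])
  show "?f k : bmeas (meas_of eta)" for k
  by (rule borel_measurable_integrable[OF Cb_integrable[OF C2_realD(1)[OF step_arctan_C2]]])
  show "AE x in meas_of eta. norm (?f k x) <= pi / 2" for k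
  unfolding step_arctan_def real_norm_def by (intro AE_I2 abs_arctan_le)
  show "?g : bmeas (meas_of eta)" by (simp cong: measurable_cong_sets)
  show "AE x in meas_of eta. (%k. ?f k x) ~~> ?g x" by (rule AE_I2) (rule lim)
  qed simp
  moreover have "(LINT x|meas_of eta. ?g x) = pi * measure (meas_of eta) {c<..} - pi / 2 * mass eta"
  by (subst bi_diff) (auto simp: mass_eq emeasure_eq_measure)
  ultimately show ?thesis by (simp add: pairing_def)
  qed
  from LIMSEQ_unique[OF this[of nu, unfolded eq] this[of kappa]] show ?thesis by (simp add: m)
 qed
 moreover interpret N: finite_measure "meas_of nu" by (rule finite_measure_meas_of)
 interpret K: finite_measure "meas_of kappa" by (rule finite_measure_meas_of)
 have "meas_of nu = meas_of kappa"
  by (rule measure_eqI_lessThan) (auto simp: N.emeasure_eq_measure K.emeasure_eq_measure calculation)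
 then show ?thesis by (simp add: meas_of_inject)
qed

section \<open>Local martingales, true martingales and the initial value\<close>

context filtered_prob_space
begin

lemma mgle_min_const:
 assumes X: "mgle X" and c: "0 <= c"
 shows "mgle (%t. X (min t c))"
proof (rule mgleI)
 show "X (min t c) : bmeas (F t)" "integrable P (X (min t c))" if "0 <= t" for t
  using F_mono[OF _ mgleD(1)[OF X, of "min t c"]] mgleD(2)[OF X] that c by auto
 fix s t A assume st: "0 <= s" "s <= t" and A: "A : sets (F s)"
 show "(LINT w|P. indicator A w * (X (min t c) w - X (min s c) w)) = 0"
 proof (cases "c <= s")
  case False
  then show ?thesis using mgle_indicator[OF X st(1) _ A, of "min t c"] st by simp
 qed (use st in simp)
qed

text \<open>The constants n serve as localizing times.\<close>

lemma local_martingale_of_mgle: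
 assumes fl: "filtration (space P) F" and X: "mgle X" and c: "continuous_paths P X"
 shows "continuous_local_martingale P F X"
 unfolding continuous_local_martingale_def
proof (intro conjI exI[of _ "%n _. real n"] allI c ballI)
 show "adapted F X" using mgleD(1)[OF X] by (simp add: adapted_def)
 show "stopping_time F (%_. real n)" for n by (simp add: stopping_time_def)
 show "martingale P F (%t w. X (min t (real n)) w)" for n
  unfolding martingale_iff_mgle[OF fl] by (rule mgle_min_const[OF X]) simp
 show "AE w in P. incseq real & filterlim real at_top sequentially"
  by (intro AE_I2 conjI filterlim_real_sequentially) (simp add: incseq_def)
qed simp

lemma localizing_times:
 assumes fl: "filtration (space P) F" and X: "continuous_local_martingale P F X"
 obtains tau where "!!n w. w : space P ==> 0 <= tau n w"
  "AE w in P. filterlim (%n. tau n w) at_top sequentially" "!!n :: nat. mgle (%t w. X (min t (tau n w)) w)"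
 using X unfolding continuous_local_martingale_def martingale_iff_mgle[OF fl] by auto

text \<open>An integrable bound for the path on [0, t] dominates all stopped values, so the
  localizing times drop out by dominated convergence.\<close>

lemma local_martingale_dominated:
 assumes fl: "filtration (space P) F" and X: "continuous_local_martingale P F X"
  and dom: "!!t. 0 <= t ==> EX Y. integrable P Y & (\<forall>w\<in>space P. ALL u. 0 <= u --> u <= t --> abs (X u w) <= Y w)"
 shows "mgle X"
proof (rule mgleI)
 obtain tau where tau: "!!n w. w : space P ==> 0 <= tau n w"
  "AE w in P. filterlim (%n. tau n w) at_top sequentially"
  and m: "!!n :: nat. mgle (%t w. X (min t (tau n w)) w)"
  by (rule localizing_times[OF fl X]) (rule that)
 show Xm: "X t : bmeas (F t)" if "0 <= t" for t
  using X that unfolding continuous_local_martingale_def adapted_def by blast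
 show "integrable P (X t)" if t: "0 <= t" for t
 proof -
  obtain Y where Y: "integrable P Y" "!!w u. w : space P ==> 0 <= u ==> u <= t ==> abs (X u w) <= Y w" using dom[OF t] by blast
  show ?thesis
  proof (rule bib_bound[OF Y(1) F_P[OF Xm[OF t]]])
  show "AE w in P. norm (X t w) <= norm (Y w)"
  using Y(2)[OF _ t order_refl] by (intro AE_I2) (auto intro: order_trans[OF _ abs_ge_self])
  qed
 qed
 fix s t A assume st: "0 <= s" "s <= t" and A: "A : sets (F s)"
 have t: "0 <= t" using st by simp
 obtain Y where Y: "integrable P Y" "!!w u. w : space P ==> 0 <= u ==> u <= t ==> abs (X u w) <= Y w" using dom[OF t] by blast
 have AP: "A : sets P" using A sub[of s] by (auto simp: subalgebra_def)
 have st': "(%w. X (min u (tau n w)) w) : bmeas P" if "0 <= u" for u n using mgleD(3)[OF m that] .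
 have "(%n. \<integral>w. indicator A w * (X (min t (tau n w)) w - X (min s (tau n w)) w) \<partial>P) ~~> (LINT w|P. indicator A w * (X t w - X s w))"
 proof (rule integral_dominated_convergence[where w = "%w. 2 * Y w"])
  show "(%w. indicator A w * (X t w - X s w)) : bmeas P"
  by (intro borel_measurable_times borel_measurable_diff borel_measurable_indicator AP F_P[OF Xm] st t)
  show "(%w. indicator A w * (X (min t (tau n w)) w - X (min s (tau n w)) w)) : bmeas P" for n
  by (intro borel_measurable_times borel_measurable_diff borel_measurable_indicator AP st' st t)
  show "integrable P (%w. 2 * Y w)" using Y by simp
  show "AE w in P. (%n. indicator A w * (X (min t (tau n w)) w - X (min s (tau n w)) w)) ~~> indicator A w * (X t w - X s w)"
  using tau(2)
  proof eventually_elim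
  case (elim w)
  have "\<forall>\<^sub>F n in sequentially. t <= tau n w" using elim by (simp add: filterlim_at_top)
  then show ?case
  by (intro tendsto_eventually) (elim eventually_mono, use st in \<open>simp add: min_absorb1\<close>)
  qed
  show "AE w in P. norm (indicator A w * (X (min t (tau n w)) w - X (min s (tau n w)) w)) <= 2 * Y w" for n
  proof (rule AE_I2)
  fix w assume w: "w : space P"
  have "abs (X (min t (tau n w)) w) <= Y w" "abs (X (min s (tau n w)) w) <= Y w"
  using tau(1)[OF w] st by (intro Y(2)[OF w]; simp add: min_le_iff_disj)+
  then have "abs (X (min t (tau n w)) w - X (min s (tau n w)) w) <= 2 * Y w" by linarith
  then show "norm (indicator A w * (X (min t (tau n w)) w - X (min s (tau n w)) w)) <= 2 * Y w"
  using order_trans[OF abs_ge_zero] by (cases "w : A") auto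
  qed
 qed
 moreover have "(LINT w|P. indicator A w * (X (min t (tau n w)) w - X (min s (tau n w)) w)) = 0" for n
  by (rule mgle_indicator[OF m st A])
 ultimately show "(LINT w|P. indicator A w * (X t w - X s w)) = 0" by (simp add: LIMSEQ_const_iff)
qed

end

context path_setting
begin

lemma MP_continuous_martingale:
 assumes MP: "MP f g" and f: "tm p f" and g: "tm p g" and m: "moment p"
  and c: "!!w. w : space Q ==> continuous_on {0..} (%t. f (w t))"
 shows "continuous_martingale Q pfilt (%t w. f (w t) - f (w 0) - (LBINT s:{0..t}. g (w s)))"
 unfolding continuous_martingale_def martingale_iff_mgle[OF filtration_Q]
proof
 obtain a where a: "tame p a f" using f by (auto simp: tm_def)
 obtain b where b: "tame p b g" using g by (auto simp: tm_def)
 have "mgle (%t w. (f (w t) - (LBINT s:{0..t}. g (w s))) - f (w 0))"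
  by (intro mgle_diff MP[unfolded MP_def] mgle_const tm_path_adapted[OF f] tame_path_integrable[OF a m]) auto
 then show "mgle (%t w. f (w t) - f (w 0) - (LBINT s:{0..t}. g (w s)))" by (simp add: algebra_simps)
 show "continuous_paths Q (%t w. f (w t) - f (w 0) - (LBINT s:{0..t}. g (w s)))"
  unfolding continuous_paths_def
  by (intro AE_I2 continuous_on_diff c continuous_on_const tame_drift_continuous[OF b])
qed

lemma pairing_eval_measurable: "f : Cb UNIV ==> (%w. pairing f (w 0)) : bmeas Q"
 by (rule F_P[OF functional_adapted[OF measurable_pairing order_refl order_refl]])

text \<open>Equality with \<mu> is a countable conjunction of equations between pairings, by
  \<open>fmeasure_eqI\<close>. This makes the event measurable and lets the almost sure equalities
  for single phi be combined.\<close>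

lemma initial_iff:
 shows "{w : space Q. w 0 = \<mu>} : sets Q"
  and "(!!phi. phi : C2_real ==> AE w in Q. pairing phi (w 0) = pairing phi \<mu>) ==> AE w in Q. w 0 = \<mu>"
proof -
 have eq: "w 0 = \<mu> \<longleftrightarrow> pairing (%_. 1) (w 0) = pairing (%_. 1) \<mu> &
  (ALL k q. pairing (step_arctan k q) (w 0) = pairing (step_arctan k q) \<mu>)" for w :: "real => fmeasure"
  using fmeasure_eqI[of "w 0" \<mu>] by (auto simp: mass_def)
 note cb = C2_realD(1)[OF step_arctan_C2] C2_realD(1)[OF C2_one(1)]
 show "{w : space Q. w 0 = \<mu>} : sets Q"
  unfolding eq using cb
  by (intro sets.sets_Collect_conj sets.sets_Collect_countable_All borel_measurable_eq pairing_eval_measurable borel_measurable_const)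
 assume "!!phi. phi : C2_real ==> AE w in Q. pairing phi (w 0) = pairing phi \<mu>"
 from this[OF C2_one(1)] this[OF step_arctan_C2] show "AE w in Q. w 0 = \<mu>"
  unfolding eq by (simp add: AE_all_countable)
qed

lemma initial_prob: "measure Q {w : space Q. w 0 = \<mu>} = 1 \<longleftrightarrow> (AE w in Q. w 0 = \<mu>)"
 using prob_Collect_eq_1[OF initial_iff(1)] by simp

lemma M_process_continuous:
 assumes "phi : C2_real" "w : space Q"
 shows "continuous_on {0..} (%t. M_process h \<mu> phi t w)" "continuous_on {0..} (%t. M_bracket h \<sigma> phi t w)"
proof -
 obtain b where b: "tame 1 b (drift phi)" using tm_drift[OF assms(1)] by (auto simp: tm_def)
 obtain d where d: "tame 2 d (\<Gamma> phi phi)" using tm_\<Gamma>[OF assms(1,1)] by (auto simp: tm_def)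
 show "continuous_on {0..} (%t. M_process h \<mu> phi t w)" unfolding M_process_eq
  by (intro continuous_on_diff continuous_on_const pairing_path_continuous tame_drift_continuous[OF b] assms C2_realD)
 show "continuous_on {0..} (%t. M_bracket h \<sigma> phi t w)" unfolding M_bracket_eq[OF assms]
  by (rule tame_drift_continuous[OF d assms(2)])
qed

lemma mgle_M_process: "mgle (M_process h \<mu> phi) \<longleftrightarrow> MP (pairing phi) (drift phi)"
proof -
 have k: "mgle (%_ _. c)" for c :: real by (rule mgle_const) auto
 have "mgle (%t w. pairing phi (w t) - (LBINT u:{0..t}. drift phi (w u)))" if "mgle (M_process h \<mu> phi)"
  using mgle_add[OF that k[of "pairing phi \<mu>"]] by (simp add: M_process_eq)
 moreover have "mgle (M_process h \<mu> phi)" if "MP (pairing phi) (drift phi)"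
  using mgle_diff[OF that[unfolded MP_def] k[of "pairing phi \<mu>"]] by (simp add: M_process_eq[abs_def] algebra_simps)
 ultimately show ?thesis unfolding MP_def by blast
qed

lemma mgle_bracket_iff:
 assumes phi: "phi : C2_real" and m: "moment 2" and lin: "MP (pairing phi) (drift phi)"
 shows "mgle (%t w. (M_process h \<mu> phi t w)^2 - M_bracket h \<sigma> phi t w) \<longleftrightarrow>
  MP (%nu. (pairing phi nu)^2) (%nu. 2 * (pairing phi nu * drift phi nu) + \<Gamma> phi phi nu)"
 unfolding quadratic_equivalence[OF phi m lin tm_\<Gamma>[OF phi phi], symmetric]
 by (rule mgle_cong) (simp add: M_bracket_eq[OF phi])

lemma quadratic_variation_bracket:
 assumes phi: "phi : C2_real" and init: "AE w in Q. w 0 = \<mu>" and m: "moment 2" and lin: "MP (pairing phi) (drift phi)"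
  and quad: "MP (%nu. (pairing phi nu)^2) (%nu. 2 * (pairing phi nu * drift phi nu) + \<Gamma> phi phi nu)"
 shows "continuous_martingale Q pfilt (M_process h \<mu> phi)"
  and "quadratic_variation Q pfilt (M_process h \<mu> phi) (M_bracket h \<sigma> phi)"
proof -
 have M: "mgle (M_process h \<mu> phi)" using lin by (simp add: mgle_M_process)
 have cM: "continuous_paths Q (M_process h \<mu> phi)"
  unfolding continuous_paths_def by (intro AE_I2 M_process_continuous phi)
 then show "continuous_martingale Q pfilt (M_process h \<mu> phi)"
  unfolding continuous_martingale_def martingale_iff_mgle[OF filtration_Q] using M by blast
 show "quadratic_variation Q pfilt (M_process h \<mu> phi) (M_bracket h \<sigma> phi)"
  unfolding quadratic_variation_def
 proof (intro conjI)
  show "continuous_local_martingale Q pfilt (M_process h \<mu> phi)"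
  by (rule local_martingale_of_mgle[OF filtration_Q M cM])
  show "AE w in Q. M_process h \<mu> phi 0 w = 0"
  using init by eventually_elim (simp add: M_process_eq set_integral_at_point)
  show "adapted pfilt (M_bracket h \<sigma> phi)"
  unfolding adapted_def
  proof (intro allI impI)
  fix t :: real assume t: "0 <= t"
  have "(%w. LBINT u:{0..t}. \<Gamma> phi phi (w u)) : bmeas (pfilt t)"
  by (rule tm_drift_adapted[OF tm_\<Gamma>[OF phi phi] order_refl t])
  then show "M_bracket h \<sigma> phi t : bmeas (pfilt t)"
  by (subst measurable_cong[of _ _ "%w. LBINT u:{0..t}. \<Gamma> phi phi (w u)"]) (simp_all add: space_F M_bracket_eq[OF phi])
  qed
  show "continuous_paths Q (M_bracket h \<sigma> phi)"
  unfolding continuous_paths_def by (intro AE_I2 M_process_continuous phi)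
  show "AE w in Q. M_bracket h \<sigma> phi 0 w = 0 & mono_on {0..} (%t. M_bracket h \<sigma> phi t w)"
  proof (rule AE_I2, rule conjI)
  fix w assume w: "w : space Q"
  show "M_bracket h \<sigma> phi 0 w = 0" by (simp add: M_bracket_eq[OF phi w] set_integral_at_point)
  show "mono_on {0..} (%t. M_bracket h \<sigma> phi t w)"
  proof (rule mono_onI)
  fix s t :: real assume st: "s : {0..}" "t : {0..}" "s <= t"
  then have "(LBINT u:{0..t}. \<Gamma> phi phi (w u)) = (LBINT u:{0..s}. \<Gamma> phi phi (w u)) + (LBINT u:{s..t}. \<Gamma> phi phi (w u))"
  by (intro tm_split[OF tm_\<Gamma>[OF phi phi] w]) auto
  moreover have "0 <= (LBINT u:{s..t}. \<Gamma> phi phi (w u))"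
  unfolding set_lebesgue_integral_def by (intro bi_nonneg) (simp add: \<Gamma>_self_nonneg[OF phi])
  ultimately show "M_bracket h \<sigma> phi s w <= M_bracket h \<sigma> phi t w" unfolding M_bracket_eq[OF phi w] by linarith
  qed
  qed
  show "continuous_local_martingale Q pfilt (%t w. (M_process h \<mu> phi t w)^2 - M_bracket h \<sigma> phi t w)"
  proof (rule local_martingale_of_mgle[OF filtration_Q])
  show "mgle (%t w. (M_process h \<mu> phi t w)^2 - M_bracket h \<sigma> phi t w)"
  unfolding mgle_bracket_iff[OF phi m lin] by (rule quad)
  show "continuous_paths Q (%t w. (M_process h \<mu> phi t w)^2 - M_bracket h \<sigma> phi t w)"
  unfolding continuous_paths_def by (intro AE_I2 continuous_on_diff continuous_on_power M_process_continuous phi)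
  qed
 qed
qed

text \<open>For phi = 1 the process is the mass minus \<open>mass \<mu>\<close> and the bracket is
  the time integral of \<open>pairing \<sigma>\<close>, integrable because the mean mass is
  constant. Localizing times give the mean of the stopped square in terms of the bracket, and
  Fatou's lemma yields the second moment at each fixed time.\<close>

lemma second_moment:
 assumes init: "AE w in Q. w 0 = \<mu>" and lin: "MP (pairing (%_. 1)) (drift (%_. 1))"
  and qv: "quadratic_variation Q pfilt (M_process h \<mu> (%_. 1)) (M_bracket h \<sigma> (%_. 1))"
 shows "moment 2"
proof -
 let ?A = "%t w. LBINT u:{0..t}. pairing \<sigma> (w u)"
 have Z: "mgle (%t w. mass (w t))" using lin unfolding MP_def drift_one mass_def by simp
 have M: "M_process h \<mu> (%_. 1) t w = mass (w t) - mass \<mu>" for t w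
  by (simp add: M_process_eq drift_one mass_def)
 have A: "M_bracket h \<sigma> (%_. 1) t w = ?A t w" if "w : space Q" for t w
  unfolding M_bracket_eq[OF C2_one(1) that] \<Gamma>_one ..
 have \<sigma>0: "0 <= pairing \<sigma> nu" for nu unfolding pairing_def by (intro bi_nonneg \<sigma>_nonneg)
 let ?X = "%t w. (M_process h \<mu> (%_. 1) t w)^2 - M_bracket h \<sigma> (%_. 1) t w"
 have "continuous_local_martingale Q pfilt ?X" using qv by (simp add: quadratic_variation_def)
 then obtain tau where tau: "!!n w. w : space Q ==> 0 <= tau n w"
  "AE w in Q. filterlim (%n. tau n w) at_top sequentially"
  and m: "!!n :: nat. mgle (%t w. ?X (min t (tau n w)) w)"
  by (rule localizing_times[OF filtration_Q]) (rule that)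
 have "integrable Q (%w. mass (w t) ^ (2 * Suc 0))" if t: "0 <= t" for t
 proof -
  have iA: "integrable Q (?A t)" by (rule mass_drift_integrable[OF Z tm_pairing[OF \<sigma>_Cb] t])
  \<comment> \<open>The bracket at the full time t is added, not the stopped one: as the bracket
    increases the sum is nonnegative, and its mean is the same for every n.\<close>
  let ?Y = "%n w. ?X (min t (tau n w)) w + ?A t w"
  have iY: "integrable Q (?Y n)" for n by (intro bib_add mgleD(2)[OF m t] iA)
  have Y0: "0 <= ?Y n w" if w: "w : space Q" for n w
  proof -
  have "?A t w = ?A (min t (tau n w)) w + (LBINT u:{min t (tau n w)..t}. pairing \<sigma> (w u))"
  by (rule tm_split[OF tm_pairing[OF \<sigma>_Cb] w]) (use t tau(1)[OF w, of n] in auto)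
  moreover have "0 <= (LBINT u:{min t (tau n w)..t}. pairing \<sigma> (w u))"
  unfolding set_lebesgue_integral_def by (intro bi_nonneg) (simp add: \<sigma>0)
  ultimately show ?thesis unfolding A[OF w] using zero_le_power2[of "M_process h \<mu> (%_. 1) (min t (tau n w)) w"] by linarith
  qed
  have EY: "(LINT w|Q. ?Y n w) = (LINT w|Q. ?A t w)" for n
  proof -
  have "(LINT w|Q. ?X (min t (tau n w)) w) - (LINT w|Q. ?X (min 0 (tau n w)) w) = 0"
  using mgle_mult_bounded[OF m[of n] order_refl t, of "%_. 1" 1]
  by (simp add: bi_diff[OF mgleD(2)[OF m t] mgleD(2)[OF m order_refl], symmetric])
  moreover have "(LINT w|Q. ?X (min 0 (tau n w)) w) = 0"
  proof (rule integral_eq_zero_AE)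
  show "AE w in Q. ?X (min 0 (tau n w)) w = 0"
  using init AE_space
  proof eventually_elim
  case (elim w)
  then show ?case using tau(1)[OF elim(2), of n] by (simp add: min_absorb1 M A set_integral_at_point)
  qed
  qed
  ultimately show ?thesis using mgleD(2)[OF m[of n] t] iA by (subst bi_add) auto
  qed
  have Mm: "(%w. (mass (w t) - mass \<mu>)^2) : bmeas Q"
  using mgleD(3)[OF Z t] by measurable
  have "(\<integral>\<^sup>+w. ennreal ((mass (w t) - mass \<mu>)^2) \<partial>Q) = (\<integral>\<^sup>+w. liminf (%n. ennreal (?Y n w)) \<partial>Q)"
  proof (rule nn_integral_cong_AE)
  show "AE w in Q. ennreal ((mass (w t) - mass \<mu>)^2) = liminf (%n. ennreal (?Y n w))"
  using tau(2) AE_space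
  proof eventually_elim
  case (elim w)
  have "\<forall>\<^sub>F n in sequentially. t <= tau n w" using elim(1) by (simp add: filterlim_at_top)
  then have "\<forall>\<^sub>F n in sequentially. ennreal (?Y n w) = ennreal ((mass (w t) - mass \<mu>)^2)"
  by eventually_elim (simp add: min_absorb1 M A[OF elim(2)])
  then show ?case by (intro lim_imp_Liminf[symmetric] tendsto_eventually) auto
  qed
  qed
  also have "... <= liminf (%n. \<integral>\<^sup>+w. ennreal (?Y n w) \<partial>Q)"
  by (rule nn_integral_liminf) (rule measurable_compose[OF borel_measurable_integrable[OF iY] measurable_ennreal])
  also have "... = ennreal (LINT w|Q. ?A t w)"
  proof -
  have "(\<integral>\<^sup>+w. ennreal (?Y n w) \<partial>Q) = ennreal (LINT w|Q. ?A t w)" for n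
  unfolding EY[of n, symmetric] by (rule nn_integral_eq_integral[OF iY]) (intro AE_I2 Y0)
  then show ?thesis by (simp add: Liminf_const)
  qed
  finally have "integrable Q (%w. (mass (w t) - mass \<mu>)^2)"
  by (intro integrableI_nonneg Mm) (auto intro: le_less_trans)
  then have "integrable Q (%w. 2 * (mass (w t) - mass \<mu>)^2 + 2 * (mass \<mu>)^2)" by simp
  then show ?thesis
  proof (rule bib_bound)
  show "(%w. mass (w t) ^ (2 * Suc 0)) : bmeas Q" using mgleD(3)[OF Z t] by measurable
  show "AE w in Q. norm (mass (w t) ^ (2 * Suc 0)) <= norm (2 * (mass (w t) - mass \<mu>)^2 + 2 * (mass \<mu>)^2)"
  proof (rule AE_I2)
  fix w
  have "(mass (w t))^2 <= 2 * (mass (w t) - mass \<mu>)^2 + 2 * (mass \<mu>)^2"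
  using zero_le_power2[of "mass (w t) - 2 * mass \<mu>"] by (simp add: power2_eq_square algebra_simps)
  then show "norm (mass (w t) ^ (2 * Suc 0)) <= norm (2 * (mass (w t) - mass \<mu>)^2 + 2 * (mass \<mu>)^2)" by simp
  qed
  qed
 qed
 from moment_from_power[OF Z this] show ?thesis by simp
qed

text \<open>With the second moment of \<open>D\<close>, the squared process minus the bracket is
  dominated on [0, t] by a multiple of \<open>1 + D t w ^ 2\<close>, so the local martingale is a
  true one.\<close>

lemma true_bracket:
 assumes phi: "phi : C2_real" and m: "moment 2" and lin: "MP (pairing phi) (drift phi)"
  and qv: "quadratic_variation Q pfilt (M_process h \<mu> phi) (M_bracket h \<sigma> phi)"
 shows "MP (%nu. (pairing phi nu)^2) (%nu. 2 * (pairing phi nu * drift phi nu) + \<Gamma> phi phi nu)"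
 unfolding mgle_bracket_iff[OF phi m lin, symmetric]
proof (rule local_martingale_dominated[OF filtration_Q])
 show "continuous_local_martingale Q pfilt (%t w. (M_process h \<mu> phi t w)^2 - M_bracket h \<sigma> phi t w)"
  using qv by (simp add: quadratic_variation_def)
 fix t :: real assume t: "0 <= t"
 obtain a where a: "tame 1 a (pairing phi)" using tm_pairing[OF C2_realD(1)[OF phi]] by (auto simp: tm_def)
 obtain b where b: "tame 1 b (drift phi)" using tm_drift[OF phi] by (auto simp: tm_def)
 obtain d where d: "tame 2 d (\<Gamma> phi phi)" using tm_\<Gamma>[OF phi phi] by (auto simp: tm_def)
 \<comment> \<open>One summand for each term of \<open>M_process\<close>, so that the process is at
   most \<open>c * (1 + D t w)\<close> up to time t.\<close>
 define c where "c = a + abs (pairing phi \<mu>) + b * t"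
 have c0: "0 <= c" using tameD(2)[OF a] tameD(2)[OF b] t by (simp add: c_def)
 have "abs ((M_process h \<mu> phi u w)^2 - M_bracket h \<sigma> phi u w) <= (2 * c^2 + d * t) * (1 + D t w ^ 2)"
  if w: "w : space Q" and u: "0 <= u" "u <= t" for u w
 proof -
  have D0: "0 <= D t w" by (rule D_nonneg[OF w t])
  have Dm: "D u w ^ k <= D t w ^ k" for k by (intro power_mono D_mono[OF w u] D_nonneg[OF w u(1)])
  have "abs (LBINT s:{0..u}. drift phi (w s)) <= b * (1 + D u w ^ 1) * (u - 0)" by (rule tame_drift_bound[OF b w order_refl u(1)])
  also have "... <= b * (1 + D t w) * t"
  using Dm[of 1] u D0 tameD(2)[OF b] D_nonneg[OF w u(1)] by (intro mult_mono) auto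
  finally have 1: "abs (LBINT s:{0..u}. drift phi (w s)) <= b * (1 + D t w) * t" .
  have 2: "abs (pairing phi (w u)) <= a * (1 + D t w)" using tame_path_bound[OF a w u] by simp
  have 3: "abs (pairing phi \<mu>) <= abs (pairing phi \<mu>) * (1 + D t w)" using D0 by (simp add: distrib_left)
  have "abs (M_process h \<mu> phi u w) <= a * (1 + D t w) + abs (pairing phi \<mu>) * (1 + D t w) + b * (1 + D t w) * t"
  unfolding M_process_eq using 1 2 3 by linarith
  also have "... = c * (1 + D t w)" by (simp add: c_def algebra_simps)
  finally have "(M_process h \<mu> phi u w)^2 <= (c * (1 + D t w))^2" by (rule abs_le_square_iff[THEN iffD1, OF order_trans[OF _ abs_ge_self]])
  also have "... <= 2 * c^2 * (1 + D t w ^ 2)"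
  proof -
  have "(1 + D t w)^2 <= 2 * (1 + D t w ^ 2)"
  using zero_le_power2[of "1 - D t w"] by (simp add: power2_eq_square algebra_simps)
  from mult_left_mono[OF this, of "c^2"]
  have "c^2 * (1 + D t w)^2 <= c^2 * (2 * (1 + D t w ^ 2))" by simp
  also have "... = 2 * c^2 * (1 + D t w ^ 2)" by (simp only: mult_ac)
  finally show ?thesis unfolding power_mult_distrib .
  qed
  finally have M: "(M_process h \<mu> phi u w)^2 <= 2 * c^2 * (1 + D t w ^ 2)" .
  have "abs (M_bracket h \<sigma> phi u w) <= d * (1 + D u w ^ 2) * (u - 0)"
  unfolding M_bracket_eq[OF phi w] by (rule tame_drift_bound[OF d w order_refl u(1)])
  also have "... <= d * (1 + D t w ^ 2) * t"
  using Dm[of 2] u tameD(2)[OF d] by (intro mult_mono) auto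
  finally have "abs (M_bracket h \<sigma> phi u w) <= d * t * (1 + D t w ^ 2)" by (simp add: mult_ac)
  then show ?thesis using M zero_le_power2[of "M_process h \<mu> phi u w"] unfolding distrib_right by linarith
 qed
 then show "EX Y. integrable Q Y & (\<forall>w\<in>space Q. ALL u. 0 <= u --> u <= t -->
  abs ((M_process h \<mu> phi u w)^2 - M_bracket h \<sigma> phi u w) <= Y w)"
  by (intro exI[of _ "%w. (2 * c^2 + d * t) * (1 + D t w ^ 2)"] conjI momentD[OF m t]) blast
qed

end

section \<open>From the martingale problem to drift and bracket\<close>

lemma Cb_cong: "(!!x. x : S ==> f x = g x) ==> g : Cb S ==> f : Cb S"
 unfolding Cb_def by (auto cong: continuous_on_cong image_cong)

lemma C2_data_C2_Rn:
 assumes C: "C2_data n f d1 d2"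
 shows "f : C2_Rn n"
proof -
 have 1: "pder i f x = d1 i x" "pdifferentiable i f x" if "i < n" "x : Rn n" for i x
  using C2_dataD(4)[OF C that]
  by (auto simp: pderivative_def pdifferentiable_def field_differentiable_def intro: DERIV_imp_deriv)
 have e: "(%u. pder i f (x(j := u))) = (%u. d1 i (x(j := u)))" if "i < n" "j < n" "x : Rn n" for i j x
  using 1(1)[OF that(1) fun_upd_Rn[OF that(3,2)]] by simp
 have 2: "pder j (pder i f) x = d2 i j x" "pdifferentiable j (pder i f) x" if "i < n" "j < n" "x : Rn n" for i j x
  using C2_dataD(5)[OF C that] unfolding pderivative_def[of j] pdifferentiable_def e[OF that]
  by (auto simp: field_differentiable_def intro: DERIV_imp_deriv)
 have "pder i f : Cb (Rn n)" if "i < n" for i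
  by (rule Cb_cong[OF 1(1)[OF that] C2_dataD(2)[OF C that]])
 moreover have "pder j (pder i f) : Cb (Rn n)" if "i < n" "j < n" for i j
  by (rule Cb_cong[OF 2(1)[OF that] C2_dataD(3)[OF C that]])
 ultimately show ?thesis unfolding C2_Rn_def using C2_dataD(1)[OF C] 1(2) 2(2) by blast
qed

text \<open>Smoothness of the product is not computed afresh: the product is \<open>V n\<close>
  applied to the constant 1, and \<open>V_C2_data\<close> supplies its derivatives.\<close>

lemma prod_gen_domain:
 assumes "phi : C2_real" "1 <= n"
 shows "poly_functional n (%x. \<Prod>i<n. phi (x i)) : gen_domain"
proof -
 have "C2_data n (%_. 1) (%_ _. 0) (%_ _ _. 0)" by (intro C2_dataI Cb_const) auto
 then obtain e1 e2 where "C2_data n (V n undefined (%_. phi) (%_. 1)) e1 e2"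
  using V_C2_data[of n "%_. 1" _ _ "%_. phi" n undefined] assms(1) by blast
 moreover have "V n undefined (%_. phi) (%_. 1) = (%x. \<Prod>i<n. phi (x i))" by (simp add: fun_eq_iff V_eq)
 ultimately have "(%x. \<Prod>i<n. phi (x i)) : C2_Rn n" using C2_data_C2_Rn by auto
 then show ?thesis using assms(2) unfolding gen_domain_def by blast
qed

context path_setting
begin

lemma cylG_prod:
 "cylG n (%x. \<Prod>i<n. x i) psi nu = (SUM i<n. (\<Prod>l\<in>{..<n} - {i}. pv n psi nu l) * drift (psi i) nu) +
  1/2 * (SUM i<n. SUM j<n. (if j : {..<n} - {i} then \<Prod>l\<in>{..<n} - {i} - {j}. pv n psi nu l else 0) * \<Gamma> (psi i) (psi j) nu)"
proof -
 have p: "pder i (%x. \<Prod>i<n. x i) = (%x. \<Prod>l\<in>{..<n} - {i}. x l)" if "i < n" for i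
  using that by (simp add: pderivative_prod(1))
 show ?thesis unfolding cylG_def
  by (intro arg_cong2[where f = "(+)"] arg_cong2[where f = "(*)"] sum.cong refl; simp add: p; simp add: pderivative_prod(1))
qed

text \<open>Degrees 1 and 2 with equal factors: the pairing and its square appear as polynomial
  functionals of bounded functions, and the generator returns the drift and the density of the
  bracket.\<close>

lemma
 assumes phi: "phi : C2_real"
 shows poly_1: "poly_functional 1 (%x. \<Prod>i<1. phi (x i)) = pairing phi" "generator h \<sigma> (pairing phi) = drift phi"
  and poly_2: "poly_functional 2 (%x. \<Prod>i<2. phi (x i)) = (%nu. (pairing phi nu)^2)"
  "generator h \<sigma> (%nu. (pairing phi nu)^2) = (%nu. 2 * (pairing phi nu * drift phi nu) + \<Gamma> phi phi nu)"
proof -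
 have two: "{..<2} = {0, 1 :: nat}" and d: "{0, 1} - {0} = {1 :: nat}" "{0, 1} - {1} = {0 :: nat}" by auto
 note P = poly_functional_prod[of "%_. phi", OF phi] and G = generator_prod[of "%_. phi", OF phi]
 show 1: "poly_functional 1 (%x. \<Prod>i<1. phi (x i)) = pairing phi"
  by (subst P) (simp add: fun_eq_iff pv_def)
 show 2: "poly_functional 2 (%x. \<Prod>i<2. phi (x i)) = (%nu. (pairing phi nu)^2)"
  by (subst P) (simp add: fun_eq_iff pv_def power2_eq_square two)
 show "generator h \<sigma> (pairing phi) = drift phi"
  unfolding G[of 1, unfolded 1] by (rule ext, subst cylG_prod) (simp add: lessThan_Suc)
 show "generator h \<sigma> (%nu. (pairing phi nu)^2) = (%nu. 2 * (pairing phi nu * drift phi nu) + \<Gamma> phi phi nu)"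
  unfolding G[of 2, unfolded 2] by (rule ext, subst cylG_prod) (simp add: pv_def two d)
qed

text \<open>The process in \<open>solves_martingale_problem\<close> subtracts the initial value and
  \<open>MP\<close> keeps it. That value is almost surely the constant \<open>f \<mu>\<close>, hence
  integrable.\<close>

lemma martingale_problem_MP:
 assumes S: "solves_martingale_problem h \<sigma> Q" and init: "AE w in Q. w 0 = \<mu>"
  and f: "f : gen_domain" "f : bmeas pair_sigma"
 shows "MP f (generator h \<sigma> f)"
proof -
 have X: "mgle (%t w. f (w t) - f (w 0) - (LBINT s:{0..t}. generator h \<sigma> f (w s)))"
  using S f(1) unfolding solves_martingale_problem_def continuous_martingale_def martingale_iff_mgle[OF filtration_Q] by blast
 have m0: "(%w. f (w 0)) : bmeas (pfilt 0)" by (rule functional_adapted[OF f(2)]) auto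
 have "AE w in Q. f (w 0) = f \<mu>" using init by eventually_elim simp
 then have "integrable Q (%w. f (w 0)) \<longleftrightarrow> integrable Q (%_. f \<mu>)"
  by (intro integrable_cong_AE F_P[OF m0]) auto
 then have "integrable Q (%w. f (w 0))" by simp
 from mgle_add[OF X mgle_const[OF m0 this]] show ?thesis unfolding MP_def by (simp add: algebra_simps)
qed

text \<open>The squared mass is a martingale plus the time integral of
  \<open>pairing \<sigma>\<close>, and \<open>mass_drift_integrable\<close> makes the latter
  integrable before any second moment is known.\<close>

lemma second_moment_of_square:
 assumes lin: "MP (pairing (%_. 1)) (drift (%_. 1))"
  and quad: "MP (%nu. (pairing (%_. 1) nu)^2) (%nu. 2 * (pairing (%_. 1) nu * drift (%_. 1) nu) + \<Gamma> (%_. 1) (%_. 1) nu)"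
 shows "moment 2"
proof -
 have Z: "mgle (%t w. mass (w t))" using lin unfolding MP_def drift_one mass_def by simp
 have "mgle (%t w. (mass (w t))^2 - (LBINT u:{0..t}. pairing \<sigma> (w u)))"
  using quad unfolding MP_def drift_one \<Gamma>_one mass_def by simp
 note i = mgleD(2)[OF this] and j = mass_drift_integrable[OF Z tm_pairing[OF \<sigma>_Cb]]
 have "integrable Q (%w. mass (w t) ^ (2 * Suc 0))" if "0 <= t" for t
  using bib_add[OF i[OF that] j[OF that]] by simp
 from moment_from_power[OF Z this] show ?thesis by simp
qed

lemma martingale_problem_imp_bracket:
 assumes S: "solves_martingale_problem h \<sigma> Q" and init: "AE w in Q. w 0 = \<mu>" and phi: "phi : C2_real"
 shows "continuous_martingale Q pfilt (M_process h \<mu> phi)"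
  and "quadratic_variation Q pfilt (M_process h \<mu> phi) (M_bracket h \<sigma> phi)"
proof -
 have lin: "MP (pairing phi) (drift phi)" if "phi : C2_real" for phi
  using martingale_problem_MP[OF S init prod_gen_domain[OF that, of 1]] measurable_pairing[OF C2_realD(1)[OF that]]
  by (simp only: poly_1[OF that] order_refl simp_thms)
 have quad: "MP (%nu. (pairing phi nu)^2) (%nu. 2 * (pairing phi nu * drift phi nu) + \<Gamma> phi phi nu)" if "phi : C2_real" for phi
  using martingale_problem_MP[OF S init prod_gen_domain[OF that, of 2]]
  borel_measurable_power[OF measurable_pairing[OF C2_realD(1)[OF that]], of 2]
  by (simp only: poly_2[OF that] one_le_numeral simp_thms)
 have m: "moment 2" by (rule second_moment_of_square[OF lin[OF C2_one(1)] quad[OF C2_one(1)]])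
 show "continuous_martingale Q pfilt (M_process h \<mu> phi)"
  and "quadratic_variation Q pfilt (M_process h \<mu> phi) (M_bracket h \<sigma> phi)"
  by (rule quadratic_variation_bracket[OF phi init m lin[OF phi] quad[OF phi]])+
qed

lemma tm_bounded:
 assumes q: "q : Cb (Rn n)" and phi: "!!i. i < n ==> phi i : C2_real"
 shows "tm 0 (%nu. q (pv n phi nu))"
proof -
 obtain K where K: "0 <= K" "!!x. x : Rn n ==> abs (q x) <= K" using Cb_bounded[OF q] by metis
 have "tame 0 K (%nu. q (pv n phi nu))"
 proof (rule tameI[OF pv_measurable[OF Cb_continuous[OF q] phi] K(1)])
  show "abs (q (pv n phi nu)) <= K * (1 + mass nu ^ 0)" for nu
  using K(2)[of "pv n phi nu"] K(1) by (simp add: pv_def)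
 qed
 then show ?thesis by (rule tmI)
qed

end

section \<open>From the bracket to the martingale problem\<close>

context solved
begin

text \<open>Bounded derivatives of f leave the growth of \<open>drift\<close> and
  \<open>\<Gamma>\<close> as it is, so order 2 suffices.\<close>

lemma cylinder_martingale:
 assumes f: "f : C2_Rn n" and phi: "!!i. i < n ==> phi i : C2_real"
 shows "continuous_martingale Q pfilt
  (%t w. cyl_functional n f phi (w t) - cyl_functional n f phi (w 0) - (LBINT s:{0..t}. generator h \<sigma> (cyl_functional n f phi) (w s)))"
proof -
 note L = C2_Rn_imp_C2_loc[OF f] and C = C2_dataD[OF C2_Rn_C2_data[OF f]]
 have F: "cyl_functional n f phi = (%nu. f (pv n phi nu))" by (rule ext) (rule cyl_functional_pv)
 have G: "generator h \<sigma> (cyl_functional n f phi) = cylG n f phi"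
  unfolding F by (rule ext) (rule generator_cylinder[OF L phi])
 have t1: "tm 2 (%nu. f (pv n phi nu))" by (rule tm_mono[OF tm_bounded[OF C(1) phi]]) auto
 have "tm 2 (%nu. pder i f (pv n phi nu) * drift (phi i) nu)" if "i < n" for i
  by (rule tm_mono[OF tm_mult[OF tm_bounded[OF C(2)[OF that] phi] tm_drift[OF phi[OF that]]]]) auto
 moreover have "tm 2 (%nu. pder j (pder i f) (pv n phi nu) * \<Gamma> (phi i) (phi j) nu)" if "i < n" "j < n" for i j
  by (rule tm_mono[OF tm_mult[OF tm_bounded[OF C(3)[OF that] phi] tm_\<Gamma>[OF phi[OF that(1)] phi[OF that(2)]]]]) auto
 ultimately have t2: "tm 2 (cylG n f phi)"
  unfolding cylG_def[abs_def] by (intro tm_add tm_cmult tm_sum) auto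
 show ?thesis unfolding G unfolding F
 proof (rule MP_continuous_martingale[OF MP_cyl[OF L phi t1 t2] t1 t2 moment_all])
  show "continuous_on {0..} (%t. f (pv n phi (w t)))" if "w : space Q" for w
  unfolding pv_def by (intro Rn_comp_continuous Cb_continuous C(1) pairing_path_continuous[OF that] C2_realD(1) phi)
 qed
qed

lemma poly_martingale:
 assumes f: "f : C2_Rn n" and n: "1 <= n"
 shows "continuous_martingale Q pfilt
  (%t w. poly_functional n f (w t) - poly_functional n f (w 0) - (LBINT s:{0..t}. generator h \<sigma> (poly_functional n f) (w s)))"
 using good_C2[OF f n] moment_all unfolding good_def
 by (intro MP_continuous_martingale[where p = n] poly_path_continuous f) auto

lemma solution: "solves_martingale_problem h \<sigma> Q"
 unfolding solves_martingale_problem_def gen_domain_def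
proof (rule ballI)
 fix f assume "f : {poly_functional n f | n f. 1 <= n & f : C2_Rn n} \<union>
  {cyl_functional n f phi | n f phi. 1 <= n & f : C2_Rn n & (\<forall>i<n. phi i : C2_real)}"
 then show "continuous_martingale Q pfilt (%t w. f (w t) - f (w 0) - (LBINT s:{0..t}. generator h \<sigma> f (w s)))"
  using poly_martingale cylinder_martingale by blast
qed

end

text \<open>The initial value comes from the clause on \<open>X 0\<close> in
  \<open>quadratic_variation\<close>: for each phi it says that \<open>pairing phi (w 0)\<close>
  equals \<open>pairing phi \<mu>\<close> almost surely. The second moment must be found before the
  brackets can be read as true martingales, hence the order of the steps.\<close>

lemma (in path_setting) bracket_imp_solved:
 assumes "!!phi. phi : C2_real ==> continuous_martingale Q pfilt (M_process h \<mu> phi)"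
  and qv: "!!phi. phi : C2_real ==> quadratic_variation Q pfilt (M_process h \<mu> phi) (M_bracket h \<sigma> phi)"
 shows "solved h \<sigma> \<mu> Q"
proof -
 have lin: "MP (pairing phi) (drift phi)" if "phi : C2_real" for phi
  using assms(1)[OF that] unfolding continuous_martingale_def martingale_iff_mgle[OF filtration_Q] mgle_M_process by blast
 have init: "AE w in Q. w 0 = \<mu>"
 proof (rule initial_iff(2))
  fix phi assume "phi : C2_real"
  then have "AE w in Q. M_process h \<mu> phi 0 w = 0" using qv by (simp add: quadratic_variation_def)
  then show "AE w in Q. pairing phi (w 0) = pairing phi \<mu>"
  by eventually_elim (simp add: M_process_eq set_integral_at_point)
 qed
 have m: "moment 2" by (rule second_moment[OF init lin[OF C2_one(1)] qv[OF C2_one(1)]])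
 show ?thesis
  by unfold_locales (use init lin m true_bracket[OF _ m lin qv] in auto)
qed

theorem theorem3p2:
  fixes h \<sigma> :: "real \<Rightarrow> real" and \<epsilon> :: real and \<mu> :: fmeasure
    and Q :: "(real \<Rightarrow> fmeasure) measure"
  assumes h_diff: "\<And>x. h field_differentiable at x"
    and h_C1: "continuous_on UNIV (deriv h)"
    and h_L2: "integrable lborel (\<lambda>x. (h x)\<^sup>2)"
    and h'_L2: "integrable lborel (\<lambda>x. (deriv h x)\<^sup>2)"
    and \<sigma>_Cb: "\<sigma> \<in> Cb UNIV"
    and \<epsilon>_pos: "\<epsilon> > 0"
    and \<sigma>_ge: "\<And>x. \<sigma> x \<ge> \<epsilon>"
    and Q_prob: "prob_space Q"
    and Q_sets: "sets Q = sets path_space"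
  shows "(solves_martingale_problem h \<sigma> Q \<and> measure Q {w \<in> space Q. w 0 = \<mu>} = 1) \<longleftrightarrow>
    (\<forall>\<phi>\<in>C2_real.
       continuous_martingale Q path_filtration (M_process h \<mu> \<phi>) \<and>
       quadratic_variation Q path_filtration (M_process h \<mu> \<phi>) (M_bracket h \<sigma> \<phi>))"
proof -
  have \<sigma>_nonneg: "0 \<le> \<sigma> x" for x using \<sigma>_ge[of x] \<epsilon>_pos by linarith
  interpret path_setting h \<sigma> \<mu> Q
    by (intro path_setting.intro kernel.intro path_setting_axioms.intro h_diff h_C1 h_L2 h'_L2 \<sigma>_Cb \<sigma>_nonneg Q_prob Q_sets)
  show ?thesis
  proof
    assume "solves_martingale_problem h \<sigma> Q \<and> measure Q {w \<in> space Q. w 0 = \<mu>} = 1"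
    then have "solves_martingale_problem h \<sigma> Q" "AE w in Q. w 0 = \<mu>" by (simp_all add: initial_prob)
    from martingale_problem_imp_bracket[OF this] show "\<forall>\<phi>\<in>C2_real.
       continuous_martingale Q path_filtration (M_process h \<mu> \<phi>) \<and>
       quadratic_variation Q path_filtration (M_process h \<mu> \<phi>) (M_bracket h \<sigma> \<phi>)" by blast
  next
    assume "\<forall>\<phi>\<in>C2_real.
       continuous_martingale Q path_filtration (M_process h \<mu> \<phi>) \<and>
       quadratic_variation Q path_filtration (M_process h \<mu> \<phi>) (M_bracket h \<sigma> \<phi>)"
    then interpret solved h \<sigma> \<mu> Q by (intro bracket_imp_solved) blast+
    show "solves_martingale_problem h \<sigma> Q \<and> measure Q {w \<in> space Q. w 0 = \<mu>} = 1"
      using solution init by (simp add: initial_prob)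
  qed
qed

end
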